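(* Consider the two-user symmetric Gaussian interference channel with channel output feedback model $F=(F_{11}F_{12}F_{21}F_{22})$ and parameters $\mathsf{SNR},\mathsf{INR}$. Let $C_{\mathrm{sum}}^{F}$ denote its sum-capacity. (i) (Weak interference.) If $\mathsf{SNR}\ge\mathsf{INR}$, then the sum-capacities of all feedback models with at least one feedback link are within $4.59$ bits/Hz of each other: $|C_{\mathrm{sum}}^{F}-C_{\mathrm{sum}}^{F'}|\le 4.59$ for all $F,F'\in\{0,1\}^4\setminus\{(0000)\}$. (ii) (Strong interference.) If $\mathsf{SNR}<\mathsf{INR}$, then the sum-capacities of all feedback models of type $(1\mathsf{xxx})$ (i.e. with $F_{11}=1$) are within $3$ bits/Hz of each other: $|C_{\mathrm{sum}}^{F}-C_{\mathrm{sum}}^{F'}|\le 3$ whenever $F_{11}=F'_{11}=1$.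
   Context: Symmetric Gaussian interference channel: at time $j$, transmitter $\mathsf{T}_u$ ($u\in\{1,2\}$) sends $X_{uj}\in\mathbb{C}$ and receivers $\mathsf{D}_1,\mathsf{D}_2$ receive $$Y_{1j}=g_dX_{1j}+g_cX_{2j}+Z_{1j},\qquad Y_{2j}=g_dX_{2j}+g_cX_{1j}+Z_{2j},$$ where $g_d,g_c\in\mathbb{C}$ are fixed gains and all noises $Z_{uj}\sim\mathcal{CN}(0,1)$ are independent of each other and of the messages. Power constraint: $\mathbb{E}|X_{uj}|^2\le P$. Define $\mathsf{SNR}=|g_d|^2P$, $\mathsf{INR}=|g_c|^2P$. Rates are in bits (logarithms base 2). Feedback model: $(F_{11}F_{12}F_{21}F_{22})\in\{0,1\}^4$, where $F_{ku}=1$ iff there is a noiseless, strictly causal feedback link from receiver $\mathsf{D}_k$ to transmitter $\mathsf{T}_u$. Codes: for block length $N$, $W_u$ is uniform on $\{1,\dots,2^{NR_u}\}$, with $W_1,W_2$ independent. The encoder of $\mathsf{T}_u$ is $X_{uj}=f_{uj}(W_u,\,Y_1^{j-1}F_{1u},\,Y_2^{j-1}F_{2u})$, $j=1,\dots,N$; that is, $X_{uj}$ may depend on $W_u$ and on the past outputs $Y_k^{j-1}=(Y_{k1},\dots,Y_{k,j-1})$ exactly for those $k$ with $F_{ku}=1$. The decoder of $\mathsf{D}_u$ is a function $\widehat W_u=h_u(Y_u^N)$. A rate pair is achievable if there are codes with $\Pr(\widehat W_u\neq W_u)\to0$ as $N\to\infty$ for $u=1,2$. The capacity region is the closure of the set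 of achievable rate pairs; the sum-capacity is the maximum of $R_1+R_2$ over the capacity region. *)

theory Defs
  imports "HOL-Probability.Probability"
begin

text \<open>The two users; \<open>u\<close> indexes transmitters and \<open>k\<close> indexes receivers.\<close>

datatype user = U1 | U2

fun other :: "user \<Rightarrow> user" where
  "other U1 = U2"
| "other U2 = U1"

text \<open>\<open>F k u\<close> is the bit \<open>F_ku\<close>: a feedback link from receiver \<open>k\<close> to transmitter \<open>u\<close>.\<close>

type_synonym feedback = "user \<Rightarrow> user \<Rightarrow> bool"

definition no_feedback :: feedback where
  "no_feedback = (\<lambda>k u. False)"

text \<open>An encoder maps user, time, own message and the two (masked) vectors of past outputs of
  receivers \<open>U1\<close> and \<open>U2\<close> to a channel input.  A vector with entries at times \<open>T\<close> is an
  extensional function on \<open>T\<close>.\<close>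

type_synonym encoder = "user \<Rightarrow> nat \<Rightarrow> nat \<Rightarrow> (nat \<Rightarrow> complex) \<Rightarrow> (nat \<Rightarrow> complex) \<Rightarrow> complex"
type_synonym decoder = "user \<Rightarrow> (nat \<Rightarrow> complex) \<Rightarrow> nat"

lemma restrict_fundef_cong [fundef_cong]:
  "A = B \<Longrightarrow> (\<And>x. x \<in> B \<Longrightarrow> f x = g x) \<Longrightarrow> restrict f A = restrict g B"
  by (auto simp: restrict_def)

text \<open>Inputs and outputs for messages \<open>w\<close> and noise realisation \<open>z\<close>.  A missing link
  replaces the past outputs by the zero vector, as in \<open>Y_k^{j-1} F_ku\<close>.\<close>

function chan_in :: "complex \<Rightarrow> complex \<Rightarrow> feedback \<Rightarrow> encoder \<Rightarrow> (user \<Rightarrow> nat) \<Rightarrow>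
      (user \<times> nat \<Rightarrow> complex) \<Rightarrow> user \<Rightarrow> nat \<Rightarrow> complex"
  and chan_out :: "complex \<Rightarrow> complex \<Rightarrow> feedback \<Rightarrow> encoder \<Rightarrow> (user \<Rightarrow> nat) \<Rightarrow>
      (user \<times> nat \<Rightarrow> complex) \<Rightarrow> user \<Rightarrow> nat \<Rightarrow> complex" where
  "chan_in gd gc F f w z u j =
     f u j (w u)
       (\<lambda>i\<in>{1..<j}. of_bool (F U1 u) * chan_out gd gc F f w z U1 i)
       (\<lambda>i\<in>{1..<j}. of_bool (F U2 u) * chan_out gd gc F f w z U2 i)"
| "chan_out gd gc F f w z k j =
     gd * chan_in gd gc F f w z k j + gc * chan_in gd gc F f w z (other k) j + z (k, j)"
  by pat_completeness auto
termination
  by (relation "Wellfounded.measure (\<lambda>x. case x of Inl (_, _, _, _, _, _, _, j) \<Rightarrow> 2 * j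
                                     | Inr (_, _, _, _, _, _, _, j) \<Rightarrow> 2 * j + 1)") auto

declare chan_in.simps [simp del] chan_out.simps [simp del]

text \<open>\<open>CN(0,1)\<close>: independent real and imaginary parts, each of variance \<open>1/2\<close>
  (\<open>normal_density\<close> takes the standard deviation).\<close>

definition std_complex_normal :: "complex measure" where
  "std_complex_normal =
     distr (density lborel (normal_density 0 (sqrt (1 / 2))) \<Otimes>\<^sub>M
            density lborel (normal_density 0 (sqrt (1 / 2))))
       borel (\<lambda>(x, y). Complex x y)"

text \<open>The set \<open>{1, ..., 2^(N R)}\<close>, i.e. the positive integers not exceeding \<open>2^(N R)\<close>.\<close>

definition messages :: "nat \<Rightarrow> real \<Rightarrow> nat set" where
  "messages N R = {1..nat \<lfloor>2 powr (real N * R)\<rfloor>}"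

fun rate :: "real \<times> real \<Rightarrow> user \<Rightarrow> real" where
  "rate (R1, R2) U1 = R1"
| "rate (R1, R2) U2 = R2"

text \<open>Joint law of the messages and the noise: all coordinates are independent.\<close>

definition source_space ::
  "nat \<Rightarrow> real \<times> real \<Rightarrow> ((user \<Rightarrow> nat) \<times> (user \<times> nat \<Rightarrow> complex)) measure" where
  "source_space N R =
     (\<Pi>\<^sub>M u\<in>UNIV. uniform_count_measure (messages N (rate R u))) \<Otimes>\<^sub>M
     (\<Pi>\<^sub>M p\<in>UNIV \<times> {1..N}. std_complex_normal)"

definition measurable_encoder :: "nat \<Rightarrow> real \<times> real \<Rightarrow> encoder \<Rightarrow> bool" where
  "measurable_encoder N R f \<longleftrightarrow>
     (\<forall>u. \<forall>j\<in>{1..N}. \<forall>m\<in>messages N (rate R u).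
        (\<lambda>(y1, y2). f u j m y1 y2) \<in> borel_measurable
          ((\<Pi>\<^sub>M i\<in>{1..<j}. borel) \<Otimes>\<^sub>M (\<Pi>\<^sub>M i\<in>{1..<j}. borel)))"

definition measurable_decoder :: "nat \<Rightarrow> decoder \<Rightarrow> bool" where
  "measurable_decoder N h \<longleftrightarrow>
     (\<forall>u. h u \<in> measurable (\<Pi>\<^sub>M i\<in>{1..N}. borel) (count_space UNIV))"

text \<open>The nonnegative integral makes an infinite second moment violate the constraint.\<close>

definition power_constraint ::
  "complex \<Rightarrow> complex \<Rightarrow> real \<Rightarrow> feedback \<Rightarrow> nat \<Rightarrow> real \<times> real \<Rightarrow> encoder \<Rightarrow> bool" where
  "power_constraint gd gc P F N R f \<longleftrightarrow>
     (\<forall>u. \<forall>j\<in>{1..N}.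
        (\<integral>\<^sup>+ (w, z). ennreal ((cmod (chan_in gd gc F f w z u j))\<^sup>2) \<partial>source_space N R)
          \<le> ennreal P)"

definition is_code ::
  "complex \<Rightarrow> complex \<Rightarrow> real \<Rightarrow> feedback \<Rightarrow> nat \<Rightarrow> real \<times> real \<Rightarrow> encoder \<Rightarrow> decoder \<Rightarrow> bool" where
  "is_code gd gc P F N R f h \<longleftrightarrow>
     measurable_encoder N R f \<and> measurable_decoder N h \<and> power_constraint gd gc P F N R f"

definition error_prob ::
  "complex \<Rightarrow> complex \<Rightarrow> feedback \<Rightarrow> nat \<Rightarrow> real \<times> real \<Rightarrow> encoder \<Rightarrow> decoder \<Rightarrow> user \<Rightarrow> real" where
  "error_prob gd gc F N R f h u =
     measure (source_space N R)
       {(w, z) \<in> space (source_space N R).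
          h u (\<lambda>j\<in>{1..N}. chan_out gd gc F f w z u j) \<noteq> w u}"

text \<open>Rates are nonnegative, so that the message sets are nonempty.\<close>

definition achievable :: "complex \<Rightarrow> complex \<Rightarrow> real \<Rightarrow> feedback \<Rightarrow> real \<times> real \<Rightarrow> bool" where
  "achievable gd gc P F R \<longleftrightarrow>
     (\<forall>u. rate R u \<ge> 0) \<and>
     (\<exists>(f :: nat \<Rightarrow> encoder) (h :: nat \<Rightarrow> decoder).
        (\<forall>N\<ge>1. is_code gd gc P F N R (f N) (h N)) \<and>
        (\<forall>u. (\<lambda>N. error_prob gd gc F N R (f N) (h N) u) \<longlonglongrightarrow> 0))"

definition capacity_region :: "complex \<Rightarrow> complex \<Rightarrow> real \<Rightarrow> feedback \<Rightarrow> (real \<times> real) set" where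
  "capacity_region gd gc P F = closure {R. achievable gd gc P F R}"

text \<open>The capacity region is nonempty and compact for \<open>P \<ge> 0\<close>, so this supremum is the
  maximum of \<open>R1 + R2\<close> over the region.\<close>

definition sum_capacity :: "complex \<Rightarrow> complex \<Rightarrow> real \<Rightarrow> feedback \<Rightarrow> real" where
  "sum_capacity gd gc P F = (SUP (R1, R2) \<in> capacity_region gd gc P F. R1 + R2)"

definition SNR :: "complex \<Rightarrow> real \<Rightarrow> real" where
  "SNR gd P = (cmod gd)\<^sup>2 * P"

definition INR :: "complex \<Rightarrow> real \<Rightarrow> real" where
  "INR gc P = (cmod gc)\<^sup>2 * P"

end

theory Submission
  imports Defs
begin

text \<open>
  Write \<open>S\<close> and \<open>I\<close> for the signal and interference to noise ratios.  Whatever the feedback, even if it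
  is complete, the sum rate is at most
  \<open>log ((1 + 2 S + 2 I) (1 + S / (1 + I)))\<close>: a genie gives \<open>W\<^sub>1\<close> and the first output to the second
  receiver.  Instead of entropies, the proof compares the law of the outputs with a Gaussian test density in the first
  output and in the part of the second one that is not predicted by \<open>W\<^sub>1\<close> and the first output; for
  fixed messages, the outputs are a volume preserving function of the noise, even with feedback.

  Conversely, any single feedback link comes within a constant of this bound.  Each user sends a
  private signal that reaches the other receiver at most at noise level.  One user adds a common message,
  which the user with feedback decodes and repeats in the next block; so each receiver can decode it
  from the direct path: forwards at its own transmitter's receiver, backwards at the other one.  Under
  strong interference, the link from receiver 1 to transmitter 1 turns it into a relay for
  transmitter 2, and the common message alone reaches \<open>log (1 + I)\<close>.  The bound exceeds what is
  achieved by a factor of at most \<open>24 \<le> 2 powr 4.59\<close> for weak interference, where \<open>9/10\<close> of the power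
  is used, and of at most \<open>8\<close> for strong interference.
\<close>

section \<open>Complex Gaussian vectors\<close>

text \<open>The power constraint binds at every single time, averaged over the messages but for one
  fixed codebook, so the right power in expectation over random codebooks is not enough. At each
  time the average over the messages is shown to concentrate, since pairs of messages rarely share a
  codeword letter; the slack this takes is the reason for using power strictly below
  \<open>P\<close>. A misled relay sends unintended letters; all letters are therefore bounded by
  the block length, and exponentially small error makes their power negligible. With feedback,
  inputs are nonlinear in the past noise. Achievability is analysed on fictitious outputs for a
  relay that never errs: these are linear in codebooks and noise, and if all decoding steps succeed
  on them, they are the true outputs. In the converse, feedback may correlate the inputs, whence the
  factors 2 in \<open>1 + 2 S + 2 I\<close>. There, the energies of a code are controlled only in
  mean, so Markov's inequality is what remains; its bound \<open>1 / (1 + d) < 1\<close> on part of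
  the success probability suffices against vanishing error.\<close>

lemma lborel_complex_eq:
  "(lborel :: complex measure) = distr (lborel \<Otimes>\<^sub>M lborel) borel (\<lambda>(x, y). Complex x y)"
proof (rule lborel_eqI)
  have meas: "(\<lambda>(x, y). Complex x y) \<in> borel_measurable (lborel \<Otimes>\<^sub>M lborel)"
    by (auto intro!: borel_measurable_continuous_onI continuous_intros
        simp: Complex_eq case_prod_beta lborel_prod)
  fix l u :: complex assume le: "\<And>b. b \<in> Basis \<Longrightarrow> l \<bullet> b \<le> u \<bullet> b"
  have l: "Re l \<le> Re u" "Im l \<le> Im u"
    using le[of 1] le[of \<i>] by (auto simp: Basis_complex_def)
  have "(\<lambda>(x, y). Complex x y) -` box l u \<inter> space (lborel \<Otimes>\<^sub>M lborel) = {Re l<..<Re u} \<times> {Im l<..<Im u}"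
    by (auto simp: box_def Basis_complex_def space_pair_measure)
  then have "emeasure (distr (lborel \<Otimes>\<^sub>M lborel) borel (\<lambda>(x, y). Complex x y)) (box l u)
     = emeasure (lborel \<Otimes>\<^sub>M lborel) ({Re l<..<Re u} \<times> {Im l<..<Im u})"
    by (subst emeasure_distr[OF meas]) auto
  also have "\<dots> = ennreal (Re u - Re l) * ennreal (Im u - Im l)"
    using l by (subst lborel.emeasure_pair_measure_Times) auto
  finally show "emeasure (distr (lborel \<Otimes>\<^sub>M lborel) borel (\<lambda>(x, y). Complex x y)) (box l u)
     = ennreal (\<Prod>b\<in>Basis. (u - l) \<bullet> b)"
    using l by (simp add: Basis_complex_def ennreal_mult)
qed simp

lemma measurable_Complex[measurable]:
  "(\<lambda>(x, y). Complex x y) \<in> borel_measurable (borel \<Otimes>\<^sub>M borel)"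
  by (auto intro!: borel_measurable_continuous_onI continuous_intros
        simp: Complex_eq case_prod_beta borel_prod)

lemma sets_std_complex_normal [measurable_cong, simp]: "sets std_complex_normal = sets borel"
  and space_std_complex_normal [simp]: "space std_complex_normal = UNIV"
  by (simp_all add: std_complex_normal_def)

interpretation half_normal: prob_space "density lborel (normal_density 0 (sqrt (1 / 2)))"
  by (rule prob_space_normal_density) simp

interpretation std_complex_normal: prob_space std_complex_normal
proof -
  interpret pair_prob_space "density lborel (normal_density 0 (sqrt (1 / 2)))"
    "density lborel (normal_density 0 (sqrt (1 / 2)))" ..
  show "prob_space std_complex_normal"
    unfolding std_complex_normal_def by (rule prob_space_distr) simp
qed

lemma nn_integral_std_complex_normal_eq_iterated:
  assumes [measurable]: "f \<in> borel_measurable borel"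
  shows "(\<integral>\<^sup>+ z. f z \<partial>std_complex_normal) =
    (\<integral>\<^sup>+ x. ennreal (normal_density 0 (sqrt (1 / 2)) x) *
      (\<integral>\<^sup>+ y. ennreal (normal_density 0 (sqrt (1 / 2)) y) * f (Complex x y) \<partial>lborel) \<partial>lborel)"
proof -
  have [measurable]: "(\<lambda>p. f (Complex (fst p) (snd p))) \<in> borel_measurable (borel \<Otimes>\<^sub>M borel)"
    using measurable_compose[OF measurable_Complex assms] by (simp add: case_prod_beta)
  have "(\<integral>\<^sup>+ z. f z \<partial>std_complex_normal) =
     (\<integral>\<^sup>+ p. f (Complex (fst p) (snd p)) \<partial>(density lborel (normal_density 0 (sqrt (1 / 2))) \<Otimes>\<^sub>M
       density lborel (normal_density 0 (sqrt (1 / 2)))))"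
    unfolding std_complex_normal_def by (subst nn_integral_distr) (auto simp: case_prod_beta)
  also have "\<dots> = (\<integral>\<^sup>+ x. (\<integral>\<^sup>+ y. f (Complex x y) \<partial>density lborel (normal_density 0 (sqrt (1 / 2))))
        \<partial>density lborel (normal_density 0 (sqrt (1 / 2))))"
    by (subst half_normal.nn_integral_fst[symmetric]) auto
  finally show ?thesis
    by (simp add: nn_integral_density)
qed

lemma std_complex_normal_eq_density:
  "std_complex_normal = density lborel (\<lambda>z. ennreal (exp (- (cmod z)\<^sup>2) / pi))"
proof (rule measure_eqI)
  fix A assume "A \<in> sets std_complex_normal"
  then have A[measurable]: "A \<in> sets borel" by simp
  have [measurable]: "(\<lambda>p. indicator A (Complex (fst p) (snd p)) :: ennreal) \<in> borel_measurable (borel \<Otimes>\<^sub>M borel)"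
    using measurable_compose[OF measurable_Complex borel_measurable_indicator[OF A]] by (simp add: case_prod_beta)
  have d: "normal_density 0 (sqrt (1/2)) x * normal_density 0 (sqrt (1/2)) y = exp (- (x\<^sup>2+y\<^sup>2)) / pi" for x y
    by (simp add: normal_density_def exp_add[symmetric])
  have "emeasure std_complex_normal A = (\<integral>\<^sup>+ z. indicator A z \<partial>std_complex_normal)" by simp
  also have "\<dots> = (\<integral>\<^sup>+ x. (\<integral>\<^sup>+ y. ennreal (exp (- (x\<^sup>2+y\<^sup>2)) / pi) * indicator A (Complex x y) \<partial>lborel) \<partial>lborel)"
    by (subst nn_integral_std_complex_normal_eq_iterated)
      (auto intro!: nn_integral_cong simp: nn_integral_cmult[symmetric] d ennreal_mult[symmetric] mult.assoc[symmetric])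
  also have "\<dots> = (\<integral>\<^sup>+ p. ennreal (exp (- ((fst p)\<^sup>2+(snd p)\<^sup>2)) / pi) * indicator A (Complex (fst p) (snd p)) \<partial>(lborel \<Otimes>\<^sub>M lborel))"
    by (subst lborel.nn_integral_fst[symmetric]) auto
  also have "\<dots> = emeasure (density lborel (\<lambda>z. ennreal (exp (- (cmod z)\<^sup>2) / pi))) A"
    by (simp add: emeasure_density lborel_complex_eq nn_integral_distr case_prod_beta cmod_def)
  finally show "emeasure std_complex_normal A = emeasure (density lborel (\<lambda>z. ennreal (exp (- (cmod z)\<^sup>2) / pi))) A" .
qed simp

text \<open>Completing the square turns the integrand into a multiple of the normal density with
  variance \<open>1 / (2 * (1 - l))\<close>. Negative \<open>l\<close> is included on purpose: it
  serves the Chernoff bounds for lower tails.\<close>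

lemma nn_integral_exp_quadratic_normal:
  fixes l m :: real
  assumes "l < 1"
  shows "(\<integral>\<^sup>+ x. ennreal (normal_density 0 (sqrt (1 / 2)) x) * ennreal (exp (l * (m + x)\<^sup>2)) \<partial>lborel)
    = ennreal (exp (l * m\<^sup>2 / (1 - l)) / sqrt (1 - l))"
proof -
  let ?s = "sqrt (1 / (2 * (1 - l)))"
  have pos: "1 - l > 0" "?s > 0" using assms by auto
  have e: "- x\<^sup>2 + l * (m + x)\<^sup>2 = l * m\<^sup>2 / (1 - l) - (x - l * m / (1 - l))\<^sup>2 * (1 - l)" for x
  proof -
    define v where "v = 1 - l"
    have v: "l = 1 - v" "v \<noteq> 0" using pos by (auto simp: v_def)
    show ?thesis unfolding v(1) using v(2) by (simp add: field_simps power2_eq_square)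
  qed
  have s2: "?s\<^sup>2 = 1 / (2 * (1 - l))" using pos by simp
  have *: "normal_density 0 (sqrt (1 / 2)) x * exp (l * (m + x)\<^sup>2)
     = exp (l * m\<^sup>2 / (1 - l)) / sqrt (1 - l) * normal_density (l * m / (1 - l)) ?s x" for x
  proof -
    have "normal_density 0 (sqrt (1 / 2)) x * exp (l * (m + x)\<^sup>2) = exp (- x\<^sup>2 + l * (m + x)\<^sup>2) / sqrt pi"
      by (simp add: normal_density_def exp_add[symmetric])
    also have "\<dots> = exp (l * m\<^sup>2 / (1 - l)) * exp (- (x - l * m / (1 - l))\<^sup>2 * (1 - l)) / sqrt pi"
      unfolding e by (simp only: exp_add[symmetric] mult_minus_left add_uminus_conv_diff)
    also have "normal_density (l * m / (1 - l)) ?s x = exp (- (x - l * m / (1 - l))\<^sup>2 * (1 - l)) / sqrt (pi / (1 - l))"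
    proof -
      have "2 * (1 / (2 * (1 - l))) = 1 / (1 - l)" using pos by (simp add: divide_simps)
      then have "2 * pi * ?s\<^sup>2 = pi / (1 - l)" "2 * ?s\<^sup>2 = 1 / (1 - l)"
        unfolding s2 by (simp_all add: divide_simps)
      then show ?thesis unfolding normal_density_def by (simp add: mult_ac)
    qed
    ultimately show ?thesis using pos by (simp add: real_sqrt_divide)
  qed
  have "(\<integral>\<^sup>+ x. ennreal (normal_density 0 (sqrt (1 / 2)) x) * ennreal (exp (l * (m + x)\<^sup>2)) \<partial>lborel)
    = (\<integral>\<^sup>+ x. ennreal (exp (l * m\<^sup>2 / (1 - l)) / sqrt (1 - l)) * ennreal (normal_density (l * m / (1 - l)) ?s x) \<partial>lborel)"
    using pos by (intro nn_integral_cong) (simp add: ennreal_mult[symmetric] *)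
  also have "\<dots> = ennreal (exp (l * m\<^sup>2 / (1 - l)) / sqrt (1 - l)) * (\<integral>\<^sup>+ x. ennreal (normal_density (l * m / (1 - l)) ?s x) \<partial>lborel)"
    by (rule nn_integral_cmult) simp
  also have "(\<integral>\<^sup>+ x. ennreal (normal_density (l * m / (1 - l)) ?s x) \<partial>lborel) = 1"
    using prob_space.emeasure_space_1[OF prob_space_normal_density[OF pos(2), of "l * m / (1 - l)"]]
    by (simp add: emeasure_density)
  finally show ?thesis by simp
qed

text \<open>Rotation invariance: writing \<open>y = a * m\<close> pulls \<open>a\<close> out of the
  modulus, and real and imaginary parts separate into two integrals with the same \<open>l'\<close>.
  Their two factors \<open>1 / sqrt (1 - l')\<close> multiply to the rational factor of the
  result.\<close>

lemma nn_integral_exp_quadratic_std_complex_normal: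
  fixes l :: real and a y :: complex
  assumes "l * (cmod a)\<^sup>2 < 1"
  shows "(\<integral>\<^sup>+ g. ennreal (exp (l * (cmod (y + a * g))\<^sup>2)) \<partial>std_complex_normal)
    = ennreal (exp (l * (cmod y)\<^sup>2 / (1 - l * (cmod a)\<^sup>2)) / (1 - l * (cmod a)\<^sup>2))"
proof (cases "a = 0")
  case True
  then show ?thesis using std_complex_normal.emeasure_space_1 by simp
next
  case False
  define l' where "l' = l * (cmod a)\<^sup>2"
  define m where "m = y / a"
  have l': "l' < 1" using assms by (simp add: l'_def)
  have ym: "y = a * m" using False by (simp add: m_def)
  have e: "l * (cmod (y + a * g))\<^sup>2 = l' * (Re m + Re g)\<^sup>2 + l' * (Im m + Im g)\<^sup>2" for g
    unfolding ym distrib_left[symmetric] norm_mult l'_def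
    by (simp add: power_mult_distrib cmod_power2 algebra_simps)
  have e0: "l * (cmod y)\<^sup>2 = l' * (Re m)\<^sup>2 + l' * (Im m)\<^sup>2"
    unfolding ym norm_mult l'_def by (simp add: power_mult_distrib cmod_power2 algebra_simps)
  have "(\<integral>\<^sup>+ g. ennreal (exp (l * (cmod (y + a * g))\<^sup>2)) \<partial>std_complex_normal)
    = (\<integral>\<^sup>+ x. ennreal (normal_density 0 (sqrt (1 / 2)) x) * (ennreal (exp (l' * (Re m + x)\<^sup>2)) *
      (\<integral>\<^sup>+ y. ennreal (normal_density 0 (sqrt (1 / 2)) y) * ennreal (exp (l' * (Im m + y)\<^sup>2)) \<partial>lborel)) \<partial>lborel)"
    unfolding e
    by (subst nn_integral_std_complex_normal_eq_iterated)
      (auto intro!: nn_integral_cong simp: nn_integral_cmult[symmetric] exp_add ennreal_mult mult_ac)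
  also have "\<dots> = (\<integral>\<^sup>+ x. ennreal (normal_density 0 (sqrt (1 / 2)) x) * ennreal (exp (l' * (Re m + x)\<^sup>2)) \<partial>lborel)
       * ennreal (exp (l' * (Im m)\<^sup>2 / (1 - l')) / sqrt (1 - l'))"
    unfolding nn_integral_exp_quadratic_normal[OF l', of "Im m"]
    by (subst nn_integral_multc[symmetric]) (auto intro!: nn_integral_cong simp: mult_ac)
  also have "\<dots> = ennreal (exp (l * (cmod y)\<^sup>2 / (1 - l')) / (1 - l'))"
    unfolding nn_integral_exp_quadratic_normal[OF l'] e0
    using l' by (simp add: ennreal_mult[symmetric] exp_add add_divide_distrib)
  finally show ?thesis by (simp add: l'_def)
qed

interpretation std_complex_normal_prod: product_sigma_finite "\<lambda>_. std_complex_normal" ..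

text \<open>Integrating over \<open>Q\<close> first leaves an exponential of the same shape in the
  new coordinate, with \<open>l\<close> replaced by \<open>l / v\<close>, so one more complex
  Gaussian integral closes the induction.\<close>

lemma nn_integral_exp_linear_comb:
  fixes l :: real and a :: "'q \<Rightarrow> complex"
  assumes "finite Q" "l * (\<Sum>q\<in>Q. (cmod (a q))\<^sup>2) < 1"
  shows "(\<integral>\<^sup>+ g. ennreal (exp (l * (cmod (y + (\<Sum>q\<in>Q. a q * g q)))\<^sup>2)) \<partial>PiM Q (\<lambda>_. std_complex_normal))
    = ennreal (exp (l * (cmod y)\<^sup>2 / (1 - l * (\<Sum>q\<in>Q. (cmod (a q))\<^sup>2))) / (1 - l * (\<Sum>q\<in>Q. (cmod (a q))\<^sup>2)))"
  using assms
proof (induction Q arbitrary: y rule: finite_induct)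
  case empty
  then show ?case by (simp add: PiM_empty)
next
  case (insert q Q)
  define A where "A = (\<Sum>q\<in>Q. (cmod (a q))\<^sup>2)"
  have A: "A \<ge> 0" by (simp add: A_def sum_nonneg)
  have lt: "l * ((cmod (a q))\<^sup>2 + A) < 1" using insert by (simp add: A_def)
  \<comment> \<open>The hypothesis concerns the full sum; it passes to the partial sum
    \<open>A\<close> for different reasons according to the sign of \<open>l\<close>.\<close>
  have lA: "l * A < 1"
  proof (cases "l \<ge> 0")
    case True
    have "l * A \<le> l * ((cmod (a q))\<^sup>2 + A)" using True by (simp add: mult_left_mono)
    then show ?thesis using lt by simp
  next
    case False
    then have "l * A \<le> 0" using A by (simp add: mult_nonpos_nonneg)
    then show ?thesis by simp
  qed
  define v where "v = 1 - l * A"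
  have v: "v > 0" using lA by (simp add: v_def)
  have lt': "l / v * (cmod (a q))\<^sup>2 < 1" using lt v by (simp add: v_def field_simps)
  have vv: "v - l * (cmod (a q))\<^sup>2 > 0" using lt by (simp add: v_def algebra_simps)
  have "(\<integral>\<^sup>+ g. ennreal (exp (l * (cmod (y + (\<Sum>q\<in>insert q Q. a q * g q)))\<^sup>2)) \<partial>PiM (insert q Q) (\<lambda>_. std_complex_normal))
    = (\<integral>\<^sup>+ x. \<integral>\<^sup>+ g. ennreal (exp (l * (cmod (y + (\<Sum>p\<in>insert q Q. a p * (g(q := x)) p)))\<^sup>2))
        \<partial>PiM Q (\<lambda>_. std_complex_normal) \<partial>std_complex_normal)"
    using insert.hyps by (intro std_complex_normal_prod.product_nn_integral_insert_rev) auto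
  also have "\<dots> = (\<integral>\<^sup>+ x. \<integral>\<^sup>+ g. ennreal (exp (l * (cmod ((y + a q * x) + (\<Sum>p\<in>Q. a p * g p)))\<^sup>2))
        \<partial>PiM Q (\<lambda>_. std_complex_normal) \<partial>std_complex_normal)"
  proof -
    have "(\<Sum>p\<in>Q. a p * (g(q := x)) p) = (\<Sum>p\<in>Q. a p * g p)" for g x
      using insert.hyps by (intro sum.cong) auto
    then show ?thesis using insert.hyps by (simp add: add.assoc)
  qed
  also have "\<dots> = (\<integral>\<^sup>+ x. ennreal (exp (l / v * (cmod (y + a q * x))\<^sup>2)) * ennreal (1 / v) \<partial>std_complex_normal)"
    using insert.IH[unfolded A_def[symmetric], OF lA] v
    by (simp add: v_def[symmetric] ennreal_mult[symmetric])
  also have "\<dots> = ennreal (exp (l / v * (cmod y)\<^sup>2 / (1 - l / v * (cmod (a q))\<^sup>2)) / (1 - l / v * (cmod (a q))\<^sup>2)) * ennreal (1 / v)"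
    by (subst nn_integral_multc) (simp_all only: nn_integral_exp_quadratic_std_complex_normal[OF lt'], simp)
  also have "\<dots> = ennreal (exp (l * (cmod y)\<^sup>2 / (v - l * (cmod (a q))\<^sup>2)) / (v - l * (cmod (a q))\<^sup>2))"
  proof -
    have "1 - l / v * (cmod (a q))\<^sup>2 = (v - l * (cmod (a q))\<^sup>2) / v" using v by (simp add: field_simps)
    then show ?thesis using v vv by (simp add: ennreal_mult[symmetric])
  qed
  also have "v - l * (cmod (a q))\<^sup>2 = 1 - l * (\<Sum>q\<in>insert q Q. (cmod (a q))\<^sup>2)"
    using insert.hyps by (simp add: v_def A_def algebra_simps)
  finally show ?case .
qed

lemma nn_integral_norm_square_std_complex_normal:
  fixes a y :: complex
  shows "(\<integral>\<^sup>+ g. ennreal ((cmod (y + a * g))\<^sup>2) \<partial>std_complex_normal) = ennreal ((cmod y)\<^sup>2 + (cmod a)\<^sup>2)"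
proof -
  let ?\<phi> = "normal_density 0 (sqrt (1 / 2))"
  have m: "(\<integral>\<^sup>+ x. ennreal (?\<phi> x) * ennreal ((p + q * x)\<^sup>2 + c) \<partial>lborel) = ennreal (p\<^sup>2 + q\<^sup>2 / 2 + c)"
    if "c \<ge> 0" for p q c :: real
  proof -
    have i: "has_bochner_integral lborel (\<lambda>x. ?\<phi> x * ((p + q * x)\<^sup>2 + c)) (p\<^sup>2 + q\<^sup>2 / 2 + c)"
    proof -
      have 0: "has_bochner_integral lborel ?\<phi> 1"
        using normal_moment_even[of "sqrt (1/2)" 0 0] by simp
      have 1: "has_bochner_integral lborel (\<lambda>x. ?\<phi> x * x) 0"
        using normal_moment_nz_1[of "sqrt (1/2)" 0] by simp
      have 2: "has_bochner_integral lborel (\<lambda>x. ?\<phi> x * x\<^sup>2) (1 / 2)"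
        using normal_moment_even[of "sqrt (1/2)" 0 1] by (simp add: real_sqrt_divide power_divide fact_numeral)
      have "has_bochner_integral lborel (\<lambda>x. ?\<phi> x * (p\<^sup>2 + c) + (?\<phi> x * x * (2 * p * q) + ?\<phi> x * x\<^sup>2 * q\<^sup>2))
         (1 * (p\<^sup>2 + c) + (0 * (2 * p * q) + 1 / 2 * q\<^sup>2))"
        by (intro has_bochner_integral_add has_bochner_integral_mult_left 0 1 2)
      then show ?thesis by (simp add: power2_eq_square algebra_simps)
    qed
    have "(\<integral>\<^sup>+ x. ennreal (?\<phi> x * ((p + q * x)\<^sup>2 + c)) \<partial>lborel) = ennreal (p\<^sup>2 + q\<^sup>2 / 2 + c)"
      using i that by (subst nn_integral_eq_integral) (auto simp: has_bochner_integral_iff)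
    then show ?thesis using that by (simp add: ennreal_mult del: ennreal_plus)
  qed
  have e: "(cmod (y + a * Complex u v))\<^sup>2 = ((Im y + Im a * u) + Re a * v)\<^sup>2 + ((Re y + Re a * u) - Im a * v)\<^sup>2" for u v
    by (simp add: cmod_power2 algebra_simps)
  have in1: "(\<integral>\<^sup>+ v. ennreal (?\<phi> v) * ennreal ((cmod (y + a * Complex u v))\<^sup>2) \<partial>lborel)
     = ennreal ((Im y + Im a * u)\<^sup>2 + ((Re y + Re a * u)\<^sup>2 + (cmod a)\<^sup>2 / 2))" for u
  proof -
    have "(\<integral>\<^sup>+ v. ennreal (?\<phi> v) * ennreal ((cmod (y + a * Complex u v))\<^sup>2) \<partial>lborel)
      = (\<integral>\<^sup>+ v. ennreal (?\<phi> v) * ennreal (((Im y + Im a * u) + Re a * v)\<^sup>2 + 0)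
           + ennreal (?\<phi> v) * ennreal (((Re y + Re a * u) + (- Im a) * v)\<^sup>2 + 0) \<partial>lborel)"
      unfolding e by (intro nn_integral_cong) (simp add: distrib_left)
    also have "\<dots> = ennreal ((Im y + Im a * u)\<^sup>2 + (Re a)\<^sup>2 / 2 + 0) + ennreal ((Re y + Re a * u)\<^sup>2 + (- Im a)\<^sup>2 / 2 + 0)"
      by (subst nn_integral_add) (simp_all only: m order_refl, auto)
    finally show ?thesis by (simp add: ennreal_plus[symmetric] cmod_power2 algebra_simps add_divide_distrib del: ennreal_plus)
  qed
  have "(\<integral>\<^sup>+ g. ennreal ((cmod (y + a * g))\<^sup>2) \<partial>std_complex_normal)
      = (\<integral>\<^sup>+ u. ennreal (?\<phi> u) * ennreal ((Im y + Im a * u)\<^sup>2 + 0)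
           + ennreal (?\<phi> u) * ennreal ((Re y + Re a * u)\<^sup>2 + (cmod a)\<^sup>2 / 2) \<partial>lborel)"
    by (subst nn_integral_std_complex_normal_eq_iterated)
      (auto intro!: nn_integral_cong simp: in1 distrib_left[symmetric])
  also have "\<dots> = ennreal ((Im y)\<^sup>2 + (Im a)\<^sup>2 / 2 + 0) + ennreal ((Re y)\<^sup>2 + (Re a)\<^sup>2 / 2 + (cmod a)\<^sup>2 / 2)"
    by (subst nn_integral_add) (subst m | simp)+
  finally show ?thesis by (simp add: ennreal_plus[symmetric] cmod_power2 algebra_simps add_divide_distrib del: ennreal_plus)
qed

lemma nn_integral_norm_square_linear_comb:
  fixes a :: "'q \<Rightarrow> complex"
  assumes "finite Q"
  shows "(\<integral>\<^sup>+ g. ennreal ((cmod (y + (\<Sum>q\<in>Q. a q * g q)))\<^sup>2) \<partial>PiM Q (\<lambda>_. std_complex_normal))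
    = ennreal ((cmod y)\<^sup>2 + (\<Sum>q\<in>Q. (cmod (a q))\<^sup>2))"
  using assms
proof (induction Q arbitrary: y rule: finite_induct)
  case empty
  then show ?case by (simp add: PiM_empty)
next
  case (insert q Q)
  have "(\<integral>\<^sup>+ g. ennreal ((cmod (y + (\<Sum>q\<in>insert q Q. a q * g q)))\<^sup>2) \<partial>PiM (insert q Q) (\<lambda>_. std_complex_normal))
    = (\<integral>\<^sup>+ x. \<integral>\<^sup>+ g. ennreal ((cmod (y + (\<Sum>p\<in>insert q Q. a p * (g(q := x)) p)))\<^sup>2)
        \<partial>PiM Q (\<lambda>_. std_complex_normal) \<partial>std_complex_normal)"
    using insert.hyps by (intro std_complex_normal_prod.product_nn_integral_insert_rev) auto
  also have "\<dots> = (\<integral>\<^sup>+ x. \<integral>\<^sup>+ g. ennreal ((cmod ((y + a q * x) + (\<Sum>p\<in>Q. a p * g p)))\<^sup>2)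
        \<partial>PiM Q (\<lambda>_. std_complex_normal) \<partial>std_complex_normal)"
  proof -
    have "(\<Sum>p\<in>Q. a p * (g(q := x)) p) = (\<Sum>p\<in>Q. a p * g p)" for g x
      using insert.hyps by (intro sum.cong) auto
    then show ?thesis using insert.hyps by (simp add: add.assoc)
  qed
  also have "\<dots> = (\<integral>\<^sup>+ x. ennreal ((cmod (y + a q * x))\<^sup>2) + ennreal (\<Sum>q\<in>Q. (cmod (a q))\<^sup>2) \<partial>std_complex_normal)"
    unfolding insert.IH by (simp add: sum_nonneg)
  also have "\<dots> = ennreal ((cmod y)\<^sup>2 + (cmod (a q))\<^sup>2) + ennreal (\<Sum>q\<in>Q. (cmod (a q))\<^sup>2)"
    using std_complex_normal.emeasure_space_1
    by (subst nn_integral_add) (simp_all add: nn_integral_norm_square_std_complex_normal)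
  finally show ?case using insert.hyps by (simp add: sum_nonneg ennreal_plus[symmetric] add.assoc del: ennreal_plus)
qed

lemma prob_space_PiM_std_complex_normal: "prob_space (PiM J (\<lambda>_. std_complex_normal))"
  by (intro prob_space_PiM std_complex_normal.prob_space_axioms)

lemma measurable_component_std_complex_normal:
  "q \<in> Q \<Longrightarrow> (\<lambda>g. g q) \<in> borel_measurable (PiM Q (\<lambda>_. std_complex_normal))"
  using measurable_component_singleton[of q Q "\<lambda>_. std_complex_normal"] by simp

text \<open>The noise sample acts as one more coordinate with coefficient 1. It is kept apart
  because noise and codebooks live on different spaces.\<close>

lemma nn_integral_exp_noise_linear_comb:
  fixes l :: real and a :: "'q \<Rightarrow> complex"
  assumes Q: "finite Q" and l: "l * (1 + (\<Sum>q\<in>Q. (cmod (a q))\<^sup>2)) < 1"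
  shows "(\<integral>\<^sup>+ z. \<integral>\<^sup>+ g. ennreal (exp (l * (cmod (z + (\<Sum>q\<in>Q. a q * g q)))\<^sup>2))
       \<partial>PiM Q (\<lambda>_. std_complex_normal) \<partial>std_complex_normal)
    = ennreal (1 / (1 - l * (1 + (\<Sum>q\<in>Q. (cmod (a q))\<^sup>2))))"
proof -
  define A where "A = (\<Sum>q\<in>Q. (cmod (a q))\<^sup>2)"
  have A: "A \<ge> 0" by (simp add: A_def sum_nonneg)
  have lA: "l * A < 1"
  proof (cases "l \<ge> 0")
    case True
    then have "l * A \<le> l * (1 + A)" by (simp add: mult_left_mono)
    then show ?thesis using l by (simp add: A_def)
  next
    case False
    then have "l * A \<le> 0" using A by (simp add: mult_nonpos_nonneg)
    then show ?thesis by simp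
  qed
  define v where "v = 1 - l * A"
  have v: "v > 0" using lA by (simp add: v_def)
  have lt: "l / v * (cmod 1)\<^sup>2 < 1" using l v by (simp add: v_def A_def field_simps)
  have "(\<integral>\<^sup>+ z. \<integral>\<^sup>+ g. ennreal (exp (l * (cmod (z + (\<Sum>q\<in>Q. a q * g q)))\<^sup>2))
       \<partial>PiM Q (\<lambda>_. std_complex_normal) \<partial>std_complex_normal)
     = (\<integral>\<^sup>+ z. ennreal (exp (l / v * (cmod (0 + 1 * z))\<^sup>2)) * ennreal (1 / v) \<partial>std_complex_normal)"
    using nn_integral_exp_linear_comb[OF Q, of l a] lA v
    by (simp add: A_def[symmetric] v_def[symmetric] ennreal_mult[symmetric])
  also have "\<dots> = ennreal (exp (l / v * (cmod 0)\<^sup>2 / (1 - l / v * (cmod 1)\<^sup>2)) / (1 - l / v * (cmod 1)\<^sup>2)) * ennreal (1 / v)"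
    by (subst nn_integral_multc, simp)
      (simp only: nn_integral_exp_quadratic_std_complex_normal[OF lt])
  also have "\<dots> = ennreal (1 / (1 - l * (1 + A)))"
  proof -
    have "(1 - l / v) * v = 1 - l * (1 + A)" using v by (simp add: v_def field_simps)
    moreover have "1 - l / v > 0" using lt by simp
    ultimately show ?thesis using v by (simp add: ennreal_mult[symmetric])
  qed
  finally show ?thesis by (simp add: A_def)
qed

lemma nn_integral_PiM_split_coordinate:
  assumes "finite Q" "q \<in> Q" and [measurable]: "f \<in> borel_measurable (PiM Q (\<lambda>_. std_complex_normal))"
  shows "(\<integral>\<^sup>+ g. f g \<partial>PiM Q (\<lambda>_. std_complex_normal))
    = (\<integral>\<^sup>+ g. \<integral>\<^sup>+ x. f (g(q := x)) \<partial>std_complex_normal \<partial>PiM (Q - {q}) (\<lambda>_. std_complex_normal))"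
  using std_complex_normal_prod.product_nn_integral_insert[of "Q - {q}" q f] assms by (simp add: insert_absorb)

section \<open>Gaussian random codes\<close>

text \<open>Up to the factor \<open>v / (v + (cmod h)\<^sup>2)\<close>, the integrand is the
  likelihood ratio of \<open>CN(h * g q, v)\<close> against
  \<open>CN(0, v + (cmod h)\<^sup>2)\<close> at the output. As \<open>a q = 0\<close>, the letter
  \<open>g q\<close> is independent of that output, and the ratio then averages to 1 whatever the
  output is.\<close>

lemma nn_integral_wrong_codeword:
  fixes a :: "'q \<Rightarrow> complex"
  assumes Q: "finite Q" "q \<in> Q" "a q = 0" and v: "v > 0"
  shows "(\<integral>\<^sup>+ g. ennreal (exp ((cmod (z + (\<Sum>p\<in>Q. a p * g p)))\<^sup>2 / (v + (cmod h)\<^sup>2)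
       - (cmod (z + (\<Sum>p\<in>Q. a p * g p) - h * g q))\<^sup>2 / v)) \<partial>PiM Q (\<lambda>_. std_complex_normal))
    = ennreal (v / (v + (cmod h)\<^sup>2))"
proof -
  have s: "(\<Sum>p\<in>Q. a p * (g(q := x)) p) = (\<Sum>p\<in>Q. a p * g p)" for g x
    using Q by (intro sum.cong) auto
  have vh: "v + (cmod h)\<^sup>2 > 0" using v by (simp add: add_pos_nonneg)
  have in1: "(\<integral>\<^sup>+ x. ennreal (exp ((cmod y)\<^sup>2 / (v + (cmod h)\<^sup>2) - (cmod (y - h * x))\<^sup>2 / v)) \<partial>std_complex_normal)
     = ennreal (v / (v + (cmod h)\<^sup>2))" for y
  proof -
    have lt: "- (1 / v) * (cmod (- h))\<^sup>2 < 1"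
      using v by (smt (verit) divide_nonneg_pos mult_minus_left mult_nonneg_nonneg zero_le_power2)
    have e: "1 - - (1 / v) * (cmod (- h))\<^sup>2 = (v + (cmod h)\<^sup>2) / v" using v by (simp add: field_simps)
    have "(\<integral>\<^sup>+ x. ennreal (exp ((cmod y)\<^sup>2 / (v + (cmod h)\<^sup>2) - (cmod (y - h * x))\<^sup>2 / v)) \<partial>std_complex_normal)
      = (\<integral>\<^sup>+ x. ennreal (exp ((cmod y)\<^sup>2 / (v + (cmod h)\<^sup>2))) * ennreal (exp (- (1 / v) * (cmod (y + (- h) * x))\<^sup>2)) \<partial>std_complex_normal)"
      by (intro nn_integral_cong) (simp add: ennreal_mult[symmetric] exp_add[symmetric])
    also have "\<dots> = ennreal (exp ((cmod y)\<^sup>2 / (v + (cmod h)\<^sup>2))) *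
        ennreal (exp (- (1 / v) * (cmod y)\<^sup>2 / ((v + (cmod h)\<^sup>2) / v)) / ((v + (cmod h)\<^sup>2) / v))"
      by (subst nn_integral_cmult) (simp_all only: nn_integral_exp_quadratic_std_complex_normal[OF lt] e, measurable)
    also have "- (1 / v) * (cmod y)\<^sup>2 / ((v + (cmod h)\<^sup>2) / v) = - ((cmod y)\<^sup>2 / (v + (cmod h)\<^sup>2))"
      using v by simp
    finally show ?thesis using v vh by (simp add: ennreal_mult[symmetric] exp_minus)
  qed
  have [measurable]: "\<And>p. p \<in> Q \<Longrightarrow> (\<lambda>g. g p) \<in> borel_measurable (PiM Q (\<lambda>_. std_complex_normal))"
    by (rule measurable_component_std_complex_normal)
  show ?thesis
    using Q prob_space.emeasure_space_1[OF prob_space_PiM_std_complex_normal, of "Q - {q}"]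
    by (subst nn_integral_PiM_split_coordinate[OF Q(1,2)]) (simp_all add: s in1 del: fun_upd_apply, simp add: in1)
qed

lemma prod_reindex_indicator:
  fixes H :: "'a \<Rightarrow> 'c :: comm_monoid_mult"
  assumes "finite J" "\<tau> ` I \<subseteq> J" "inj_on \<tau> I"
  shows "(\<Prod>t\<in>I. H (z (\<tau> t))) = (\<Prod>p\<in>J. if p \<in> \<tau> ` I then H (z p) else 1)"
  using assms by (subst prod.inter_restrict[symmetric]) (auto simp: prod.reindex Int_absorb1)

text \<open>Independence of the positions \<open>t\<close> of the random codebook and of the corresponding noise samples
  \<open>z (\<tau> t)\<close>.\<close>

lemma nn_integral_noise_codebook_prod:
  assumes J: "finite J" "\<tau> ` {..<n} \<subseteq> J" "inj_on \<tau> {..<n}"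
    and Q: "finite Q"
    and F[measurable]: "(\<lambda>(x, g). F x g) \<in> borel_measurable (borel \<Otimes>\<^sub>M PiM Q (\<lambda>_. std_complex_normal))"
  shows "(\<integral>\<^sup>+ z. \<integral>\<^sup>+ \<theta>. (\<Prod>t<n. F (z (\<tau> t)) (\<theta> t)) \<partial>PiM {..<n} (\<lambda>_. PiM Q (\<lambda>_. std_complex_normal))
      \<partial>PiM J (\<lambda>_. std_complex_normal))
    = (\<integral>\<^sup>+ x. \<integral>\<^sup>+ g. F x g \<partial>PiM Q (\<lambda>_. std_complex_normal) \<partial>std_complex_normal) ^ n"
proof -
  interpret PQ: prob_space "PiM Q (\<lambda>_. std_complex_normal)" by (rule prob_space_PiM_std_complex_normal)
  interpret P: product_sigma_finite "\<lambda>_::nat. PiM Q (\<lambda>_. std_complex_normal)" ..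
  define H where "H = (\<lambda>x. \<integral>\<^sup>+ g. F x g \<partial>PiM Q (\<lambda>_. std_complex_normal))"
  have F1: "F x \<in> borel_measurable (PiM Q (\<lambda>_. std_complex_normal))" for x
    using measurable_compose[OF _ F, of "\<lambda>g. (x, g)"] by simp
  have [measurable]: "H \<in> borel_measurable borel"
    unfolding H_def by measurable
  have "(\<integral>\<^sup>+ z. \<integral>\<^sup>+ \<theta>. (\<Prod>t<n. F (z (\<tau> t)) (\<theta> t)) \<partial>PiM {..<n} (\<lambda>_. PiM Q (\<lambda>_. std_complex_normal))
      \<partial>PiM J (\<lambda>_. std_complex_normal)) = (\<integral>\<^sup>+ z. (\<Prod>t<n. H (z (\<tau> t))) \<partial>PiM J (\<lambda>_. std_complex_normal))"
    unfolding H_def by (intro nn_integral_cong P.product_nn_integral_prod) (auto intro: F1)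
  also have "\<dots> = (\<integral>\<^sup>+ z. (\<Prod>p\<in>J. (if p \<in> \<tau> ` {..<n} then H else (\<lambda>_. 1)) (z p)) \<partial>PiM J (\<lambda>_. std_complex_normal))"
    by (subst prod_reindex_indicator[OF J]) (auto intro!: nn_integral_cong prod.cong)
  also have "\<dots> = (\<Prod>p\<in>J. \<integral>\<^sup>+ x. (if p \<in> \<tau> ` {..<n} then H else (\<lambda>_. 1)) x \<partial>std_complex_normal)"
    using J by (intro std_complex_normal_prod.product_nn_integral_prod) auto
  also have "\<dots> = (\<Prod>p\<in>J. if p \<in> \<tau> ` {..<n} then (\<integral>\<^sup>+ x. H x \<partial>std_complex_normal) else 1)"
    using std_complex_normal.emeasure_space_1 by (intro prod.cong) auto
  also have "\<dots> = (\<integral>\<^sup>+ x. H x \<partial>std_complex_normal) ^ n"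
    using J by (subst prod.inter_restrict[symmetric]) (auto simp: Int_absorb1 card_image)
  finally show ?thesis by (simp add: H_def)
qed

text \<open>The log-likelihood ratio of "\<open>X\<close> was sent" against an independent input,
  without the constant \<open>n * ln ((v + (cmod h)\<^sup>2) / v)\<close>. Without it, the true
  codeword has expected score 0 when \<open>v\<close> is the exact noise variance.\<close>

definition score :: "nat \<Rightarrow> complex \<Rightarrow> real \<Rightarrow> (nat \<Rightarrow> complex) \<Rightarrow> (nat \<Rightarrow> complex) \<Rightarrow> real" where
  "score n h v Y X = (\<Sum>t<n. (cmod (Y t))\<^sup>2 / (v + (cmod h)\<^sup>2) - (cmod (Y t - h * X t))\<^sup>2 / v)"

text \<open>Here \<open>s\<close> is the actual noise variance and \<open>v\<close> the one assumed
  by the decoder. Up to relative errors \<open>e\<close>, the normalised score is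
  \<open>q - p\<close> with \<open>p = s / v\<close> and
  \<open>q = (s + (cmod h)\<^sup>2) / (v + (cmod h)\<^sup>2)\<close>. Overestimating the noise is
  harmless because \<open>p \<le> q\<close>, and both are at most 1, hence the slack
  \<open>2 * e\<close>.\<close>

lemma score_true_codeword_ge:
  fixes W X :: "nat \<Rightarrow> complex"
  assumes s: "0 < s" "s \<le> v" and e: "0 < e" "e < 1"
    and W: "(\<Sum>t<n. (cmod (W t))\<^sup>2) \<le> n * s * (1 + e)"
    and Y: "(\<Sum>t<n. (cmod (W t + h * X t))\<^sup>2) \<ge> n * (s + (cmod h)\<^sup>2) * (1 - e)"
  shows "score n h v (\<lambda>t. W t + h * X t) X \<ge> - (2 * e * n)"
proof -
  have pos: "v > 0" "s + (cmod h)\<^sup>2 > 0" "v + (cmod h)\<^sup>2 > 0" using s by (auto intro!: add_pos_nonneg)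
  define p where "p = s / v"
  define q where "q = (s + (cmod h)\<^sup>2) / (v + (cmod h)\<^sup>2)"
  have p: "p \<le> 1" using s by (simp add: p_def)
  have q: "q \<le> 1" using s pos by (simp add: q_def)
  have "s * (cmod h)\<^sup>2 \<le> v * (cmod h)\<^sup>2" using s by (simp add: mult_right_mono)
  then have pq: "p \<le> q" using pos by (simp add: p_def q_def field_simps)
  have "score n h v (\<lambda>t. W t + h * X t) X
     = (\<Sum>t<n. (cmod (W t + h * X t))\<^sup>2) / (v + (cmod h)\<^sup>2) - (\<Sum>t<n. (cmod (W t))\<^sup>2) / v"
    by (simp add: score_def sum_subtractf sum_divide_distrib)
  also have "\<dots> \<ge> n * (s + (cmod h)\<^sup>2) * (1 - e) / (v + (cmod h)\<^sup>2) - n * s * (1 + e) / v"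
    using W Y pos by (intro diff_mono divide_right_mono) auto
  also have "n * (s + (cmod h)\<^sup>2) * (1 - e) / (v + (cmod h)\<^sup>2) - n * s * (1 + e) / v
     = n * ((q - p) - e * (q + p))"
    by (simp add: p_def q_def algebra_simps add_divide_distrib diff_divide_distrib)
  also have "\<dots> \<ge> n * (- (2 * e))"
  proof (intro mult_left_mono)
    have "e * (q + p) \<le> e * 2" using p q e by (intro mult_left_mono) auto
    then show "- (2 * e) \<le> q - p - e * (q + p)" using pq by simp
  qed simp
  finally show ?thesis by (simp add: mult_ac)
qed

text \<open>The terms bound, in this order, the chances that the noise energy is too large, that the
  output energy is too small, and that one of \<open>M - 1\<close> wrong codewords passes the
  threshold.\<close>

definition step_bound :: "real \<Rightarrow> nat \<Rightarrow> real \<Rightarrow> real \<Rightarrow> nat \<Rightarrow> real" where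
  "step_bound e M v H n = ((1 + e) * exp (- e)) ^ n + ((1 - e) * exp e) ^ n
      + real (M - 1) * (exp (2 * e) * v / (v + H)) ^ n"

text \<open>Each failure event is dominated by a product over the positions \<open>t\<close>
  (Markov's inequality in exponential form); positions are independent, so the expectations are
  \<open>n\<close>-th powers. The map \<open>\<tau>\<close> places position \<open>t\<close> at a
  channel time, so that one bound serves every block and receiver.\<close>

lemma random_coding_bound:
  fixes a :: "'q \<Rightarrow> complex"
  assumes J: "finite J" "\<tau> ` {..<n} \<subseteq> J" "inj_on \<tau> {..<n}"
    and Q: "finite Q" "q0 \<in> Q" "C \<subseteq> Q" "q0 \<notin> C" and a: "a q0 = 0" "\<And>q. q \<in> C \<Longrightarrow> a q = 0"
    and v: "1 + (\<Sum>q\<in>Q. (cmod (a q))\<^sup>2) \<le> v" and e: "0 < e" "e < 1"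
    and Y: "\<And>\<theta> z t. t < n \<Longrightarrow> Y \<theta> z t = z (\<tau> t) + h * \<theta> t q0 + (\<Sum>q\<in>Q. a q * \<theta> t q)"
  defines "ok \<equiv> \<lambda>\<theta> z. score n h v (Y \<theta> z) (\<lambda>t. \<theta> t q0) \<ge> - (2 * e * n) \<and>
     (\<forall>q\<in>C. score n h v (Y \<theta> z) (\<lambda>t. \<theta> t q) < - (2 * e * n))"
  shows "(\<integral>\<^sup>+ z. \<integral>\<^sup>+ \<theta>. of_bool (\<not> ok \<theta> z) \<partial>PiM {..<n} (\<lambda>_. PiM Q (\<lambda>_. std_complex_normal))
      \<partial>PiM J (\<lambda>_. std_complex_normal)) \<le> ennreal (step_bound e (Suc (card C)) v ((cmod h)\<^sup>2) n)"
proof -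
  define s where "s = 1 + (\<Sum>q\<in>Q. (cmod (a q))\<^sup>2)"
  have s: "s > 0" "s \<le> v" using v by (auto simp: s_def intro!: add_pos_nonneg sum_nonneg)
  \<comment> \<open>The coefficients of the whole output, true codeword included, as opposed to
    those of the interference.\<close>
  define b where "b = a(q0 := h)"
  have sb: "1 + (\<Sum>q\<in>Q. (cmod (b q))\<^sup>2) = s + (cmod h)\<^sup>2"
    using Q a by (simp add: s_def b_def sum.remove)
  have sh: "s + (cmod h)\<^sup>2 > 0" using s by (auto intro!: add_pos_nonneg)
  have finC: "finite C" using Q finite_subset by blast
  let ?MQ = "PiM Q (\<lambda>_. std_complex_normal)"
  let ?Mn = "PiM {..<n} (\<lambda>_. ?MQ)"
  let ?MJ = "PiM J (\<lambda>_. std_complex_normal)"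
  have [measurable]: "\<And>p. p \<in> Q \<Longrightarrow> (\<lambda>g. g p) \<in> borel_measurable ?MQ"
    by (rule measurable_component_std_complex_normal)
  have q0m[measurable]: "(\<lambda>g. g q0) \<in> borel_measurable ?MQ" using Q by measurable
  define W where "W = (\<lambda>x g. x + (\<Sum>q\<in>Q. a q * g q))"
  define V where "V = (\<lambda>x g. x + (\<Sum>q\<in>Q. b q * g q))"
  have V: "V x g = W x g + h * g q0" for x g
    using Q a by (simp add: V_def W_def b_def sum.remove)
  \<comment> \<open>The exponents in \<open>F1\<close> and \<open>F2\<close> minimise the Chernoff
    bounds for an energy above \<open>1 + e\<close> and below \<open>1 - e\<close> times its mean,
    which is \<open>s\<close> and \<open>s + (cmod h)\<^sup>2\<close> per position.\<close>
  define F1 where "F1 = (\<lambda>x g. ennreal (exp (e / (1 + e) / s * (cmod (W x g))\<^sup>2)) * ennreal (exp (- e)))"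
  define F2 where "F2 = (\<lambda>x g. ennreal (exp (- (e / (1 - e)) / (s + (cmod h)\<^sup>2) * (cmod (V x g))\<^sup>2)) * ennreal (exp e))"
  define F3 where "F3 = (\<lambda>q x g. ennreal (exp ((cmod (V x g))\<^sup>2 / (v + (cmod h)\<^sup>2) - (cmod (V x g - h * g q))\<^sup>2 / v)) * ennreal (exp (2 * e)))"
  have mF1[measurable]: "(\<lambda>(x, g). F1 x g) \<in> borel_measurable (borel \<Otimes>\<^sub>M ?MQ)"
    unfolding F1_def W_def case_prod_beta by measurable
  have mF2[measurable]: "(\<lambda>(x, g). F2 x g) \<in> borel_measurable (borel \<Otimes>\<^sub>M ?MQ)"
    unfolding F2_def V_def case_prod_beta by measurable
  have mF3[measurable]: "(\<lambda>(x, g). F3 q x g) \<in> borel_measurable (borel \<Otimes>\<^sub>M ?MQ)" if [measurable]: "q \<in> Q" for q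
  proof -
    have [measurable]: "(\<lambda>g. g q) \<in> borel_measurable ?MQ" using that by measurable
    show ?thesis unfolding F3_def V_def case_prod_beta by measurable
  qed
  have multc: "(\<integral>\<^sup>+ x. \<integral>\<^sup>+ g. f x g * c \<partial>?MQ \<partial>std_complex_normal) = (\<integral>\<^sup>+ x. \<integral>\<^sup>+ g. f x g \<partial>?MQ \<partial>std_complex_normal) * c"
    if f[measurable]: "(\<lambda>(x, g). f x g) \<in> borel_measurable (borel \<Otimes>\<^sub>M ?MQ)" for f and c :: ennreal
  proof -
    interpret PQ: prob_space ?MQ by (rule prob_space_PiM_std_complex_normal)
    have "f x \<in> borel_measurable ?MQ" for x
      using measurable_compose[OF _ f, of "\<lambda>g. (x, g)"] by simp
    then have "(\<integral>\<^sup>+ x. \<integral>\<^sup>+ g. f x g * c \<partial>?MQ \<partial>std_complex_normal) = (\<integral>\<^sup>+ x. (\<integral>\<^sup>+ g. f x g \<partial>?MQ) * c \<partial>std_complex_normal)"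
      by (simp add: nn_integral_multc)
    also have "\<dots> = (\<integral>\<^sup>+ x. \<integral>\<^sup>+ g. f x g \<partial>?MQ \<partial>std_complex_normal) * c"
      by (rule nn_integral_multc) measurable
    finally show ?thesis .
  qed
  have i1: "(\<integral>\<^sup>+ x. \<integral>\<^sup>+ g. F1 x g \<partial>?MQ \<partial>std_complex_normal) = ennreal ((1 + e) * exp (- e))"
  proof -
    have l: "e / (1 + e) / s * (1 + (\<Sum>q\<in>Q. (cmod (a q))\<^sup>2)) = e / (1 + e)"
      unfolding s_def[symmetric] using s by simp
    have "(\<integral>\<^sup>+ x. \<integral>\<^sup>+ g. F1 x g \<partial>?MQ \<partial>std_complex_normal) = ennreal (1 / (1 - e / (1 + e))) * ennreal (exp (- e))"
    proof -
      have "e / (1 + e) < 1" using e by simp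
      then show ?thesis unfolding F1_def W_def
        by (subst multc, unfold case_prod_beta, measurable)
          (subst nn_integral_exp_noise_linear_comb[OF Q(1)], simp_all only: l)
    qed
    also have "1 / (1 - e / (1 + e)) = 1 + e" using e by (simp add: field_simps)
    finally show ?thesis using e by (simp add: ennreal_mult)
  qed
  have i2: "(\<integral>\<^sup>+ x. \<integral>\<^sup>+ g. F2 x g \<partial>?MQ \<partial>std_complex_normal) = ennreal ((1 - e) * exp e)"
  proof -
    have l: "- (e / (1 - e)) / (s + (cmod h)\<^sup>2) * (1 + (\<Sum>q\<in>Q. (cmod (b q))\<^sup>2)) = - (e / (1 - e))"
      unfolding sb using sh by simp
    have "- (e / (1 - e)) \<le> 0" using e by simp
    then have l1: "- (e / (1 - e)) < 1" by linarith
    have "(\<integral>\<^sup>+ x. \<integral>\<^sup>+ g. F2 x g \<partial>?MQ \<partial>std_complex_normal) = ennreal (1 / (1 - - (e / (1 - e)))) * ennreal (exp e)"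
      unfolding F2_def V_def
      by (subst multc, unfold case_prod_beta, measurable)
        (subst nn_integral_exp_noise_linear_comb[OF Q(1)], use l1 in \<open>simp_all only: l\<close>)
    also have "1 / (1 - - (e / (1 - e))) = 1 - e" using e by (simp add: field_simps)
    finally show ?thesis using e by (simp add: ennreal_mult)
  qed
  have i3: "(\<integral>\<^sup>+ x. \<integral>\<^sup>+ g. F3 q x g \<partial>?MQ \<partial>std_complex_normal) = ennreal (exp (2 * e) * v / (v + (cmod h)\<^sup>2))"
    if "q \<in> C" for q
  proof -
    have [measurable]: "q \<in> Q" using that Q by auto
    have [measurable]: "(\<lambda>g. g q) \<in> borel_measurable ?MQ" by measurable
    have bq: "b q = 0" using that a Q by (auto simp: b_def)
    have "(\<integral>\<^sup>+ g. F3 q x g \<partial>?MQ) = ennreal (v / (v + (cmod h)\<^sup>2)) * ennreal (exp (2 * e))" for x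
      unfolding F3_def V_def using s
      by (subst nn_integral_multc, measurable) (subst nn_integral_wrong_codeword[where q=q], use Q that bq in auto)
    then show ?thesis using std_complex_normal.emeasure_space_1 s
      by (simp add: ennreal_mult[symmetric] mult_ac)
  qed
  have W2: "(\<lambda>t. W (z (\<tau> t)) (\<theta> t) + h * \<theta> t q0) = (\<lambda>t. V (z (\<tau> t)) (\<theta> t))" for z \<theta>
    by (simp add: V)
  have scY: "score n h v (Y \<theta> z) X = score n h v (\<lambda>t. V (z (\<tau> t)) (\<theta> t)) X" for \<theta> z X
    unfolding score_def by (intro sum.cong) (auto simp: Y V W_def algebra_simps)
  have bound: "of_bool (\<not> ok \<theta> z) \<le> (\<Prod>t<n. F1 (z (\<tau> t)) (\<theta> t)) + (\<Prod>t<n. F2 (z (\<tau> t)) (\<theta> t))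
      + (\<Sum>q\<in>C. \<Prod>t<n. F3 q (z (\<tau> t)) (\<theta> t))" for \<theta> z
  proof (cases "ok \<theta> z")
    case False
    have P1: "(\<Prod>t<n. F1 (z (\<tau> t)) (\<theta> t)) = ennreal (exp (e / (1 + e) / s * (\<Sum>t<n. (cmod (W (z (\<tau> t)) (\<theta> t)))\<^sup>2) - n * e))"
      unfolding F1_def by (simp add: ennreal_mult[symmetric] prod_ennreal exp_sum[symmetric] exp_add[symmetric]
          sum.distrib sum_distrib_left sum_divide_distrib sum_subtractf)
    have P2: "(\<Prod>t<n. F2 (z (\<tau> t)) (\<theta> t)) = ennreal (exp (- (e / (1 - e)) / (s + (cmod h)\<^sup>2) * (\<Sum>t<n. (cmod (V (z (\<tau> t)) (\<theta> t)))\<^sup>2) + n * e))"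
      unfolding F2_def by (simp add: ennreal_mult[symmetric] prod_ennreal exp_sum[symmetric] exp_add[symmetric]
          sum.distrib sum_distrib_left sum_divide_distrib sum_negf sum_subtractf)
    have P3: "(\<Prod>t<n. F3 q (z (\<tau> t)) (\<theta> t)) = ennreal (exp (score n h v (Y \<theta> z) (\<lambda>t. \<theta> t q) + 2 * e * n))" for q
      unfolding F3_def scY unfolding score_def
      by (simp add: ennreal_mult[symmetric] prod_ennreal exp_sum[symmetric] exp_add[symmetric]
          sum.distrib sum_distrib_left sum_divide_distrib mult_ac)
    consider (true) "score n h v (Y \<theta> z) (\<lambda>t. \<theta> t q0) < - (2 * e * n)"
      | (wrong) q where "q \<in> C" "score n h v (Y \<theta> z) (\<lambda>t. \<theta> t q) \<ge> - (2 * e * n)"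
      using False unfolding ok_def by force
    then show ?thesis
    proof cases
      case true
      have "(\<Sum>t<n. (cmod (W (z (\<tau> t)) (\<theta> t)))\<^sup>2) > n * s * (1 + e) \<or>
        (\<Sum>t<n. (cmod (W (z (\<tau> t)) (\<theta> t) + h * \<theta> t q0))\<^sup>2) < n * (s + (cmod h)\<^sup>2) * (1 - e)"
        using score_true_codeword_ge[OF s e, where n=n and W="\<lambda>t. W (z (\<tau> t)) (\<theta> t)" and h=h and X="\<lambda>t. \<theta> t q0"] true
        unfolding scY W2 by linarith
      then show ?thesis
      proof
        assume "(\<Sum>t<n. (cmod (W (z (\<tau> t)) (\<theta> t)))\<^sup>2) > n * s * (1 + e)"
        then have "e / (1 + e) / s * (\<Sum>t<n. (cmod (W (z (\<tau> t)) (\<theta> t)))\<^sup>2) \<ge> e / (1 + e) / s * (n * s * (1 + e))"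
          using e s by (intro mult_left_mono) auto
        also have "e / (1 + e) / s * (n * s * (1 + e)) = n * e" using e s by simp
        finally have "(\<Prod>t<n. F1 (z (\<tau> t)) (\<theta> t)) \<ge> 1" unfolding P1 by simp
        then show ?thesis by (auto simp: add.assoc add_increasing2)
      next
        assume "(\<Sum>t<n. (cmod (W (z (\<tau> t)) (\<theta> t) + h * \<theta> t q0))\<^sup>2) < n * (s + (cmod h)\<^sup>2) * (1 - e)"
        then have "- (e / (1 - e)) / (s + (cmod h)\<^sup>2) * (\<Sum>t<n. (cmod (V (z (\<tau> t)) (\<theta> t)))\<^sup>2)
            \<ge> - (e / (1 - e)) / (s + (cmod h)\<^sup>2) * (n * (s + (cmod h)\<^sup>2) * (1 - e))"
          using e sh unfolding V by (intro mult_left_mono_neg) auto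
        moreover have "- (e / (1 - e)) / (s + (cmod h)\<^sup>2) * (n * (s + (cmod h)\<^sup>2) * (1 - e)) = - (n * e)"
          using e sh by simp
        ultimately have "(\<Prod>t<n. F2 (z (\<tau> t)) (\<theta> t)) \<ge> 1" unfolding P2 by simp
        then have "1 \<le> (\<Prod>t<n. F1 (z (\<tau> t)) (\<theta> t)) + (\<Prod>t<n. F2 (z (\<tau> t)) (\<theta> t))"
          by (simp add: add_increasing)
        then show ?thesis by (auto simp: add_increasing2)
      qed
    next
      case wrong
      then have "1 \<le> (\<Prod>t<n. F3 q (z (\<tau> t)) (\<theta> t))" unfolding P3 by simp
      also have "\<dots> \<le> (\<Sum>q\<in>C. \<Prod>t<n. F3 q (z (\<tau> t)) (\<theta> t))"
        using wrong finC by (intro member_le_sum) auto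
      finally show ?thesis by (auto simp: add_increasing)
    qed
  qed simp
  interpret PQ: prob_space ?MQ by (rule prob_space_PiM_std_complex_normal)
  interpret Pn: prob_space ?Mn by (intro prob_space_PiM PQ.prob_space_axioms)
  have pm: "(\<lambda>(z, \<theta>). \<Prod>t<n. F (z (\<tau> t)) (\<theta> t)) \<in> borel_measurable (?MJ \<Otimes>\<^sub>M ?Mn)"
    if [measurable]: "(\<lambda>(x, g). F x g) \<in> borel_measurable (borel \<Otimes>\<^sub>M ?MQ)" for F :: "complex \<Rightarrow> ('q \<Rightarrow> complex) \<Rightarrow> ennreal"
  proof -
    have "(\<lambda>p. F (fst p (\<tau> t)) (snd p t)) \<in> borel_measurable (?MJ \<Otimes>\<^sub>M ?Mn)" if "t \<in> {..<n}" for t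
    proof -
      have "(\<lambda>z. z (\<tau> t)) \<in> borel_measurable ?MJ"
        using J that by (intro measurable_component_std_complex_normal) auto
      moreover have "(\<lambda>\<theta>. \<theta> t) \<in> measurable ?Mn ?MQ"
        using that by (intro measurable_component_singleton) auto
      ultimately have "(\<lambda>p. (fst p (\<tau> t), snd p t)) \<in> measurable (?MJ \<Otimes>\<^sub>M ?Mn) (borel \<Otimes>\<^sub>M ?MQ)"
        by (intro measurable_Pair measurable_compose[OF measurable_fst] measurable_compose[OF measurable_snd])
      from measurable_compose[OF this \<open>(\<lambda>(x, g). F x g) \<in> borel_measurable (borel \<Otimes>\<^sub>M ?MQ)\<close>] show ?thesis by simp
    qed
    then show ?thesis unfolding case_prod_beta by (intro borel_measurable_prod_ennreal)
  qed
  note pmF[measurable] = pm[OF mF1] pm[OF mF2]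
  have pmF3[measurable]: "\<And>q. q \<in> C \<Longrightarrow> (\<lambda>(z, \<theta>). \<Prod>t<n. F3 q (z (\<tau> t)) (\<theta> t)) \<in> borel_measurable (?MJ \<Otimes>\<^sub>M ?Mn)"
    using Q by (intro pm mF3) auto
  have fst_m: "(\<lambda>\<theta>. f z \<theta>) \<in> borel_measurable ?Mn" if "(\<lambda>(z, \<theta>). f z \<theta>) \<in> borel_measurable (?MJ \<Otimes>\<^sub>M ?Mn)" "z \<in> space ?MJ"
    for f :: "('a \<Rightarrow> complex) \<Rightarrow> (nat \<Rightarrow> 'q \<Rightarrow> complex) \<Rightarrow> ennreal" and z
    using measurable_compose[OF measurable_Pair1' that(1), OF that(2)] by simp
  have "(\<integral>\<^sup>+ z. \<integral>\<^sup>+ \<theta>. of_bool (\<not> ok \<theta> z) \<partial>?Mn \<partial>?MJ)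
     \<le> (\<integral>\<^sup>+ z. \<integral>\<^sup>+ \<theta>. (\<Prod>t<n. F1 (z (\<tau> t)) (\<theta> t)) + (\<Prod>t<n. F2 (z (\<tau> t)) (\<theta> t))
      + (\<Sum>q\<in>C. \<Prod>t<n. F3 q (z (\<tau> t)) (\<theta> t)) \<partial>?Mn \<partial>?MJ)"
    by (intro nn_integral_mono bound)
  also have "\<dots> = (\<integral>\<^sup>+ z. (\<integral>\<^sup>+ \<theta>. (\<Prod>t<n. F1 (z (\<tau> t)) (\<theta> t)) \<partial>?Mn) + (\<integral>\<^sup>+ \<theta>. (\<Prod>t<n. F2 (z (\<tau> t)) (\<theta> t)) \<partial>?Mn)
      + (\<Sum>q\<in>C. \<integral>\<^sup>+ \<theta>. (\<Prod>t<n. F3 q (z (\<tau> t)) (\<theta> t)) \<partial>?Mn) \<partial>?MJ)"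
  proof (rule nn_integral_cong)
    fix z assume z: "z \<in> space ?MJ"
    have [measurable]: "(\<lambda>\<theta>. \<Prod>t<n. F1 (z (\<tau> t)) (\<theta> t)) \<in> borel_measurable ?Mn"
        "(\<lambda>\<theta>. \<Prod>t<n. F2 (z (\<tau> t)) (\<theta> t)) \<in> borel_measurable ?Mn"
        "\<And>q. q \<in> C \<Longrightarrow> (\<lambda>\<theta>. \<Prod>t<n. F3 q (z (\<tau> t)) (\<theta> t)) \<in> borel_measurable ?Mn"
      using fst_m[OF _ z] pmF pmF3 by blast+
    show "(\<integral>\<^sup>+ \<theta>. (\<Prod>t<n. F1 (z (\<tau> t)) (\<theta> t)) + (\<Prod>t<n. F2 (z (\<tau> t)) (\<theta> t))
      + (\<Sum>q\<in>C. \<Prod>t<n. F3 q (z (\<tau> t)) (\<theta> t)) \<partial>?Mn) = (\<integral>\<^sup>+ \<theta>. (\<Prod>t<n. F1 (z (\<tau> t)) (\<theta> t)) \<partial>?Mn) + (\<integral>\<^sup>+ \<theta>. (\<Prod>t<n. F2 (z (\<tau> t)) (\<theta> t)) \<partial>?Mn)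
      + (\<Sum>q\<in>C. \<integral>\<^sup>+ \<theta>. (\<Prod>t<n. F3 q (z (\<tau> t)) (\<theta> t)) \<partial>?Mn)"
      by (subst nn_integral_add, measurable)+ (simp add: nn_integral_sum)
  qed
  also have "\<dots> = (\<integral>\<^sup>+ z. \<integral>\<^sup>+ \<theta>. (\<Prod>t<n. F1 (z (\<tau> t)) (\<theta> t)) \<partial>?Mn \<partial>?MJ) + (\<integral>\<^sup>+ z. \<integral>\<^sup>+ \<theta>. (\<Prod>t<n. F2 (z (\<tau> t)) (\<theta> t)) \<partial>?Mn \<partial>?MJ)
      + (\<Sum>q\<in>C. \<integral>\<^sup>+ z. \<integral>\<^sup>+ \<theta>. (\<Prod>t<n. F3 q (z (\<tau> t)) (\<theta> t)) \<partial>?Mn \<partial>?MJ)"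
    by (subst nn_integral_add, measurable)+ (simp add: nn_integral_sum)
  also have "\<dots> = ennreal ((1 + e) * exp (- e)) ^ n + ennreal ((1 - e) * exp e) ^ n
      + (\<Sum>q\<in>C. ennreal (exp (2 * e) * v / (v + (cmod h)\<^sup>2)) ^ n)"
  proof -
    have "(\<integral>\<^sup>+ z. \<integral>\<^sup>+ \<theta>. (\<Prod>t<n. F3 q (z (\<tau> t)) (\<theta> t)) \<partial>?Mn \<partial>?MJ) = ennreal (exp (2 * e) * v / (v + (cmod h)\<^sup>2)) ^ n"
      if "q \<in> C" for q
      using that Q i3 by (subst nn_integral_noise_codebook_prod[OF J Q(1) mF3]) auto
    then show ?thesis
      by (simp add: nn_integral_noise_codebook_prod[OF J Q(1) mF1] nn_integral_noise_codebook_prod[OF J Q(1) mF2] i1 i2)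
  qed
  also have "\<dots> = ennreal (step_bound e (Suc (card C)) v ((cmod h)\<^sup>2) n)"
  proof -
    have "0 \<le> ((1 + e) * exp (- e)) ^ n" "0 \<le> ((1 - e) * exp e) ^ n" "0 \<le> exp (2 * e) * v / (v + (cmod h)\<^sup>2)"
      using e s by auto
    then show ?thesis
      using e by (simp add: step_bound_def ennreal_power ennreal_of_nat_eq_real_of_nat ennreal_mult'[symmetric]
          ennreal_mult''[symmetric] ennreal_plus[symmetric] del: ennreal_plus)
  qed
  finally show ?thesis .
qed

section \<open>Messages and noise\<close>

lemma UNIV_user: "(UNIV :: user set) = {U1, U2}"
  using user.exhaust by auto

instance user :: finite
  by standard (simp add: UNIV_user)

definition message_pairs :: "nat \<Rightarrow> real \<times> real \<Rightarrow> (user \<Rightarrow> nat) set" where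
  "message_pairs N R = {w. \<forall>u. w u \<in> messages N (rate R u)}"

definition noise_space :: "nat \<Rightarrow> (user \<times> nat \<Rightarrow> complex) measure" where
  "noise_space N = (\<Pi>\<^sub>M p\<in>UNIV \<times> {1..N}. std_complex_normal)"

lemma message_pairs_eq_PiE: "message_pairs N R = (\<Pi>\<^sub>E u\<in>UNIV. messages N (rate R u))"
  by (auto simp: message_pairs_def)

lemma finite_messages [simp]: "finite (messages N r)"
  by (simp add: messages_def)

lemma messages_nonempty: "r \<ge> 0 \<Longrightarrow> 1 \<in> messages N r"
  by (simp add: messages_def le_nat_floor ge_one_powr_ge_zero)

lemma finite_message_pairs [simp]: "finite (message_pairs N R)"
  unfolding message_pairs_eq_PiE by (rule finite_PiE) auto

lemma message_pairs_nonempty: "(\<And>u. rate R u \<ge> 0) \<Longrightarrow> message_pairs N R \<noteq> {}"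
  using messages_nonempty[of "rate R _"] by (auto simp: message_pairs_def intro!: exI[of _ "\<lambda>_. 1"])

lemma card_message_pairs:
  "card (message_pairs N R) = card (messages N (rate R U1)) * card (messages N (rate R U2))"
  unfolding message_pairs_eq_PiE by (subst card_PiE) (auto simp: UNIV_user)

lemma prob_space_noise_space: "prob_space (noise_space N)"
  unfolding noise_space_def by (rule prob_space_PiM_std_complex_normal)

interpretation noise: prob_space "noise_space N" for N
  by (rule prob_space_noise_space)

lemma measurable_noise_component:
  "j \<in> {1..N} \<Longrightarrow> (\<lambda>z. z (u, j)) \<in> borel_measurable (noise_space N)"
  unfolding noise_space_def by (rule measurable_component_std_complex_normal) auto

lemma PiM_uniform_count_measure:
  assumes "finite I" "\<And>i. i \<in> I \<Longrightarrow> finite (A i)"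
  shows "PiM I (\<lambda>i. uniform_count_measure (A i)) = uniform_count_measure (PiE I A)"
proof -
  \<comment> \<open>\<open>product_sigma_finite\<close> constrains every index, also those outside
    \<open>I\<close>, where \<open>A\<close> is arbitrary; the empty set makes the measure there
    finite.\<close>
  define B where "B = (\<lambda>i. if i \<in> I then A i else {})"
  have B: "finite (B i)" for i using assms by (simp add: B_def)
  have 1: "PiM I (\<lambda>i. uniform_count_measure (A i)) = PiM I (\<lambda>i. uniform_count_measure (B i))"
    by (rule PiM_cong) (auto simp: B_def)
  have 2: "PiE I A = PiE I B" by (rule PiE_cong) (simp add: B_def)
  have 3: "sets (PiM I (\<lambda>i. uniform_count_measure (B i))) = Pow (PiE I B)"
  proof -
    have "sets (PiM I (\<lambda>i. uniform_count_measure (B i))) = sets (PiM I (\<lambda>i. count_space (B i)))"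
      by (rule sets_PiM_cong) (auto simp: sets_uniform_count_measure)
    also have "\<dots> = Pow (PiE I B)"
      using count_space_PiM_finite[of I B] assms(1) B by (simp add: countable_finite)
    finally show ?thesis .
  qed
  interpret product_sigma_finite "\<lambda>i. uniform_count_measure (B i)"
  proof (rule product_sigma_finite.intro)
    fix i show "sigma_finite_measure (uniform_count_measure (B i))"
      using B[of i] by (intro finite_measure.axioms(1) finite_measureI)
        (simp add: emeasure_uniform_count_measure space_uniform_count_measure)
  qed
  have "uniform_count_measure (PiE I B) = PiM I (\<lambda>i. uniform_count_measure (B i))"
  proof (rule PiM_eqI)
    show "sets (uniform_count_measure (PiE I B)) = sets (PiM I (\<lambda>i. uniform_count_measure (B i)))"
      by (simp add: 3 sets_uniform_count_measure)
    fix C assume "\<And>i. i \<in> I \<Longrightarrow> C i \<in> sets (uniform_count_measure (B i))"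
    then have C: "C i \<subseteq> B i" if "i \<in> I" for i using that by (simp add: sets_uniform_count_measure)
    have fin: "finite (PiE I B)" using assms(1) B by (intro finite_PiE) auto
    have sub: "PiE I C \<subseteq> PiE I B" using C by (intro PiE_mono)
    show "emeasure (uniform_count_measure (PiE I B)) (PiE I C) = (\<Prod>i\<in>I. emeasure (uniform_count_measure (B i)) (C i))"
      unfolding emeasure_uniform_count_measure[OF fin sub] using C assms(1) B
      by (simp add: emeasure_uniform_count_measure card_PiE prod_ennreal prod_dividef)
  qed (use assms in auto)
  then show ?thesis using 1 2 by simp
qed

lemma source_space_eq:
  "source_space N R = uniform_count_measure (message_pairs N R) \<Otimes>\<^sub>M noise_space N"
  unfolding source_space_def noise_space_def message_pairs_eq_PiE
  by (subst PiM_uniform_count_measure) auto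

lemma nn_integral_uniform_count_measure:
  "finite A \<Longrightarrow> (\<integral>\<^sup>+ x. f x \<partial>uniform_count_measure A) = (\<Sum>x\<in>A. f x) / ennreal (card A)"
proof -
  assume A: "finite A"
  have "(\<integral>\<^sup>+ x. f x \<partial>uniform_count_measure A) = (\<Sum>x\<in>A. ennreal (1 / real (card A)) * f x)"
    using A unfolding uniform_count_measure_def
    by (subst nn_integral_point_measure_finite) auto
  also have "\<dots> = (\<Sum>x\<in>A. f x) * ennreal (1 / real (card A))"
    by (simp add: sum_distrib_right mult.commute)
  also have "\<dots> = (\<Sum>x\<in>A. f x) / ennreal (card A)"
  proof (cases "A = {}")
    case False
    then have "card A > 0" using A by (simp add: card_gt_0_iff)
    then show ?thesis
      by (simp add: divide_ennreal_def inverse_ennreal divide_inverse)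
  qed simp
  finally show ?thesis .
qed

lemma prob_space_messages:
  "(\<And>u. rate R u \<ge> 0) \<Longrightarrow> prob_space (uniform_count_measure (message_pairs N R))"
  using message_pairs_nonempty by (intro prob_space_uniform_count_measure) auto

text \<open>The messages form a finite discrete factor, so measurability is a matter of the noise
  alone, one message pair at a time. This fits \<open>measurable_encoder\<close>, which speaks about
  each message separately.\<close>

lemma measurable_source_space:
  assumes "\<And>w. w \<in> message_pairs N R \<Longrightarrow> (\<lambda>z. f (w, z)) \<in> measurable (noise_space N) M"
  shows "f \<in> measurable (source_space N R) M"
proof -
  have "f \<in> measurable (count_space (message_pairs N R) \<Otimes>\<^sub>M noise_space N) M"
    using assms by (intro measurable_pair_measure_countable1) (auto simp: countable_finite)
  also have "measurable (count_space (message_pairs N R) \<Otimes>\<^sub>M noise_space N) M = measurable (source_space N R) M"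
    unfolding source_space_eq
    by (intro measurable_cong_sets sets_pair_measure_cong) (auto simp: sets_uniform_count_measure)
  finally show ?thesis .
qed

lemma nn_integral_source_space:
  assumes f: "\<And>w. w \<in> message_pairs N R \<Longrightarrow> (\<lambda>z. f (w, z)) \<in> borel_measurable (noise_space N)"
  shows "(\<integral>\<^sup>+ p. f p \<partial>source_space N R) =
    (\<Sum>w\<in>message_pairs N R. \<integral>\<^sup>+ z. f (w, z) \<partial>noise_space N) / ennreal (card (message_pairs N R))"
proof -
  have "f \<in> borel_measurable (uniform_count_measure (message_pairs N R) \<Otimes>\<^sub>M noise_space N)"
    using measurable_source_space[OF f] by (simp add: source_space_eq)
  then show ?thesis
    unfolding source_space_eq
    by (subst noise.nn_integral_fst[symmetric]) (auto simp: nn_integral_uniform_count_measure)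
qed

lemma emeasure_source_space:
  assumes S: "\<And>w. w \<in> message_pairs N R \<Longrightarrow> {z \<in> space (noise_space N). P w z} \<in> sets (noise_space N)"
  shows "emeasure (source_space N R) {(w, z) \<in> space (source_space N R). P w z} =
    (\<Sum>w\<in>message_pairs N R. emeasure (noise_space N) {z \<in> space (noise_space N). P w z}) / ennreal (card (message_pairs N R))"
proof -
  let ?A = "{(w, z) \<in> space (source_space N R). P w z}"
  have sp: "space (source_space N R) = message_pairs N R \<times> space (noise_space N)"
    by (simp add: source_space_eq space_pair_measure space_uniform_count_measure)
  have "(\<lambda>p. P (fst p) (snd p)) \<in> measurable (source_space N R) (count_space UNIV)"
    using S by (intro measurable_source_space) (simp add: pred_def)
  then have A: "?A \<in> sets (source_space N R)"
    by (simp add: pred_def case_prod_beta' conj_commute)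
  have "emeasure (source_space N R) ?A = (\<integral>\<^sup>+ p. indicator ?A p \<partial>source_space N R)"
    using A by simp
  also have "\<dots> = (\<Sum>w\<in>message_pairs N R. \<integral>\<^sup>+ z. indicator ?A (w, z) \<partial>noise_space N) / ennreal (card (message_pairs N R))"
  proof (rule nn_integral_source_space)
    fix w assume w: "w \<in> message_pairs N R"
    show "(\<lambda>z. indicator ?A (w, z) :: ennreal) \<in> borel_measurable (noise_space N)"
      using w by (subst measurable_cong[where g="indicator {z \<in> space (noise_space N). P w z}"])
        (auto simp: sp indicator_def S[OF w] intro!: borel_measurable_indicator)
  qed
  also have "(\<Sum>w\<in>message_pairs N R. \<integral>\<^sup>+ z. indicator ?A (w, z) \<partial>noise_space N)
     = (\<Sum>w\<in>message_pairs N R. emeasure (noise_space N) {z \<in> space (noise_space N). P w z})"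
  proof (rule sum.cong[OF refl])
    fix w assume w: "w \<in> message_pairs N R"
    have "(\<integral>\<^sup>+ z. indicator ?A (w, z) \<partial>noise_space N) = (\<integral>\<^sup>+ z. indicator {z \<in> space (noise_space N). P w z} z \<partial>noise_space N)"
      using w by (intro nn_integral_cong) (auto simp: sp indicator_def)
    then show "(\<integral>\<^sup>+ z. indicator ?A (w, z) \<partial>noise_space N) = emeasure (noise_space N) {z \<in> space (noise_space N). P w z}"
      using S[OF w] by simp
  qed
  finally show ?thesis .
qed

text \<open>The horizon \<open>n\<close> may be shorter than the code length \<open>N\<close>: the
  change of variables from noise to outputs is an induction on the horizon for one fixed
  code.\<close>

lemma measurable_channel:
  assumes f: "measurable_encoder N R f" and w: "w \<in> message_pairs N R" and n: "n \<le> N"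
  shows measurable_chan_in: "j \<in> {1..n} \<Longrightarrow> (\<lambda>z. chan_in gd gc F f w z u j) \<in> borel_measurable (noise_space n)"
    and measurable_chan_out: "j \<in> {1..n} \<Longrightarrow> (\<lambda>z. chan_out gd gc F f w z u j) \<in> borel_measurable (noise_space n)"
proof -
  have in_step: "(\<lambda>z. chan_in gd gc F f w z u j) \<in> borel_measurable (noise_space n)"
    if j: "j \<in> {1..n}" and IH: "\<And>i u. i \<in> {1..<j} \<Longrightarrow> (\<lambda>z. chan_out gd gc F f w z u i) \<in> borel_measurable (noise_space n)"
    for j u
  proof -
    have past: "(\<lambda>z. \<lambda>i\<in>{1..<j}. of_bool (F k u) * chan_out gd gc F f w z k i) \<in> measurable (noise_space n) (\<Pi>\<^sub>M i\<in>{1..<j}. borel)" for k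
      using IH by (intro measurable_restrict borel_measurable_times) auto
    have "(\<lambda>(y1, y2). f u j (w u) y1 y2) \<in> borel_measurable ((\<Pi>\<^sub>M i\<in>{1..<j}. borel) \<Otimes>\<^sub>M (\<Pi>\<^sub>M i\<in>{1..<j}. borel))"
      using f w j n by (auto simp: measurable_encoder_def message_pairs_def)
    from measurable_compose[OF measurable_Pair[OF past[of U1] past[of U2]] this]
    show ?thesis by (subst chan_in.simps) simp
  qed
  have out: "(\<lambda>z. chan_out gd gc F f w z u j) \<in> borel_measurable (noise_space n)" if "j \<in> {1..n}" for u j
    using that
  proof (induction j arbitrary: u rule: less_induct)
    case (less j)
    have "(\<lambda>z. chan_in gd gc F f w z u j) \<in> borel_measurable (noise_space n)" for u
      using less by (intro in_step) auto
    then show ?case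
      using less.prems by (subst chan_out.simps) (intro borel_measurable_add borel_measurable_times measurable_noise_component borel_measurable_const)
  qed
  show "j \<in> {1..n} \<Longrightarrow> (\<lambda>z. chan_in gd gc F f w z u j) \<in> borel_measurable (noise_space n)"
    using out by (intro in_step) auto
  show "j \<in> {1..n} \<Longrightarrow> (\<lambda>z. chan_out gd gc F f w z u j) \<in> borel_measurable (noise_space n)"
    by (rule out)
qed

lemma pred_decoding:
  assumes f: "measurable_encoder N R f" and h: "measurable_decoder N h" and w: "w \<in> message_pairs N R"
  shows "Measurable.pred (noise_space N) (\<lambda>z. h u (\<lambda>j\<in>{1..N}. chan_out gd gc F f w z u j) = m)"
proof -
  have "(\<lambda>z. \<lambda>j\<in>{1..N}. chan_out gd gc F f w z u j) \<in> measurable (noise_space N) (\<Pi>\<^sub>M j\<in>{1..N}. borel)"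
    using measurable_chan_out[OF f w order_refl] by (intro measurable_restrict) auto
  from measurable_compose[OF this, of "h u" "count_space UNIV"]
  have "(\<lambda>z. h u (\<lambda>j\<in>{1..N}. chan_out gd gc F f w z u j)) \<in> measurable (noise_space N) (count_space UNIV)"
    using h by (auto simp: measurable_decoder_def)
  then show ?thesis by (rule measurable_compose) simp
qed

lemma error_prob_eq:
  assumes f: "measurable_encoder N R f" and h: "measurable_decoder N h" and R: "\<And>u. rate R u \<ge> 0"
  shows "error_prob gd gc F N R f h u = (\<Sum>w\<in>message_pairs N R.
      measure (noise_space N) {z \<in> space (noise_space N). h u (\<lambda>j\<in>{1..N}. chan_out gd gc F f w z u j) \<noteq> w u})
        / card (message_pairs N R)"
proof -
  have S: "{z \<in> space (noise_space N). h u (\<lambda>j\<in>{1..N}. chan_out gd gc F f w z u j) \<noteq> w u} \<in> sets (noise_space N)"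
    if w: "w \<in> message_pairs N R" for w
    using pred_intros_logic(2)[OF pred_decoding[OF f h w, of u gd gc F "w u"]] by (simp add: pred_def)
  have c: "card (message_pairs N R) > 0"
    using message_pairs_nonempty[OF R] by (simp add: card_gt_0_iff)
  have "ennreal (error_prob gd gc F N R f h u) = emeasure (source_space N R)
     {(w, z) \<in> space (source_space N R). h u (\<lambda>j\<in>{1..N}. chan_out gd gc F f w z u j) \<noteq> w u}"
  proof -
    interpret M: prob_space "uniform_count_measure (message_pairs N R)" by (rule prob_space_messages[OF R])
    interpret pair_prob_space "uniform_count_measure (message_pairs N R)" "noise_space N" ..
    show ?thesis unfolding error_prob_def by (simp add: source_space_eq emeasure_eq_measure)
  qed
  also have "\<dots> = ennreal ((\<Sum>w\<in>message_pairs N R.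
      measure (noise_space N) {z \<in> space (noise_space N). h u (\<lambda>j\<in>{1..N}. chan_out gd gc F f w z u j) \<noteq> w u})
        / card (message_pairs N R))"
    by (subst emeasure_source_space[OF S])
      (use c in \<open>auto simp: noise.emeasure_eq_measure divide_ennreal sum_nonneg\<close>)
  finally show ?thesis
    by (subst (asm) ennreal_inj) (auto simp: error_prob_def intro!: divide_nonneg_nonneg sum_nonneg)
qed

text \<open>Strict causality: an input sees only earlier outputs, and these see only noise up to
  their own time. Hence the noise at time \<open>j\<close> is independent of both inputs at time
  \<open>j\<close>, which is all the independence that survives feedback.\<close>

lemma chan_cong:
  assumes "\<And>u i. 1 \<le> i \<Longrightarrow> i < j \<Longrightarrow> z (u, i) = z' (u, i)"
  shows chan_in_cong: "chan_in gd gc F f w z u j = chan_in gd gc F f w z' u j"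
    and chan_out_cong: "z (u, j) = z' (u, j) \<Longrightarrow> chan_out gd gc F f w z u j = chan_out gd gc F f w z' u j"
proof -
  have "(\<forall>u. chan_in gd gc F f w z u j = chan_in gd gc F f w z' u j) \<and>
      (\<forall>u. z (u, j) = z' (u, j) \<longrightarrow> chan_out gd gc F f w z u j = chan_out gd gc F f w z' u j)"
    using assms
  proof (induction j rule: less_induct)
    case (less j)
    have "chan_out gd gc F f w z u i = chan_out gd gc F f w z' u i" if "i \<in> {1..<j}" for u i
      using less.IH[of i] less.prems that by auto
    then have "chan_in gd gc F f w z u j = chan_in gd gc F f w z' u j" for u
      by (subst (1 2) chan_in.simps) (intro arg_cong2[where f="f u j (w u)"] restrict_ext, auto)
    then show ?case by (simp add: chan_out.simps)
  qed
  then show "chan_in gd gc F f w z u j = chan_in gd gc F f w z' u j"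
    "z (u, j) = z' (u, j) \<Longrightarrow> chan_out gd gc F f w z u j = chan_out gd gc F f w z' u j" by blast+
qed

section \<open>The sum-rate bound\<close>

lemma nn_integral_lborel_translate:
  fixes g :: "complex \<Rightarrow> ennreal"
  assumes [measurable]: "g \<in> borel_measurable borel"
  shows "(\<integral>\<^sup>+ z. g (s + z) \<partial>lborel) = (\<integral>\<^sup>+ z. g z \<partial>lborel)"
proof -
  have "(\<integral>\<^sup>+ z. g z \<partial>lborel) = (\<integral>\<^sup>+ z. g z \<partial>distr lborel borel ((+) s))"
    by (simp add: lborel_distr_plus)
  also have "\<dots> = (\<integral>\<^sup>+ z. g (s + z) \<partial>lborel)" by (subst nn_integral_distr) auto
  finally show ?thesis by simp
qed

text \<open>The factor \<open>pi * exp ((cmod z)\<^sup>2)\<close> cancels the Gaussian density; what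
  remains is Lebesgue measure, which does not see the shift \<open>s\<close>. This is one step of
  the change of variables from noise to outputs.\<close>

lemma nn_integral_std_complex_normal_shift:
  assumes [measurable]: "g \<in> borel_measurable borel"
  shows "(\<integral>\<^sup>+ z. g (s + z) * ennreal (pi * exp ((cmod z)\<^sup>2)) \<partial>std_complex_normal) = (\<integral>\<^sup>+ z. g z \<partial>lborel)"
proof -
  have e: "ennreal (exp (- (cmod z)\<^sup>2) / pi) * ennreal (pi * exp ((cmod z)\<^sup>2)) = 1" for z
    by (simp add: ennreal_mult'[symmetric] exp_minus)
  have "(\<integral>\<^sup>+ z. g (s + z) * ennreal (pi * exp ((cmod z)\<^sup>2)) \<partial>std_complex_normal)
     = (\<integral>\<^sup>+ z. ennreal (exp (- (cmod z)\<^sup>2) / pi) * (g (s + z) * ennreal (pi * exp ((cmod z)\<^sup>2))) \<partial>lborel)"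
    unfolding std_complex_normal_eq_density by (subst nn_integral_density) auto
  also have "\<dots> = (\<integral>\<^sup>+ z. g (s + z) \<partial>lborel)"
    by (intro nn_integral_cong) (simp add: e mult.left_commute)
  finally show ?thesis by (simp add: nn_integral_lborel_translate)
qed

lemma (in product_sigma_finite) product_nn_integral_insert2:
  assumes J: "finite J" "finite (insert q J)" "q \<notin> J" "p \<notin> insert q J"
    and f: "f \<in> borel_measurable (PiM (insert p (insert q J)) M)"
  shows "integral\<^sup>N (PiM (insert p (insert q J)) M) f
    = (\<integral>\<^sup>+ x. \<integral>\<^sup>+ b. \<integral>\<^sup>+ a. f (x(q := b, p := a)) \<partial>M p \<partial>M q \<partial>PiM J M)"
proof -
  have "(\<lambda>(x, a). f (x(p := a))) \<in> borel_measurable (PiM (insert q J) M \<Otimes>\<^sub>M M p)"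
    using measurable_compose[OF measurable_add_dim f] by (simp add: case_prod_beta)
  then have "(\<lambda>x. \<integral>\<^sup>+ a. f (x(p := a)) \<partial>M p) \<in> borel_measurable (PiM (insert q J) M)"
    using sigma_finite_measure.borel_measurable_nn_integral[OF sigma_finite_measures] by blast
  then show ?thesis
    by (subst product_nn_integral_insert[OF J(2,4) f]) (rule product_nn_integral_insert[OF J(1,3)])
qed

interpretation lborel_prod: product_sigma_finite "\<lambda>_. lborel :: complex measure" ..

lemma user_times_Suc:
  "(UNIV :: user set) \<times> {1..Suc n} = insert (U1, Suc n) (insert (U2, Suc n) (UNIV \<times> {1..n}))"
  by (auto simp: UNIV_user)

lemma sets_PiM_complex [simp]:
  "sets (PiM I (\<lambda>_. lborel :: complex measure)) = sets (PiM I (\<lambda>_. borel))"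
  "sets (PiM I (\<lambda>_. std_complex_normal)) = sets (PiM I (\<lambda>_. borel))"
  by (auto intro!: sets_PiM_cong)

text \<open>Given the messages, the map from noise to outputs is a triangular shear, hence preserves
  Lebesgue measure.\<close>

lemma nn_integral_channel_outputs:
  assumes f: "measurable_encoder N R f" and w: "w \<in> message_pairs N R" and n: "n \<le> N"
    and G: "G \<in> borel_measurable (PiM (UNIV \<times> {1..n}) (\<lambda>_. borel))"
  shows "(\<integral>\<^sup>+ z. G (\<lambda>p\<in>UNIV \<times> {1..n}. chan_out gd gc F f w z (fst p) (snd p)) *
       (\<Prod>p\<in>UNIV \<times> {1..n}. ennreal (pi * exp ((cmod (z p))\<^sup>2))) \<partial>noise_space n)
     = (\<integral>\<^sup>+ y. G y \<partial>PiM (UNIV \<times> {1..n}) (\<lambda>_. lborel))"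
  using n G
proof (induction n arbitrary: G)
  case 0
  show ?case
    using prob_space.emeasure_space_1[OF prob_space_PiM_std_complex_normal, of "{} :: (user \<times> nat) set"]
    by (simp add: noise_space_def lborel_prod.nn_integral_empty std_complex_normal_prod.nn_integral_empty)
next
  case (Suc n)
  let ?J = "(UNIV :: user set) \<times> {1..n}"
  let ?p1 = "(U1, Suc n)" and ?p2 = "(U2, Suc n)"
  have fin: "finite ?J" "finite (insert ?p2 ?J)" "?p2 \<notin> ?J" "?p1 \<notin> insert ?p2 ?J" by auto
  have Gm[measurable]: "G \<in> borel_measurable (PiM (insert ?p1 (insert ?p2 ?J)) (\<lambda>_. borel))"
    using Suc.prems(2) unfolding user_times_Suc .
  define y where "y = (\<lambda>z. \<lambda>p\<in>?J. chan_out gd gc F f w z (fst p) (snd p))"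
  define s where "s = (\<lambda>z u. gd * chan_in gd gc F f w z u (Suc n) + gc * chan_in gd gc F f w z (other u) (Suc n))"
  \<comment> \<open>\<open>H\<close> has the last two outputs integrated out, so that the induction
    hypothesis applies to it.\<close>
  define H where "H = (\<lambda>y. \<integral>\<^sup>+ y2. \<integral>\<^sup>+ y1. G (y(?p2 := y2, ?p1 := y1)) \<partial>lborel \<partial>lborel)"
  have upd: "(\<lambda>(x, y). (x :: user \<times> nat \<Rightarrow> complex)(p := y)) \<in> measurable (PiM I (\<lambda>_. borel) \<Otimes>\<^sub>M borel) (PiM (insert p I) (\<lambda>_. borel))" for I p
    using measurable_add_dim[of p I "\<lambda>_. borel"] by simp
  have m1: "(\<lambda>(x, y1). G (x(?p1 := y1))) \<in> borel_measurable (PiM (insert ?p2 ?J) (\<lambda>_. borel) \<Otimes>\<^sub>M borel)"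
    using measurable_compose[OF upd Gm] by (simp add: case_prod_beta)
  have m2: "(\<lambda>x. \<integral>\<^sup>+ y1. G (x(?p1 := y1)) \<partial>lborel) \<in> borel_measurable (PiM (insert ?p2 ?J) (\<lambda>_. borel))"
    using lborel.borel_measurable_nn_integral[of "\<lambda>x y1. G (x(?p1 := y1))"] m1 by simp
  have m3: "(\<lambda>(x, y2). \<integral>\<^sup>+ y1. G (x(?p2 := y2, ?p1 := y1)) \<partial>lborel) \<in> borel_measurable (PiM ?J (\<lambda>_. borel) \<Otimes>\<^sub>M borel)"
    using measurable_compose[OF upd m2] by (simp add: case_prod_beta)
  have Hm: "H \<in> borel_measurable (PiM ?J (\<lambda>_. borel))"
    unfolding H_def using lborel.borel_measurable_nn_integral[of "\<lambda>x y2. \<integral>\<^sup>+ y1. G (x(?p2 := y2, ?p1 := y1)) \<partial>lborel"] m3 by simp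
  \<comment> \<open>The shifts \<open>s z\<close> depend on noise before time \<open>Suc n\<close>
    only, so for given past the two new outputs are translates of the two new noise samples.\<close>
  have out: "(\<lambda>p\<in>UNIV \<times> {1..Suc n}. chan_out gd gc F f w (z(?p2 := z2, ?p1 := z1)) (fst p) (snd p))
     = (y z)(?p2 := s z U2 + z2, ?p1 := s z U1 + z1)" for z z1 z2
  proof
    fix p :: "user \<times> nat"
    obtain u j where p: "p = (u, j)" by force
    let ?z = "z(?p2 := z2, ?p1 := z1)"
    have in_eq: "chan_in gd gc F f w ?z u j = chan_in gd gc F f w z u j" if "j \<le> Suc n" for u j
      using that by (intro chan_in_cong) auto
    consider "j \<in> {1..n}" | "j = Suc n" | "j \<notin> {1..Suc n}" by fastforce
    then show "(\<lambda>p\<in>UNIV \<times> {1..Suc n}. chan_out gd gc F f w ?z (fst p) (snd p)) p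
      = ((y z)(?p2 := s z U2 + z2, ?p1 := s z U1 + z1)) p"
    proof cases
      case 1
      then show ?thesis
        by (auto simp: p y_def chan_out.simps in_eq)
    next
      case 2
      then show ?thesis
        by (cases u) (auto simp: p s_def chan_out.simps in_eq)
    next
      case 3
      then show ?thesis by (auto simp: p y_def)
    qed
  qed
  have prod: "(\<Prod>p\<in>UNIV \<times> {1..Suc n}. ennreal (pi * exp ((cmod ((z(?p2 := z2, ?p1 := z1)) p))\<^sup>2)))
    = ennreal (pi * exp ((cmod z1)\<^sup>2)) * (ennreal (pi * exp ((cmod z2)\<^sup>2)) * (\<Prod>p\<in>?J. ennreal (pi * exp ((cmod (z p))\<^sup>2))))" for z z1 z2
  proof -
    have "(\<Prod>p\<in>?J. ennreal (pi * exp ((cmod ((z(?p2 := z2, ?p1 := z1)) p))\<^sup>2))) = (\<Prod>p\<in>?J. ennreal (pi * exp ((cmod (z p))\<^sup>2)))"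
      by (intro prod.cong) auto
    then show ?thesis unfolding user_times_Suc using fin by (subst prod.insert) (auto simp: prod.insert)
  qed
  let ?G' = "\<lambda>z. G (\<lambda>p\<in>UNIV \<times> {1..Suc n}. chan_out gd gc F f w z (fst p) (snd p)) *
       (\<Prod>p\<in>UNIV \<times> {1..Suc n}. ennreal (pi * exp ((cmod (z p))\<^sup>2)))"
  have meas: "?G' \<in> borel_measurable (noise_space (Suc n))"
  proof (intro borel_measurable_times_ennreal)
    have "(\<lambda>z. \<lambda>p\<in>UNIV \<times> {1..Suc n}. chan_out gd gc F f w z (fst p) (snd p)) \<in> measurable (noise_space (Suc n)) (PiM (UNIV \<times> {1..Suc n}) (\<lambda>_. borel))"
      using measurable_chan_out[OF f w Suc.prems(1)] by (intro measurable_restrict) auto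
    from measurable_compose[OF this Suc.prems(2)]
    show "(\<lambda>z. G (\<lambda>p\<in>UNIV \<times> {1..Suc n}. chan_out gd gc F f w z (fst p) (snd p))) \<in> borel_measurable (noise_space (Suc n))" .
    have "(\<lambda>z. ennreal (pi * exp ((cmod (z p))\<^sup>2))) \<in> borel_measurable (noise_space (Suc n))" if "p \<in> UNIV \<times> {1..Suc n}" for p
      using measurable_noise_component[of "snd p" "Suc n" "fst p"] that by auto
    then show "(\<lambda>z. \<Prod>p\<in>UNIV \<times> {1..Suc n}. ennreal (pi * exp ((cmod (z p))\<^sup>2))) \<in> borel_measurable (noise_space (Suc n))"
      by (intro borel_measurable_prod_ennreal)
  qed
  have inner: "(\<integral>\<^sup>+ z2. \<integral>\<^sup>+ z1. ?G' (z(?p2 := z2, ?p1 := z1)) \<partial>std_complex_normal \<partial>std_complex_normal)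
     = H (y z) * (\<Prod>p\<in>?J. ennreal (pi * exp ((cmod (z p))\<^sup>2)))" if z: "z \<in> space (noise_space n)" for z
  proof -
    have yz: "y z \<in> space (PiM ?J (\<lambda>_. borel))" by (auto simp: y_def space_PiM)
    let ?c = "\<Prod>p\<in>?J. ennreal (pi * exp ((cmod (z p))\<^sup>2))"
    have g1: "(\<lambda>y1. G ((y z)(?p2 := y2, ?p1 := y1))) \<in> borel_measurable borel" for y2
    proof -
      have "(y z)(?p2 := y2) \<in> space (PiM (insert ?p2 ?J) (\<lambda>_. borel))" by (auto simp: y_def space_PiM PiE_def extensional_def)
      from measurable_compose[OF measurable_Pair1'[OF this] m1] show ?thesis by simp
    qed
    have g2: "(\<lambda>y2. \<integral>\<^sup>+ y1. G ((y z)(?p2 := y2, ?p1 := y1)) \<partial>lborel) \<in> borel_measurable borel"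
      using measurable_compose[OF measurable_Pair1'[OF yz] m3] by simp
    have "(\<integral>\<^sup>+ z1. ?G' (z(?p2 := z2, ?p1 := z1)) \<partial>std_complex_normal)
      = (\<integral>\<^sup>+ y1. G ((y z)(?p2 := s z U2 + z2, ?p1 := y1)) \<partial>lborel) * ennreal (pi * exp ((cmod z2)\<^sup>2)) * ?c" for z2
    proof -
      have "(\<integral>\<^sup>+ z1. ?G' (z(?p2 := z2, ?p1 := z1)) \<partial>std_complex_normal)
        = (\<integral>\<^sup>+ z1. G ((y z)(?p2 := s z U2 + z2, ?p1 := s z U1 + z1)) * ennreal (pi * exp ((cmod z1)\<^sup>2)) * (ennreal (pi * exp ((cmod z2)\<^sup>2)) * ?c) \<partial>std_complex_normal)"
        unfolding out prod by (simp add: mult.assoc)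
      also have "\<dots> = (\<integral>\<^sup>+ z1. G ((y z)(?p2 := s z U2 + z2, ?p1 := s z U1 + z1)) * ennreal (pi * exp ((cmod z1)\<^sup>2)) \<partial>std_complex_normal) * (ennreal (pi * exp ((cmod z2)\<^sup>2)) * ?c)"
        using measurable_compose[OF _ g1, of "\<lambda>z1. s z U1 + z1"] by (intro nn_integral_multc borel_measurable_times_ennreal) auto
      finally show ?thesis by (simp add: nn_integral_std_complex_normal_shift[OF g1] mult.assoc)
    qed
    then have "(\<integral>\<^sup>+ z2. \<integral>\<^sup>+ z1. ?G' (z(?p2 := z2, ?p1 := z1)) \<partial>std_complex_normal \<partial>std_complex_normal)
      = (\<integral>\<^sup>+ z2. (\<integral>\<^sup>+ y1. G ((y z)(?p2 := s z U2 + z2, ?p1 := y1)) \<partial>lborel) * ennreal (pi * exp ((cmod z2)\<^sup>2)) \<partial>std_complex_normal) * ?c"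
      using measurable_compose[OF _ g2, of "\<lambda>z1. s z U2 + z1"] by (simp only:) (intro nn_integral_multc borel_measurable_times_ennreal, auto)
    then show ?thesis by (simp add: nn_integral_std_complex_normal_shift[OF g2] H_def)
  qed
  have "(\<integral>\<^sup>+ z. ?G' z \<partial>noise_space (Suc n)) =
     (\<integral>\<^sup>+ z. \<integral>\<^sup>+ z2. \<integral>\<^sup>+ z1. ?G' (z(?p2 := z2, ?p1 := z1)) \<partial>std_complex_normal \<partial>std_complex_normal \<partial>noise_space n)"
    using meas unfolding noise_space_def user_times_Suc
    by (intro std_complex_normal_prod.product_nn_integral_insert2 fin)
  also have "\<dots> = (\<integral>\<^sup>+ z. H (y z) * (\<Prod>p\<in>?J. ennreal (pi * exp ((cmod (z p))\<^sup>2))) \<partial>noise_space n)"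
    by (rule nn_integral_cong) (rule inner)
  also have "\<dots> = (\<integral>\<^sup>+ y. H y \<partial>PiM ?J (\<lambda>_. lborel))"
    unfolding y_def using Suc.prems(1) Hm by (intro Suc.IH) auto
  also have "\<dots> = (\<integral>\<^sup>+ y. G y \<partial>PiM (UNIV \<times> {1..Suc n}) (\<lambda>_. lborel))"
    unfolding H_def user_times_Suc using Gm
    by (intro lborel_prod.product_nn_integral_insert2[symmetric] fin) simp
  finally show ?case .
qed

text \<open>The centre \<open>m j\<close> depends on earlier coordinates only, so integrating the
  last coordinate first yields the mass of \<open>K\<close> by translation, whatever the predictor.
  The extra index \<open>l\<close> in the measurability assumption admits every horizon that
  contains the past of \<open>j\<close>, since the index set shrinks during the induction.\<close>

lemma nn_integral_seq_prod:
  fixes K :: "complex \<Rightarrow> ennreal" and m :: "nat \<Rightarrow> (user \<times> nat \<Rightarrow> complex) \<Rightarrow> complex"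
  assumes K[measurable]: "K \<in> borel_measurable borel"
    and m: "\<And>j y y'. (\<And>i. 1 \<le> i \<Longrightarrow> i < j \<Longrightarrow> y (u, i) = y' (u, i)) \<Longrightarrow> m j y = m j y'"
    and mm: "\<And>j l. 1 \<le> j \<Longrightarrow> j \<le> n \<Longrightarrow> j \<le> Suc l \<Longrightarrow> m j \<in> borel_measurable (PiM ({u} \<times> {1..l}) (\<lambda>_. borel))"
  shows "(\<integral>\<^sup>+ y. (\<Prod>j=1..n. K (y (u, j) - m j y)) \<partial>PiM ({u} \<times> {1..n}) (\<lambda>_. lborel)) = (\<integral>\<^sup>+ x. K x \<partial>lborel) ^ n"
  using mm
proof (induction n)
  case 0
  show ?case by (simp add: PiM_empty)
next
  case (Suc n)
  let ?J = "{u} \<times> {1..n}" and ?p = "(u, Suc n)"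
  have J: "{u} \<times> {1..Suc n} = insert ?p ?J" by auto
  have comp: "(\<lambda>y. y (u, j)) \<in> borel_measurable (PiM ({u} \<times> {1..l}) (\<lambda>_. borel))" if "j \<in> {1..l}" for j l
    using that by (intro measurable_component_singleton) auto
  have Kj: "(\<lambda>y. K (y (u, j) - m j y)) \<in> borel_measurable (PiM ({u} \<times> {1..l}) (\<lambda>_. borel))" if "j \<in> {1..l}" "l \<le> Suc n" for j l
    using that Suc.prems by (intro measurable_compose[OF _ K] borel_measurable_diff comp) auto
  have Km: "(\<lambda>y. \<Prod>j=1..l. K (y (u, j) - m j y)) \<in> borel_measurable (PiM ({u} \<times> {1..l}) (\<lambda>_. borel))" if "l \<le> Suc n" for l
    using that by (intro borel_measurable_prod_ennreal Kj)
  have me: "m j (y(?p := x)) = m j y" if "j \<le> Suc n" for j y x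
    using that by (intro m) auto
  have "(\<integral>\<^sup>+ y. (\<Prod>j=1..Suc n. K (y (u, j) - m j y)) \<partial>PiM ({u} \<times> {1..Suc n}) (\<lambda>_. lborel))
     = (\<integral>\<^sup>+ y. \<integral>\<^sup>+ x. (\<Prod>j=1..Suc n. K ((y(?p := x)) (u, j) - m j (y(?p := x)))) \<partial>lborel \<partial>PiM ?J (\<lambda>_. lborel))"
    unfolding J using Km[of "Suc n"] J by (intro lborel_prod.product_nn_integral_insert) auto
  also have "\<dots> = (\<integral>\<^sup>+ y. (\<integral>\<^sup>+ x. K x \<partial>lborel) * (\<Prod>j=1..n. K (y (u, j) - m j y)) \<partial>PiM ?J (\<lambda>_. lborel))"
  proof (rule nn_integral_cong)
    fix y
    have "(\<integral>\<^sup>+ x. (\<Prod>j=1..Suc n. K ((y(?p := x)) (u, j) - m j (y(?p := x)))) \<partial>lborel)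
      = (\<integral>\<^sup>+ x. K (- m (Suc n) y + x) * (\<Prod>j=1..n. K (y (u, j) - m j y)) \<partial>lborel)"
      by (intro nn_integral_cong) (simp add: prod.nat_ivl_Suc' me del: fun_upd_apply, simp add: mult.commute)
    also have "\<dots> = (\<integral>\<^sup>+ x. K x \<partial>lborel) * (\<Prod>j=1..n. K (y (u, j) - m j y))"
      by (subst nn_integral_multc) (simp_all add: nn_integral_lborel_translate[OF K, of "- m (Suc n) y", simplified])
    finally show "(\<integral>\<^sup>+ x. (\<Prod>j=1..Suc n. K ((y(?p := x)) (u, j) - m j (y(?p := x)))) \<partial>lborel)
       = (\<integral>\<^sup>+ x. K x \<partial>lborel) * (\<Prod>j=1..n. K (y (u, j) - m j y))" .
  qed
  also have "\<dots> = (\<integral>\<^sup>+ x. K x \<partial>lborel) * (\<integral>\<^sup>+ y. (\<Prod>j=1..n. K (y (u, j) - m j y)) \<partial>PiM ?J (\<lambda>_. lborel))"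
    using Km[of n] by (intro nn_integral_cmult) simp
  also have "\<dots> = (\<integral>\<^sup>+ x. K x \<partial>lborel) ^ Suc n"
    using Suc.prems by (subst Suc.IH) auto
  finally show ?case .
qed

section \<open>The Gaussian test density and its mass\<close>

lemma nn_integral_gaussian_kernel:
  fixes s :: real assumes "s > 0"
  shows "(\<integral>\<^sup>+ z. ennreal (exp (- ((cmod z)\<^sup>2 / s)) / pi) \<partial>lborel) = ennreal s"
proof -
  have "(\<integral>\<^sup>+ z. ennreal (exp (- ((cmod z)\<^sup>2 / s)) / pi) \<partial>lborel)
    = (\<integral>\<^sup>+ z. ennreal (exp (- (cmod z)\<^sup>2) / pi) * ennreal (exp ((1 - 1 / s) * (cmod (0 + 1 * z))\<^sup>2)) \<partial>lborel)"
    by (intro nn_integral_cong) (simp add: ennreal_mult'[symmetric] exp_add[symmetric] algebra_simps)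
  also have "\<dots> = (\<integral>\<^sup>+ z. ennreal (exp ((1 - 1 / s) * (cmod (0 + 1 * z))\<^sup>2)) \<partial>std_complex_normal)"
    unfolding std_complex_normal_eq_density by (subst nn_integral_density) auto
  also have "\<dots> = ennreal s"
    using assms by (subst nn_integral_exp_quadratic_std_complex_normal) auto
  finally show ?thesis .
qed

text \<open>The encoder as a function of the output array instead of the noise; only in this form
  can it enter a density on the output space.\<close>

definition encoder_at :: "feedback \<Rightarrow> encoder \<Rightarrow> user \<Rightarrow> nat \<Rightarrow> nat \<Rightarrow> (user \<times> nat \<Rightarrow> complex) \<Rightarrow> complex" where
  "encoder_at F f u j m y = f u j m (\<lambda>i\<in>{1..<j}. of_bool (F U1 u) * y (U1, i)) (\<lambda>i\<in>{1..<j}. of_bool (F U2 u) * y (U2, i))"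

lemma chan_in_eq_encoder_at:
  assumes "j \<in> {1..N}"
  shows "chan_in gd gc F f w z u j = encoder_at F f u j (w u) (\<lambda>p\<in>UNIV \<times> {1..N}. chan_out gd gc F f w z (fst p) (snd p))"
  using assms unfolding encoder_at_def
  by (subst chan_in.simps) (intro arg_cong2[where f="f u j (w u)"] restrict_ext, auto)

lemma measurable_encoder_at:
  assumes f: "measurable_encoder N R f" and j: "j \<in> {1..N}" and mu: "m \<in> messages N (rate R u)"
    and y: "\<And>k i. i \<in> {1..<j} \<Longrightarrow> (\<lambda>x. y x (k, i)) \<in> borel_measurable M"
  shows "(\<lambda>x. encoder_at F f u j m (y x)) \<in> borel_measurable M"
proof -
  have past: "(\<lambda>x. \<lambda>i\<in>{1..<j}. of_bool (F k u) * y x (k, i)) \<in> measurable M (\<Pi>\<^sub>M i\<in>{1..<j}. borel)" for k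
    using y by (intro measurable_restrict borel_measurable_times) auto
  have "(\<lambda>(y1, y2). f u j m y1 y2) \<in> borel_measurable ((\<Pi>\<^sub>M i\<in>{1..<j}. borel) \<Otimes>\<^sub>M (\<Pi>\<^sub>M i\<in>{1..<j}. borel))"
    using f j mu by (auto simp: measurable_encoder_def)
  from measurable_compose[OF measurable_Pair[OF past[of U1] past[of U2]] this]
  show ?thesis by (simp add: encoder_at_def)
qed

lemma all_user: "(\<forall>u. P u) \<longleftrightarrow> P U1 \<and> P U2"
  by (metis user.exhaust)

lemma sum_message_pairs:
  "(\<Sum>w\<in>message_pairs N R. g (w U1) (w U2)) = (\<Sum>m1\<in>messages N (rate R U1). \<Sum>m2\<in>messages N (rate R U2). g m1 m2)"
proof -
  have "bij_betw (\<lambda>w. (w U1, w U2)) (message_pairs N R) (messages N (rate R U1) \<times> messages N (rate R U2))"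
  proof (rule bij_betwI[where g="\<lambda>(a, b) u. if u = U1 then a else b"])
    show "(\<lambda>(a, b) u. if u = U1 then a else b) \<in> messages N (rate R U1) \<times> messages N (rate R U2) \<rightarrow> message_pairs N R"
      by (auto simp: message_pairs_def all_user)
  next
    fix w :: "user \<Rightarrow> nat"
    show "(case (w U1, w U2) of (a, b) \<Rightarrow> \<lambda>u. if u = U1 then a else b) = w"
      by (simp add: fun_eq_iff all_user)
  qed (auto simp: message_pairs_def)
  then have "(\<Sum>w\<in>message_pairs N R. (\<lambda>(a, b). g a b) (w U1, w U2)) = (\<Sum>p\<in>messages N (rate R U1) \<times> messages N (rate R U2). (\<lambda>(a, b). g a b) p)"
    by (rule sum.reindex_bij_betw)
  then show ?thesis by (simp add: sum.cartesian_product)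
qed

lemma user_times_split: "(UNIV :: user set) \<times> A = {U1} \<times> A \<union> {U2} \<times> A"
  by (auto simp: UNIV_user)

lemma borel_measurable_PiM_lborel:
  "f \<in> measurable (PiM I (\<lambda>_. lborel :: complex measure)) M \<longleftrightarrow> f \<in> measurable (PiM I (\<lambda>_. borel)) M"
  by (simp cong: measurable_cong_sets)

text \<open>With the first input removed, the two outputs are
  \<open>gd * X\<^sub>2 + Z\<^sub>2\<close> and \<open>gc * X\<^sub>2 + Z\<^sub>1\<close>; the
  residual is the error of estimating the former by \<open>\<kappa>\<close> times the latter. The
  first input can be rebuilt from the first message and the past outputs.\<close>

definition genie_residual :: "complex \<Rightarrow> complex \<Rightarrow> complex \<Rightarrow> feedback \<Rightarrow> encoder \<Rightarrow> nat \<Rightarrow> (user \<times> nat \<Rightarrow> complex) \<Rightarrow> nat \<Rightarrow> complex" where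
  "genie_residual gd gc \<kappa> F f m y j = y (U2, j) - gc * encoder_at F f U1 j m y - \<kappa> * (y (U1, j) - gd * encoder_at F f U1 j m y)"

text \<open>The kernels have mass \<open>s\<close> and \<open>t\<close> instead of 1, so that the
  total mass \<open>(s * t) ^ N\<close> is what gets compared with the number of message pairs; the
  factors \<open>1 / pi\<close> match those of the noise density.\<close>

definition test_density :: "complex \<Rightarrow> complex \<Rightarrow> complex \<Rightarrow> feedback \<Rightarrow> encoder \<Rightarrow> real \<Rightarrow> real \<Rightarrow> nat \<Rightarrow> nat \<Rightarrow> (user \<times> nat \<Rightarrow> complex) \<Rightarrow> ennreal" where
  "test_density gd gc \<kappa> F f s t N m y =
     (\<Prod>j=1..N. ennreal (exp (- ((cmod (y (U1, j)))\<^sup>2 / s)) / pi)) *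
     (\<Prod>j=1..N. ennreal (exp (- ((cmod (genie_residual gd gc \<kappa> F f m y j))\<^sup>2 / t)) / pi))"

lemma measurable_component_borel:
  "p \<in> I \<Longrightarrow> (\<lambda>y. y p) \<in> borel_measurable (PiM I (\<lambda>_. borel))"
  by (rule measurable_component_singleton)

lemma measurable_genie_residual:
  assumes "measurable_encoder N R f" "j \<in> {1..N}" "m \<in> messages N (rate R U1)"
  shows "(\<lambda>y. genie_residual gd gc \<kappa> F f m y j) \<in> borel_measurable (PiM (UNIV \<times> {1..N}) (\<lambda>_. borel))"
  unfolding genie_residual_def using assms
  by (intro borel_measurable_diff borel_measurable_times borel_measurable_const measurable_encoder_at[OF assms]
      measurable_component_borel) auto

lemma measurable_test_density:
  assumes "measurable_encoder N R f" "m \<in> messages N (rate R U1)"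
  shows "test_density gd gc \<kappa> F f s t N m \<in> borel_measurable (PiM (UNIV \<times> {1..N}) (\<lambda>_. borel))"
proof -
  have k: "(\<lambda>z. ennreal (exp (- ((cmod z)\<^sup>2 / r)) / pi)) \<in> borel_measurable borel" for r by measurable
  show ?thesis unfolding test_density_def
    by (intro borel_measurable_times_ennreal borel_measurable_prod_ennreal measurable_compose[OF _ k]
        measurable_component_borel measurable_genie_residual[OF assms(1) _ assms(2)]) auto
qed

lemma measurable_decoder_output:
  assumes "measurable_decoder N h"
  shows "Measurable.pred (PiM (UNIV \<times> {1..N}) (\<lambda>_. borel)) (\<lambda>y. h u (\<lambda>j\<in>{1..N}. y (u, j)) = m)"
proof -
  have "(\<lambda>y. \<lambda>j\<in>{1..N}. y (u, j)) \<in> measurable (PiM (UNIV \<times> {1..N}) (\<lambda>_. borel)) (\<Pi>\<^sub>M i\<in>{1..N}. borel)"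
    by (intro measurable_restrict measurable_component_borel) auto
  then have "(\<lambda>y. h u (\<lambda>j\<in>{1..N}. y (u, j))) \<in> measurable (PiM (UNIV \<times> {1..N}) (\<lambda>_. borel)) (count_space UNIV)"
    by (rule measurable_compose) (use assms in \<open>simp add: measurable_decoder_def\<close>)
  then show ?thesis by (rule measurable_compose) simp
qed

lemma sum_of_bool_eq_le_1: "finite A \<Longrightarrow> (\<Sum>m\<in>A. of_bool (c = m) :: ennreal) \<le> 1"
  by (simp add: of_bool_def)

text \<open>The residual does not involve the second message, so that summing over it costs nothing;
  then the second output can be integrated out.\<close>

lemma nn_integral_test_density_le:
  assumes f: "measurable_encoder N R f" and h: "measurable_decoder N h" and st: "s > 0" "t > 0"
  shows "(\<Sum>w\<in>message_pairs N R. \<integral>\<^sup>+ y. of_bool (\<forall>u. h u (\<lambda>j\<in>{1..N}. y (u, j)) = w u) *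
      test_density gd gc \<kappa> F f s t N (w U1) y \<partial>PiM (UNIV \<times> {1..N}) (\<lambda>_. lborel)) \<le> ennreal ((s * t) ^ N)"
proof -
  let ?I = "{U1} \<times> {1..N}" and ?J = "{U2} \<times> {1..N}"
  let ?M = "\<lambda>I. PiM I (\<lambda>_. lborel :: complex measure)"
  let ?h1 = "\<lambda>y. h U1 (\<lambda>j\<in>{1..N}. y (U1, j))" and ?h2 = "\<lambda>y. h U2 (\<lambda>j\<in>{1..N}. y (U2, j))"
  let ?td = "test_density gd gc \<kappa> F f s t N"
  define K where "K = (\<lambda>s z. ennreal (exp (- ((cmod z)\<^sup>2 / s)) / pi))"
  have Km[measurable]: "K r \<in> borel_measurable borel" for r unfolding K_def by measurable
  have KI: "(\<integral>\<^sup>+ z. K r z \<partial>lborel) = ennreal r" if "r > 0" for r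
    unfolding K_def using that by (rule nn_integral_gaussian_kernel)
  have hm: "(\<lambda>y. of_bool (h u (\<lambda>j\<in>{1..N}. y (u, j)) = m) :: ennreal) \<in> borel_measurable (PiM (UNIV \<times> {1..N}) (\<lambda>_. borel))" for u m
    using measurable_decoder_output[OF h, of u m] by measurable
  have tdm: "?td m \<in> borel_measurable (PiM (UNIV \<times> {1..N}) (\<lambda>_. borel))" if "m \<in> messages N (rate R U1)" for m
    using measurable_test_density[OF f that] .
  have all: "(\<forall>u. h u (\<lambda>j\<in>{1..N}. y (u, j)) = w u) \<longleftrightarrow> ?h1 y = w U1 \<and> ?h2 y = w U2" for y and w :: "user \<Rightarrow> nat"
    by (simp add: all_user)
  \<comment> \<open>For fixed first outputs \<open>a\<close>, the residual at time \<open>j\<close>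
    is \<open>b (U2, j)\<close> minus a function of earlier entries of \<open>b\<close>, the
    situation of \<open>nn_integral_seq_prod\<close>.\<close>
  have inner: "(\<integral>\<^sup>+ b. ?td m (merge ?I ?J (a, b)) \<partial>?M ?J) = (\<Prod>j=1..N. K s (a (U1, j))) * ennreal t ^ N"
    if m: "m \<in> messages N (rate R U1)" for m a
  proof -
    define e where "e = (\<lambda>j b. encoder_at F f U1 j m (merge ?I ?J (a, b)))"
    have e_cong: "e j b = e j b'" if "\<And>i. 1 \<le> i \<Longrightarrow> i < j \<Longrightarrow> b (U2, i) = b' (U2, i)" for j b b'
    proof -
      have "merge ?I ?J (a, b) (k, i) = merge ?I ?J (a, b') (k, i)" if "i \<in> {1..<j}" for k i
        using \<open>\<And>i. 1 \<le> i \<Longrightarrow> i < j \<Longrightarrow> b (U2, i) = b' (U2, i)\<close>[of i] that by (cases k) (auto simp: merge_def)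
      then show ?thesis unfolding e_def encoder_at_def
        by (intro arg_cong2[where f="f U1 j m"] restrict_ext) auto
    qed
    have e_meas: "e j \<in> borel_measurable (PiM ({U2} \<times> {1..l}) (\<lambda>_. borel))" if "1 \<le> j" "j \<le> N" "j \<le> Suc l" for j l
      unfolding e_def
    proof (rule measurable_encoder_at[OF f _ m])
      show "j \<in> {1..N}" using that by auto
      fix k i assume i: "i \<in> {1..<j}"
      show "(\<lambda>b. merge ?I ?J (a, b) (k, i)) \<in> borel_measurable (PiM ({U2} \<times> {1..l}) (\<lambda>_. borel))"
        using i that by (cases k) (auto simp: merge_def intro!: measurable_component_borel)
    qed
    have "(\<integral>\<^sup>+ b. (\<Prod>j=1..N. K t (b (U2, j) - (gc * e j b + \<kappa> * (a (U1, j) - gd * e j b)))) \<partial>?M ?J) = (\<integral>\<^sup>+ z. K t z \<partial>lborel) ^ N"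
    proof (rule nn_integral_seq_prod[OF Km])
      fix j and b b' :: "user \<times> nat \<Rightarrow> complex"
      assume "\<And>i. 1 \<le> i \<Longrightarrow> i < j \<Longrightarrow> b (U2, i) = b' (U2, i)"
      then have "e j b = e j b'" by (rule e_cong)
      then show "gc * e j b + \<kappa> * (a (U1, j) - gd * e j b) = gc * e j b' + \<kappa> * (a (U1, j) - gd * e j b')" by simp
    qed (intro borel_measurable_add borel_measurable_diff borel_measurable_times borel_measurable_const e_meas)
    then have i1: "(\<integral>\<^sup>+ b. (\<Prod>j=1..N. K t (b (U2, j) - (gc * e j b + \<kappa> * (a (U1, j) - gd * e j b)))) \<partial>?M ?J) = ennreal t ^ N"
      using KI st by simp
    have i2: "?td m (merge ?I ?J (a, b)) = (\<Prod>j=1..N. K s (a (U1, j))) * (\<Prod>j=1..N. K t (b (U2, j) - (gc * e j b + \<kappa> * (a (U1, j) - gd * e j b))))" for b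
    proof -
      have "merge ?I ?J (a, b) (U1, j) = a (U1, j)" "merge ?I ?J (a, b) (U2, j) = b (U2, j)" if "j \<in> {1..N}" for j
        using that by (auto simp: merge_def)
      then show ?thesis unfolding test_density_def genie_residual_def K_def e_def
        by (intro arg_cong2[where f="(*)"] prod.cong) (auto simp: algebra_simps)
    qed
    have e_meas': "e j \<in> borel_measurable (?M ?J)" if "j \<in> {1..N}" for j
      using e_meas[of j N] that by simp
    have comp: "(\<lambda>b. b (U2, j)) \<in> borel_measurable (?M ?J)" if "j \<in> {1..N}" for j
      using measurable_component_borel[of "(U2, j)" ?J] that by simp
    have "(\<integral>\<^sup>+ b. ?td m (merge ?I ?J (a, b)) \<partial>?M ?J)
       = (\<Prod>j=1..N. K s (a (U1, j))) * (\<integral>\<^sup>+ b. (\<Prod>j=1..N. K t (b (U2, j) - (gc * e j b + \<kappa> * (a (U1, j) - gd * e j b)))) \<partial>?M ?J)"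
      unfolding i2
      by (rule nn_integral_cmult)
        (intro borel_measurable_prod_ennreal measurable_compose[OF _ Km] borel_measurable_add borel_measurable_diff
           borel_measurable_times borel_measurable_const e_meas' comp)
    then show ?thesis by (simp only: i1)
  qed
  have mI: "(\<lambda>a. of_bool (?h1 a = m) :: ennreal) \<in> borel_measurable (PiM ?I (\<lambda>_. borel))" for m
  proof -
    have "(\<lambda>y. \<lambda>j\<in>{1..N}. y (U1, j)) \<in> measurable (PiM ?I (\<lambda>_. borel)) (\<Pi>\<^sub>M i\<in>{1..N}. borel)"
      by (intro measurable_restrict measurable_component_borel) auto
    then have "?h1 \<in> measurable (PiM ?I (\<lambda>_. borel)) (count_space UNIV)"
      by (rule measurable_compose) (use h in \<open>simp add: measurable_decoder_def\<close>)
    then show ?thesis by measurable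
  qed
  have mK: "(\<lambda>a. \<Prod>j=1..N. K s (a (U1, j))) \<in> borel_measurable (PiM ?I (\<lambda>_. borel))"
    by (auto intro!: borel_measurable_prod_ennreal measurable_compose[OF _ Km] measurable_component_borel)
  have "(\<Sum>w\<in>message_pairs N R. \<integral>\<^sup>+ y. of_bool (\<forall>u. h u (\<lambda>j\<in>{1..N}. y (u, j)) = w u) * ?td (w U1) y \<partial>?M (UNIV \<times> {1..N}))
    = (\<Sum>m1\<in>messages N (rate R U1). \<Sum>m2\<in>messages N (rate R U2). \<integral>\<^sup>+ y. of_bool (?h1 y = m1 \<and> ?h2 y = m2) * ?td m1 y \<partial>?M (UNIV \<times> {1..N}))"
    unfolding all by (rule sum_message_pairs)
  \<comment> \<open>A decoder returns one message, so at each \<open>y\<close> at most one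
    \<open>m2\<close> contributes; later the same is used for \<open>m1\<close>.\<close>
  also have "\<dots> \<le> (\<Sum>m1\<in>messages N (rate R U1). \<integral>\<^sup>+ y. of_bool (?h1 y = m1) * ?td m1 y \<partial>?M (UNIV \<times> {1..N}))"
  proof (rule sum_mono)
    fix m1 assume m1: "m1 \<in> messages N (rate R U1)"
    have "(\<Sum>m2\<in>messages N (rate R U2). \<integral>\<^sup>+ y. of_bool (?h1 y = m1 \<and> ?h2 y = m2) * ?td m1 y \<partial>?M (UNIV \<times> {1..N}))
       = (\<integral>\<^sup>+ y. (\<Sum>m2\<in>messages N (rate R U2). of_bool (?h1 y = m1 \<and> ?h2 y = m2) * ?td m1 y) \<partial>?M (UNIV \<times> {1..N}))"
    proof (rule nn_integral_sum[symmetric])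
      fix m2
      have "(\<lambda>y. of_bool (?h1 y = m1) * of_bool (?h2 y = m2) * ?td m1 y) \<in> borel_measurable (?M (UNIV \<times> {1..N}))"
        using tdm[OF m1] hm[of U1 m1] hm[of U2 m2] by (intro borel_measurable_times_ennreal) auto
      then show "(\<lambda>y. of_bool (?h1 y = m1 \<and> ?h2 y = m2) * ?td m1 y) \<in> borel_measurable (?M (UNIV \<times> {1..N}))"
        by (simp add: of_bool_conj)
    qed
    also have "\<dots> = (\<integral>\<^sup>+ y. of_bool (?h1 y = m1) * ?td m1 y * (\<Sum>m2\<in>messages N (rate R U2). of_bool (?h2 y = m2)) \<partial>?M (UNIV \<times> {1..N}))"
      by (intro nn_integral_cong) (simp add: of_bool_conj sum_distrib_left mult_ac)
    also have "\<dots> \<le> (\<integral>\<^sup>+ y. of_bool (?h1 y = m1) * ?td m1 y * 1 \<partial>?M (UNIV \<times> {1..N}))"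
      by (intro nn_integral_mono mult_left_mono sum_of_bool_eq_le_1) auto
    finally show "(\<Sum>m2\<in>messages N (rate R U2). \<integral>\<^sup>+ y. of_bool (?h1 y = m1 \<and> ?h2 y = m2) * ?td m1 y \<partial>?M (UNIV \<times> {1..N}))
       \<le> (\<integral>\<^sup>+ y. of_bool (?h1 y = m1) * ?td m1 y \<partial>?M (UNIV \<times> {1..N}))" by simp
  qed
  also have "\<dots> = (\<Sum>m1\<in>messages N (rate R U1). \<integral>\<^sup>+ a. of_bool (?h1 a = m1) * ((\<Prod>j=1..N. K s (a (U1, j))) * ennreal t ^ N) \<partial>?M ?I)"
  proof (rule sum.cong[OF refl])
    fix m1 assume m1: "m1 \<in> messages N (rate R U1)"
    have mm: "(\<lambda>y. of_bool (?h1 y = m1) * ?td m1 y) \<in> borel_measurable (?M (?I \<union> ?J))"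
      unfolding user_times_split[symmetric] borel_measurable_PiM_lborel
      by (intro borel_measurable_times_ennreal tdm[OF m1] hm)
    have "(\<integral>\<^sup>+ y. of_bool (?h1 y = m1) * ?td m1 y \<partial>?M (UNIV \<times> {1..N}))
      = (\<integral>\<^sup>+ a. \<integral>\<^sup>+ b. of_bool (?h1 (merge ?I ?J (a, b)) = m1) * ?td m1 (merge ?I ?J (a, b)) \<partial>?M ?J \<partial>?M ?I)"
      unfolding user_times_split
      using mm by (intro lborel_prod.product_nn_integral_fold) auto
    also have "\<dots> = (\<integral>\<^sup>+ a. of_bool (?h1 a = m1) * (\<integral>\<^sup>+ b. ?td m1 (merge ?I ?J (a, b)) \<partial>?M ?J) \<partial>?M ?I)"
    proof (rule nn_integral_cong)
      fix a assume a: "a \<in> space (?M ?I)"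
      have "(\<lambda>j\<in>{1..N}. merge ?I ?J (a, b) (U1, j)) = (\<lambda>j\<in>{1..N}. a (U1, j))" for b
        by (auto simp: merge_def restrict_def)
      moreover have "(\<lambda>b. ?td m1 (merge ?I ?J (a, b))) \<in> borel_measurable (?M ?J)"
      proof -
        have "(\<lambda>b. merge ?I ?J (a, b)) \<in> measurable (?M ?J) (PiM (?I \<union> ?J) (\<lambda>_. lborel))"
          using measurable_compose[OF measurable_Pair1'[OF a] measurable_merge] .
        from measurable_compose[OF this, of "?td m1" borel] tdm[OF m1] show ?thesis
          by (simp add: user_times_split[symmetric])
      qed
      ultimately show "(\<integral>\<^sup>+ b. of_bool (?h1 (merge ?I ?J (a, b)) = m1) * ?td m1 (merge ?I ?J (a, b)) \<partial>?M ?J)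
         = of_bool (?h1 a = m1) * (\<integral>\<^sup>+ b. ?td m1 (merge ?I ?J (a, b)) \<partial>?M ?J)"
        by (simp add: nn_integral_cmult)
    qed
    finally show "(\<integral>\<^sup>+ y. of_bool (?h1 y = m1) * ?td m1 y \<partial>?M (UNIV \<times> {1..N}))
      = (\<integral>\<^sup>+ a. of_bool (?h1 a = m1) * ((\<Prod>j=1..N. K s (a (U1, j))) * ennreal t ^ N) \<partial>?M ?I)"
      by (simp only: inner[OF m1])
  qed
  also have "\<dots> = (\<integral>\<^sup>+ a. (\<Sum>m1\<in>messages N (rate R U1). of_bool (?h1 a = m1) * ((\<Prod>j=1..N. K s (a (U1, j))) * ennreal t ^ N)) \<partial>?M ?I)"
    using mI mK by (intro nn_integral_sum[symmetric] borel_measurable_times_ennreal) auto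
  also have "\<dots> = (\<integral>\<^sup>+ a. (\<Sum>m1\<in>messages N (rate R U1). of_bool (?h1 a = m1)) * ((\<Prod>j=1..N. K s (a (U1, j))) * ennreal t ^ N) \<partial>?M ?I)"
    by (simp add: sum_distrib_right)
  also have "\<dots> \<le> (\<integral>\<^sup>+ a. 1 * ((\<Prod>j=1..N. K s (a (U1, j))) * ennreal t ^ N) \<partial>?M ?I)"
    by (intro nn_integral_mono mult_right_mono sum_of_bool_eq_le_1) auto
  also have "\<dots> = (\<integral>\<^sup>+ a. (\<Prod>j=1..N. K s (a (U1, j) - 0)) \<partial>?M ?I) * ennreal t ^ N"
    using mK by (simp add: nn_integral_multc)
  also have "\<dots> = ennreal s ^ N * ennreal t ^ N"
    using KI st by (subst nn_integral_seq_prod[OF Km]) auto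
  also have "\<dots> = ennreal ((s * t) ^ N)"
    using st by (simp add: ennreal_power ennreal_mult[symmetric] power_mult_distrib)
  finally show ?thesis .
qed

section \<open>Second moments of inputs, outputs and residuals of a code\<close>

lemma nn_integral_add_noise:
  fixes s :: "(user \<times> nat \<Rightarrow> complex) \<Rightarrow> complex"
  assumes q: "q \<in> UNIV \<times> {1..N}" and s: "s \<in> borel_measurable (noise_space N)" and ind: "\<And>z x. s (z(q := x)) = s z"
  shows "(\<integral>\<^sup>+ z. ennreal ((cmod (s z + b * z q))\<^sup>2) \<partial>noise_space N) = (\<integral>\<^sup>+ z. ennreal ((cmod (s z))\<^sup>2) \<partial>noise_space N) + ennreal ((cmod b)\<^sup>2)"
proof -
  let ?J = "UNIV \<times> {1..N} - {q}"
  have zq: "(\<lambda>z. z q) \<in> borel_measurable (noise_space N)"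
    unfolding noise_space_def using q by (rule measurable_component_std_complex_normal)
  have m1: "(\<lambda>z. ennreal ((cmod (s z + b * z q))\<^sup>2)) \<in> borel_measurable (noise_space N)"
    and m2: "(\<lambda>z. ennreal ((cmod (s z))\<^sup>2 + (cmod b)\<^sup>2)) \<in> borel_measurable (noise_space N)"
    using s zq by measurable
  have "(\<integral>\<^sup>+ z. ennreal ((cmod (s z + b * z q))\<^sup>2) \<partial>noise_space N)
     = (\<integral>\<^sup>+ z. \<integral>\<^sup>+ x. ennreal ((cmod (s (z(q := x)) + b * (z(q := x)) q))\<^sup>2) \<partial>std_complex_normal \<partial>PiM ?J (\<lambda>_. std_complex_normal))"
    unfolding noise_space_def
    by (rule nn_integral_PiM_split_coordinate) (use q m1 in \<open>simp_all add: noise_space_def\<close>)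
  also have "\<dots> = (\<integral>\<^sup>+ z. ennreal ((cmod (s z))\<^sup>2 + (cmod b)\<^sup>2) \<partial>PiM ?J (\<lambda>_. std_complex_normal))"
    by (simp only: ind fun_upd_same nn_integral_norm_square_std_complex_normal)
  also have "\<dots> = (\<integral>\<^sup>+ z. \<integral>\<^sup>+ x. ennreal ((cmod (s (z(q := x))))\<^sup>2 + (cmod b)\<^sup>2) \<partial>std_complex_normal \<partial>PiM ?J (\<lambda>_. std_complex_normal))"
    using std_complex_normal.emeasure_space_1 by (simp only: ind nn_integral_const) simp
  also have "\<dots> = (\<integral>\<^sup>+ z. ennreal ((cmod (s z))\<^sup>2 + (cmod b)\<^sup>2) \<partial>noise_space N)"
    unfolding noise_space_def
    by (rule nn_integral_PiM_split_coordinate[symmetric]) (use q m2 in \<open>simp_all add: noise_space_def\<close>)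
  also have "\<dots> = (\<integral>\<^sup>+ z. ennreal ((cmod (s z))\<^sup>2) + ennreal ((cmod b)\<^sup>2) \<partial>noise_space N)"
    by simp
  also have "\<dots> = (\<integral>\<^sup>+ z. ennreal ((cmod (s z))\<^sup>2) \<partial>noise_space N) + ennreal ((cmod b)\<^sup>2)"
    using s noise.emeasure_space_1 by (subst nn_integral_add) auto
  finally show ?thesis .
qed

lemma card_user [simp]: "CARD(user) = 2"
  by (simp add: UNIV_user)

lemma borel_measurable_of_bool:
  "Measurable.pred M P \<Longrightarrow> (\<lambda>x. of_bool (P x) :: ennreal) \<in> borel_measurable M"
  unfolding of_bool_def by measurable

lemma code_input_power:
  assumes code: "is_code gd gc P F N R f h" and R: "\<And>u. rate R u \<ge> 0" and P: "P \<ge> 0" and j: "j \<in> {1..N}"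
  shows "(\<Sum>w\<in>message_pairs N R. \<integral>\<^sup>+ z. ennreal ((cmod (chan_in gd gc F f w z u j))\<^sup>2) \<partial>noise_space N)
     \<le> ennreal (P * card (message_pairs N R))"
proof -
  have f: "measurable_encoder N R f" using code by (simp add: is_code_def)
  have c: "card (message_pairs N R) > 0"
    using message_pairs_nonempty[OF R] by (simp add: card_gt_0_iff)
  have m: "(\<lambda>z. ennreal ((cmod (chan_in gd gc F f w z u j))\<^sup>2)) \<in> borel_measurable (noise_space N)"
    if "w \<in> message_pairs N R" for w
    using measurable_chan_in[OF f that order_refl j] by measurable
  have "(\<integral>\<^sup>+ (w, z). ennreal ((cmod (chan_in gd gc F f w z u j))\<^sup>2) \<partial>source_space N R) \<le> ennreal P"
    using code j by (simp add: is_code_def power_constraint_def)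
  then have "(\<Sum>w\<in>message_pairs N R. \<integral>\<^sup>+ z. ennreal ((cmod (chan_in gd gc F f w z u j))\<^sup>2) \<partial>noise_space N)
      / ennreal (card (message_pairs N R)) \<le> ennreal P"
    by (subst (asm) nn_integral_source_space) (use m in auto)
  then have "(\<Sum>w\<in>message_pairs N R. \<integral>\<^sup>+ z. ennreal ((cmod (chan_in gd gc F f w z u j))\<^sup>2) \<partial>noise_space N)
      / ennreal (card (message_pairs N R)) * ennreal (card (message_pairs N R)) \<le> ennreal P * ennreal (card (message_pairs N R))"
    by (rule mult_right_mono) simp
  moreover have "ennreal (card (message_pairs N R)) / ennreal (card (message_pairs N R)) = 1"
    using c by (subst divide_ennreal) auto
  ultimately show ?thesis using P by (simp add: ennreal_mult ennreal_divide_times)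
qed

lemma chan_in_update_noise:
  "j \<le> i \<Longrightarrow> chan_in gd gc F f w (z((k, i) := x)) u j = chan_in gd gc F f w z u j"
  by (rule chan_in_cong) auto

lemma norm_add_sq_le: "(cmod (a + b))\<^sup>2 \<le> 2 * (cmod a)\<^sup>2 + 2 * (cmod b)\<^sup>2"
proof -
  have "(cmod (a + b))\<^sup>2 \<le> (cmod a + cmod b)\<^sup>2" by (intro power_mono norm_triangle_ineq) auto
  also have "\<dots> \<le> 2 * (cmod a)\<^sup>2 + 2 * (cmod b)\<^sup>2"
    using sum_squares_bound[of "cmod a" "cmod b"] by (simp add: power2_sum)
  finally show ?thesis .
qed

text \<open>Feedback can correlate the two inputs, so their cross term does not vanish and is
  absorbed by \<open>norm_add_sq_le\<close>; hence the factors 2.\<close>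

lemma code_output_power:
  assumes code: "is_code gd gc P F N R f h" and R: "\<And>u. rate R u \<ge> 0" and P: "P \<ge> 0" and j: "j \<in> {1..N}"
  shows "(\<Sum>w\<in>message_pairs N R. \<integral>\<^sup>+ z. ennreal ((cmod (chan_out gd gc F f w z U1 j))\<^sup>2) \<partial>noise_space N)
     \<le> ennreal ((1 + 2 * SNR gd P + 2 * INR gc P) * card (message_pairs N R))"
proof -
  let ?W = "message_pairs N R"
  let ?x = "chan_in gd gc F f"
  have f: "measurable_encoder N R f" using code by (simp add: is_code_def)
  have xm: "(\<lambda>z. ?x w z u j) \<in> borel_measurable (noise_space N)" if "w \<in> ?W" for w u
    using measurable_chan_in[OF f that order_refl j] .
  have q: "(U1, j) \<in> UNIV \<times> {1..N}" using j by simp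
  have "(\<integral>\<^sup>+ z. ennreal ((cmod (chan_out gd gc F f w z U1 j))\<^sup>2) \<partial>noise_space N)
    \<le> ennreal (2 * (cmod gd)\<^sup>2) * (\<integral>\<^sup>+ z. ennreal ((cmod (?x w z U1 j))\<^sup>2) \<partial>noise_space N)
      + ennreal (2 * (cmod gc)\<^sup>2) * (\<integral>\<^sup>+ z. ennreal ((cmod (?x w z U2 j))\<^sup>2) \<partial>noise_space N) + ennreal 1"
    if w: "w \<in> ?W" for w
  proof -
    define s where "s = (\<lambda>z. gd * ?x w z U1 j + gc * ?x w z U2 j)"
    have sm[measurable]: "s \<in> borel_measurable (noise_space N)" unfolding s_def
      using xm[OF w] by (intro borel_measurable_add borel_measurable_times) auto
    have [measurable]: "(\<lambda>z. ?x w z u j) \<in> borel_measurable (noise_space N)" for u by (rule xm[OF w])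
    have "(\<integral>\<^sup>+ z. ennreal ((cmod (chan_out gd gc F f w z U1 j))\<^sup>2) \<partial>noise_space N)
      = (\<integral>\<^sup>+ z. ennreal ((cmod (s z + 1 * z (U1, j)))\<^sup>2) \<partial>noise_space N)"
      by (simp add: chan_out.simps s_def)
    also have "\<dots> = (\<integral>\<^sup>+ z. ennreal ((cmod (s z))\<^sup>2) \<partial>noise_space N) + ennreal ((cmod 1)\<^sup>2)"
    proof (rule nn_integral_add_noise[OF q sm])
      show "s (z((U1, j) := x)) = s z" for z x by (simp add: s_def chan_in_update_noise)
    qed
    also have "(\<integral>\<^sup>+ z. ennreal ((cmod (s z))\<^sup>2) \<partial>noise_space N)
      \<le> (\<integral>\<^sup>+ z. ennreal (2 * (cmod gd)\<^sup>2) * ennreal ((cmod (?x w z U1 j))\<^sup>2) + ennreal (2 * (cmod gc)\<^sup>2) * ennreal ((cmod (?x w z U2 j))\<^sup>2) \<partial>noise_space N)"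
    proof (rule nn_integral_mono)
      fix z
      have "(cmod (s z))\<^sup>2 \<le> 2 * (cmod gd)\<^sup>2 * (cmod (?x w z U1 j))\<^sup>2 + 2 * (cmod gc)\<^sup>2 * (cmod (?x w z U2 j))\<^sup>2"
        using norm_add_sq_le[of "gd * ?x w z U1 j" "gc * ?x w z U2 j"] by (simp add: s_def norm_mult power_mult_distrib mult.assoc)
      then show "ennreal ((cmod (s z))\<^sup>2) \<le> ennreal (2 * (cmod gd)\<^sup>2) * ennreal ((cmod (?x w z U1 j))\<^sup>2) + ennreal (2 * (cmod gc)\<^sup>2) * ennreal ((cmod (?x w z U2 j))\<^sup>2)"
        by (simp add: ennreal_mult[symmetric] ennreal_plus[symmetric] ennreal_leI del: ennreal_plus)
    qed
    also have "\<dots> = ennreal (2 * (cmod gd)\<^sup>2) * (\<integral>\<^sup>+ z. ennreal ((cmod (?x w z U1 j))\<^sup>2) \<partial>noise_space N)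
      + ennreal (2 * (cmod gc)\<^sup>2) * (\<integral>\<^sup>+ z. ennreal ((cmod (?x w z U2 j))\<^sup>2) \<partial>noise_space N)"
      by (subst nn_integral_add) (auto simp: nn_integral_cmult)
    finally show ?thesis by (simp add: add_right_mono)
  qed
  then have "(\<Sum>w\<in>?W. \<integral>\<^sup>+ z. ennreal ((cmod (chan_out gd gc F f w z U1 j))\<^sup>2) \<partial>noise_space N)
    \<le> (\<Sum>w\<in>?W. ennreal (2 * (cmod gd)\<^sup>2) * (\<integral>\<^sup>+ z. ennreal ((cmod (?x w z U1 j))\<^sup>2) \<partial>noise_space N)
      + ennreal (2 * (cmod gc)\<^sup>2) * (\<integral>\<^sup>+ z. ennreal ((cmod (?x w z U2 j))\<^sup>2) \<partial>noise_space N) + ennreal 1)"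
    by (intro sum_mono)
  also have "\<dots> = ennreal (2 * (cmod gd)\<^sup>2) * (\<Sum>w\<in>?W. \<integral>\<^sup>+ z. ennreal ((cmod (?x w z U1 j))\<^sup>2) \<partial>noise_space N)
      + ennreal (2 * (cmod gc)\<^sup>2) * (\<Sum>w\<in>?W. \<integral>\<^sup>+ z. ennreal ((cmod (?x w z U2 j))\<^sup>2) \<partial>noise_space N) + ennreal (card ?W)"
    by (simp add: sum.distrib sum_distrib_left ennreal_of_nat_eq_real_of_nat)
  also have "\<dots> \<le> ennreal (2 * (cmod gd)\<^sup>2) * ennreal (P * card ?W) + ennreal (2 * (cmod gc)\<^sup>2) * ennreal (P * card ?W) + ennreal (card ?W)"
    by (intro add_mono mult_left_mono code_input_power[OF code R P j]) auto
  also have "\<dots> = ennreal ((1 + 2 * SNR gd P + 2 * INR gc P) * card ?W)"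
    using P by (simp add: ennreal_mult'[symmetric] ennreal_plus[symmetric] SNR_def INR_def algebra_simps del: ennreal_plus)
  finally show ?thesis .
qed

text \<open>The minimiser of \<open>\<kappa> \<mapsto> \<bar>gd - \<kappa> gc\<bar>\<^sup>2 P + 1 + \<bar>\<kappa>\<bar>\<^sup>2\<close>, i.e. linear MMSE estimation of the
  second output from the noisy interference at the first receiver.\<close>

definition mmse_coeff :: "complex \<Rightarrow> complex \<Rightarrow> real \<Rightarrow> complex" where
  "mmse_coeff gd gc P = gd * cnj gc * of_real (P / (1 + INR gc P))"

lemma mmse_value:
  fixes gd gc :: complex
  assumes "P \<ge> 0"
  defines "\<kappa> \<equiv> mmse_coeff gd gc P"
  shows "(cmod (gd - \<kappa> * gc))\<^sup>2 * P + 1 + (cmod \<kappa>)\<^sup>2 = 1 + SNR gd P / (1 + INR gc P)"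
proof -
  define I where "I = INR gc P"
  have I: "1 + I > 0" using assms by (simp add: I_def INR_def add_pos_nonneg)
  have "gd - \<kappa> * gc = gd * of_real (1 - (cmod gc)\<^sup>2 * P / (1 + I))"
    using complex_norm_square[of gc] by (simp add: \<kappa>_def mmse_coeff_def I_def[symmetric] algebra_simps)
  also have "1 - (cmod gc)\<^sup>2 * P / (1 + I) = 1 / (1 + I)"
    using I by (simp add: I_def INR_def field_simps)
  finally have 1: "(cmod (gd - \<kappa> * gc))\<^sup>2 = (cmod gd)\<^sup>2 / (1 + I)\<^sup>2"
    by (simp add: norm_mult power_mult_distrib norm_divide power_divide del: of_real_divide)
  have 2: "(cmod \<kappa>)\<^sup>2 = (cmod gd)\<^sup>2 * P * I / (1 + I)\<^sup>2"
    using assms by (simp add: \<kappa>_def mmse_coeff_def I_def[symmetric] norm_mult power_mult_distrib norm_divide power_divide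
       del: of_real_divide of_real_mult) (simp add: I_def INR_def power2_eq_square)
  have "(cmod gd)\<^sup>2 / (1 + I)\<^sup>2 * P + (cmod gd)\<^sup>2 * P * I / (1 + I)\<^sup>2 = (cmod gd)\<^sup>2 * P * (1 + I) / (1 + I)\<^sup>2"
    by (simp add: add_divide_distrib algebra_simps)
  also have "\<dots> = SNR gd P / (1 + I)"
    using I by (simp add: power2_eq_square SNR_def)
  finally show ?thesis unfolding 1 2 I_def by simp
qed

lemma genie_residual_chan_out:
  assumes "j \<in> {1..N}"
  shows "genie_residual gd gc \<kappa> F f (w U1) (\<lambda>p\<in>UNIV \<times> {1..N}. chan_out gd gc F f w z (fst p) (snd p)) j
    = ((gd - \<kappa> * gc) * chan_in gd gc F f w z U2 j + (- \<kappa>) * z (U1, j)) + 1 * z (U2, j)"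
  using assms unfolding genie_residual_def chan_in_eq_encoder_at[OF assms, symmetric]
  by (simp add: chan_out.simps algebra_simps)

text \<open>On the channel the residual is a multiple of the second input plus noise of both
  receivers at the same time. By causality the three parts are uncorrelated, so only the input power
  enters, and \<open>mmse_value\<close> evaluates the sum.\<close>

lemma code_residual_power:
  assumes code: "is_code gd gc P F N R f h" and R: "\<And>u. rate R u \<ge> 0" and P: "P \<ge> 0" and j: "j \<in> {1..N}"
  shows "(\<Sum>w\<in>message_pairs N R. \<integral>\<^sup>+ z. ennreal ((cmod (genie_residual gd gc (mmse_coeff gd gc P) F f (w U1)
       (\<lambda>p\<in>UNIV \<times> {1..N}. chan_out gd gc F f w z (fst p) (snd p)) j))\<^sup>2) \<partial>noise_space N)
     \<le> ennreal ((1 + SNR gd P / (1 + INR gc P)) * card (message_pairs N R))"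
proof -
  let ?W = "message_pairs N R" and ?x = "chan_in gd gc F f"
  define \<kappa> where "\<kappa> = mmse_coeff gd gc P"
  define c where "c = gd - \<kappa> * gc"
  have f: "measurable_encoder N R f" using code by (simp add: is_code_def)
  have q: "(u, j) \<in> UNIV \<times> {1..N}" for u using j by simp
  have eq: "(\<integral>\<^sup>+ z. ennreal ((cmod ((c * ?x w z U2 j + (- \<kappa>) * z (U1, j)) + 1 * z (U2, j)))\<^sup>2) \<partial>noise_space N)
     = ennreal ((cmod c)\<^sup>2) * (\<integral>\<^sup>+ z. ennreal ((cmod (?x w z U2 j))\<^sup>2) \<partial>noise_space N) + ennreal ((cmod \<kappa>)\<^sup>2 + 1)"
    if w: "w \<in> ?W" for w
  proof -
    have [measurable]: "(\<lambda>z. ?x w z u j) \<in> borel_measurable (noise_space N)" for u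
      using measurable_chan_in[OF f w order_refl j] .
    have [measurable]: "(\<lambda>z. z (u, j)) \<in> borel_measurable (noise_space N)" for u
      using j by (rule measurable_noise_component)
    have "(\<integral>\<^sup>+ z. ennreal ((cmod ((c * ?x w z U2 j + (- \<kappa>) * z (U1, j)) + 1 * z (U2, j)))\<^sup>2) \<partial>noise_space N)
      = (\<integral>\<^sup>+ z. ennreal ((cmod (c * ?x w z U2 j + (- \<kappa>) * z (U1, j)))\<^sup>2) \<partial>noise_space N) + ennreal ((cmod 1)\<^sup>2)"
      by (rule nn_integral_add_noise[OF q]) (simp_all add: chan_in_update_noise)
    also have "(\<integral>\<^sup>+ z. ennreal ((cmod (c * ?x w z U2 j + (- \<kappa>) * z (U1, j)))\<^sup>2) \<partial>noise_space N)
      = (\<integral>\<^sup>+ z. ennreal ((cmod (c * ?x w z U2 j))\<^sup>2) \<partial>noise_space N) + ennreal ((cmod (- \<kappa>))\<^sup>2)"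
      by (rule nn_integral_add_noise[OF q]) (simp_all add: chan_in_update_noise)
    also have "(\<integral>\<^sup>+ z. ennreal ((cmod (c * ?x w z U2 j))\<^sup>2) \<partial>noise_space N)
      = ennreal ((cmod c)\<^sup>2) * (\<integral>\<^sup>+ z. ennreal ((cmod (?x w z U2 j))\<^sup>2) \<partial>noise_space N)"
      by (subst nn_integral_cmult[symmetric]) (auto simp: norm_mult power_mult_distrib ennreal_mult)
    finally show ?thesis by (simp add: add.assoc)
  qed
  have "(\<Sum>w\<in>?W. \<integral>\<^sup>+ z. ennreal ((cmod (genie_residual gd gc \<kappa> F f (w U1)
       (\<lambda>p\<in>UNIV \<times> {1..N}. chan_out gd gc F f w z (fst p) (snd p)) j))\<^sup>2) \<partial>noise_space N)
     = ennreal ((cmod c)\<^sup>2) * (\<Sum>w\<in>?W. \<integral>\<^sup>+ z. ennreal ((cmod (?x w z U2 j))\<^sup>2) \<partial>noise_space N) + ennreal (card ?W) * ennreal ((cmod \<kappa>)\<^sup>2 + 1)"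
  proof -
    have "(\<Sum>w\<in>?W. \<integral>\<^sup>+ z. ennreal ((cmod ((c * ?x w z U2 j + (- \<kappa>) * z (U1, j)) + 1 * z (U2, j)))\<^sup>2) \<partial>noise_space N)
      = (\<Sum>w\<in>?W. ennreal ((cmod c)\<^sup>2) * (\<integral>\<^sup>+ z. ennreal ((cmod (?x w z U2 j))\<^sup>2) \<partial>noise_space N) + ennreal ((cmod \<kappa>)\<^sup>2 + 1))"
      by (intro sum.cong refl eq)
    then show ?thesis unfolding genie_residual_chan_out[OF j] c_def[symmetric]
      by (simp add: sum.distrib sum_distrib_left ennreal_of_nat_eq_real_of_nat del: ennreal_plus)
  qed
  also have "\<dots> \<le> ennreal ((cmod c)\<^sup>2) * ennreal (P * card ?W) + ennreal (card ?W) * ennreal ((cmod \<kappa>)\<^sup>2 + 1)"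
    by (intro add_mono mult_left_mono code_input_power[OF code R P j]) auto
  also have "\<dots> = ennreal (((cmod c)\<^sup>2 * P + 1 + (cmod \<kappa>)\<^sup>2) * card ?W)"
    using P by (simp add: ennreal_mult'[symmetric] ennreal_plus[symmetric] algebra_simps del: ennreal_plus)
  also have "(cmod c)\<^sup>2 * P + 1 + (cmod \<kappa>)\<^sup>2 = 1 + SNR gd P / (1 + INR gc P)"
    unfolding c_def \<kappa>_def by (rule mmse_value[OF P])
  finally show ?thesis by (simp only: \<kappa>_def)
qed

text \<open>Meant for the Chernoff bound on the lower tail: \<open>d / (1 - d)\<close> is the
  optimal exponent for a noise energy below \<open>1 - d\<close> times its mean
  \<open>2 * N\<close>.\<close>

lemma nn_integral_exp_noise_energy:
  assumes "0 < d" "d < 1"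
  shows "(\<integral>\<^sup>+ z. ennreal (exp (d / (1 - d) * (2 * real N * (1 - d) - (\<Sum>p\<in>UNIV \<times> {1..N}. (cmod (z p))\<^sup>2)))) \<partial>noise_space N)
     = ennreal (((1 - d) * exp d) ^ (2 * N))"
proof -
  have c: "card ((UNIV :: user set) \<times> {1..N}) = 2 * N" by (simp add: UNIV_user)
  have l: "- (d / (1 - d)) * (cmod 1)\<^sup>2 < 1" using assms by (simp add: divide_simps)
  have "(\<integral>\<^sup>+ z. ennreal (exp (d / (1 - d) * (2 * real N * (1 - d) - (\<Sum>p\<in>UNIV \<times> {1..N}. (cmod (z p))\<^sup>2)))) \<partial>noise_space N)
    = (\<integral>\<^sup>+ z. (\<Prod>p\<in>UNIV \<times> {1..N}. ennreal (exp d) * ennreal (exp (- (d / (1 - d)) * (cmod (0 + 1 * z p))\<^sup>2))) \<partial>noise_space N)"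
  proof (rule nn_integral_cong)
    fix z :: "user \<times> nat \<Rightarrow> complex"
    have "(\<Prod>p\<in>UNIV \<times> {1..N}. ennreal (exp d) * ennreal (exp (- (d / (1 - d)) * (cmod (0 + 1 * z p))\<^sup>2)))
       = ennreal (exp (\<Sum>p\<in>UNIV \<times> {1..N}. d + - (d / (1 - d)) * (cmod (z p))\<^sup>2))"
      by (simp add: ennreal_mult[symmetric] exp_add[symmetric] prod_ennreal exp_sum[symmetric])
    also have "(\<Sum>p\<in>UNIV \<times> {1..N}. d + - (d / (1 - d)) * (cmod (z p))\<^sup>2)
       = d / (1 - d) * (2 * real N * (1 - d) - (\<Sum>p\<in>UNIV \<times> {1..N}. (cmod (z p))\<^sup>2))"
    proof -
      have "d / (1 - d) * (2 * real N * (1 - d)) = 2 * real N * d" using assms by simp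
      then show ?thesis
        by (simp add: sum.distrib sum_distrib_left[symmetric] sum_negf sum_subtractf c right_diff_distrib del: times_divide_eq_left)
    qed
    finally show "ennreal (exp (d / (1 - d) * (2 * real N * (1 - d) - (\<Sum>p\<in>UNIV \<times> {1..N}. (cmod (z p))\<^sup>2))))
      = (\<Prod>p\<in>UNIV \<times> {1..N}. ennreal (exp d) * ennreal (exp (- (d / (1 - d)) * (cmod (0 + 1 * z p))\<^sup>2)))" by simp
  qed
  also have "\<dots> = (\<Prod>p\<in>(UNIV :: user set) \<times> {1..N}. \<integral>\<^sup>+ x. ennreal (exp d) * ennreal (exp (- (d / (1 - d)) * (cmod (0 + 1 * x))\<^sup>2)) \<partial>std_complex_normal)"
    unfolding noise_space_def by (intro std_complex_normal_prod.product_nn_integral_prod) auto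
  also have "(\<integral>\<^sup>+ x. ennreal (exp d) * ennreal (exp (- (d / (1 - d)) * (cmod (0 + 1 * x))\<^sup>2)) \<partial>std_complex_normal)
      = ennreal (exp d) * ennreal (1 - d)"
  proof -
    have "1 / (1 + d / (1 - d)) = 1 - d" using assms by (simp add: field_simps)
    then show ?thesis
      by (subst nn_integral_cmult, measurable, subst nn_integral_exp_quadratic_std_complex_normal[OF l]) simp
  qed
  finally show ?thesis using assms by (simp add: c ennreal_mult'[symmetric] ennreal_power mult.commute)
qed

text \<open>A change of measure. On correct decoding, the normalised output energy \<open>A\<close>
  is large, or the noise energy \<open>B\<close> is small, or \<open>B - A\<close> is at least
  \<open>- (4 * d * N)\<close>. The last event is rare because under the test density its weight is
  at most \<open>(s * t) ^ N\<close>, shared by \<open>K\<close> message pairs. The mean of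
  \<open>A\<close> is at most \<open>2 * N\<close>, and as nothing but means is known of a code,
  Markov's inequality gives \<open>1 / (1 + d)\<close> for the first event.\<close>

lemma code_correct_probability_le:
  assumes code: "is_code gd gc P F N R f h" and R: "\<And>u. rate R u \<ge> 0" and P: "P \<ge> 0" and N: "N \<ge> 1"
    and d: "0 < d" "d < 1"
  defines "K \<equiv> card (message_pairs N R)"
  shows "1 - error_prob gd gc F N R f h U1 - error_prob gd gc F N R f h U2 \<le>
     1 / (1 + d) + ((1 - d) * exp d) ^ (2 * N)
      + exp (4 * d * N) * ((1 + 2 * SNR gd P + 2 * INR gc P) * (1 + SNR gd P / (1 + INR gc P))) ^ N / K"
proof -
  let ?W = "message_pairs N R" and ?Z = "noise_space N"
  define s where "s = 1 + 2 * SNR gd P + 2 * INR gc P"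
  define t where "t = 1 + SNR gd P / (1 + INR gc P)"
  define \<kappa> where "\<kappa> = mmse_coeff gd gc P"
  have SI: "SNR gd P \<ge> 0" "INR gc P \<ge> 0" using P by (auto simp: SNR_def INR_def)
  have st: "s > 0" "t > 0" using SI by (auto simp: s_def t_def intro!: add_pos_nonneg)
  have f: "measurable_encoder N R f" and h: "measurable_decoder N h" using code by (simp_all add: is_code_def)
  have K: "K > 0" using message_pairs_nonempty[OF R] by (simp add: card_gt_0_iff K_def)
  define y where "y = (\<lambda>w z. \<lambda>p\<in>UNIV \<times> {1..N}. chan_out gd gc F f w z (fst p) (snd p))"
  define V where "V = (\<lambda>w z j. genie_residual gd gc \<kappa> F f (w U1) (y w z) j)"
  define A where "A = (\<lambda>w z. (\<Sum>j=1..N. (cmod (y w z (U1, j)))\<^sup>2 / s) + (\<Sum>j=1..N. (cmod (V w z j))\<^sup>2 / t))"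
  define B where "B = (\<lambda>z :: user \<times> nat \<Rightarrow> complex. \<Sum>p\<in>UNIV \<times> {1..N}. (cmod (z p))\<^sup>2)"
  define corr where "corr = (\<lambda>w z. \<forall>u. h u (\<lambda>j\<in>{1..N}. chan_out gd gc F f w z u j) = w u)"
  define td where "td = test_density gd gc \<kappa> F f s t N"
  have ym: "y w \<in> measurable ?Z (PiM (UNIV \<times> {1..N}) (\<lambda>_. borel))" if "w \<in> ?W" for w
    unfolding y_def using measurable_chan_out[OF f that order_refl] by (intro measurable_restrict) auto
  have wm: "w U1 \<in> messages N (rate R U1)" if "w \<in> ?W" for w using that by (simp add: message_pairs_def)
  have Ym: "(\<lambda>z. y w z (U1, j)) \<in> borel_measurable ?Z" if "w \<in> ?W" "j \<in> {1..N}" for w j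
    using measurable_compose[OF ym[OF that(1)] measurable_component_borel] that by simp
  have Vm: "(\<lambda>z. V w z j) \<in> borel_measurable ?Z" if "w \<in> ?W" "j \<in> {1..N}" for w j
    unfolding V_def using measurable_compose[OF ym[OF that(1)] measurable_genie_residual[OF f that(2) wm[OF that(1)]]] .
  have Am: "(\<lambda>z. A w z) \<in> borel_measurable ?Z" if w: "w \<in> ?W" for w
  proof -
    have "(\<lambda>z. (cmod (y w z (U1, j)))\<^sup>2 / s) \<in> borel_measurable ?Z" "(\<lambda>z. (cmod (V w z j))\<^sup>2 / t) \<in> borel_measurable ?Z" if "j \<in> {1..N}" for j
      using Ym[OF w that] Vm[OF w that] by measurable
    then show ?thesis unfolding A_def by (intro borel_measurable_add borel_measurable_sum) auto
  qed
  have A0: "A w z \<ge> 0" for w z using st by (auto simp: A_def intro!: add_nonneg_nonneg sum_nonneg)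
  have Bm: "B \<in> borel_measurable ?Z"
  proof -
    have "(\<lambda>z. (cmod (z p))\<^sup>2) \<in> borel_measurable ?Z" if "p \<in> UNIV \<times> {1..N}" for p
      using measurable_noise_component[of "snd p" N "fst p"] that by auto
    then show ?thesis unfolding B_def by (intro borel_measurable_sum)
  qed
  have corr_y: "corr w z \<longleftrightarrow> (\<forall>u. h u (\<lambda>j\<in>{1..N}. y w z (u, j)) = w u)" for w z
  proof -
    have "(\<lambda>j\<in>{1..N}. y w z (u, j)) = (\<lambda>j\<in>{1..N}. chan_out gd gc F f w z u j)" for u
      by (auto simp: y_def restrict_def)
    then show ?thesis by (simp add: corr_def)
  qed
  have corr_m: "Measurable.pred ?Z (corr w)" if w: "w \<in> ?W" for w
    unfolding corr_def all_user using pred_decoding[OF f h w] by (intro pred_intros_logic)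
  have corr_m': "(\<lambda>z. of_bool (corr w z) :: ennreal) \<in> borel_measurable ?Z" if w: "w \<in> ?W" for w
    using corr_m[OF w] by (rule borel_measurable_of_bool)
  have ind: "(\<lambda>y. of_bool (\<forall>u. h u (\<lambda>j\<in>{1..N}. y (u, j)) = w u) * td (w U1) y) \<in> borel_measurable (PiM (UNIV \<times> {1..N}) (\<lambda>_. borel))"
    if w: "w \<in> ?W" for w
  proof -
    have "Measurable.pred (PiM (UNIV \<times> {1..N}) (\<lambda>_. borel)) (\<lambda>y. \<forall>u. h u (\<lambda>j\<in>{1..N}. y (u, j)) = w u)"
      unfolding all_user using measurable_decoder_output[OF h] by (intro pred_intros_logic)
    then show ?thesis unfolding td_def
      by (intro borel_measurable_times_ennreal measurable_test_density[OF f wm[OF w]] borel_measurable_of_bool)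
  qed

  \<comment> \<open>\<open>exp (B - A)\<close> is the ratio of the test density to the noise
    density, since both carry the factor \<open>1 / pi\<close> to the power
    \<open>2 * N\<close>.\<close>
  have tilt: "of_bool (corr w z) * ennreal (exp (B z - A w z))
      = (of_bool (\<forall>u. h u (\<lambda>j\<in>{1..N}. y w z (u, j)) = w u) * td (w U1) (y w z)) * (\<Prod>p\<in>UNIV \<times> {1..N}. ennreal (pi * exp ((cmod (z p))\<^sup>2)))" for w z
  proof -
    have c: "card ((UNIV :: user set) \<times> {1..N}) = N + N" by simp
    have 1: "(\<Prod>p\<in>UNIV \<times> {1..N}. ennreal (pi * exp ((cmod (z p))\<^sup>2))) = ennreal (pi ^ (N + N) * exp (B z))"
      by (simp add: prod_ennreal prod.distrib exp_sum[symmetric] B_def mult_2)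
    have 2: "td (w U1) (y w z) = ennreal (exp (- A w z) / pi ^ (N + N))"
      unfolding td_def test_density_def
      by (simp add: V_def prod_ennreal prod_dividef exp_sum[symmetric] ennreal_mult[symmetric] prod_nonneg A_def sum_negf exp_add[symmetric] power_add)
    show ?thesis unfolding 1 2 corr_y[symmetric]
      by (simp add: mult.assoc ennreal_mult[symmetric] exp_diff exp_minus divide_inverse)
  qed
  have third: "(\<Sum>w\<in>?W. \<integral>\<^sup>+ z. of_bool (corr w z) * ennreal (exp (B z - A w z)) \<partial>?Z) \<le> ennreal ((s * t) ^ N)"
  proof -
    have "(\<integral>\<^sup>+ z. of_bool (corr w z) * ennreal (exp (B z - A w z)) \<partial>?Z)
       = (\<integral>\<^sup>+ y. of_bool (\<forall>u. h u (\<lambda>j\<in>{1..N}. y (u, j)) = w u) * td (w U1) y \<partial>PiM (UNIV \<times> {1..N}) (\<lambda>_. lborel))" if w: "w \<in> ?W" for w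
      unfolding tilt y_def by (rule nn_integral_channel_outputs[OF f w order_refl ind[OF w]])
    then have "(\<Sum>w\<in>?W. \<integral>\<^sup>+ z. of_bool (corr w z) * ennreal (exp (B z - A w z)) \<partial>?Z)
      = (\<Sum>w\<in>?W. \<integral>\<^sup>+ y. of_bool (\<forall>u. h u (\<lambda>j\<in>{1..N}. y (u, j)) = w u) * td (w U1) y \<partial>PiM (UNIV \<times> {1..N}) (\<lambda>_. lborel))"
      by (intro sum.cong refl)
    also have "\<dots> \<le> ennreal ((s * t) ^ N)"
      unfolding td_def by (rule nn_integral_test_density_le[OF f h st])
    finally show ?thesis .
  qed
  have first: "(\<Sum>w\<in>?W. \<integral>\<^sup>+ z. ennreal (A w z) \<partial>?Z) \<le> ennreal (2 * N * K)"
  proof -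
    have yo: "y w z (U1, j) = chan_out gd gc F f w z U1 j" if "j \<in> {1..N}" for w z j using that by (simp add: y_def)
    have "(\<integral>\<^sup>+ z. ennreal (A w z) \<partial>?Z) = (\<Sum>j=1..N. ennreal (1 / s) * (\<integral>\<^sup>+ z. ennreal ((cmod (chan_out gd gc F f w z U1 j))\<^sup>2) \<partial>?Z))
       + (\<Sum>j=1..N. ennreal (1 / t) * (\<integral>\<^sup>+ z. ennreal ((cmod (V w z j))\<^sup>2) \<partial>?Z))" if w: "w \<in> ?W" for w
    proof -
      have [measurable]: "j \<in> {1..N} \<Longrightarrow> (\<lambda>z. chan_out gd gc F f w z U1 j) \<in> borel_measurable ?Z" for j
        using measurable_chan_out[OF f w order_refl] .
      have [measurable]: "j \<in> {1..N} \<Longrightarrow> (\<lambda>z. V w z j) \<in> borel_measurable ?Z" for j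
        using Vm[OF w] .
      have m1: "(\<lambda>z. ennreal ((cmod (chan_out gd gc F f w z U1 j))\<^sup>2)) \<in> borel_measurable ?Z"
        and m2: "(\<lambda>z. ennreal ((cmod (V w z j))\<^sup>2)) \<in> borel_measurable ?Z" if [measurable]: "j \<in> {1..N}" for j
        by measurable
      have "(\<integral>\<^sup>+ z. ennreal (A w z) \<partial>?Z) = (\<integral>\<^sup>+ z. (\<Sum>j=1..N. ennreal (1 / s) * ennreal ((cmod (chan_out gd gc F f w z U1 j))\<^sup>2))
        + (\<Sum>j=1..N. ennreal (1 / t) * ennreal ((cmod (V w z j))\<^sup>2)) \<partial>?Z)"
        unfolding A_def using st
        by (intro nn_integral_cong)
          (simp only: yo ennreal_mult'[symmetric] sum_ennreal divide_nonneg_nonneg zero_le_power2 zero_le_one less_imp_le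
            mult_nonneg_nonneg sum_nonneg ennreal_plus mult_1 times_divide_eq_left cong: sum.cong)
      also have "\<dots> = (\<integral>\<^sup>+ z. (\<Sum>j=1..N. ennreal (1 / s) * ennreal ((cmod (chan_out gd gc F f w z U1 j))\<^sup>2)) \<partial>?Z)
        + (\<integral>\<^sup>+ z. (\<Sum>j=1..N. ennreal (1 / t) * ennreal ((cmod (V w z j))\<^sup>2)) \<partial>?Z)"
        by (intro nn_integral_add borel_measurable_sum borel_measurable_times_ennreal borel_measurable_const m1 m2)
      also have "\<dots> = (\<Sum>j=1..N. \<integral>\<^sup>+ z. ennreal (1 / s) * ennreal ((cmod (chan_out gd gc F f w z U1 j))\<^sup>2) \<partial>?Z)
        + (\<Sum>j=1..N. \<integral>\<^sup>+ z. ennreal (1 / t) * ennreal ((cmod (V w z j))\<^sup>2) \<partial>?Z)"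
        by (intro arg_cong2[where f="(+)"] nn_integral_sum borel_measurable_times_ennreal borel_measurable_const m1 m2)
      finally show ?thesis
        using m1 m2 by (simp add: nn_integral_cmult)
    qed
    then have "(\<Sum>w\<in>?W. \<integral>\<^sup>+ z. ennreal (A w z) \<partial>?Z)
      = (\<Sum>j=1..N. ennreal (1 / s) * (\<Sum>w\<in>?W. \<integral>\<^sup>+ z. ennreal ((cmod (chan_out gd gc F f w z U1 j))\<^sup>2) \<partial>?Z))
       + (\<Sum>j=1..N. ennreal (1 / t) * (\<Sum>w\<in>?W. \<integral>\<^sup>+ z. ennreal ((cmod (V w z j))\<^sup>2) \<partial>?Z))"
      by (simp add: sum.distrib sum_distrib_left) (intro arg_cong2[where f="(+)"] sum.swap)
    also have "\<dots> \<le> (\<Sum>j=1..N. ennreal (1 / s) * ennreal (s * K)) + (\<Sum>j=1..N. ennreal (1 / t) * ennreal (t * K))"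
      unfolding V_def y_def \<kappa>_def s_def t_def K_def
      by (intro add_mono sum_mono mult_left_mono code_output_power[OF code R P] code_residual_power[OF code R P]) auto
    also have "\<dots> = (\<Sum>j=1..N. ennreal K) + (\<Sum>j=1..N. ennreal K)"
      using st by (simp add: ennreal_mult'[symmetric])
    also have "\<dots> = ennreal (2 * N * K)"
      by (simp add: ennreal_of_nat_eq_real_of_nat ennreal_mult''[symmetric] ennreal_plus[symmetric] del: ennreal_plus)
    finally show ?thesis .
  qed
  have ptw: "of_bool (corr w z) \<le> ennreal (1 / (2 * N * (1 + d))) * ennreal (A w z)
      + ennreal (exp (d / (1 - d) * (2 * real N * (1 - d) - B z)))
      + ennreal (exp (4 * d * N)) * (of_bool (corr w z) * ennreal (exp (B z - A w z)))" (is "_ \<le> ?T1 + ?T2 + ?T3") for w z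
  proof (cases "corr w z")
    case True
    consider "A w z \<ge> 2 * N * (1 + d)" | "B z \<le> 2 * N * (1 - d)" | "A w z < 2 * N * (1 + d)" "B z > 2 * N * (1 - d)" by linarith
    then show ?thesis
    proof cases
      case 1
      have "1 \<le> ennreal (1 / (2 * N * (1 + d)) * A w z)"
      proof -
        have "2 * N * (1 + d) > 0" using N d by simp
        then have "1 \<le> A w z / (2 * N * (1 + d))" using 1 by (simp add: pos_le_divide_eq)
        then show ?thesis by simp
      qed
      then have "1 \<le> ?T1" using A0 d by (subst (asm) ennreal_mult) auto
      then show ?thesis by (auto simp: True add.assoc add_increasing2)
    next
      case 2
      have "0 \<le> d / (1 - d) * (2 * real N * (1 - d) - B z)" using 2 d by (intro mult_nonneg_nonneg) auto
      then have "1 \<le> ?T2" by simp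
      then have "1 \<le> ?T1 + ?T2" by (simp add: add_increasing)
      then show ?thesis by (auto simp: True add_increasing2)
    next
      case 3
      then have "A w z - B z \<le> 4 * d * N" by (simp add: algebra_simps)
      then have "1 \<le> ?T3" by (simp add: True ennreal_mult[symmetric] exp_add[symmetric])
      then show ?thesis by (auto simp: True add_increasing)
    qed
  qed simp
  have "(\<Sum>w\<in>?W. \<integral>\<^sup>+ z. of_bool (corr w z) \<partial>?Z) \<le> (\<Sum>w\<in>?W. \<integral>\<^sup>+ z. ennreal (1 / (2 * N * (1 + d))) * ennreal (A w z)
      + ennreal (exp (d / (1 - d) * (2 * real N * (1 - d) - B z)))
      + ennreal (exp (4 * d * N)) * (of_bool (corr w z) * ennreal (exp (B z - A w z))) \<partial>?Z)"
    by (intro sum_mono nn_integral_mono ptw)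
  also have "\<dots> = (\<Sum>w\<in>?W. ennreal (1 / (2 * N * (1 + d))) * (\<integral>\<^sup>+ z. ennreal (A w z) \<partial>?Z)
      + (\<integral>\<^sup>+ z. ennreal (exp (d / (1 - d) * (2 * real N * (1 - d) - B z))) \<partial>?Z)
      + ennreal (exp (4 * d * N)) * (\<integral>\<^sup>+ z. of_bool (corr w z) * ennreal (exp (B z - A w z)) \<partial>?Z))"
  proof (rule sum.cong[OF refl])
    fix w assume w: "w \<in> ?W"
    note [measurable] = Am[OF w] Bm corr_m'[OF w]
    show "(\<integral>\<^sup>+ z. ennreal (1 / (2 * N * (1 + d))) * ennreal (A w z)
      + ennreal (exp (d / (1 - d) * (2 * real N * (1 - d) - B z)))
      + ennreal (exp (4 * d * N)) * (of_bool (corr w z) * ennreal (exp (B z - A w z))) \<partial>?Z) =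
      ennreal (1 / (2 * N * (1 + d))) * (\<integral>\<^sup>+ z. ennreal (A w z) \<partial>?Z)
      + (\<integral>\<^sup>+ z. ennreal (exp (d / (1 - d) * (2 * real N * (1 - d) - B z))) \<partial>?Z)
      + ennreal (exp (4 * d * N)) * (\<integral>\<^sup>+ z. of_bool (corr w z) * ennreal (exp (B z - A w z)) \<partial>?Z)"
      by (subst nn_integral_add, measurable)+ (subst nn_integral_cmult, measurable)+
  qed
  also have "\<dots> = ennreal (1 / (2 * N * (1 + d))) * (\<Sum>w\<in>?W. \<integral>\<^sup>+ z. ennreal (A w z) \<partial>?Z)
      + ennreal K * ennreal (((1 - d) * exp d) ^ (2 * N))
      + ennreal (exp (4 * d * N)) * (\<Sum>w\<in>?W. \<integral>\<^sup>+ z. of_bool (corr w z) * ennreal (exp (B z - A w z)) \<partial>?Z)"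
    unfolding B_def nn_integral_exp_noise_energy[OF d]
    by (simp add: sum.distrib sum_distrib_left K_def ennreal_of_nat_eq_real_of_nat)
  also have "\<dots> \<le> ennreal (1 / (2 * N * (1 + d))) * ennreal (2 * N * K)
      + ennreal K * ennreal (((1 - d) * exp d) ^ (2 * N)) + ennreal (exp (4 * d * N)) * ennreal ((s * t) ^ N)"
    by (intro add_mono mult_left_mono first third order_refl) auto
  also have "\<dots> = ennreal (K * (1 / (1 + d) + ((1 - d) * exp d) ^ (2 * N) + exp (4 * d * N) * (s * t) ^ N / K))"
  proof -
    have 1: "ennreal (1 / (2 * N * (1 + d))) * ennreal (2 * N * K) = ennreal (K * (1 / (1 + d)))"
    proof -
      have "1 / (2 * N * (1 + d)) * (2 * N * K) = K * (1 / (1 + d))" using N by simp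
      then show ?thesis by (subst ennreal_mult''[symmetric]) auto
    qed
    have 2: "ennreal K * ennreal (((1 - d) * exp d) ^ (2 * N)) = ennreal (K * ((1 - d) * exp d) ^ (2 * N))"
      by (simp add: ennreal_mult')
    have 3: "ennreal (exp (4 * d * N)) * ennreal ((s * t) ^ N) = ennreal (K * (exp (4 * d * N) * (s * t) ^ N / K))"
      using K st by (simp add: ennreal_mult')
    show ?thesis unfolding 1 2 3 using d st
      by (simp add: ennreal_plus[symmetric] distrib_left del: ennreal_plus)
  qed
  finally have le: "(\<Sum>w\<in>?W. \<integral>\<^sup>+ z. of_bool (corr w z) \<partial>?Z) \<le> ennreal (K * (1 / (1 + d) + ((1 - d) * exp d) ^ (2 * N) + exp (4 * d * N) * (s * t) ^ N / K))" .
  let ?e = "\<lambda>w u. measure ?Z {z \<in> space ?Z. h u (\<lambda>j\<in>{1..N}. chan_out gd gc F f w z u j) \<noteq> w u}"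
  have ge: "(\<integral>\<^sup>+ z. of_bool (corr w z) \<partial>?Z) \<ge> ennreal (1 - ?e w U1 - ?e w U2)" if w: "w \<in> ?W" for w
  proof -
    have S: "{z \<in> space ?Z. corr w z} \<in> sets ?Z" using corr_m[OF w] by (simp add: pred_def)
    have E: "{z \<in> space ?Z. h u (\<lambda>j\<in>{1..N}. chan_out gd gc F f w z u j) \<noteq> w u} \<in> sets ?Z" for u
      using pred_intros_logic(2)[OF pred_decoding[OF f h w, of u gd gc F "w u"]] by (simp add: pred_def)
    have "space ?Z \<subseteq> {z \<in> space ?Z. corr w z} \<union> ({z \<in> space ?Z. h U1 (\<lambda>j\<in>{1..N}. chan_out gd gc F f w z U1 j) \<noteq> w U1} \<union>
        {z \<in> space ?Z. h U2 (\<lambda>j\<in>{1..N}. chan_out gd gc F f w z U2 j) \<noteq> w U2})"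
      by (auto simp: corr_def all_user)
    then have "measure ?Z (space ?Z) \<le> measure ?Z ({z \<in> space ?Z. corr w z} \<union> ({z \<in> space ?Z. h U1 (\<lambda>j\<in>{1..N}. chan_out gd gc F f w z U1 j) \<noteq> w U1} \<union>
        {z \<in> space ?Z. h U2 (\<lambda>j\<in>{1..N}. chan_out gd gc F f w z U2 j) \<noteq> w U2}))"
      using S E by (intro noise.finite_measure_mono) auto
    also have "\<dots> \<le> measure ?Z {z \<in> space ?Z. corr w z} + (?e w U1 + ?e w U2)"
      using S E by (intro order_trans[OF measure_Un_le] add_left_mono measure_Un_le) auto
    finally have "1 - ?e w U1 - ?e w U2 \<le> measure ?Z {z \<in> space ?Z. corr w z}"
      by (simp add: noise.prob_space)
    also have "ennreal (measure ?Z {z \<in> space ?Z. corr w z}) = (\<integral>\<^sup>+ z. indicator {z \<in> space ?Z. corr w z} z \<partial>?Z)"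
      using S by (simp add: noise.emeasure_eq_measure)
    also have "\<dots> = (\<integral>\<^sup>+ z. of_bool (corr w z) \<partial>?Z)"
      by (intro nn_integral_cong) (simp add: indicator_def)
    finally show ?thesis by (simp add: ennreal_leI)
  qed
  have "1 - error_prob gd gc F N R f h U1 - error_prob gd gc F N R f h U2 = (\<Sum>w\<in>?W. 1 - ?e w U1 - ?e w U2) / K"
    unfolding error_prob_eq[OF f h R] K_def[symmetric] using K
    by (simp add: sum_subtractf K_def[symmetric] diff_divide_distrib)
  also have "\<dots> \<le> 1 / (1 + d) + ((1 - d) * exp d) ^ (2 * N) + exp (4 * d * N) * (s * t) ^ N / K"
  proof -
    have "ennreal (\<Sum>w\<in>?W. 1 - ?e w U1 - ?e w U2) \<le> ennreal (\<Sum>w\<in>?W. max 0 (1 - ?e w U1 - ?e w U2))"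
      by (intro ennreal_leI sum_mono) auto
    also have "\<dots> = (\<Sum>w\<in>?W. ennreal (1 - ?e w U1 - ?e w U2))"
      by (simp add: sum_ennreal[symmetric])
    also have "\<dots> \<le> (\<Sum>w\<in>?W. \<integral>\<^sup>+ z. of_bool (corr w z) \<partial>?Z)" by (intro sum_mono ge)
    also note le
    finally have "(\<Sum>w\<in>?W. 1 - ?e w U1 - ?e w U2) \<le> K * (1 / (1 + d) + ((1 - d) * exp d) ^ (2 * N) + exp (4 * d * N) * (s * t) ^ N / K)"
      by (subst (asm) ennreal_le_iff) (use d st in \<open>auto intro!: mult_nonneg_nonneg add_nonneg_nonneg\<close>)
    then show ?thesis using K by (simp add: pos_divide_le_eq mult.commute)
  qed
  finally show ?thesis by (simp add: s_def t_def)
qed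

text \<open>Rounding down a number that is at least 1 loses at most a factor 2.\<close>

lemma card_messages_ge:
  assumes "r \<ge> 0"
  shows "real (card (messages N r)) \<ge> 2 powr (real N * r) / 2"
proof -
  define x where "x = 2 powr (real N * r)"
  have x: "x \<ge> 1" using assms by (simp add: x_def ge_one_powr_ge_zero)
  then have "real (card (messages N r)) = real_of_int \<lfloor>x\<rfloor>" by (simp add: messages_def x_def)
  moreover have "real_of_int \<lfloor>x\<rfloor> \<ge> 1" using x by simp
  moreover have "x < real_of_int \<lfloor>x\<rfloor> + 1" by linarith
  ultimately show ?thesis unfolding x_def[symmetric] by linarith
qed

lemma one_minus_times_exp_less_1:
  assumes "0 < d" "d < (1 :: real)"
  shows "(1 - d) * exp d < 1"
proof -
  have "1 - d < exp (- d)" using exp_minus_greater assms by blast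
  then show ?thesis by (simp add: exp_minus field_simps)
qed

definition sum_rate_bound :: "complex \<Rightarrow> complex \<Rightarrow> real \<Rightarrow> real" where
  "sum_rate_bound gd gc P = (1 + 2 * SNR gd P + 2 * INR gc P) * (1 + SNR gd P / (1 + INR gc P))"

text \<open>A sum rate above the bound makes the number of message pairs outgrow the mass of the
  test density by a factor of order \<open>exp (g * N)\<close>. Since \<open>4 * d < g\<close>, the
  third term of \<open>code_correct_probability_le\<close> vanishes, and the limit would be
  \<open>1 \<le> 1 / (1 + d)\<close>.\<close>

lemma achievable_sum_rate_le:
  assumes ach: "achievable gd gc P F R" and P: "P \<ge> 0"
  shows "rate R U1 + rate R U2 \<le> log 2 (sum_rate_bound gd gc P)"
proof (rule ccontr)
  define c where "c = sum_rate_bound gd gc P"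
  define r where "r = rate R U1 + rate R U2"
  assume "\<not> ?thesis"
  then have gt: "r > log 2 c" by (simp add: c_def r_def)
  have SI: "SNR gd P \<ge> 0" "INR gc P \<ge> 0" using P by (auto simp: SNR_def INR_def)
  have c: "c > 0" using SI by (auto simp: c_def sum_rate_bound_def intro!: mult_pos_pos add_pos_nonneg)
  define g where "g = (r - log 2 c) * ln 2"
  have g: "g > 0" using gt by (simp add: g_def)
  define d where "d = min (1 / 2) (g / 8)"
  have d: "0 < d" "d < 1" "4 * d < g" using g by (auto simp: d_def min_def)
  have R: "rate R u \<ge> 0" for u using ach by (simp add: achievable_def)
  obtain f h where code: "\<And>N. N \<ge> 1 \<Longrightarrow> is_code gd gc P F N R (f N) (h N)"
    and err: "\<And>u. (\<lambda>N. error_prob gd gc F N R (f N) (h N) u) \<longlonglongrightarrow> 0"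
    using ach by (auto simp: achievable_def)
  define q where "q = exp (4 * d - g)"
  have term3: "exp (4 * d * N) * c ^ N / card (message_pairs N R) \<le> 4 * q ^ N" for N :: nat
  proof -
    have K: "real (card (message_pairs N R)) \<ge> 2 powr (real N * r) / 4"
    proof -
      have "2 powr (real N * rate R U1) / 2 * (2 powr (real N * rate R U2) / 2)
        \<le> real (card (messages N (rate R U1))) * real (card (messages N (rate R U2)))"
        by (intro mult_mono card_messages_ge R) auto
      then show ?thesis by (simp add: card_message_pairs r_def distrib_left powr_add)
    qed
    have cN: "c ^ N = exp (real N * ln c)" using c by (simp add: exp_of_nat_mult)
    have "exp (4 * d * N) * c ^ N / card (message_pairs N R) \<le> exp (4 * d * N) * c ^ N / (2 powr (real N * r) / 4)"
    proof -
      have "card (message_pairs N R) > 0" using message_pairs_nonempty[OF R] by (simp add: card_gt_0_iff)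
      then show ?thesis using K c by (intro divide_left_mono mult_nonneg_nonneg mult_pos_pos) auto
    qed
    also have "\<dots> = 4 * exp (4 * d * N + real N * ln c - real N * r * ln 2)"
      by (simp add: cN powr_def exp_add exp_diff)
    also have "4 * d * N + real N * ln c - real N * r * ln 2 = real N * (4 * d - g)"
      by (simp add: g_def log_def algebra_simps)
    finally show ?thesis by (simp add: q_def exp_of_nat_mult)
  qed
  have le: "1 - error_prob gd gc F N R (f N) (h N) U1 - error_prob gd gc F N R (f N) (h N) U2
     \<le> 1 / (1 + d) + (((1 - d) * exp d)\<^sup>2) ^ N + 4 * q ^ N" if "N \<ge> 1" for N
    using code_correct_probability_le[OF code[OF that] R P that d(1,2)] term3[of N]
    by (simp add: sum_rate_bound_def[symmetric] c_def[symmetric] power_mult)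
  have q: "0 \<le> q" "q < 1" using d by (auto simp: q_def)
  have p0: "((1 - d) * exp d)\<^sup>2 < 1"
    using one_minus_times_exp_less_1[OF d(1,2)] d by (simp add: power_less_one_iff abs_square_less_1)
  have lim1: "(\<lambda>N. 1 / (1 + d) + (((1 - d) * exp d)\<^sup>2) ^ N + 4 * q ^ N) \<longlonglongrightarrow> 1 / (1 + d) + 0 + 4 * 0"
    by (intro tendsto_intros LIMSEQ_power_zero) (use p0 q in auto)
  have lim2: "(\<lambda>N. 1 - error_prob gd gc F N R (f N) (h N) U1 - error_prob gd gc F N R (f N) (h N) U2) \<longlonglongrightarrow> 1 - 0 - 0"
    by (intro tendsto_intros err)
  have "1 - 0 - 0 \<le> 1 / (1 + d) + 0 + 4 * (0 :: real)"
    using le by (intro LIMSEQ_le[OF lim2 lim1]) blast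
  then show False using d by simp
qed

section \<open>Block Markov codes\<close>

lemma other_simps [simp]: "other u \<noteq> u" "u \<noteq> other u" "other (other u) = u"
  by (cases u; simp)+

lemma user_eq_other: "u \<noteq> v \<Longrightarrow> u = other v"
  by (cases u; cases v) auto

text \<open>The event controlled by \<open>random_coding_bound\<close>. It forces
  \<open>threshold_decode\<close> to return \<open>i\<close>, and unlike the decoder it is a plain
  conjunction of score conditions.\<close>

definition decodes_to :: "nat \<Rightarrow> real \<Rightarrow> complex \<Rightarrow> real \<Rightarrow> nat \<Rightarrow> (nat \<Rightarrow> nat \<Rightarrow> complex) \<Rightarrow> (nat \<Rightarrow> complex) \<Rightarrow> nat \<Rightarrow> bool" where
  "decodes_to n e h v M X Y i \<longleftrightarrow> score n h v Y (X i) \<ge> - (2 * e * n) \<and>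
     (\<forall>i'\<in>{1..M} - {i}. score n h v Y (X i') < - (2 * e * n))"

text \<open>The disjunct \<open>i = M\<close> is a default: the least index exists even if no score
  passes, and the estimate is always a valid index, which limits what a misled relay can
  transmit.\<close>

definition threshold_decode :: "nat \<Rightarrow> real \<Rightarrow> complex \<Rightarrow> real \<Rightarrow> nat \<Rightarrow> (nat \<Rightarrow> nat \<Rightarrow> complex) \<Rightarrow> (nat \<Rightarrow> complex) \<Rightarrow> nat" where
  "threshold_decode n e h v M X Y = (LEAST i. 1 \<le> i \<and> (i = M \<or> score n h v Y (X i) \<ge> - (2 * e * n)))"

lemma score_cong: "(\<And>p. p < n \<Longrightarrow> Y p = Y' p) \<Longrightarrow> score n h v Y X = score n h v Y' X"
  by (simp add: score_def)

lemma threshold_decode_cong: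
  "(\<And>p. p < n \<Longrightarrow> Y p = Y' p) \<Longrightarrow> threshold_decode n e h v M X Y = threshold_decode n e h v M X Y'"
  unfolding threshold_decode_def using score_cong[of n Y Y'] by simp

lemma threshold_decode_eq:
  assumes "decodes_to n e h v M X Y i" "i \<in> {1..M}"
  shows "threshold_decode n e h v M X Y = i"
  unfolding threshold_decode_def
proof (rule Least_equality)
  fix i' assume i': "1 \<le> i' \<and> (i' = M \<or> score n h v Y (X i') \<ge> - (2 * e * n))"
  show "i \<le> i'"
  proof (rule ccontr)
    assume "\<not> i \<le> i'"
    then have *: "i' \<in> {1..M} - {i}" "i' \<noteq> M" using i' assms(2) by auto
    then have "score n h v Y (X i') < - (2 * e * n)" using assms(1) unfolding decodes_to_def by blast
    then show False using i' *(2) by auto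
  qed
qed (use assms in \<open>auto simp: decodes_to_def\<close>)

lemma threshold_decode_bounds:
  assumes "M \<ge> 1" shows "threshold_decode n e h v M X Y \<in> {1..M}"
proof -
  let ?P = "\<lambda>i. 1 \<le> i \<and> (i = M \<or> score n h v Y (X i) \<ge> - (2 * e * n))"
  have "?P M" using assms by simp
  then have "?P (LEAST i. ?P i)" "(LEAST i. ?P i) \<le> M" by (rule LeastI, rule Least_le)
  then show ?thesis by (simp add: threshold_decode_def)
qed

lemma digits_expansion:
  assumes "x < Q ^ D" shows "(\<Sum>b<D. (x div Q ^ b mod Q) * Q ^ b) = (x :: nat)"
proof -
  have "(\<Sum>b<D. (x div Q ^ b mod Q) * Q ^ b) = x mod Q ^ D"
  proof (induction D)
    case (Suc D)
    have "x mod Q ^ Suc D = Q ^ D * (x div Q ^ D mod Q) + x mod Q ^ D"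
      by (metis mod_mult2_eq power_Suc2)
    then show ?case using Suc by simp
  qed simp
  then show ?thesis using assms by simp
qed

type_synonym codeword_id = "bool \<times> user \<times> nat"

text \<open>Block Markov coding with relay transmitter \<open>r\<close>, which hears receiver \<open>k\<close>, and source transmitter
  \<open>other r\<close>.  In block \<open>b < B\<close> the source sends the fresh common index \<open>b + 1\<close> (amplitude \<open>al\<close>)
  and a private index (amplitude \<open>be\<close>), while the relay repeats the common index \<open>b\<close>, as decoded from
  the feedback, on top of its own private index.  Codeword id \<open>(True, u, i)\<close> is the \<open>i\<close>-th common
  codeword of transmitter \<open>u\<close>, and \<open>(False, u, i)\<close> the \<open>i\<close>-th private one; index \<open>0\<close> stands for silence.
  Receiver \<open>d\<close> decodes the common indices forwards from the source's codewords if \<open>fw d\<close>, otherwise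
  backwards from the relay's codewords.\<close>

locale block_markov =
  fixes gd gc :: complex and F :: feedback and r k :: user and n B A :: nat and C :: "user \<Rightarrow> nat"
    and al be :: "user \<Rightarrow> real" and e :: real and fw :: "user \<Rightarrow> bool"
  assumes link: "F k r" and n: "n \<ge> 1" and B: "B \<ge> 1" and A: "A \<ge> 1" and C: "\<And>u. C u \<ge> 1" and e: "0 < e" "e < 1"
begin

abbreviation "s \<equiv> other r"

definition gain :: "user \<Rightarrow> user \<Rightarrow> complex" where
  "gain d t = (if d = t then gd else gc)"

text \<open>Fresh indices are sent in \<open>D\<close> blocks; the last block leaves room for the
  relay to repeat the final common index.\<close>

definition D :: nat where "D = B - 1"

text \<open>Only the source splits its message; that of the relay is entirely private, hence the
  trivial factor 1.\<close>

definition common_size :: "user \<Rightarrow> nat" where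
  "common_size u = (if u = s then A else 1)"

definition base :: "user \<Rightarrow> nat" where
  "base u = common_size u * C u"

text \<open>\<open>m - 1\<close> is read in base \<open>base s\<close>, one digit per block; within
  a digit the residue modulo \<open>A\<close> is common and the quotient private. \<open>Suc\<close>
  keeps index 0 free for silence.\<close>

definition common_index :: "nat \<Rightarrow> nat \<Rightarrow> nat" where
  "common_index m b = (if 1 \<le> b \<and> b \<le> D then Suc ((m - 1) div base s ^ (b - 1) mod A) else 0)"

definition private_index :: "user \<Rightarrow> nat \<Rightarrow> nat \<Rightarrow> nat" where
  "private_index u m b = (if b < D then Suc ((m - 1) div (base u ^ b * common_size u) mod C u) else 0)"

definition cw :: "(nat \<Rightarrow> codeword_id \<Rightarrow> complex) \<Rightarrow> bool \<Rightarrow> user \<Rightarrow> nat \<Rightarrow> nat \<Rightarrow> complex" where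
  "cw \<theta> c u i p = (if i = 0 then 0 else \<theta> p (c, u, i))"

definition signal :: "(nat \<Rightarrow> codeword_id \<Rightarrow> complex) \<Rightarrow> user \<Rightarrow> nat \<Rightarrow> nat \<Rightarrow> nat \<Rightarrow> complex" where
  "signal \<theta> u i j p = al u * cw \<theta> True u i p + be u * cw \<theta> False u j p"

definition decode :: "complex \<Rightarrow> real \<Rightarrow> nat \<Rightarrow> (nat \<Rightarrow> nat \<Rightarrow> complex) \<Rightarrow> (nat \<Rightarrow> complex) \<Rightarrow> nat" where
  "decode = threshold_decode n e"

text \<open>The noise levels of the three kinds of decoding. The relay subtracts its own signal, so
  the source's private signal remains; a receiver that decodes common indices faces both private
  signals; after that, only the other user's private signal is left.\<close>

definition relay_var :: real where "relay_var = 1 + (cmod (gain k s * be s))\<^sup>2"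
definition common_var :: "user \<Rightarrow> real" where
  "common_var d = 1 + (cmod (gain d s * be s))\<^sup>2 + (cmod (gain d r * be r))\<^sup>2"
definition private_var :: "user \<Rightarrow> real" where "private_var d = 1 + (cmod (gc * be (other d)))\<^sup>2"

text \<open>Index \<open>Suc b\<close> is estimated from block \<open>b\<close> and the previous
  estimate, so it is available when block \<open>Suc b\<close> starts, as strictly causal feedback
  demands.\<close>

primrec relay_est :: "(nat \<Rightarrow> codeword_id \<Rightarrow> complex) \<Rightarrow> nat \<Rightarrow> (nat \<Rightarrow> complex) \<Rightarrow> nat \<Rightarrow> nat" where
  "relay_est \<theta> m Y 0 = 0"
| "relay_est \<theta> m Y (Suc b) = decode (gain k s * al s) relay_var A (cw \<theta> True s)
     (\<lambda>p. Y (b * n + p + 1) - gain k r * signal \<theta> r (relay_est \<theta> m Y b) (private_index r m b) p)"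

text \<open>Times start at 1, blocks and positions at 0. The case \<open>B \<le> b\<close> covers
  the times after \<open>B * n\<close>, since the code length need not be a multiple of
  \<open>B\<close>.\<close>

definition enc :: "(nat \<Rightarrow> codeword_id \<Rightarrow> complex) \<Rightarrow> encoder" where
  "enc \<theta> u j m y1 y2 =
     (let b = (j - 1) div n; p = (j - 1) mod n in
      if B \<le> b then 0
      else if u = s then signal \<theta> s (common_index m (b + 1)) (private_index s m b) p
      else signal \<theta> r (relay_est \<theta> m (if k = U1 then y1 else y2) b) (private_index r m b) p)"

primrec forward_est :: "(nat \<Rightarrow> codeword_id \<Rightarrow> complex) \<Rightarrow> user \<Rightarrow> (nat \<Rightarrow> complex) \<Rightarrow> nat \<Rightarrow> nat" where
  "forward_est \<theta> d Y 0 = 0"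
| "forward_est \<theta> d Y (Suc b) = decode (gain d s * al s) (common_var d) A (cw \<theta> True s)
     (\<lambda>p. Y (b * n + p + 1) - gain d r * al r * cw \<theta> True r (forward_est \<theta> d Y b) p)"

text \<open>\<open>backward_est \<theta> d Y j\<close> estimates the common index \<open>B - j\<close>.\<close>

primrec backward_est :: "(nat \<Rightarrow> codeword_id \<Rightarrow> complex) \<Rightarrow> user \<Rightarrow> (nat \<Rightarrow> complex) \<Rightarrow> nat \<Rightarrow> nat" where
  "backward_est \<theta> d Y 0 = 0"
| "backward_est \<theta> d Y (Suc j) = decode (gain d r * al r) (common_var d) A (cw \<theta> True r)
     (\<lambda>p. Y ((D - j) * n + p + 1) - gain d s * al s * cw \<theta> True s (backward_est \<theta> d Y j) p)"

definition common_est :: "(nat \<Rightarrow> codeword_id \<Rightarrow> complex) \<Rightarrow> user \<Rightarrow> (nat \<Rightarrow> complex) \<Rightarrow> nat \<Rightarrow> nat" where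
  "common_est \<theta> d Y b = (if fw d then forward_est \<theta> d Y b else if b = 0 then 0 else backward_est \<theta> d Y (B - b))"

definition private_est :: "(nat \<Rightarrow> codeword_id \<Rightarrow> complex) \<Rightarrow> user \<Rightarrow> (nat \<Rightarrow> complex) \<Rightarrow> nat \<Rightarrow> nat" where
  "private_est \<theta> d Y b = decode (gd * be d) (private_var d) (C d) (cw \<theta> False d)
     (\<lambda>p. Y (b * n + p + 1) - gain d r * al r * cw \<theta> True r (common_est \<theta> d Y b) p
        - gain d s * al s * cw \<theta> True s (common_est \<theta> d Y (b + 1)) p)"

definition dec :: "(nat \<Rightarrow> codeword_id \<Rightarrow> complex) \<Rightarrow> decoder" where
  "dec \<theta> d Y = 1 + (\<Sum>b<D. ((common_est \<theta> d Y (b + 1) - 1) mod common_size d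
      + common_size d * (private_est \<theta> d Y b - 1)) * base d ^ b)"

text \<open>The output if the relay always knew the common index. For fixed messages it is linear in
  codebooks and noise with constant coefficients, so the Gaussian integrals apply; the true output
  is not, because the relay's decisions enter it.\<close>

definition ideal_out :: "(nat \<Rightarrow> codeword_id \<Rightarrow> complex) \<Rightarrow> (user \<Rightarrow> nat) \<Rightarrow> (user \<times> nat \<Rightarrow> complex) \<Rightarrow> user \<Rightarrow> nat \<Rightarrow> nat \<Rightarrow> complex" where
  "ideal_out \<theta> w z d b p =
     gain d s * signal \<theta> s (common_index (w s) (b + 1)) (private_index s (w s) b) p
     + gain d r * signal \<theta> r (common_index (w s) b) (private_index r (w r) b) p + z (d, b * n + p + 1)"

definition relay_ok where
  "relay_ok \<theta> w z b \<longleftrightarrow> decodes_to n e (gain k s * al s) relay_var A (cw \<theta> True s)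
     (\<lambda>p. ideal_out \<theta> w z k b p - gain k r * signal \<theta> r (common_index (w s) b) (private_index r (w r) b) p)
     (common_index (w s) (b + 1))"

definition forward_ok where
  "forward_ok \<theta> w z d b \<longleftrightarrow> decodes_to n e (gain d s * al s) (common_var d) A (cw \<theta> True s)
     (\<lambda>p. ideal_out \<theta> w z d b p - gain d r * al r * cw \<theta> True r (common_index (w s) b) p)
     (common_index (w s) (b + 1))"

text \<open>In block \<open>b + 1\<close> the relay repeats index \<open>b + 1\<close>, while the
  source already sends index \<open>b + 2\<close>, which the previous backward step has supplied (or
  which is silence).\<close>

definition backward_ok where
  "backward_ok \<theta> w z d b \<longleftrightarrow> decodes_to n e (gain d r * al r) (common_var d) A (cw \<theta> True r)
     (\<lambda>p. ideal_out \<theta> w z d (b + 1) p - gain d s * al s * cw \<theta> True s (common_index (w s) (b + 2)) p)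
     (common_index (w s) (b + 1))"

definition private_ok where
  "private_ok \<theta> w z d b \<longleftrightarrow> decodes_to n e (gd * be d) (private_var d) (C d) (cw \<theta> False d)
     (\<lambda>p. ideal_out \<theta> w z d b p - gain d r * al r * cw \<theta> True r (common_index (w s) b) p
        - gain d s * al s * cw \<theta> True s (common_index (w s) (b + 1)) p)
     (private_index d (w d) b)"

definition all_ok where
  "all_ok \<theta> w z \<longleftrightarrow> (\<forall>b<D. relay_ok \<theta> w z b \<and>
     (\<forall>d. (if fw d then forward_ok \<theta> w z d b else backward_ok \<theta> w z d b) \<and> private_ok \<theta> w z d b))"

lemma common_index_bounds: "b < D \<Longrightarrow> common_index m (b + 1) \<in> {1..A}"
  using A by (auto simp: common_index_def Suc_le_eq)

lemma private_index_bounds: "b < D \<Longrightarrow> private_index u m b \<in> {1..C u}"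
  using C[of u] by (auto simp: private_index_def Suc_le_eq)

lemma common_index_0 [simp]: "common_index m 0 = 0" "D < b \<Longrightarrow> common_index m b = 0"
  by (simp_all add: common_index_def)

lemma relay_est_cong:
  "(\<And>i. 1 \<le> i \<Longrightarrow> i \<le> b * n \<Longrightarrow> Y i = Y' i) \<Longrightarrow> relay_est \<theta> m Y b = relay_est \<theta> m Y' b"
proof (induction b)
  case (Suc b)
  then have "relay_est \<theta> m Y b = relay_est \<theta> m Y' b" by simp
  then show ?case
    unfolding relay_est.simps decode_def using Suc.prems by (intro threshold_decode_cong) auto
qed simp

definition out :: "(nat \<Rightarrow> codeword_id \<Rightarrow> complex) \<Rightarrow> (user \<Rightarrow> nat) \<Rightarrow> (user \<times> nat \<Rightarrow> complex) \<Rightarrow> user \<Rightarrow> nat \<Rightarrow> complex" where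
  "out \<theta> w z u j = chan_out gd gc F (enc \<theta>) w z u j"

lemma time_index: "p < n \<Longrightarrow> (b * n + p + 1 - 1) div n = b" "p < n \<Longrightarrow> (b * n + p + 1 - 1) mod n = p"
  by auto

lemma chan_in_source:
  assumes "p < n" "b < B"
  shows "chan_in gd gc F (enc \<theta>) w z s (b * n + p + 1) = signal \<theta> s (common_index (w s) (b + 1)) (private_index s (w s) b) p"
  using assms by (subst chan_in.simps) (simp add: enc_def Let_def)

lemma chan_in_relay:
  assumes "p < n" "b < B"
  shows "chan_in gd gc F (enc \<theta>) w z r (b * n + p + 1) = signal \<theta> r (relay_est \<theta> (w r) (out \<theta> w z k) b) (private_index r (w r) b) p"
proof -
  let ?j = "b * n + p + 1"
  let ?y = "\<lambda>u. \<lambda>i\<in>{1..<?j}. of_bool (F u r) * chan_out gd gc F (enc \<theta>) w z u i"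
  have est: "relay_est \<theta> (w r) (if k = U1 then ?y U1 else ?y U2) b = relay_est \<theta> (w r) (out \<theta> w z k) b"
  proof (rule relay_est_cong)
    fix i assume "1 \<le> i" "i \<le> b * n"
    then show "(if k = U1 then ?y U1 else ?y U2) i = out \<theta> w z k i"
      unfolding out_def using link by (cases k) auto
  qed
  show ?thesis
    by (subst chan_in.simps, simp only: enc_def Let_def time_index[OF assms(1)] est) (use assms in simp)
qed

lemma chan_in_idle:
  assumes "B * n < j" shows "chan_in gd gc F (enc \<theta>) w z u j = 0"
proof -
  have "B \<le> (j - 1) div n" using assms n by (simp add: less_eq_div_iff_mult_less_eq)
  then show ?thesis by (subst chan_in.simps) (simp add: enc_def Let_def)
qed

lemma out_block:
  assumes "p < n" "b < B"
  shows "out \<theta> w z d (b * n + p + 1) =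
     gain d s * signal \<theta> s (common_index (w s) (b + 1)) (private_index s (w s) b) p
     + gain d r * signal \<theta> r (relay_est \<theta> (w r) (out \<theta> w z k) b) (private_index r (w r) b) p + z (d, b * n + p + 1)"
proof (cases "d = r")
  case True
  then show ?thesis unfolding out_def[of _ _ _ d] using chan_in_source[OF assms] chan_in_relay[OF assms]
    by (subst chan_out.simps) (simp add: gain_def)
next
  case False
  then have "d = s" by (rule user_eq_other)
  then show ?thesis unfolding out_def[of _ _ _ d] using chan_in_source[OF assms] chan_in_relay[OF assms]
    by (subst chan_out.simps) (simp add: gain_def)
qed

text \<open>Success on the ideal outputs bootstraps itself: as long as the relay has been right, the
  true outputs are the ideal ones, so its next decision is right as well.\<close>

lemma relay_est_correct:
  assumes ok: "\<And>b. b < D \<Longrightarrow> relay_ok \<theta> w z b" and b: "b \<le> D"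
  shows "relay_est \<theta> (w r) (out \<theta> w z k) b = common_index (w s) b"
  using b
proof (induction b)
  case (Suc b)
  then have IH: "relay_est \<theta> (w r) (out \<theta> w z k) b = common_index (w s) b" and b: "b < D" "b < B"
    by (auto simp: D_def)
  have "relay_est \<theta> (w r) (out \<theta> w z k) (Suc b) = threshold_decode n e (gain k s * al s) relay_var A (cw \<theta> True s)
     (\<lambda>p. ideal_out \<theta> w z k b p - gain k r * signal \<theta> r (common_index (w s) b) (private_index r (w r) b) p)"
    unfolding relay_est.simps decode_def IH
    by (rule threshold_decode_cong) (simp add: out_block[OF _ b(2), simplified] IH ideal_out_def)
  also have "\<dots> = common_index (w s) (b + 1)"
    using ok[OF b(1)] common_index_bounds[OF b(1)] unfolding relay_ok_def by (rule threshold_decode_eq)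
  finally show ?case by simp
qed simp

lemma out_eq_ideal_out:
  assumes ok: "\<And>b. b < D \<Longrightarrow> relay_ok \<theta> w z b" and "p < n" "b < B"
  shows "out \<theta> w z d (b * n + p + 1) = ideal_out \<theta> w z d b p"
proof -
  have "relay_est \<theta> (w r) (out \<theta> w z k) b = common_index (w s) b"
    using assms by (intro relay_est_correct) (auto simp: D_def)
  then show ?thesis unfolding out_block[OF assms(2,3)] ideal_out_def by simp
qed

text \<open>All receiver steps run on ideal outputs: the common indices first, in either direction,
  then the private ones with both common signals removed. In reassembling the digits,
  \<open>mod common_size d\<close> discards the common index at the receiver of the relay's message,
  where the modulus is 1.\<close>

lemma dec_correct:
  assumes ok: "all_ok \<theta> w z" and N: "B * n \<le> N"
    and w: "1 \<le> w d" "w d \<le> base d ^ D"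
  shows "dec \<theta> d (\<lambda>j\<in>{1..N}. out \<theta> w z d j) = w d"
proof -
  define Y where "Y = (\<lambda>j\<in>{1..N}. out \<theta> w z d j)"
  have rok: "\<And>b. b < D \<Longrightarrow> relay_ok \<theta> w z b" using ok by (simp add: all_ok_def)
  have fok: "fw d \<Longrightarrow> b < D \<Longrightarrow> forward_ok \<theta> w z d b"
    and bok: "\<not> fw d \<Longrightarrow> b < D \<Longrightarrow> backward_ok \<theta> w z d b"
    and pok: "b < D \<Longrightarrow> private_ok \<theta> w z d b" for b
    using ok unfolding all_ok_def by presburger+
  have Yb: "Y (b * n + p + 1) = ideal_out \<theta> w z d b p" if "p < n" "b < B" for b p
  proof -
    have "b * n + p + 1 \<le> b * n + n" using that by simp
    also have "\<dots> = (b + 1) * n" by simp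
    also have "\<dots> \<le> B * n" using that by (intro mult_right_mono) auto
    finally have "b * n + p + 1 \<in> {1..N}" using N by auto
    then show ?thesis using out_eq_ideal_out[OF rok that] by (simp add: Y_def)
  qed
  have fwd: "forward_est \<theta> d Y b = common_index (w s) b" if "fw d" "b \<le> D" for b
    using that(2)
  proof (induction b)
    case (Suc b)
    have IH: "forward_est \<theta> d Y b = common_index (w s) b"
      by (rule Suc.IH) (use Suc.prems in simp)
    have b: "b < D" "b < B"
      using Suc.prems by (auto simp: D_def)
    have "forward_est \<theta> d Y (Suc b) = threshold_decode n e (gain d s * al s) (common_var d) A (cw \<theta> True s)
       (\<lambda>p. ideal_out \<theta> w z d b p - gain d r * al r * cw \<theta> True r (common_index (w s) b) p)"
      unfolding forward_est.simps decode_def IH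
      by (rule threshold_decode_cong) (use Yb[OF _ b(2)] in simp)
    also have "\<dots> = common_index (w s) (b + 1)"
      using fok[OF that(1) b(1)] common_index_bounds[OF b(1)] unfolding forward_ok_def by (rule threshold_decode_eq)
    finally show ?case by simp
  qed simp
  have bwd: "backward_est \<theta> d Y j = common_index (w s) (B - j)" if "\<not> fw d" "j \<le> D" for j
    using that(2)
  proof (induction j)
    case 0
    then show ?case using B by (simp add: D_def)
  next
    case (Suc j)
    have IH: "backward_est \<theta> d Y j = common_index (w s) (B - j)"
      by (rule Suc.IH) (use Suc.prems in simp)
    have j: "j < D" using Suc.prems by simp
    define b where "b = D - Suc j"
    have b: "D - j = b + 1" "b < D" "b + 1 < B" "B - j = b + 2" "B - Suc j = b + 1" using j by (auto simp: b_def D_def)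
    have "backward_est \<theta> d Y (Suc j) = threshold_decode n e (gain d r * al r) (common_var d) A (cw \<theta> True r)
       (\<lambda>p. ideal_out \<theta> w z d (b + 1) p - gain d s * al s * cw \<theta> True s (common_index (w s) (b + 2)) p)"
      unfolding backward_est.simps decode_def IH b
      by (rule threshold_decode_cong) (use Yb[OF _ b(3)] in simp)
    also have "\<dots> = common_index (w s) (b + 1)"
      using bok[OF that(1) b(2)] common_index_bounds[OF b(2)] unfolding backward_ok_def by (rule threshold_decode_eq)
    finally show ?case using b by simp
  qed
  have com: "common_est \<theta> d Y b = common_index (w s) b" if "b \<le> D" for b
  proof (cases "fw d")
    case False
    have "backward_est \<theta> d Y (B - b) = common_index (w s) (B - (B - b))" if "b \<noteq> 0"
      using that by (intro bwd False) (auto simp: D_def)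
    then show ?thesis using False that B by (auto simp: common_est_def D_def)
  qed (use fwd that in \<open>simp add: common_est_def\<close>)
  have priv: "private_est \<theta> d Y b = private_index d (w d) b" if b: "b < D" for b
  proof -
    have c: "common_est \<theta> d Y b = common_index (w s) b" "common_est \<theta> d Y (b + 1) = common_index (w s) (b + 1)" and bB: "b < B"
      using b com[of b] com[of "b + 1"] by (auto simp: D_def)
    have "private_est \<theta> d Y b = threshold_decode n e (gd * be d) (private_var d) (C d) (cw \<theta> False d)
     (\<lambda>p. ideal_out \<theta> w z d b p - gain d r * al r * cw \<theta> True r (common_index (w s) b) p
        - gain d s * al s * cw \<theta> True s (common_index (w s) (b + 1)) p)"
      unfolding private_est_def decode_def c
      by (rule threshold_decode_cong) (use Yb[OF _ bB] in simp)
    also have "\<dots> = private_index d (w d) b"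
      using pok[OF b] private_index_bounds[OF b] unfolding private_ok_def by (rule threshold_decode_eq)
    finally show ?thesis .
  qed
  have dig: "(common_est \<theta> d Y (b + 1) - 1) mod common_size d + common_size d * (private_est \<theta> d Y b - 1)
     = (w d - 1) div base d ^ b mod base d" if b: "b < D" for b
  proof -
    have 1: "(common_est \<theta> d Y (b + 1) - 1) mod common_size d = (w d - 1) div base d ^ b mod common_size d"
    proof (cases "d = s")
      case True
      then show ?thesis using b com[of "b + 1"] by (simp add: common_index_def common_size_def)
    qed (simp add: common_size_def)
    have 2: "private_est \<theta> d Y b - 1 = (w d - 1) div base d ^ b div common_size d mod C d"
      using b by (simp add: priv private_index_def div_mult2_eq)
    have "(w d - 1) div base d ^ b mod base d = common_size d * ((w d - 1) div base d ^ b div common_size d mod C d) + (w d - 1) div base d ^ b mod common_size d"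
      unfolding base_def by (rule mod_mult2_eq)
    then show ?thesis unfolding 1 2 by simp
  qed
  have "dec \<theta> d Y = 1 + (\<Sum>b<D. ((w d - 1) div base d ^ b mod base d) * base d ^ b)"
    unfolding dec_def using dig by simp
  also have "\<dots> = w d"
    using w by (subst digits_expansion) auto
  finally show ?thesis unfolding Y_def .
qed

end

text \<open>Outside \<open>I\<close> a component is constantly \<open>undefined\<close> on the
  product space. The estimates may thus refer to any time, observed or not.\<close>

lemma measurable_component_any:
  fixes I :: "nat set"
  shows "(\<lambda>y. y i) \<in> borel_measurable (PiM I (\<lambda>_. borel :: complex measure))"
proof (cases "i \<in> I")
  case False
  then have "(\<lambda>y. y i) \<in> borel_measurable (PiM I (\<lambda>_. borel :: complex measure)) \<longleftrightarrow>
      (\<lambda>y. undefined :: complex) \<in> borel_measurable (PiM I (\<lambda>_. borel :: complex measure))"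
    by (intro measurable_cong) (auto simp: space_PiM PiE_def extensional_def)
  then show ?thesis by simp
qed (rule measurable_component_singleton)

lemma measurable_discrete_compose:
  assumes "f \<in> measurable M (count_space (UNIV :: nat set))"
  shows "(\<lambda>x. g (f x) :: complex) \<in> borel_measurable M"
  using measurable_compose[OF assms, of g borel] by simp

lemma measurable_discrete_binop:
  fixes g :: "nat \<Rightarrow> nat \<Rightarrow> nat"
  assumes "f1 \<in> measurable M (count_space UNIV)" "f2 \<in> measurable M (count_space UNIV)"
  shows "(\<lambda>x. g (f1 x) (f2 x)) \<in> measurable M (count_space UNIV)"
  by (rule measurable_compose_countable[OF _ assms(1)]) (rule measurable_compose[OF assms(2)], simp)

lemma measurable_discrete_sum:
  fixes f :: "nat \<Rightarrow> 'a \<Rightarrow> nat"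
  assumes "\<And>b. f b \<in> measurable M (count_space UNIV)"
  shows "(\<lambda>x. \<Sum>b<D. f b x) \<in> measurable M (count_space UNIV)"
proof (induction D)
  case (Suc D)
  then show ?case using measurable_discrete_binop[OF Suc assms[of D], of "(+)"] by simp
qed simp

lemma measurable_score:
  assumes "\<And>p. p < n \<Longrightarrow> (\<lambda>x. Y x p) \<in> borel_measurable M" "\<And>p. p < n \<Longrightarrow> (\<lambda>x. X x p) \<in> borel_measurable M"
  shows "(\<lambda>x. score n h v (Y x) (X x)) \<in> borel_measurable M"
proof -
  have "(\<lambda>x. (cmod (Y x p))\<^sup>2 / (v + (cmod h)\<^sup>2) - (cmod (Y x p - h * X x p))\<^sup>2 / v) \<in> borel_measurable M" if "p \<in> {..<n}" for p
  proof -
    have [measurable]: "(\<lambda>x. Y x p) \<in> borel_measurable M" "(\<lambda>x. X x p) \<in> borel_measurable M"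
      using assms that by auto
    show ?thesis by measurable
  qed
  then show ?thesis unfolding score_def by (intro borel_measurable_sum)
qed

lemma measurable_threshold_decode:
  assumes "\<And>p. p < n \<Longrightarrow> (\<lambda>x. Y x p) \<in> borel_measurable M"
  shows "(\<lambda>x. threshold_decode n e h v K X (Y x)) \<in> measurable M (count_space UNIV)"
  unfolding threshold_decode_def
proof (rule measurable_Least)
  fix i
  have [measurable]: "(\<lambda>x. score n h v (Y x) (X i)) \<in> borel_measurable M"
    using assms by (intro measurable_score) auto
  show "Measurable.pred M (\<lambda>x. 1 \<le> i \<and> (i = K \<or> score n h v (Y x) (X i) \<ge> - (2 * e * n)))" by measurable
qed

lemma pred_decodes_to:
  assumes Y: "\<And>p. p < n \<Longrightarrow> (\<lambda>x. Y x p) \<in> borel_measurable M"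
    and X: "\<And>i p. i \<in> {1..K} \<Longrightarrow> p < n \<Longrightarrow> (\<lambda>x. X x i p) \<in> borel_measurable M" and i: "i \<in> {1..K}"
  shows "Measurable.pred M (\<lambda>x. decodes_to n e h v K (X x) (Y x) i)"
proof -
  have s: "(\<lambda>x. score n h v (Y x) (X x i')) \<in> borel_measurable M" if "i' \<in> {1..K}" for i'
    using Y X that by (intro measurable_score) auto
  have [measurable]: "(\<lambda>x. score n h v (Y x) (X x i)) \<in> borel_measurable M" using i by (rule s)
  have [measurable]: "Measurable.pred M (\<lambda>x. \<forall>i'\<in>{1..K} - {i}. score n h v (Y x) (X x i') < - (2 * e * n))"
  proof (rule pred_intros_countable_bounded(3))
    fix i' assume "i' \<in> {1..K} - {i}"
    then have [measurable]: "(\<lambda>x. score n h v (Y x) (X x i')) \<in> borel_measurable M" by (intro s) auto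
    show "Measurable.pred M (\<lambda>x. score n h v (Y x) (X x i') < - (2 * e * n))" by measurable
  qed
  show ?thesis unfolding decodes_to_def by measurable
qed

section \<open>Measurability of encoders and decoders\<close>

context block_markov
begin

lemma measurable_signal:
  assumes "f \<in> measurable M (count_space UNIV)"
  shows "(\<lambda>x. signal \<theta> u (f x) j p) \<in> borel_measurable M" "(\<lambda>x. cw \<theta> c u (f x) p) \<in> borel_measurable M"
  using measurable_discrete_compose[OF assms, of "\<lambda>i. signal \<theta> u i j p"]
    measurable_discrete_compose[OF assms, of "\<lambda>i. cw \<theta> c u i p"] by simp_all

lemma measurable_relay_est:
  assumes Y: "\<And>i. (\<lambda>x. Y x i) \<in> borel_measurable M"
  shows "(\<lambda>x. relay_est \<theta> m (Y x) b) \<in> measurable M (count_space UNIV)"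
proof (induction b)
  case (Suc b)
  show ?case unfolding relay_est.simps decode_def
    by (intro measurable_threshold_decode borel_measurable_diff borel_measurable_times Y borel_measurable_const
        measurable_signal Suc)
qed simp

lemma measurable_encoder_enc: "measurable_encoder N R (enc \<theta>)"
  unfolding measurable_encoder_def
proof (intro allI ballI)
  fix u j m assume "j \<in> {1..N}"
  let ?M = "(\<Pi>\<^sub>M i\<in>{1..<j}. (borel :: complex measure)) \<Otimes>\<^sub>M (\<Pi>\<^sub>M i\<in>{1..<j}. (borel :: complex measure))"
  have "(\<lambda>x. (if k = U1 then fst x else snd x) i) \<in> borel_measurable ?M" for i
    using measurable_compose[OF measurable_fst measurable_component_any[of i "{1..<j}"]]
      measurable_compose[OF measurable_snd measurable_component_any[of i "{1..<j}"]] by (cases "k = U1") auto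
  then have "(\<lambda>x. relay_est \<theta> m (if k = U1 then fst x else snd x) b) \<in> measurable ?M (count_space UNIV)" for b
    by (rule measurable_relay_est)
  then have sig: "(\<lambda>x. signal \<theta> r (relay_est \<theta> m (if k = U1 then fst x else snd x) b) i p) \<in> borel_measurable ?M" for b i p
    by (rule measurable_signal)
  show "(\<lambda>(y1, y2). enc \<theta> u j m y1 y2) \<in> borel_measurable ?M"
    unfolding enc_def Let_def case_prod_beta
    using sig by (cases "B \<le> (j - 1) div n"; cases "u = s") auto
qed

lemma measurable_forward_est:
  assumes Y: "\<And>i. (\<lambda>x. Y x i) \<in> borel_measurable M"
  shows "(\<lambda>x. forward_est \<theta> d (Y x) b) \<in> measurable M (count_space UNIV)"
proof (induction b)
  case (Suc b)
  show ?case unfolding forward_est.simps decode_def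
    by (intro measurable_threshold_decode borel_measurable_diff borel_measurable_times Y borel_measurable_const
        measurable_signal Suc)
qed simp

lemma measurable_backward_est:
  assumes Y: "\<And>i. (\<lambda>x. Y x i) \<in> borel_measurable M"
  shows "(\<lambda>x. backward_est \<theta> d (Y x) b) \<in> measurable M (count_space UNIV)"
proof (induction b)
  case (Suc b)
  show ?case unfolding backward_est.simps decode_def
    by (intro measurable_threshold_decode borel_measurable_diff borel_measurable_times Y borel_measurable_const
        measurable_signal Suc)
qed simp

lemma measurable_common_est:
  assumes Y: "\<And>i. (\<lambda>x. Y x i) \<in> borel_measurable M"
  shows "(\<lambda>x. common_est \<theta> d (Y x) b) \<in> measurable M (count_space UNIV)"
  using measurable_forward_est[OF Y] measurable_backward_est[OF Y] by (simp add: common_est_def)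

lemma measurable_private_est:
  assumes Y: "\<And>i. (\<lambda>x. Y x i) \<in> borel_measurable M"
  shows "(\<lambda>x. private_est \<theta> d (Y x) b) \<in> measurable M (count_space UNIV)"
  unfolding private_est_def decode_def
  by (intro measurable_threshold_decode borel_measurable_diff borel_measurable_times Y borel_measurable_const
        measurable_signal measurable_common_est[OF Y])

lemma measurable_decoder_dec: "measurable_decoder N (dec \<theta>)"
  unfolding measurable_decoder_def
proof
  fix d
  let ?M = "\<Pi>\<^sub>M i\<in>{1..N}. (borel :: complex measure)"
  have Y: "(\<lambda>y. y i) \<in> borel_measurable ?M" for i by (rule measurable_component_any)
  have "(\<lambda>Y. \<Sum>b<D. ((common_est \<theta> d Y (b + 1) - 1) mod common_size d
      + common_size d * (private_est \<theta> d Y b - 1)) * base d ^ b) \<in> measurable ?M (count_space UNIV)"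
    by (intro measurable_discrete_sum)
      (rule measurable_discrete_binop[OF measurable_common_est[OF Y] measurable_private_est[OF Y],
        where g="\<lambda>a c. ((a - 1) mod common_size d + common_size d * (c - 1)) * base d ^ b" for b])
  from measurable_compose[OF this, of "\<lambda>x. 1 + x" "count_space UNIV"]
  show "dec \<theta> d \<in> measurable ?M (count_space UNIV)" by (simp add: dec_def[abs_def])
qed

section \<open>Single decoding steps averaged over random codebooks\<close>

definition book_size :: "bool \<Rightarrow> user \<Rightarrow> nat" where
  "book_size c u = (if c then A else C u)"

definition ids :: "codeword_id set" where
  "ids = (SIGMA c:UNIV. SIGMA u:UNIV. {1..book_size c u})"

lemma ids_iff: "(c, u, i) \<in> ids \<longleftrightarrow> 1 \<le> i \<and> i \<le> book_size c u"
  by (auto simp: ids_def)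

lemma finite_ids: "finite ids"
  unfolding ids_def by (intro finite_SigmaI) auto

text \<open>One Gaussian vector over all codeword ids per position, independent across positions. A
  codeword is read along the positions, whereas the signals at one position are linear forms in one
  vector.\<close>

definition codebooks :: "(nat \<Rightarrow> codeword_id \<Rightarrow> complex) measure" where
  "codebooks = PiM {..<n} (\<lambda>_. PiM ids (\<lambda>_. std_complex_normal))"

lemma prob_space_codebooks: "prob_space codebooks"
  unfolding codebooks_def by (intro prob_space_PiM prob_space_PiM_std_complex_normal)

lemma measurable_codeword:
  assumes "p < n" "q \<in> ids" shows "(\<lambda>\<theta>. \<theta> p q) \<in> borel_measurable codebooks"
proof -
  have "(\<lambda>\<theta>. \<theta> p) \<in> measurable codebooks (PiM ids (\<lambda>_. std_complex_normal))"
    unfolding codebooks_def using assms by (intro measurable_component_singleton) auto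
  from measurable_compose[OF this measurable_component_std_complex_normal[OF assms(2)]] show ?thesis .
qed

lemma measurable_cw:
  assumes "p < n" "i \<le> book_size c u" shows "(\<lambda>\<theta>. cw \<theta> c u i p) \<in> borel_measurable codebooks"
  using measurable_codeword[OF assms(1), of "(c, u, i)"] assms(2) by (cases "i = 0") (auto simp: cw_def ids_iff)

lemma index_le:
  "common_index m b \<le> book_size True u" "private_index u m b \<le> book_size False u"
  using A C[of u] by (auto simp: common_index_def private_index_def book_size_def Suc_le_eq)

text \<open>Coefficient vectors with one entry turn signals into linear forms over
  \<open>ids\<close>, the shape of the Gaussian lemmas. Index 0 lies outside \<open>ids\<close>, so
  its form vanishes, as silence should.\<close>

definition coeff :: "complex \<Rightarrow> bool \<Rightarrow> user \<Rightarrow> nat \<Rightarrow> codeword_id \<Rightarrow> complex" where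
  "coeff x c u i q = (if q = (c, u, i) then x else 0)"

lemma sum_coeff:
  assumes "i \<le> book_size c u"
  shows "(\<Sum>q\<in>ids. coeff x c u i q * \<theta> p q) = x * cw \<theta> c u i p"
proof -
  have "(\<Sum>q\<in>ids. coeff x c u i q * \<theta> p q) = (\<Sum>q\<in>ids. if q = (c, u, i) then x * \<theta> p q else 0)"
    by (intro sum.cong) (auto simp: coeff_def)
  also have "\<dots> = (if (c, u, i) \<in> ids then x * \<theta> p (c, u, i) else 0)"
    by (rule sum.delta[OF finite_ids])
  also have "\<dots> = x * cw \<theta> c u i p" using assms by (auto simp: ids_iff cw_def)
  finally show ?thesis .
qed

lemma sum_coeff_norm: "(\<Sum>q\<in>ids. (cmod (coeff x c u i q))\<^sup>2) \<le> (cmod x)\<^sup>2"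
proof -
  have "(\<Sum>q\<in>ids. (cmod (coeff x c u i q))\<^sup>2) = (\<Sum>q\<in>ids. if q = (c, u, i) then (cmod x)\<^sup>2 else 0)"
    by (intro sum.cong) (auto simp: coeff_def)
  also have "\<dots> \<le> (cmod x)\<^sup>2" by (simp add: finite_ids)
  finally show ?thesis .
qed

lemma sum_coeff_add_norm:
  assumes "(c, u) \<noteq> (c', u')"
  shows "(\<Sum>q\<in>ids. (cmod (coeff x c u i q + coeff y c' u' j q))\<^sup>2) \<le> (cmod x)\<^sup>2 + (cmod y)\<^sup>2"
proof -
  have "(\<Sum>q\<in>ids. (cmod (coeff x c u i q + coeff y c' u' j q))\<^sup>2)
     = (\<Sum>q\<in>ids. (cmod (coeff x c u i q))\<^sup>2) + (\<Sum>q\<in>ids. (cmod (coeff y c' u' j q))\<^sup>2)"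
    unfolding sum.distrib[symmetric] using assms by (intro sum.cong) (auto simp: coeff_def)
  then show ?thesis using sum_coeff_norm[of x c u i] sum_coeff_norm[of y c' u' j] by simp
qed

lemma block_times:
  assumes "b < B" "B * n \<le> N"
  shows "(\<lambda>p. (d, b * n + p + 1)) ` {..<n} \<subseteq> UNIV \<times> {1..N}" "inj_on (\<lambda>p. (d, b * n + p + 1)) {..<n}"
proof -
  have "(b + 1) * n \<le> B * n" using assms by (intro mult_right_mono) auto
  then show "(\<lambda>p. (d, b * n + p + 1)) ` {..<n} \<subseteq> UNIV \<times> {1..N}" using assms by auto
qed (auto simp: inj_on_def)

text \<open>The condition on \<open>a\<close> keeps all codewords of the decoded book out of the
  interference, so that wrong codewords are independent of the output. It can be met because source
  and relay use separate common books.\<close>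

lemma decoding_step_bound:
  assumes M: "M = book_size c u" and b: "b < B" "B * n \<le> N" and i: "i \<in> {1..M}"
    and a: "\<And>i'. a (c, u, i') = 0" and v: "1 + (\<Sum>q\<in>ids. (cmod (a q))\<^sup>2) \<le> v"
    and Y: "\<And>\<theta> z p. Y \<theta> z p = z (d, b * n + p + 1) + h * cw \<theta> c u i p + (\<Sum>q\<in>ids. a q * \<theta> p q)"
  shows "(\<integral>\<^sup>+ z. \<integral>\<^sup>+ \<theta>. of_bool (\<not> decodes_to n e h v M (cw \<theta> c u) (Y \<theta> z) i) \<partial>codebooks \<partial>noise_space N)
     \<le> ennreal (step_bound e M v ((cmod h)\<^sup>2) n)" (is "?I \<le> _")
proof -
  define Cs where "Cs = (\<lambda>i. (c, u, i)) ` ({1..M} - {i})"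
  have card: "Suc (card Cs) = M"
    using i unfolding Cs_def by (subst card_image) (auto simp: inj_on_def)
  have eq: "decodes_to n e h v M (cw \<theta> c u) (Y \<theta> z) i \<longleftrightarrow>
      score n h v (Y \<theta> z) (\<lambda>t. \<theta> t (c, u, i)) \<ge> - (2 * e * n) \<and> (\<forall>q\<in>Cs. score n h v (Y \<theta> z) (\<lambda>t. \<theta> t q) < - (2 * e * n))" for \<theta> z
  proof -
    have "cw \<theta> c u i' = (\<lambda>t. \<theta> t (c, u, i'))" if "i' \<ge> 1" for i' using that by (auto simp: cw_def)
    then show ?thesis using i by (auto simp: decodes_to_def Cs_def)
  qed
  have "?I \<le> ennreal (step_bound e (Suc (card Cs)) v ((cmod h)\<^sup>2) n)"
    unfolding eq codebooks_def noise_space_def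
  proof (rule random_coding_bound[where \<tau>="\<lambda>p. (d, b * n + p + 1)" and a=a])
    show "(\<lambda>p. (d, b * n + p + 1)) ` {..<n} \<subseteq> UNIV \<times> {1..N}" "inj_on (\<lambda>p. (d, b * n + p + 1)) {..<n}"
      by (rule block_times[OF b])+
    show "Y \<theta> z t = z (d, b * n + t + 1) + h * \<theta> t (c, u, i) + (\<Sum>q\<in>ids. a q * \<theta> t q)" for \<theta> z t
      using i by (simp add: Y cw_def)
  qed (use i e v finite_ids a M in \<open>auto simp: ids_iff Cs_def\<close>)
  then show ?thesis unfolding card .
qed

lemma gain_self: "gain d d = gd" and gain_other: "gain d (other d) = gc"
  by (simp_all add: gain_def)

lemma relay_step_bound:
  assumes b: "b < D" and N: "B * n \<le> N"
  shows "(\<integral>\<^sup>+ z. \<integral>\<^sup>+ \<theta>. of_bool (\<not> relay_ok \<theta> w z b) \<partial>codebooks \<partial>noise_space N)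
     \<le> ennreal (step_bound e A relay_var ((cmod (gain k s * al s))\<^sup>2) n)"
proof -
  have bs: "book_size True s = A" by (simp add: book_size_def)
  show ?thesis unfolding relay_ok_def
  proof (rule decoding_step_bound[where b=b and d=k and a="coeff (gain k s * be s) False s (private_index s (w s) b)"])
    show "common_index (w s) (b + 1) \<in> {1..A}" using common_index_bounds[OF b] .
    show "1 + (\<Sum>q\<in>ids. (cmod (coeff (gain k s * be s) False s (private_index s (w s) b) q))\<^sup>2) \<le> relay_var"
      using sum_coeff_norm by (simp add: relay_var_def)
    show "ideal_out \<theta> w z k b p - gain k r * signal \<theta> r (common_index (w s) b) (private_index r (w r) b) p
      = z (k, b * n + p + 1) + gain k s * al s * cw \<theta> True s (common_index (w s) (b + 1)) p
        + (\<Sum>q\<in>ids. coeff (gain k s * be s) False s (private_index s (w s) b) q * \<theta> p q)" for \<theta> z p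
      by (simp add: sum_coeff index_le ideal_out_def signal_def) (simp add: algebra_simps)
  qed (use b N bs in \<open>auto simp: D_def coeff_def\<close>)
qed

lemma forward_step_bound:
  assumes b: "b < D" and N: "B * n \<le> N"
  shows "(\<integral>\<^sup>+ z. \<integral>\<^sup>+ \<theta>. of_bool (\<not> forward_ok \<theta> w z d b) \<partial>codebooks \<partial>noise_space N)
     \<le> ennreal (step_bound e A (common_var d) ((cmod (gain d s * al s))\<^sup>2) n)"
proof -
  have bs: "book_size True s = A" by (simp add: book_size_def)
  let ?a = "\<lambda>q. coeff (gain d s * be s) False s (private_index s (w s) b) q + coeff (gain d r * be r) False r (private_index r (w r) b) q"
  show ?thesis unfolding forward_ok_def
  proof (rule decoding_step_bound[where b=b and d=d and a="?a"])
    show "common_index (w s) (b + 1) \<in> {1..A}" using common_index_bounds[OF b] .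
    show "1 + (\<Sum>q\<in>ids. (cmod (?a q))\<^sup>2) \<le> common_var d"
      using sum_coeff_add_norm[of False s False r] by (simp add: common_var_def add.assoc)
    show "ideal_out \<theta> w z d b p - gain d r * al r * cw \<theta> True r (common_index (w s) b) p
      = z (d, b * n + p + 1) + gain d s * al s * cw \<theta> True s (common_index (w s) (b + 1)) p + (\<Sum>q\<in>ids. ?a q * \<theta> p q)" for \<theta> z p
      by (simp add: distrib_right sum.distrib sum_coeff index_le ideal_out_def signal_def)
        (simp add: algebra_simps)
  qed (use b N bs in \<open>auto simp: D_def coeff_def\<close>)
qed

lemma backward_step_bound:
  assumes b: "b < D" and N: "B * n \<le> N"
  shows "(\<integral>\<^sup>+ z. \<integral>\<^sup>+ \<theta>. of_bool (\<not> backward_ok \<theta> w z d b) \<partial>codebooks \<partial>noise_space N)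
     \<le> ennreal (step_bound e A (common_var d) ((cmod (gain d r * al r))\<^sup>2) n)"
proof -
  have bs: "book_size True r = A" by (simp add: book_size_def)
  let ?a = "\<lambda>q. coeff (gain d s * be s) False s (private_index s (w s) (b + 1)) q + coeff (gain d r * be r) False r (private_index r (w r) (b + 1)) q"
  show ?thesis unfolding backward_ok_def
  proof (rule decoding_step_bound[where b="b + 1" and d=d and a="?a"])
    show "common_index (w s) (b + 1) \<in> {1..A}" using common_index_bounds[OF b] .
    show "1 + (\<Sum>q\<in>ids. (cmod (?a q))\<^sup>2) \<le> common_var d"
      using sum_coeff_add_norm[of False s False r] by (simp add: common_var_def add.assoc)
    show "ideal_out \<theta> w z d (b + 1) p - gain d s * al s * cw \<theta> True s (common_index (w s) (b + 2)) p
      = z (d, (b + 1) * n + p + 1) + gain d r * al r * cw \<theta> True r (common_index (w s) (b + 1)) p + (\<Sum>q\<in>ids. ?a q * \<theta> p q)" for \<theta> z p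
      by (simp add: distrib_right sum.distrib sum_coeff index_le ideal_out_def signal_def)
        (simp add: algebra_simps)
  qed (use b N bs in \<open>auto simp: D_def coeff_def\<close>)
qed

lemma private_step_bound:
  assumes b: "b < D" and N: "B * n \<le> N"
  shows "(\<integral>\<^sup>+ z. \<integral>\<^sup>+ \<theta>. of_bool (\<not> private_ok \<theta> w z d b) \<partial>codebooks \<partial>noise_space N)
     \<le> ennreal (step_bound e (C d) (private_var d) ((cmod (gd * be d))\<^sup>2) n)"
proof -
  have bs: "book_size False d = C d" by (simp add: book_size_def)
  let ?o = "other d"
  let ?a = "coeff (gc * be ?o) False ?o (private_index ?o (w ?o) b)"
  \<comment> \<open>Regroups the users from source and relay into own and interfering transmitter of
    receiver \<open>d\<close>.\<close>
  have two: "f s + f r = f d + f ?o" for f :: "user \<Rightarrow> complex"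
    by (cases "d = r") (auto dest: user_eq_other)
  have out: "ideal_out \<theta> w z d b p - gain d r * al r * cw \<theta> True r (common_index (w s) b) p
        - gain d s * al s * cw \<theta> True s (common_index (w s) (b + 1)) p
      = z (d, b * n + p + 1) + gd * be d * cw \<theta> False d (private_index d (w d) b) p + (\<Sum>q\<in>ids. ?a q * \<theta> p q)" for \<theta> z p
  proof -
    have "ideal_out \<theta> w z d b p - gain d r * al r * cw \<theta> True r (common_index (w s) b) p
        - gain d s * al s * cw \<theta> True s (common_index (w s) (b + 1)) p
      = z (d, b * n + p + 1) + (gain d s * be s * cw \<theta> False s (private_index s (w s) b) p + gain d r * be r * cw \<theta> False r (private_index r (w r) b) p)"
      by (simp add: ideal_out_def signal_def algebra_simps)
    also have "gain d s * be s * cw \<theta> False s (private_index s (w s) b) p + gain d r * be r * cw \<theta> False r (private_index r (w r) b) p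
      = gain d d * be d * cw \<theta> False d (private_index d (w d) b) p + gain d ?o * be ?o * cw \<theta> False ?o (private_index ?o (w ?o) b) p"
      by (rule two[of "\<lambda>t. gain d t * be t * cw \<theta> False t (private_index t (w t) b) p"])
    finally show ?thesis by (simp add: sum_coeff index_le gain_self gain_other)
  qed
  show ?thesis unfolding private_ok_def
  proof (rule decoding_step_bound[where b=b and d=d and a="?a"])
    show "private_index d (w d) b \<in> {1..C d}" using private_index_bounds[OF b] .
    show "1 + (\<Sum>q\<in>ids. (cmod (?a q))\<^sup>2) \<le> private_var d"
      using sum_coeff_norm by (simp add: private_var_def)
  qed (use b N out bs in \<open>auto simp: D_def coeff_def\<close>)
qed

end

section \<open>Power of random codes\<close>

text \<open>Forms with disjoint supports are functions of disjoint groups of coordinates, hence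
  independent.\<close>

lemma nn_integral_linear_comb_sq_prod:
  fixes a b :: "'q \<Rightarrow> complex"
  assumes Q: "finite Q" and disj: "\<And>q. q \<in> Q \<Longrightarrow> a q = 0 \<or> b q = 0"
  shows "(\<integral>\<^sup>+ g. ennreal ((cmod (\<Sum>q\<in>Q. a q * g q))\<^sup>2 * (cmod (\<Sum>q\<in>Q. b q * g q))\<^sup>2) \<partial>PiM Q (\<lambda>_. std_complex_normal))
    = ennreal ((\<Sum>q\<in>Q. (cmod (a q))\<^sup>2) * (\<Sum>q\<in>Q. (cmod (b q))\<^sup>2))"
proof -
  let ?N = "\<lambda>I. PiM I (\<lambda>_. std_complex_normal)"
  define I where "I = {q \<in> Q. a q \<noteq> 0}"
  define J where "J = Q - I"
  have IJ: "I \<inter> J = {}" "finite I" "finite J" and QIJ: "Q = I \<union> J" using Q by (auto simp: I_def J_def)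
  have sub: "I \<subseteq> Q" "J \<subseteq> Q" by (auto simp: I_def J_def)
  have aJ: "\<And>q. q \<in> Q - I \<Longrightarrow> a q = 0" and bI: "\<And>q. q \<in> Q - J \<Longrightarrow> b q = 0"
    using disj by (auto simp: I_def J_def)
  have sa: "(\<Sum>q\<in>Q. a q * g q) = (\<Sum>q\<in>I. a q * g q)" and sb: "(\<Sum>q\<in>Q. b q * g q) = (\<Sum>q\<in>J. b q * g q)" for g
    using aJ bI sub Q by (auto intro!: sum.mono_neutral_right)
  have na: "(\<Sum>q\<in>Q. (cmod (a q))\<^sup>2) = (\<Sum>q\<in>I. (cmod (a q))\<^sup>2)" and nb: "(\<Sum>q\<in>Q. (cmod (b q))\<^sup>2) = (\<Sum>q\<in>J. (cmod (b q))\<^sup>2)"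
    using aJ bI sub Q by (auto intro!: sum.mono_neutral_right)
  have m: "(\<lambda>g. \<Sum>q\<in>K. c q * g q) \<in> borel_measurable (?N L)" if "K \<subseteq> L" for K L and c :: "'q \<Rightarrow> complex"
    using that by (intro borel_measurable_sum borel_measurable_times borel_measurable_const measurable_component_std_complex_normal) auto
  have m': "(\<lambda>g. ennreal ((cmod (\<Sum>q\<in>K. c q * g q))\<^sup>2)) \<in> borel_measurable (?N L)" if "K \<subseteq> L" for K L and c :: "'q \<Rightarrow> complex"
    using m[OF that] by measurable
  have "(\<integral>\<^sup>+ g. ennreal ((cmod (\<Sum>q\<in>Q. a q * g q))\<^sup>2 * (cmod (\<Sum>q\<in>Q. b q * g q))\<^sup>2) \<partial>?N Q)
    = (\<integral>\<^sup>+ g. ennreal ((cmod (\<Sum>q\<in>I. a q * g q))\<^sup>2) * ennreal ((cmod (\<Sum>q\<in>J. b q * g q))\<^sup>2) \<partial>?N (I \<union> J))"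
    unfolding sa sb QIJ[symmetric] by (simp add: ennreal_mult)
  also have "\<dots> = (\<integral>\<^sup>+ x. \<integral>\<^sup>+ y. ennreal ((cmod (\<Sum>q\<in>I. a q * merge I J (x, y) q))\<^sup>2) * ennreal ((cmod (\<Sum>q\<in>J. b q * merge I J (x, y) q))\<^sup>2) \<partial>?N J \<partial>?N I)"
    by (intro std_complex_normal_prod.product_nn_integral_fold IJ borel_measurable_times_ennreal m') auto
  also have "\<dots> = (\<integral>\<^sup>+ x. \<integral>\<^sup>+ y. ennreal ((cmod (\<Sum>q\<in>I. a q * x q))\<^sup>2) * ennreal ((cmod (\<Sum>q\<in>J. b q * y q))\<^sup>2) \<partial>?N J \<partial>?N I)"
  proof -
    have "(\<Sum>q\<in>I. a q * merge I J (x, y) q) = (\<Sum>q\<in>I. a q * x q)" "(\<Sum>q\<in>J. b q * merge I J (x, y) q) = (\<Sum>q\<in>J. b q * y q)" for x y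
      using IJ by (auto intro!: sum.cong)
    then show ?thesis by simp
  qed
  also have "\<dots> = (\<integral>\<^sup>+ x. ennreal ((cmod (\<Sum>q\<in>I. a q * x q))\<^sup>2) \<partial>?N I) * (\<integral>\<^sup>+ y. ennreal ((cmod (\<Sum>q\<in>J. b q * y q))\<^sup>2) \<partial>?N J)"
    by (simp add: nn_integral_cmult[OF m'[OF order_refl]] nn_integral_multc[OF m'[OF order_refl]])
  also have "\<dots> = ennreal (\<Sum>q\<in>Q. (cmod (a q))\<^sup>2) * ennreal (\<Sum>q\<in>Q. (cmod (b q))\<^sup>2)"
    using nn_integral_norm_square_linear_comb[OF IJ(2), of 0 a] nn_integral_norm_square_linear_comb[OF IJ(3), of 0 b]
    by (simp add: na nb)
  finally show ?thesis by (simp add: ennreal_mult sum_nonneg)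
qed

lemma square_le_exp: "0 \<le> (x::real) \<Longrightarrow> x\<^sup>2 \<le> 8 * exp (x / 2)"
  using exp_lower_Taylor_quadratic[of "x / 2"] by (simp add: power_divide)

text \<open>A fourth moment from an exponential one: \<open>square_le_exp\<close> is applied to the
  squared modulus divided by its mean \<open>A\<close>, whose exponential moment at
  \<open>1 / 2\<close> is 2. The constant is generous; a complex Gaussian of variance
  \<open>A\<close> has fourth moment \<open>2 * A\<^sup>2\<close>.\<close>

lemma nn_integral_linear_comb_fourth_moment:
  fixes a :: "'q \<Rightarrow> complex"
  assumes Q: "finite Q" and p: "(\<Sum>q\<in>Q. (cmod (a q))\<^sup>2) \<le> p"
  shows "(\<integral>\<^sup>+ g. ennreal (((cmod (\<Sum>q\<in>Q. a q * g q))\<^sup>2)\<^sup>2) \<partial>PiM Q (\<lambda>_. std_complex_normal)) \<le> ennreal (16 * p\<^sup>2)"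
proof -
  define A where "A = (\<Sum>q\<in>Q. (cmod (a q))\<^sup>2)"
  have A0: "A \<ge> 0" by (simp add: A_def sum_nonneg)
  have Ap: "A\<^sup>2 \<le> p\<^sup>2" using p A0 by (intro power_mono) (auto simp: A_def)
  let ?M = "PiM Q (\<lambda>_. std_complex_normal)"
  have m[measurable]: "(\<lambda>g. \<Sum>q\<in>Q. a q * g q) \<in> borel_measurable ?M"
    by (intro borel_measurable_sum borel_measurable_times borel_measurable_const measurable_component_std_complex_normal) auto
  show ?thesis
  proof (cases "A = 0")
    case True
    then have "\<And>q. q \<in> Q \<Longrightarrow> a q = 0" using Q by (simp add: A_def sum_nonneg_eq_0_iff)
    then have "(\<Sum>q\<in>Q. a q * g q) = 0" for g by simp
    then show ?thesis by simp
  next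
    case False
    then have A: "A > 0" using A0 by simp
    have "(\<integral>\<^sup>+ g. ennreal (((cmod (\<Sum>q\<in>Q. a q * g q))\<^sup>2)\<^sup>2) \<partial>?M)
      \<le> (\<integral>\<^sup>+ g. ennreal (8 * A\<^sup>2) * ennreal (exp (1 / (2 * A) * (cmod (0 + (\<Sum>q\<in>Q. a q * g q)))\<^sup>2)) \<partial>?M)"
    proof (rule nn_integral_mono)
      fix g
      let ?x = "(cmod (\<Sum>q\<in>Q. a q * g q))\<^sup>2"
      have "(?x / A)\<^sup>2 \<le> 8 * exp (?x / A / 2)" using A by (intro square_le_exp) auto
      then have "?x\<^sup>2 \<le> 8 * A\<^sup>2 * exp (1 / (2 * A) * ?x)" using A by (simp add: power_divide field_simps)
      then show "ennreal (?x\<^sup>2) \<le> ennreal (8 * A\<^sup>2) * ennreal (exp (1 / (2 * A) * (cmod (0 + (\<Sum>q\<in>Q. a q * g q)))\<^sup>2))"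
        by (simp add: ennreal_mult[symmetric] ennreal_leI)
    qed
    also have "\<dots> = ennreal (8 * A\<^sup>2) * ennreal (exp (1 / (2 * A) * (cmod 0)\<^sup>2 / (1 - 1 / (2 * A) * A)) / (1 - 1 / (2 * A) * A))"
      using A by (subst nn_integral_cmult, measurable, subst nn_integral_exp_linear_comb[OF Q]) (simp_all add: A_def[symmetric])
    also have "exp (1 / (2 * A) * (cmod 0)\<^sup>2 / (1 - 1 / (2 * A) * A)) / (1 - 1 / (2 * A) * A) = 2"
      using A by simp
    also have "ennreal (8 * A\<^sup>2) * ennreal 2 = ennreal (16 * A\<^sup>2)"
      by (subst ennreal_mult[symmetric]) auto
    also have "\<dots> \<le> ennreal (16 * p\<^sup>2)" using Ap by (intro ennreal_leI) simp
    finally show ?thesis .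
  qed
qed

text \<open>Chebyshev's inequality for the power of random codewords: two linear forms are independent unless
  they share a coordinate.\<close>

lemma codeword_power_concentration:
  fixes a :: "'w \<Rightarrow> 'q \<Rightarrow> complex" and \<kappa> p d :: real
  assumes Q: "finite Q" and W: "finite W" "W \<noteq> {}" and p: "\<And>w. w \<in> W \<Longrightarrow> (\<Sum>q\<in>Q. (cmod (a w q))\<^sup>2) \<le> p"
    and d: "d > 0"
    and K: "real (card {(w, w') \<in> W \<times> W. \<exists>q\<in>Q. a w q \<noteq> 0 \<and> a w' q \<noteq> 0}) \<le> \<kappa> * (card W)\<^sup>2"
  shows "(\<integral>\<^sup>+ g. of_bool ((\<Sum>w\<in>W. (cmod (\<Sum>q\<in>Q. a w q * g q))\<^sup>2) > (p + d) * card W) \<partial>PiM Q (\<lambda>_. std_complex_normal))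
    \<le> ennreal (16 * p\<^sup>2 * \<kappa> / d\<^sup>2)"
proof -
  let ?M = "PiM Q (\<lambda>_. std_complex_normal)"
  define f where "f = (\<lambda>w g. (cmod (\<Sum>q\<in>Q. a w q * g q))\<^sup>2)"
  define P where "P = (\<lambda>w. \<Sum>q\<in>Q. (cmod (a w q))\<^sup>2)"
  define S where "S = (\<lambda>g. \<Sum>w\<in>W. f w g)"
  define c where "c = (\<Sum>w\<in>W. P w)"
  \<comment> \<open>Pairs of forms that share a coordinate: independence fails for them, and the
    fourth-moment bound takes over.\<close>
  define Col where "Col = {(w, w') \<in> W \<times> W. \<exists>q\<in>Q. a w q \<noteq> 0 \<and> a w' q \<noteq> 0}"
  have f0: "f w g \<ge> 0" for w g by (simp add: f_def)
  have P0: "P w \<ge> 0" for w by (simp add: P_def sum_nonneg)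
  have c0: "c \<ge> 0" by (simp add: c_def P0 sum_nonneg)
  have cp: "c \<le> p * card W" using sum_bounded_above[of W P p] p by (simp add: c_def P_def mult.commute)
  have cW: "real (card W) > 0" using W by (simp add: card_gt_0_iff)
  have m[measurable]: "f w \<in> borel_measurable ?M" for w
  proof -
    have [measurable]: "(\<lambda>g. \<Sum>q\<in>Q. a w q * g q) \<in> borel_measurable ?M"
      by (intro borel_measurable_sum borel_measurable_times borel_measurable_const measurable_component_std_complex_normal) auto
    show ?thesis unfolding f_def by measurable
  qed
  have Sm[measurable]: "S \<in> borel_measurable ?M" unfolding S_def by measurable
  have S0: "S g \<ge> 0" for g by (simp add: S_def f0 sum_nonneg)
  have E1: "(\<integral>\<^sup>+ g. ennreal (f w g) \<partial>?M) = ennreal (P w)" for w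
    using nn_integral_norm_square_linear_comb[OF Q, of 0 "a w"] by (simp add: f_def P_def)
  have E2: "(\<integral>\<^sup>+ g. ennreal (f w g * f w' g) \<partial>?M) \<le> ennreal (P w * P w' + of_bool ((w, w') \<in> Col) * (16 * p\<^sup>2))"
    if w: "w \<in> W" "w' \<in> W" for w w'
  proof (cases "(w, w') \<in> Col")
    case False
    then have "\<And>q. q \<in> Q \<Longrightarrow> a w q = 0 \<or> a w' q = 0" using w by (auto simp: Col_def)
    from nn_integral_linear_comb_sq_prod[OF Q this] show ?thesis using False by (simp add: f_def P_def)
  next
    case True
    have "(\<integral>\<^sup>+ g. ennreal (f w g * f w' g) \<partial>?M) \<le> (\<integral>\<^sup>+ g. ennreal (1 / 2) * (ennreal ((f w g)\<^sup>2) + ennreal ((f w' g)\<^sup>2)) \<partial>?M)"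
    proof (rule nn_integral_mono)
      fix g
      have "f w g * f w' g \<le> 1 / 2 * ((f w g)\<^sup>2 + (f w' g)\<^sup>2)"
        using sum_squares_bound[of "f w g" "f w' g"] by simp
      then have "ennreal (f w g * f w' g) \<le> ennreal (1 / 2 * ((f w g)\<^sup>2 + (f w' g)\<^sup>2))" by (rule ennreal_leI)
      also have "\<dots> = ennreal (1 / 2) * (ennreal ((f w g)\<^sup>2) + ennreal ((f w' g)\<^sup>2))"
        by (subst ennreal_mult') (simp_all add: ennreal_plus)
      finally show "ennreal (f w g * f w' g) \<le> ennreal (1 / 2) * (ennreal ((f w g)\<^sup>2) + ennreal ((f w' g)\<^sup>2))" .
    qed
    also have "\<dots> = ennreal (1 / 2) * ((\<integral>\<^sup>+ g. ennreal ((f w g)\<^sup>2) \<partial>?M) + (\<integral>\<^sup>+ g. ennreal ((f w' g)\<^sup>2) \<partial>?M))"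
      by (subst nn_integral_cmult, measurable) (subst nn_integral_add, auto)
    also have "\<dots> \<le> ennreal (1 / 2) * (ennreal (16 * p\<^sup>2) + ennreal (16 * p\<^sup>2))"
      unfolding f_def by (intro mult_left_mono add_mono nn_integral_linear_comb_fourth_moment[OF Q] p w) auto
    also have "\<dots> = ennreal (1 / 2 * (16 * p\<^sup>2 + 16 * p\<^sup>2))"
    proof -
      have "ennreal (1 / 2 * (x + x)) = ennreal (1 / 2) * (ennreal x + ennreal x)" if "x \<ge> 0" for x
        using that ennreal_mult'[of "1 / 2" "x + x"] ennreal_plus[of x x] by (simp only:)
      from this[of "16 * p\<^sup>2"] show ?thesis by (simp only: zero_le_mult_iff zero_le_power2) simp
    qed
    also have "\<dots> = ennreal (16 * p\<^sup>2)" by simp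
    also have "\<dots> \<le> ennreal (P w * P w' + of_bool ((w, w') \<in> Col) * (16 * p\<^sup>2))"
      using True P0 by (intro ennreal_leI) simp
    finally show ?thesis .
  qed
  have ES: "(\<integral>\<^sup>+ g. ennreal (S g) \<partial>?M) = ennreal c"
  proof -
    have "(\<integral>\<^sup>+ g. ennreal (S g) \<partial>?M) = (\<integral>\<^sup>+ g. (\<Sum>w\<in>W. ennreal (f w g)) \<partial>?M)"
      by (simp add: S_def sum_ennreal f0)
    also have "\<dots> = (\<Sum>w\<in>W. ennreal (P w))" by (simp add: nn_integral_sum E1)
    finally show ?thesis by (simp add: c_def sum_ennreal P0)
  qed
  have fin: "finite (W \<times> W)" using W by simp
  have ES2: "(\<integral>\<^sup>+ g. ennreal ((S g)\<^sup>2) \<partial>?M) \<le> ennreal (c\<^sup>2 + 16 * p\<^sup>2 * \<kappa> * (card W)\<^sup>2)"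
  proof -
    have "(\<integral>\<^sup>+ g. ennreal ((S g)\<^sup>2) \<partial>?M) = (\<integral>\<^sup>+ g. (\<Sum>w\<in>W. \<Sum>w'\<in>W. ennreal (f w g * f w' g)) \<partial>?M)"
      by (simp add: S_def power2_eq_square sum_product sum_ennreal f0 sum_nonneg)
    also have "\<dots> = (\<Sum>w\<in>W. \<Sum>w'\<in>W. \<integral>\<^sup>+ g. ennreal (f w g * f w' g) \<partial>?M)"
      by (simp add: nn_integral_sum)
    also have "\<dots> \<le> (\<Sum>w\<in>W. \<Sum>w'\<in>W. ennreal (P w * P w' + of_bool ((w, w') \<in> Col) * (16 * p\<^sup>2)))"
      by (intro sum_mono E2)
    also have "\<dots> = ennreal (\<Sum>w\<in>W. \<Sum>w'\<in>W. P w * P w' + of_bool ((w, w') \<in> Col) * (16 * p\<^sup>2))"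
    proof -
      have "0 \<le> P w * P w' + of_bool ((w, w') \<in> Col) * (16 * p\<^sup>2)" for w w' using P0 by simp
      then show ?thesis by (simp add: sum_ennreal sum_nonneg del: ennreal_plus)
    qed
    also have "(\<Sum>w\<in>W. \<Sum>w'\<in>W. P w * P w' + of_bool ((w, w') \<in> Col) * (16 * p\<^sup>2))
      = c\<^sup>2 + (\<Sum>x\<in>W \<times> W. of_bool (x \<in> Col)) * (16 * p\<^sup>2)"
    proof -
      have "c\<^sup>2 = (\<Sum>w\<in>W. \<Sum>w'\<in>W. P w * P w')" by (simp add: c_def power2_eq_square sum_product)
      moreover have "(\<Sum>x\<in>W \<times> W. of_bool (x \<in> Col)) * (16 * p\<^sup>2) = (\<Sum>w\<in>W. \<Sum>w'\<in>W. of_bool ((w, w') \<in> Col) * (16 * p\<^sup>2))"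
        by (simp add: sum.cartesian_product sum_distrib_right case_prod_beta)
      ultimately show ?thesis by (simp only: sum.distrib)
    qed
    also have "(\<Sum>x\<in>W \<times> W. of_bool (x \<in> Col)) = real (card Col)"
    proof -
      have "(W \<times> W) \<inter> Col = Col" by (auto simp: Col_def)
      then show ?thesis using fin by (simp add: of_bool_def sum.If_cases)
    qed
    also have "ennreal (c\<^sup>2 + real (card Col) * (16 * p\<^sup>2)) \<le> ennreal (c\<^sup>2 + \<kappa> * (card W)\<^sup>2 * (16 * p\<^sup>2))"
      using K by (intro ennreal_leI add_left_mono mult_right_mono) (auto simp: Col_def)
    finally show ?thesis by (simp add: mult_ac)
  qed
  have k0: "\<kappa> \<ge> 0"
  proof -
    have "0 \<le> \<kappa> * (card W)\<^sup>2" using K order_trans[OF of_nat_0_le_iff] by blast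
    then show ?thesis using cW by (simp add: zero_le_mult_iff)
  qed
  \<comment> \<open>Truncated subtraction is avoided: \<open>2 * c\<^sup>2\<close> is added on both
    sides, where it equals \<open>2 * c\<close> times the mean of \<open>S\<close>, and is cancelled
    at the end.\<close>
  have var: "(\<integral>\<^sup>+ g. ennreal ((S g - c)\<^sup>2) \<partial>?M) \<le> ennreal (16 * p\<^sup>2 * \<kappa> * (card W)\<^sup>2)"
  proof -
    have "(\<integral>\<^sup>+ g. ennreal ((S g - c)\<^sup>2) \<partial>?M) + ennreal (2 * c\<^sup>2) = (\<integral>\<^sup>+ g. ennreal ((S g - c)\<^sup>2) \<partial>?M) + ennreal (2 * c) * (\<integral>\<^sup>+ g. ennreal (S g) \<partial>?M)"
      using c0 by (simp add: ES ennreal_mult[symmetric] power2_eq_square mult.assoc)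
    also have "\<dots> = (\<integral>\<^sup>+ g. ennreal ((S g - c)\<^sup>2) + ennreal (2 * c) * ennreal (S g) \<partial>?M)"
      by (subst nn_integral_add) (auto simp: nn_integral_cmult)
    also have "\<dots> = (\<integral>\<^sup>+ g. ennreal ((S g)\<^sup>2) + ennreal (c\<^sup>2) \<partial>?M)"
    proof (rule nn_integral_cong)
      fix g
      have "0 \<le> 2 * c" "0 \<le> S g" "0 \<le> 2 * c * S g" using c0 S0 by auto
      then have "ennreal ((S g - c)\<^sup>2) + ennreal (2 * c) * ennreal (S g) = ennreal ((S g - c)\<^sup>2 + 2 * c * S g)"
        by (simp only: ennreal_mult[symmetric] ennreal_plus zero_le_power2)
      also have "(S g - c)\<^sup>2 + 2 * c * S g = (S g)\<^sup>2 + c\<^sup>2" by (simp add: power2_diff)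
      finally show "ennreal ((S g - c)\<^sup>2) + ennreal (2 * c) * ennreal (S g) = ennreal ((S g)\<^sup>2) + ennreal (c\<^sup>2)"
        by simp
    qed
    also have "\<dots> = (\<integral>\<^sup>+ g. ennreal ((S g)\<^sup>2) \<partial>?M) + ennreal (c\<^sup>2)"
      using prob_space.emeasure_space_1[OF prob_space_PiM_std_complex_normal, of Q] by (subst nn_integral_add) auto
    also have "\<dots> \<le> ennreal (c\<^sup>2 + 16 * p\<^sup>2 * \<kappa> * (card W)\<^sup>2) + ennreal (c\<^sup>2)" by (intro add_right_mono ES2)
    also have "\<dots> = ennreal (16 * p\<^sup>2 * \<kappa> * (card W)\<^sup>2) + ennreal (2 * c\<^sup>2)"
      using k0 by (simp add: ennreal_plus[symmetric] del: ennreal_plus)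
    finally show ?thesis by (simp add: ennreal_add_left_cancel_le add.commute[of _ "ennreal (2 * c\<^sup>2)"] del: ennreal_plus)
  qed
  have "(\<integral>\<^sup>+ g. of_bool (S g > (p + d) * card W) \<partial>?M)
     \<le> (\<integral>\<^sup>+ g. ennreal (1 / (d * card W)\<^sup>2) * ennreal ((S g - c)\<^sup>2) \<partial>?M)"
  proof (rule nn_integral_mono)
    fix g
    show "(of_bool (S g > (p + d) * card W) :: ennreal) \<le> ennreal (1 / (d * card W)\<^sup>2) * ennreal ((S g - c)\<^sup>2)"
    proof (cases "S g > (p + d) * card W")
      case True
      then have "S g - c \<ge> d * card W" using cp by (simp add: algebra_simps)
      then have "(S g - c)\<^sup>2 \<ge> (d * card W)\<^sup>2" using d cW by (intro power_mono) auto
      moreover have "(d * card W)\<^sup>2 > 0" using d cW by simp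
      ultimately have "1 \<le> 1 / (d * card W)\<^sup>2 * (S g - c)\<^sup>2" by (simp add: pos_le_divide_eq)
      then have "1 \<le> ennreal (1 / (d * card W)\<^sup>2 * (S g - c)\<^sup>2)" by simp
      then show ?thesis using True by (simp add: ennreal_mult[symmetric])
    qed simp
  qed
  also have "\<dots> = ennreal (1 / (d * card W)\<^sup>2) * (\<integral>\<^sup>+ g. ennreal ((S g - c)\<^sup>2) \<partial>?M)"
    by (rule nn_integral_cmult) measurable
  also have "\<dots> \<le> ennreal (1 / (d * card W)\<^sup>2) * ennreal (16 * p\<^sup>2 * \<kappa> * (card W)\<^sup>2)"
    by (intro mult_left_mono var) auto
  also have "\<dots> = ennreal (16 * p\<^sup>2 * \<kappa> / d\<^sup>2)"
    using cW k0 by (simp add: ennreal_mult[symmetric] power_mult_distrib)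
  finally show ?thesis by (simp add: S_def f_def)
qed

lemma card_message_pairs_component:
  "card {w \<in> message_pairs N R. w v \<in> S} = card (messages N (rate R v) \<inter> S) * card (messages N (rate R (other v)))"
proof -
  have "{w \<in> message_pairs N R. w v \<in> S} = (\<Pi>\<^sub>E u\<in>UNIV. if u = v then messages N (rate R v) \<inter> S else messages N (rate R u))"
    by (auto simp: message_pairs_def PiE_def Pi_def split: if_splits)
  then have "card {w \<in> message_pairs N R. w v \<in> S} = (\<Prod>u\<in>UNIV. card (if u = v then messages N (rate R v) \<inter> S else messages N (rate R u)))"
    by (simp add: card_PiE)
  also have "\<dots> = card (messages N (rate R v) \<inter> S) * card (messages N (rate R (other v)))"
    by (cases v) (simp_all add: UNIV_user)
  finally show ?thesis .
qed

lemma card_message_pairs_other: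
  "card (message_pairs N R) = card (messages N (rate R v)) * card (messages N (rate R (other v)))"
  using card_message_pairs_component[of N R v UNIV] by simp

text \<open>For a fixed first pair, the second must have its component \<open>v\<close> in the same
  fibre of \<open>\<phi>\<close>, which holds at most the fraction \<open>\<kappa>\<close> of the
  messages. The value 0 means silence, on which all messages may agree, and is therefore
  excluded.\<close>

lemma card_collisions_le:
  fixes \<kappa> :: real
  assumes "\<And>x. x \<ge> 1 \<Longrightarrow> real (card {m \<in> messages N (rate R v). \<phi> m = x}) \<le> \<kappa> * card (messages N (rate R v))"
    and k: "\<kappa> \<ge> 0"
  shows "real (card {(w, w') \<in> message_pairs N R \<times> message_pairs N R. \<phi> (w v) = \<phi> (w' v) \<and> \<phi> (w v) \<ge> (1 :: nat)}) \<le> \<kappa> * (card (message_pairs N R))\<^sup>2"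
proof -
  let ?W = "message_pairs N R"
  have fib: "real (card {w' \<in> ?W. \<phi> (w v) = \<phi> (w' v) \<and> \<phi> (w v) \<ge> 1}) \<le> \<kappa> * card ?W" for w
  proof (cases "\<phi> (w v) \<ge> 1")
    case True
    have "{w' \<in> ?W. \<phi> (w v) = \<phi> (w' v) \<and> \<phi> (w v) \<ge> 1} = {w' \<in> ?W. w' v \<in> {m. \<phi> m = \<phi> (w v)}}" using True by auto
    then have "real (card {w' \<in> ?W. \<phi> (w v) = \<phi> (w' v) \<and> \<phi> (w v) \<ge> 1})
      = real (card {m \<in> messages N (rate R v). \<phi> m = \<phi> (w v)}) * card (messages N (rate R (other v)))"
      by (simp only: card_message_pairs_component) (simp add: Int_def)
    also have "\<dots> \<le> \<kappa> * card (messages N (rate R v)) * card (messages N (rate R (other v)))"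
      using assms(1)[OF True] by (intro mult_right_mono) auto
    finally show ?thesis by (simp add: card_message_pairs_other[of N R v] mult.assoc)
  qed (use k in simp)
  have "{(w, w') \<in> ?W \<times> ?W. \<phi> (w v) = \<phi> (w' v) \<and> \<phi> (w v) \<ge> 1} = (SIGMA w:?W. {w' \<in> ?W. \<phi> (w v) = \<phi> (w' v) \<and> \<phi> (w v) \<ge> 1})"
    by auto
  then have "real (card {(w, w') \<in> ?W \<times> ?W. \<phi> (w v) = \<phi> (w' v) \<and> \<phi> (w v) \<ge> 1}) = (\<Sum>w\<in>?W. real (card {w' \<in> ?W. \<phi> (w v) = \<phi> (w' v) \<and> \<phi> (w v) \<ge> 1}))"
    by (simp add: card_SigmaI)
  also have "\<dots> \<le> (\<Sum>w\<in>?W. \<kappa> * card ?W)" by (intro sum_mono fib)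
  finally show ?thesis by (simp add: power2_eq_square mult_ac)
qed

section \<open>Average error of the block Markov code\<close>

context block_markov
begin

lemma measurable_joint:
  assumes "p < n" "i \<le> book_size c u"
  shows "(\<lambda>x. cw (snd x) c u i p) \<in> borel_measurable (noise_space N \<Otimes>\<^sub>M codebooks)"
  using measurable_compose[OF measurable_snd measurable_cw[OF assms]] .

lemma measurable_joint_signal:
  assumes "p < n" "i \<le> book_size True u" "j \<le> book_size False u"
  shows "(\<lambda>x. signal (snd x) u i j p) \<in> borel_measurable (noise_space N \<Otimes>\<^sub>M codebooks)"
  unfolding signal_def using measurable_joint[OF assms(1,2), of N] measurable_joint[OF assms(1,3), of N]
  by (intro borel_measurable_add borel_measurable_times borel_measurable_const)

lemma measurable_joint_ideal_out:
  assumes "p < n" "b < B" "B * n \<le> N"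
  shows "(\<lambda>x. ideal_out (snd x) w (fst x) d b p) \<in> borel_measurable (noise_space N \<Otimes>\<^sub>M codebooks)"
proof -
  have "b * n + p + 1 \<in> {1..N}" using block_times(1)[OF assms(2,3), of d] assms(1) by auto
  then have "(\<lambda>x. (fst x) (d, b * n + p + 1)) \<in> borel_measurable (noise_space N \<Otimes>\<^sub>M codebooks)"
    by (rule measurable_compose[OF measurable_fst measurable_noise_component])
  then show ?thesis unfolding ideal_out_def
    by (intro borel_measurable_add borel_measurable_times borel_measurable_const measurable_joint_signal index_le assms(1))
qed

lemma pred_steps_ok:
  assumes b: "b < D" and N: "B * n \<le> N"
  shows "Measurable.pred (noise_space N \<Otimes>\<^sub>M codebooks) (\<lambda>x. relay_ok (snd x) w (fst x) b)"
    "Measurable.pred (noise_space N \<Otimes>\<^sub>M codebooks) (\<lambda>x. forward_ok (snd x) w (fst x) d b)"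
    "Measurable.pred (noise_space N \<Otimes>\<^sub>M codebooks) (\<lambda>x. backward_ok (snd x) w (fst x) d b)"
    "Measurable.pred (noise_space N \<Otimes>\<^sub>M codebooks) (\<lambda>x. private_ok (snd x) w (fst x) d b)"
proof -
  have bB: "b < B" "b + 1 < B" using b by (auto simp: D_def)
  have bs: "i \<in> {1..A} \<Longrightarrow> i \<le> book_size True u" "i \<in> {1..C u} \<Longrightarrow> i \<le> book_size False u" for i u by (auto simp: book_size_def)
  note m = borel_measurable_diff borel_measurable_times borel_measurable_const measurable_joint_signal
    measurable_joint measurable_joint_ideal_out index_le N bB
  show "Measurable.pred (noise_space N \<Otimes>\<^sub>M codebooks) (\<lambda>x. relay_ok (snd x) w (fst x) b)"
    unfolding relay_ok_def by (rule pred_decodes_to) (use bs common_index_bounds[OF b] in \<open>auto intro!: m\<close>)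
  show "Measurable.pred (noise_space N \<Otimes>\<^sub>M codebooks) (\<lambda>x. forward_ok (snd x) w (fst x) d b)"
    unfolding forward_ok_def by (rule pred_decodes_to) (use bs common_index_bounds[OF b] in \<open>auto intro!: m\<close>)
  show "Measurable.pred (noise_space N \<Otimes>\<^sub>M codebooks) (\<lambda>x. backward_ok (snd x) w (fst x) d b)"
    unfolding backward_ok_def by (rule pred_decodes_to) (use bs common_index_bounds[OF b] bB(2) in \<open>auto intro!: m\<close>)
  show "Measurable.pred (noise_space N \<Otimes>\<^sub>M codebooks) (\<lambda>x. private_ok (snd x) w (fst x) d b)"
    unfolding private_ok_def by (rule pred_decodes_to) (use bs private_index_bounds[OF b] in \<open>auto intro!: m\<close>)
qed

definition receiver_ok where
  "receiver_ok \<theta> w z d b \<longleftrightarrow> (if fw d then forward_ok \<theta> w z d b else backward_ok \<theta> w z d b)"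

definition receiver_bound :: "user \<Rightarrow> real" where
  "receiver_bound d = step_bound e A (common_var d) ((cmod (if fw d then gain d s * al s else gain d r * al r))\<^sup>2) n"

definition err_bound :: real where
  "err_bound = D * (step_bound e A relay_var ((cmod (gain k s * al s))\<^sup>2) n
     + (\<Sum>d\<in>UNIV. receiver_bound d + step_bound e (C d) (private_var d) ((cmod (gd * be d))\<^sup>2) n))"

lemma all_ok_iff:
  "all_ok \<theta> w z \<longleftrightarrow> (\<forall>b\<in>{..<D}. relay_ok \<theta> w z b \<and> (\<forall>d\<in>UNIV. receiver_ok \<theta> w z d b \<and> private_ok \<theta> w z d b))"
  by (auto simp: all_ok_def receiver_ok_def)

lemma pred_receiver_ok:
  "b < D \<Longrightarrow> B * n \<le> N \<Longrightarrow> Measurable.pred (noise_space N \<Otimes>\<^sub>M codebooks) (\<lambda>x. receiver_ok (snd x) w (fst x) d b)"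
  unfolding receiver_ok_def using pred_steps_ok(2,3) by (cases "fw d") auto

lemma receiver_step_bound:
  "b < D \<Longrightarrow> B * n \<le> N \<Longrightarrow> (\<integral>\<^sup>+ z. \<integral>\<^sup>+ \<theta>. of_bool (\<not> receiver_ok \<theta> w z d b) \<partial>codebooks \<partial>noise_space N) \<le> ennreal (receiver_bound d)"
  unfolding receiver_ok_def receiver_bound_def using forward_step_bound backward_step_bound by (cases "fw d") auto

lemma pred_all_ok:
  assumes "B * n \<le> N"
  shows "Measurable.pred (noise_space N \<Otimes>\<^sub>M codebooks) (\<lambda>x. all_ok (snd x) w (fst x))"
  unfolding all_ok_iff
  by (intro pred_intros_finite(3) pred_intros_logic pred_steps_ok(1,4) pred_receiver_ok) (use assms in auto)

lemma step_bound_nonneg: "v > 0 \<Longrightarrow> H \<ge> 0 \<Longrightarrow> step_bound e M v H n \<ge> 0"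
  using e by (auto simp: step_bound_def intro!: add_nonneg_nonneg mult_nonneg_nonneg zero_le_power divide_nonneg_pos add_pos_nonneg)

lemma var_pos: "relay_var > 0" "common_var d > 0" "private_var d > 0"
  by (auto simp: relay_var_def common_var_def private_var_def intro!: add_pos_nonneg)

text \<open>A union bound over blocks and decoding steps. Fubini is applied because the single steps
  were bounded with the noise integrated outside, whereas the choice of a codebook asks for it
  inside.\<close>

lemma random_code_error:
  assumes N: "B * n \<le> N"
  shows "(\<integral>\<^sup>+ \<theta>. \<integral>\<^sup>+ z. of_bool (\<not> all_ok \<theta> w z) \<partial>noise_space N \<partial>codebooks) \<le> ennreal err_bound"
proof -
  interpret cb: prob_space codebooks by (rule prob_space_codebooks)
  interpret pair_sigma_finite "noise_space N" codebooks ..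
  let ?M = "noise_space N \<Otimes>\<^sub>M codebooks"
  have m_all: "(\<lambda>(z, \<theta>). of_bool (\<not> all_ok \<theta> w z) :: ennreal) \<in> borel_measurable ?M"
    unfolding case_prod_beta by (intro borel_measurable_of_bool pred_intros_logic pred_all_ok N)
  have m1: "(\<lambda>x. of_bool (\<not> relay_ok (snd x) w (fst x) b) :: ennreal) \<in> borel_measurable ?M" if "b < D" for b
    by (intro borel_measurable_of_bool pred_intros_logic pred_steps_ok that N)
  have m2: "(\<lambda>x. of_bool (\<not> receiver_ok (snd x) w (fst x) d b) :: ennreal) \<in> borel_measurable ?M" if "b < D" for b d
    by (intro borel_measurable_of_bool pred_intros_logic pred_receiver_ok that N)
  have m3: "(\<lambda>x. of_bool (\<not> private_ok (snd x) w (fst x) d b) :: ennreal) \<in> borel_measurable ?M" if "b < D" for b d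
    by (intro borel_measurable_of_bool pred_intros_logic pred_steps_ok that N)
  have m23: "(\<lambda>x. \<Sum>d\<in>UNIV. of_bool (\<not> receiver_ok (snd x) w (fst x) d b) + of_bool (\<not> private_ok (snd x) w (fst x) d b) :: ennreal) \<in> borel_measurable ?M" if "b < D" for b
    by (intro borel_measurable_sum borel_measurable_add m2 m3 that)
  have "(\<integral>\<^sup>+ \<theta>. \<integral>\<^sup>+ z. of_bool (\<not> all_ok \<theta> w z) \<partial>noise_space N \<partial>codebooks)
     = (\<integral>\<^sup>+ x. of_bool (\<not> all_ok (snd x) w (fst x)) \<partial>?M)"
    using nn_integral_snd[OF m_all] by (simp add: case_prod_beta')
  also have "\<dots> \<le> (\<integral>\<^sup>+ x. (\<Sum>b<D. of_bool (\<not> relay_ok (snd x) w (fst x) b)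
      + (\<Sum>d\<in>UNIV. of_bool (\<not> receiver_ok (snd x) w (fst x) d b) + of_bool (\<not> private_ok (snd x) w (fst x) d b))) \<partial>?M)"
  proof (rule nn_integral_mono)
    fix x
    let ?a = "\<lambda>b. of_bool (\<not> relay_ok (snd x) w (fst x) b) :: ennreal"
    let ?b = "\<lambda>b d. of_bool (\<not> receiver_ok (snd x) w (fst x) d b) + of_bool (\<not> private_ok (snd x) w (fst x) d b) :: ennreal"
    show "of_bool (\<not> all_ok (snd x) w (fst x)) \<le> (\<Sum>b<D. ?a b + (\<Sum>d\<in>UNIV. ?b b d))"
    proof (cases "all_ok (snd x) w (fst x)")
      case False
      then obtain b where b: "b < D" "\<not> relay_ok (snd x) w (fst x) b \<or> (\<exists>d. \<not> receiver_ok (snd x) w (fst x) d b \<or> \<not> private_ok (snd x) w (fst x) d b)"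
        unfolding all_ok_iff by auto
      have "1 \<le> ?a b + (\<Sum>d\<in>UNIV. ?b b d)"
        using b(2)
      proof
        assume "\<not> relay_ok (snd x) w (fst x) b"
        then have "1 \<le> ?a b" by simp
        then show ?thesis by (rule order_trans) (simp add: add_increasing2)
      next
        assume "\<exists>d. \<not> receiver_ok (snd x) w (fst x) d b \<or> \<not> private_ok (snd x) w (fst x) d b"
        then obtain d where "\<not> receiver_ok (snd x) w (fst x) d b \<or> \<not> private_ok (snd x) w (fst x) d b" by blast
        then have "1 \<le> ?b b d" by (auto simp: add_increasing add_increasing2)
        also have "?b b d \<le> (\<Sum>d\<in>UNIV. ?b b d)" by (intro member_le_sum) auto
        finally show ?thesis by (rule order_trans) (simp add: add_increasing)
      qed
      also have "\<dots> \<le> (\<Sum>b<D. ?a b + (\<Sum>d\<in>UNIV. ?b b d))"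
        using b(1) by (intro member_le_sum[where f="\<lambda>b. ?a b + (\<Sum>d\<in>UNIV. ?b b d)"]) auto
      finally show ?thesis using False by simp
    qed simp
  qed
  also have "\<dots> = (\<Sum>b<D. (\<integral>\<^sup>+ x. of_bool (\<not> relay_ok (snd x) w (fst x) b) \<partial>?M)
      + (\<Sum>d\<in>UNIV. (\<integral>\<^sup>+ x. of_bool (\<not> receiver_ok (snd x) w (fst x) d b) \<partial>?M) + (\<integral>\<^sup>+ x. of_bool (\<not> private_ok (snd x) w (fst x) d b) \<partial>?M)))"
  proof -
    have "(\<integral>\<^sup>+ x. of_bool (\<not> relay_ok (snd x) w (fst x) b)
      + (\<Sum>d\<in>UNIV. of_bool (\<not> receiver_ok (snd x) w (fst x) d b) + of_bool (\<not> private_ok (snd x) w (fst x) d b)) \<partial>?M)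
      = (\<integral>\<^sup>+ x. of_bool (\<not> relay_ok (snd x) w (fst x) b) \<partial>?M)
      + (\<Sum>d\<in>UNIV. (\<integral>\<^sup>+ x. of_bool (\<not> receiver_ok (snd x) w (fst x) d b) \<partial>?M) + (\<integral>\<^sup>+ x. of_bool (\<not> private_ok (snd x) w (fst x) d b) \<partial>?M))" if b: "b < D" for b
      using m1[OF b] m2[OF b] m3[OF b] m23[OF b] by (simp add: nn_integral_add nn_integral_sum)
    moreover have "(\<lambda>x. of_bool (\<not> relay_ok (snd x) w (fst x) b)
      + (\<Sum>d\<in>UNIV. of_bool (\<not> receiver_ok (snd x) w (fst x) d b) + of_bool (\<not> private_ok (snd x) w (fst x) d b)) :: ennreal) \<in> borel_measurable ?M" if b: "b < D" for b
      using m1[OF b] m23[OF b] by (intro borel_measurable_add)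
    ultimately show ?thesis by (subst nn_integral_sum) auto
  qed
  also have "\<dots> \<le> (\<Sum>b<D. ennreal (step_bound e A relay_var ((cmod (gain k s * al s))\<^sup>2) n)
      + (\<Sum>d\<in>UNIV. ennreal (receiver_bound d) + ennreal (step_bound e (C d) (private_var d) ((cmod (gd * be d))\<^sup>2) n)))"
  proof -
    have it: "(\<integral>\<^sup>+ x. f (fst x) (snd x) \<partial>?M) = (\<integral>\<^sup>+ z. \<integral>\<^sup>+ \<theta>. f z \<theta> \<partial>codebooks \<partial>noise_space N)"
      if "(\<lambda>x. f (fst x) (snd x)) \<in> borel_measurable ?M" for f :: "_ \<Rightarrow> _ \<Rightarrow> ennreal"
      using cb.nn_integral_fst[OF that] by simp
    show ?thesis
    proof (intro sum_mono add_mono)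
      fix b d assume "b \<in> {..<D}"
      then have b: "b < D" by simp
      show "(\<integral>\<^sup>+ x. of_bool (\<not> relay_ok (snd x) w (fst x) b) \<partial>?M) \<le> ennreal (step_bound e A relay_var ((cmod (gain k s * al s))\<^sup>2) n)"
        using it[of "\<lambda>z \<theta>. of_bool (\<not> relay_ok \<theta> w z b)", OF m1[OF b]] relay_step_bound[OF b N] by simp
      show "(\<integral>\<^sup>+ x. of_bool (\<not> receiver_ok (snd x) w (fst x) d b) \<partial>?M) \<le> ennreal (receiver_bound d)"
        using it[of "\<lambda>z \<theta>. of_bool (\<not> receiver_ok \<theta> w z d b)", OF m2[OF b]] receiver_step_bound[OF b N] by simp
      show "(\<integral>\<^sup>+ x. of_bool (\<not> private_ok (snd x) w (fst x) d b) \<partial>?M) \<le> ennreal (step_bound e (C d) (private_var d) ((cmod (gd * be d))\<^sup>2) n)"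
        using it[of "\<lambda>z \<theta>. of_bool (\<not> private_ok \<theta> w z d b)", OF m3[OF b]] private_step_bound[OF b N] by simp
    qed
  qed
  also have "\<dots> = ennreal err_bound"
  proof -
    have p: "0 \<le> step_bound e A relay_var ((cmod (gain k s * al s))\<^sup>2) n" "0 \<le> receiver_bound d"
      "0 \<le> step_bound e (C d) (private_var d) ((cmod (gd * be d))\<^sup>2) n" for d
      using var_pos step_bound_nonneg by (auto simp: receiver_bound_def)
    have 1: "(\<Sum>d\<in>UNIV. ennreal (receiver_bound d) + ennreal (step_bound e (C d) (private_var d) ((cmod (gd * be d))\<^sup>2) n))
      = ennreal (\<Sum>d\<in>UNIV. receiver_bound d + step_bound e (C d) (private_var d) ((cmod (gd * be d))\<^sup>2) n)"
      using p by (subst sum_ennreal[symmetric]) (auto simp: ennreal_plus)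
    have p2: "0 \<le> (\<Sum>d\<in>UNIV. receiver_bound d + step_bound e (C d) (private_var d) ((cmod (gd * be d))\<^sup>2) n)"
      using p by (intro sum_nonneg add_nonneg_nonneg)
    show ?thesis unfolding 1 ennreal_plus[OF p(1) p2, symmetric] err_bound_def
      by (simp add: ennreal_of_nat_eq_real_of_nat ennreal_mult' del: ennreal_plus)
  qed
  finally show ?thesis .
qed

section \<open>Power of the transmitted signals and choice of a codebook\<close>

lemma nn_integral_codebooks_component:
  assumes p: "p < n" and f: "f \<in> borel_measurable (PiM ids (\<lambda>_. std_complex_normal))"
  shows "(\<integral>\<^sup>+ \<theta>. f (\<theta> p) \<partial>codebooks) = (\<integral>\<^sup>+ g. f g \<partial>PiM ids (\<lambda>_. std_complex_normal))"
proof -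
  have "distr codebooks (PiM ids (\<lambda>_. std_complex_normal)) (\<lambda>\<theta>. \<theta> p) = PiM ids (\<lambda>_. std_complex_normal)"
    unfolding codebooks_def using p by (intro distr_PiM_component prob_space_PiM_std_complex_normal) auto
  then have "(\<integral>\<^sup>+ g. f g \<partial>PiM ids (\<lambda>_. std_complex_normal)) = (\<integral>\<^sup>+ g. f g \<partial>distr codebooks (PiM ids (\<lambda>_. std_complex_normal)) (\<lambda>\<theta>. \<theta> p))"
    by simp
  also have "\<dots> = (\<integral>\<^sup>+ \<theta>. f (\<theta> p) \<partial>codebooks)"
    using p f by (intro nn_integral_distr) (auto simp: codebooks_def)
  finally show ?thesis by simp
qed

text \<open>The common index that \<open>u\<close> is meant to send in block \<open>b\<close>; the
  relay lags one block behind the source.\<close>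

definition tx_common :: "user \<Rightarrow> (user \<Rightarrow> nat) \<Rightarrow> nat \<Rightarrow> nat" where
  "tx_common u w b = common_index (w s) (if u = s then b + 1 else b)"

definition tx_coeff :: "user \<Rightarrow> nat \<Rightarrow> (user \<Rightarrow> nat) \<Rightarrow> codeword_id \<Rightarrow> complex" where
  "tx_coeff u b w q = coeff (al u) True u (tx_common u w b) q + coeff (be u) False u (private_index u (w u) b) q"

lemma signal_eq_sum:
  "signal \<theta> u (tx_common u w b) (private_index u (w u) b) p = (\<Sum>q\<in>ids. tx_coeff u b w q * \<theta> p q)"
  unfolding signal_def tx_coeff_def by (simp add: distrib_right sum.distrib sum_coeff index_le tx_common_def)

lemma tx_coeff_norm: "(\<Sum>q\<in>ids. (cmod (tx_coeff u b w q))\<^sup>2) \<le> (al u)\<^sup>2 + (be u)\<^sup>2"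
  unfolding tx_coeff_def using sum_coeff_add_norm[of True u False u "al u" _ "be u"] by simp

text \<open>No digit of a uniform message takes a value with probability more than \<open>\<kappa>\<close>, except in
  codebooks that are not used.\<close>

definition spread :: "nat \<Rightarrow> real \<times> real \<Rightarrow> real \<Rightarrow> bool" where
  "spread N R \<kappa> \<longleftrightarrow>
    ((\<exists>u. al u \<noteq> 0) \<longrightarrow> (\<forall>b<D. \<forall>x. real (card {m \<in> messages N (rate R s). (m - 1) div base s ^ b mod A = x}) \<le> \<kappa> * card (messages N (rate R s)))) \<and>
    (\<forall>u. be u \<noteq> 0 \<longrightarrow> (\<forall>b<D. \<forall>x. real (card {m \<in> messages N (rate R u). (m - 1) div (base u ^ b * common_size u) mod C u = x}) \<le> \<kappa> * card (messages N (rate R u))))"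

text \<open>Signals of two message pairs share a letter only if the pairs agree in the common or in
  the private index sent by \<open>u\<close>, and each agreement has frequency at most
  \<open>\<kappa>\<close>.\<close>

lemma tx_collisions:
  assumes sp: "spread N R \<kappa>" and k: "\<kappa> \<ge> 0"
  shows "real (card {(w, w') \<in> message_pairs N R \<times> message_pairs N R. \<exists>q\<in>ids. tx_coeff u b w q \<noteq> 0 \<and> tx_coeff u b w' q \<noteq> 0})
     \<le> 2 * \<kappa> * (card (message_pairs N R))\<^sup>2"
proof -
  let ?W = "message_pairs N R"
  define b' where "b' = (if u = s then b + 1 else b)"
  define S1 where "S1 = {(w, w') \<in> ?W \<times> ?W. common_index (w s) b' = common_index (w' s) b' \<and> common_index (w s) b' \<ge> 1}"
  define S2 where "S2 = {(w, w') \<in> ?W \<times> ?W. private_index u (w u) b = private_index u (w' u) b \<and> private_index u (w u) b \<ge> 1}"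
  define S where "S = {(w, w') \<in> ?W \<times> ?W. \<exists>q\<in>ids. tx_coeff u b w q \<noteq> 0 \<and> tx_coeff u b w' q \<noteq> 0}"
  have fin: "finite S1" "finite S2" by (auto simp: S1_def S2_def intro: finite_subset[of _ "?W \<times> ?W"])
  have S1: "real (card S1) \<le> \<kappa> * (card ?W)\<^sup>2" if "al u \<noteq> 0"
    unfolding S1_def
  proof (rule card_collisions_le[OF _ k])
    fix x :: nat assume x: "x \<ge> 1"
    show "real (card {m \<in> messages N (rate R s). common_index m b' = x}) \<le> \<kappa> * card (messages N (rate R s))"
    proof (cases "1 \<le> b' \<and> b' \<le> D")
      case True
      then have "{m \<in> messages N (rate R s). common_index m b' = x} = {m \<in> messages N (rate R s). (m - 1) div base s ^ (b' - 1) mod A = x - 1}"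
        using x by (auto simp: common_index_def)
      moreover have "b' - 1 < D" using True by auto
      ultimately show ?thesis using sp that by (auto simp: spread_def)
    next
      case False
      then have "{m \<in> messages N (rate R s). common_index m b' = x} = {}" using x by (auto simp: common_index_def)
      then show ?thesis using k by (simp only:) simp
    qed
  qed
  have S2: "real (card S2) \<le> \<kappa> * (card ?W)\<^sup>2" if "be u \<noteq> 0"
    unfolding S2_def
  proof (rule card_collisions_le[OF _ k])
    fix x :: nat assume x: "x \<ge> 1"
    show "real (card {m \<in> messages N (rate R u). private_index u m b = x}) \<le> \<kappa> * card (messages N (rate R u))"
    proof (cases "b < D")
      case True
      then have "{m \<in> messages N (rate R u). private_index u m b = x} = {m \<in> messages N (rate R u). (m - 1) div (base u ^ b * common_size u) mod C u = x - 1}"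
        using x by (auto simp: private_index_def)
      then show ?thesis using sp that True by (auto simp: spread_def)
    next
      case False
      then have "{m \<in> messages N (rate R u). private_index u m b = x} = {}" using x by (auto simp: private_index_def)
      then show ?thesis using k by (simp only:) simp
    qed
  qed
  have sub: "S \<subseteq> (if al u \<noteq> 0 then S1 else {}) \<union> (if be u \<noteq> 0 then S2 else {})"
  proof
    fix x assume "x \<in> S"
    then obtain w w' q where x: "x = (w, w')" and W: "w \<in> ?W" "w' \<in> ?W" and q: "q \<in> ids" "tx_coeff u b w q \<noteq> 0" "tx_coeff u b w' q \<noteq> 0"
      by (auto simp: S_def)
    have nz: "(al u \<noteq> 0 \<and> q = (True, u, common_index (v s) b')) \<or> (be u \<noteq> 0 \<and> q = (False, u, private_index u (v u) b))"
      if "tx_coeff u b v q \<noteq> 0" for v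
      using that unfolding tx_coeff_def coeff_def tx_common_def b'_def by (auto split: if_splits)
    show "x \<in> (if al u \<noteq> 0 then S1 else {}) \<union> (if be u \<noteq> 0 then S2 else {})"
      using nz[OF q(2)] nz[OF q(3)] q(1) W by (auto simp: x S1_def S2_def ids_iff)
  qed
  have "real (card S) \<le> real (card (if al u \<noteq> 0 then S1 else {}) + card (if be u \<noteq> 0 then S2 else {}))"
    unfolding of_nat_le_iff
    by (rule order_trans[OF card_mono[OF _ sub] card_Un_le]) (use fin in auto)
  also have "\<dots> \<le> \<kappa> * (card ?W)\<^sup>2 + \<kappa> * (card ?W)\<^sup>2"
  proof -
    have "0 \<le> \<kappa> * (card ?W)\<^sup>2" using k by simp
    then have "real (card (if al u \<noteq> 0 then S1 else {})) \<le> \<kappa> * (card ?W)\<^sup>2"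
      "real (card (if be u \<noteq> 0 then S2 else {})) \<le> \<kappa> * (card ?W)\<^sup>2" using S1 S2 by auto
    then show ?thesis by simp
  qed
  finally show ?thesis by (simp add: S_def)
qed

end

context block_markov
begin

definition power_bad :: "nat \<Rightarrow> real \<times> real \<Rightarrow> real \<Rightarrow> (nat \<Rightarrow> codeword_id \<Rightarrow> complex) \<Rightarrow> user \<Rightarrow> nat \<Rightarrow> nat \<Rightarrow> bool" where
  "power_bad N R y \<theta> u b p \<longleftrightarrow>
     (\<Sum>w\<in>message_pairs N R. (cmod (signal \<theta> u (tx_common u w b) (private_index u (w u) b) p))\<^sup>2) > y * card (message_pairs N R)"

lemma power_bad_measure:
  fixes \<kappa> p0 d :: real
  assumes R: "\<And>u. rate R u \<ge> 0" and sp: "spread N R \<kappa>" and k: "\<kappa> \<ge> 0" and p: "p < n"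
    and p0: "(al u)\<^sup>2 + (be u)\<^sup>2 \<le> p0" and d: "d > 0"
  shows "(\<integral>\<^sup>+ \<theta>. of_bool (power_bad N R (p0 + d) \<theta> u b p) \<partial>codebooks) \<le> ennreal (32 * p0\<^sup>2 * \<kappa> / d\<^sup>2)"
    and "(\<lambda>\<theta>. of_bool (power_bad N R (p0 + d) \<theta> u b p) :: ennreal) \<in> borel_measurable codebooks"
proof -
  let ?W = "message_pairs N R"
  define f where "f = (\<lambda>g :: codeword_id \<Rightarrow> complex. of_bool ((\<Sum>w\<in>?W. (cmod (\<Sum>q\<in>ids. tx_coeff u b w q * g q))\<^sup>2) > (p0 + d) * card ?W) :: ennreal)"
  have f_eq: "of_bool (power_bad N R (p0 + d) \<theta> u b p) = f (\<theta> p)" for \<theta>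
    by (simp add: power_bad_def f_def signal_eq_sum)
  have fm: "f \<in> borel_measurable (PiM ids (\<lambda>_. std_complex_normal))"
  proof -
    have [measurable]: "(\<lambda>g. \<Sum>q\<in>ids. tx_coeff u b w q * g q) \<in> borel_measurable (PiM ids (\<lambda>_. std_complex_normal))" for w
      by (intro borel_measurable_sum borel_measurable_times borel_measurable_const measurable_component_std_complex_normal) auto
    show ?thesis unfolding f_def by (intro borel_measurable_of_bool) measurable
  qed
  have "(\<integral>\<^sup>+ g. f g \<partial>PiM ids (\<lambda>_. std_complex_normal)) \<le> ennreal (16 * p0\<^sup>2 * (2 * \<kappa>) / d\<^sup>2)"
    unfolding f_def
    using codeword_power_concentration[where a="tx_coeff u b" and p=p0 and \<kappa>="2 * \<kappa>",
        OF finite_ids finite_message_pairs message_pairs_nonempty[OF R] order_trans[OF tx_coeff_norm p0] d tx_collisions[OF sp k]]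
    by blast
  then show "(\<integral>\<^sup>+ \<theta>. of_bool (power_bad N R (p0 + d) \<theta> u b p) \<partial>codebooks) \<le> ennreal (32 * p0\<^sup>2 * \<kappa> / d\<^sup>2)"
    unfolding f_eq nn_integral_codebooks_component[OF p fm] by (simp add: mult.assoc)
  show "(\<lambda>\<theta>. of_bool (power_bad N R (p0 + d) \<theta> u b p) :: ennreal) \<in> borel_measurable codebooks"
    unfolding f_eq
    by (rule measurable_compose[OF _ fm]) (use p in \<open>auto simp: codebooks_def intro: measurable_component_singleton\<close>)
qed

text \<open>Chernoff's bound with exponent \<open>1 / 2\<close>, where the exponential moment is 2.
  It will bound every letter by \<open>n\<close>: the letters of a misled relay are selected by the
  noise, so averaging over messages says nothing about them.\<close>

lemma entry_bad_measure:
  assumes p: "p < n" and q: "q \<in> ids"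
  shows "(\<integral>\<^sup>+ \<theta>. of_bool ((cmod (\<theta> p q))\<^sup>2 > y) \<partial>codebooks) \<le> ennreal (2 * exp (- y / 2))"
    and "(\<lambda>\<theta>. of_bool ((cmod (\<theta> p q))\<^sup>2 > y) :: ennreal) \<in> borel_measurable codebooks"
proof -
  let ?M = "PiM ids (\<lambda>_. std_complex_normal)"
  let ?a = "\<lambda>q'. if q' = q then 1 else 0 :: complex"
  have [measurable]: "(\<lambda>g. g q) \<in> borel_measurable ?M" using q by (rule measurable_component_std_complex_normal)
  have sa: "(\<Sum>q'\<in>ids. ?a q' * g q') = g q" for g :: "codeword_id \<Rightarrow> complex"
  proof -
    have "(\<Sum>q'\<in>ids. ?a q' * g q') = (\<Sum>q'\<in>ids. if q' = q then g q' else 0)" by (intro sum.cong) auto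
    then show ?thesis using q by (simp add: finite_ids)
  qed
  have na: "(\<Sum>q'\<in>ids. (cmod (?a q'))\<^sup>2) = 1"
  proof -
    have "(\<Sum>q'\<in>ids. (cmod (?a q'))\<^sup>2) = (\<Sum>q'\<in>ids. if q' = q then 1 else 0)" by (intro sum.cong) auto
    then show ?thesis using q by (simp add: finite_ids)
  qed
  have "(\<integral>\<^sup>+ \<theta>. of_bool ((cmod (\<theta> p q))\<^sup>2 > y) \<partial>codebooks) = (\<integral>\<^sup>+ g. of_bool ((cmod (g q))\<^sup>2 > y) \<partial>?M)"
    by (rule nn_integral_codebooks_component[OF p]) (intro borel_measurable_of_bool, measurable)
  also have "\<dots> \<le> (\<integral>\<^sup>+ g. ennreal (exp (- y / 2)) * ennreal (exp (1 / 2 * (cmod (0 + (\<Sum>q'\<in>ids. ?a q' * g q')))\<^sup>2)) \<partial>?M)"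
  proof (rule nn_integral_mono)
    fix g :: "codeword_id \<Rightarrow> complex"
    show "of_bool ((cmod (g q))\<^sup>2 > y) \<le> ennreal (exp (- y / 2)) * ennreal (exp (1 / 2 * (cmod (0 + (\<Sum>q'\<in>ids. ?a q' * g q')))\<^sup>2))"
      unfolding sa by (cases "(cmod (g q))\<^sup>2 > y") (auto simp: ennreal_mult[symmetric] exp_add[symmetric])
  qed
  also have "\<dots> = ennreal (exp (- y / 2)) * (\<integral>\<^sup>+ g. ennreal (exp (1 / 2 * (cmod (0 + (\<Sum>q'\<in>ids. ?a q' * g q')))\<^sup>2)) \<partial>?M)"
    unfolding sa by (rule nn_integral_cmult) measurable
  also have "(\<integral>\<^sup>+ g. ennreal (exp (1 / 2 * (cmod (0 + (\<Sum>q'\<in>ids. ?a q' * g q')))\<^sup>2)) \<partial>?M) = ennreal 2"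
    by (subst nn_integral_exp_linear_comb[OF finite_ids]) (simp_all only: na, simp_all)
  also have "ennreal (exp (- y / 2)) * ennreal 2 = ennreal (2 * exp (- y / 2))"
    by (subst ennreal_mult'[symmetric]) (simp_all only: exp_ge_zero mult.commute)
  finally show "(\<integral>\<^sup>+ \<theta>. of_bool ((cmod (\<theta> p q))\<^sup>2 > y) \<partial>codebooks) \<le> ennreal (2 * exp (- y / 2))" .
  show "(\<lambda>\<theta>. of_bool ((cmod (\<theta> p q))\<^sup>2 > y) :: ennreal) \<in> borel_measurable codebooks"
  proof -
    define f where "f = (\<lambda>\<theta> :: nat \<Rightarrow> codeword_id \<Rightarrow> complex. (cmod (\<theta> p q))\<^sup>2)"
    have [measurable]: "f \<in> borel_measurable codebooks"
      unfolding f_def using measurable_compose[OF measurable_codeword[OF p q], of "\<lambda>z. (cmod z)\<^sup>2" borel] by simp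
    have "(\<lambda>\<theta>. of_bool (f \<theta> > y) :: ennreal) \<in> borel_measurable codebooks"
      by (intro borel_measurable_of_bool) measurable
    then show ?thesis by (simp only: f_def)
  qed
qed

text \<open>The probabilistic method with three weights: \<open>\<Phi>1\<close> is the decoding
  error, scaled to mean at most \<open>1 / 4\<close>, while \<open>\<Phi>2\<close> and
  \<open>\<Phi>3\<close> count violations of the power and letter bounds, with total mean at most
  \<open>1 / 2\<close>. Somewhere the sum is below 1, and a count below 1 is 0.\<close>

lemma good_codebooks_exist:
  fixes \<eta> \<kappa> p0 d :: real
  assumes N: "B * n \<le> N" and R: "\<And>u. rate R u \<ge> 0"
    and sp: "spread N R \<kappa>" and k: "\<kappa> \<ge> 0" and p0: "\<And>u. (al u)\<^sup>2 + (be u)\<^sup>2 \<le> p0" and d: "d > 0"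
    and eta: "err_bound \<le> \<eta>" "\<eta> > 0"
    and small: "2 * B * n * (32 * p0\<^sup>2 * \<kappa> / d\<^sup>2) + n * card ids * (2 * exp (- (real n)\<^sup>2 / 2)) \<le> 1 / 2"
  obtains \<theta> where "\<theta> \<in> space codebooks"
    "(\<Sum>w\<in>message_pairs N R. \<integral>\<^sup>+ z. of_bool (\<not> all_ok \<theta> w z) \<partial>noise_space N) \<le> ennreal (4 * \<eta> * card (message_pairs N R))"
    "\<And>u b p. b < B \<Longrightarrow> p < n \<Longrightarrow> \<not> power_bad N R (p0 + d) \<theta> u b p"
    "\<And>p q. p < n \<Longrightarrow> q \<in> ids \<Longrightarrow> (cmod (\<theta> p q))\<^sup>2 \<le> (real n)\<^sup>2"
proof -
  interpret cb: prob_space codebooks by (rule prob_space_codebooks)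
  interpret pair_sigma_finite "noise_space N" codebooks ..
  let ?W = "message_pairs N R"
  have ne: "?W \<noteq> {}" by (rule message_pairs_nonempty[OF R])
  then have K: "real (card ?W) > 0" by (simp add: card_gt_0_iff)
  define E where "E = (\<lambda>\<theta> w. \<integral>\<^sup>+ z. of_bool (\<not> all_ok \<theta> w z) \<partial>noise_space N :: ennreal)"
  define c where "c = 1 / (4 * \<eta> * card ?W)"
  have c: "c > 0" unfolding c_def by (intro divide_pos_pos mult_pos_pos[OF _ K]) (use eta in auto)
  define \<Phi>1 where "\<Phi>1 = (\<lambda>\<theta>. ennreal c * (\<Sum>w\<in>?W. E \<theta> w))"
  define \<Phi>2 where "\<Phi>2 = (\<lambda>\<theta>. \<Sum>u\<in>UNIV. \<Sum>b<B. \<Sum>p<n. of_bool (power_bad N R (p0 + d) \<theta> u b p) :: ennreal)"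
  define \<Phi>3 where "\<Phi>3 = (\<lambda>\<theta>. \<Sum>p<n. \<Sum>q\<in>ids. of_bool ((cmod (\<theta> p q))\<^sup>2 > (real n)\<^sup>2) :: ennreal)"
  have mE: "(\<lambda>\<theta>. E \<theta> w) \<in> borel_measurable codebooks" for w
  proof -
    have "(\<lambda>(\<theta>, z). of_bool (\<not> all_ok \<theta> w z) :: ennreal) \<in> borel_measurable (codebooks \<Otimes>\<^sub>M noise_space N)"
    proof -
      have "(\<lambda>x. of_bool (\<not> all_ok (snd x) w (fst x)) :: ennreal) \<in> borel_measurable (noise_space N \<Otimes>\<^sub>M codebooks)"
        by (intro borel_measurable_of_bool pred_intros_logic pred_all_ok N)
      from measurable_compose[OF measurable_pair_swap' this] show ?thesis by (simp add: case_prod_beta')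
    qed
    then show ?thesis unfolding E_def using noise.borel_measurable_nn_integral by fast
  qed
  have m1: "\<Phi>1 \<in> borel_measurable codebooks"
    unfolding \<Phi>1_def by (intro borel_measurable_times_ennreal borel_measurable_const borel_measurable_sum mE)
  have m2: "\<Phi>2 \<in> borel_measurable codebooks"
    unfolding \<Phi>2_def by (intro borel_measurable_sum power_bad_measure(2)[OF R sp k _ p0 d]) auto
  have m3: "\<Phi>3 \<in> borel_measurable codebooks"
    unfolding \<Phi>3_def by (intro borel_measurable_sum entry_bad_measure(2)) auto
  have i1: "(\<integral>\<^sup>+ \<theta>. \<Phi>1 \<theta> \<partial>codebooks) \<le> ennreal (1 / 4)"
  proof -
    have "(\<integral>\<^sup>+ \<theta>. \<Phi>1 \<theta> \<partial>codebooks) = ennreal c * (\<Sum>w\<in>?W. \<integral>\<^sup>+ \<theta>. E \<theta> w \<partial>codebooks)"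
      unfolding \<Phi>1_def using mE by (simp add: nn_integral_cmult nn_integral_sum)
    also have "\<dots> \<le> ennreal c * (\<Sum>w\<in>?W. ennreal \<eta>)"
    proof (intro mult_left_mono sum_mono)
      fix w
      have "(\<integral>\<^sup>+ \<theta>. E \<theta> w \<partial>codebooks) \<le> ennreal err_bound" unfolding E_def by (rule random_code_error[OF N])
      also have "\<dots> \<le> ennreal \<eta>" using eta by (intro ennreal_leI)
      finally show "(\<integral>\<^sup>+ \<theta>. E \<theta> w \<partial>codebooks) \<le> ennreal \<eta>" .
    qed simp
    also have "\<dots> = ennreal (c * (card ?W * \<eta>))"
      using c eta by (simp add: ennreal_of_nat_eq_real_of_nat ennreal_mult)
    also have "c * (card ?W * \<eta>) = 1 / 4" using eta K ne by (simp add: c_def)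
    finally show ?thesis .
  qed
  have i2: "(\<integral>\<^sup>+ \<theta>. \<Phi>2 \<theta> \<partial>codebooks) \<le> ennreal (2 * B * n * (32 * p0\<^sup>2 * \<kappa> / d\<^sup>2))"
  proof -
    have m: "(\<lambda>\<theta>. of_bool (power_bad N R (p0 + d) \<theta> u b p) :: ennreal) \<in> borel_measurable codebooks" if "p \<in> {..<n}" for u b p
      using that by (intro power_bad_measure(2)[OF R sp k _ p0 d]) auto
    have "(\<integral>\<^sup>+ \<theta>. \<Phi>2 \<theta> \<partial>codebooks) = (\<Sum>u\<in>UNIV. \<integral>\<^sup>+ \<theta>. (\<Sum>b<B. \<Sum>p<n. of_bool (power_bad N R (p0 + d) \<theta> u b p)) \<partial>codebooks)"
      unfolding \<Phi>2_def by (intro nn_integral_sum borel_measurable_sum m)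
    also have "\<dots> = (\<Sum>u\<in>UNIV. \<Sum>b<B. \<integral>\<^sup>+ \<theta>. (\<Sum>p<n. of_bool (power_bad N R (p0 + d) \<theta> u b p)) \<partial>codebooks)"
      by (intro sum.cong refl nn_integral_sum borel_measurable_sum m)
    also have "\<dots> = (\<Sum>u\<in>UNIV. \<Sum>b<B. \<Sum>p<n. \<integral>\<^sup>+ \<theta>. of_bool (power_bad N R (p0 + d) \<theta> u b p) \<partial>codebooks)"
      by (intro sum.cong refl nn_integral_sum m)
    also have "\<dots> \<le> (\<Sum>u\<in>(UNIV :: user set). \<Sum>b<B. \<Sum>p<n. ennreal (32 * p0\<^sup>2 * \<kappa> / d\<^sup>2))"
      by (intro sum_mono power_bad_measure(1)[OF R sp k _ p0 d]) auto
    also have "\<dots> = ennreal (2 * B * n * (32 * p0\<^sup>2 * \<kappa> / d\<^sup>2))"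
    proof -
      define x where "x = 32 * p0\<^sup>2 * \<kappa> / d\<^sup>2"
      have "x \<ge> 0" using k by (simp add: x_def)
      have "(\<Sum>u\<in>(UNIV :: user set). \<Sum>b<B. \<Sum>p<n. ennreal x) = of_nat (2 * B * n) * ennreal x"
        by (simp add: mult.assoc)
      also have "\<dots> = ennreal (real (2 * B * n) * x)"
        by (simp only: ennreal_of_nat_eq_real_of_nat ennreal_mult' of_nat_0_le_iff)
      finally show ?thesis by (simp add: x_def)
    qed
    finally show ?thesis .
  qed
  have i3: "(\<integral>\<^sup>+ \<theta>. \<Phi>3 \<theta> \<partial>codebooks) \<le> ennreal (n * card ids * (2 * exp (- (real n)\<^sup>2 / 2)))"
  proof -
    have m: "(\<lambda>\<theta>. of_bool ((cmod (\<theta> p q))\<^sup>2 > (real n)\<^sup>2) :: ennreal) \<in> borel_measurable codebooks" if "p \<in> {..<n}" "q \<in> ids" for p q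
      using that by (intro entry_bad_measure(2)) auto
    have "(\<integral>\<^sup>+ \<theta>. \<Phi>3 \<theta> \<partial>codebooks) = (\<Sum>p<n. \<integral>\<^sup>+ \<theta>. (\<Sum>q\<in>ids. of_bool ((cmod (\<theta> p q))\<^sup>2 > (real n)\<^sup>2)) \<partial>codebooks)"
      unfolding \<Phi>3_def by (intro nn_integral_sum borel_measurable_sum m)
    also have "\<dots> = (\<Sum>p<n. \<Sum>q\<in>ids. \<integral>\<^sup>+ \<theta>. of_bool ((cmod (\<theta> p q))\<^sup>2 > (real n)\<^sup>2) \<partial>codebooks)"
      by (intro sum.cong refl nn_integral_sum m)
    also have "\<dots> \<le> (\<Sum>p<n. \<Sum>q\<in>ids. ennreal (2 * exp (- (real n)\<^sup>2 / 2)))"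
      by (intro sum_mono entry_bad_measure(1)) auto
    also have "\<dots> = ennreal (n * card ids * (2 * exp (- (real n)\<^sup>2 / 2)))"
      by (simp only: sum_constant card_lessThan ennreal_of_nat_eq_real_of_nat)
         (simp only: ennreal_mult'[symmetric] of_nat_0_le_iff mult.assoc of_nat_mult)
    finally show ?thesis .
  qed
  have "\<exists>\<theta>\<in>space codebooks. \<Phi>1 \<theta> + \<Phi>2 \<theta> + \<Phi>3 \<theta> < 1"
  proof (rule ccontr)
    assume "\<not> ?thesis"
    then have "(\<integral>\<^sup>+ \<theta>. 1 \<partial>codebooks) \<le> (\<integral>\<^sup>+ \<theta>. \<Phi>1 \<theta> + \<Phi>2 \<theta> + \<Phi>3 \<theta> \<partial>codebooks)"
      by (intro nn_integral_mono) (auto simp: not_less)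
    also have "\<dots> = (\<integral>\<^sup>+ \<theta>. \<Phi>1 \<theta> \<partial>codebooks) + (\<integral>\<^sup>+ \<theta>. \<Phi>2 \<theta> \<partial>codebooks) + (\<integral>\<^sup>+ \<theta>. \<Phi>3 \<theta> \<partial>codebooks)"
      using m1 m2 m3 by (simp add: nn_integral_add)
    also have "\<dots> \<le> ennreal (1 / 4) + ennreal (2 * B * n * (32 * p0\<^sup>2 * \<kappa> / d\<^sup>2)) + ennreal (n * card ids * (2 * exp (- (real n)\<^sup>2 / 2)))"
      by (intro add_mono i1 i2 i3)
    also have "\<dots> = ennreal (1 / 4 + 2 * B * n * (32 * p0\<^sup>2 * \<kappa> / d\<^sup>2) + n * card ids * (2 * exp (- (real n)\<^sup>2 / 2)))"
      using k by (subst ennreal_plus, simp_all)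
    also have "\<dots> \<le> ennreal (3 / 4)" using small by (intro ennreal_leI) simp
    finally have "(1 :: ennreal) \<le> ennreal (3 / 4)" using cb.emeasure_space_1 by simp
    then show False by simp
  qed
  then obtain \<theta> where sp\<theta>: "\<theta> \<in> space codebooks" and \<theta>: "\<Phi>1 \<theta> + \<Phi>2 \<theta> + \<Phi>3 \<theta> < 1" by blast
  have le: "\<Phi>1 \<theta> < 1" "\<Phi>2 \<theta> < 1" "\<Phi>3 \<theta> < 1"
  proof -
    have "\<Phi>1 \<theta> \<le> \<Phi>1 \<theta> + \<Phi>2 \<theta> + \<Phi>3 \<theta>" "\<Phi>2 \<theta> \<le> \<Phi>1 \<theta> + \<Phi>2 \<theta> + \<Phi>3 \<theta>" "\<Phi>3 \<theta> \<le> \<Phi>1 \<theta> + \<Phi>2 \<theta> + \<Phi>3 \<theta>"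
      by (auto simp: add_increasing add_increasing2 add.assoc)
    then show "\<Phi>1 \<theta> < 1" "\<Phi>2 \<theta> < 1" "\<Phi>3 \<theta> < 1" using le_less_trans[OF _ \<theta>] by blast+
  qed
  show ?thesis
  proof (rule that[OF sp\<theta>])
    have "ennreal (4 * \<eta> * card ?W) * \<Phi>1 \<theta> \<le> ennreal (4 * \<eta> * card ?W) * 1"
      using le by (intro mult_left_mono) auto
    moreover have "ennreal (4 * \<eta> * card ?W) * \<Phi>1 \<theta> = (\<Sum>w\<in>?W. E \<theta> w)"
    proof -
      have "ennreal (4 * \<eta> * card ?W) * ennreal c = 1"
        using eta K c ne by (subst ennreal_mult[symmetric]) (auto simp: c_def)
      then show ?thesis unfolding \<Phi>1_def by (simp add: mult.assoc[symmetric])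
    qed
    ultimately show "(\<Sum>w\<in>?W. \<integral>\<^sup>+ z. of_bool (\<not> all_ok \<theta> w z) \<partial>noise_space N) \<le> ennreal (4 * \<eta> * card ?W)"
      by (simp add: E_def)
  next
    fix u b p assume b: "b < B" "p < n"
    show "\<not> power_bad N R (p0 + d) \<theta> u b p"
    proof
      assume bad: "power_bad N R (p0 + d) \<theta> u b p"
      have "1 = (of_bool (power_bad N R (p0 + d) \<theta> u b p) :: ennreal)" using bad by simp
      also have "\<dots> \<le> (\<Sum>p<n. of_bool (power_bad N R (p0 + d) \<theta> u b p))"
        using b by (intro member_le_sum) auto
      also have "\<dots> \<le> (\<Sum>b<B. \<Sum>p<n. of_bool (power_bad N R (p0 + d) \<theta> u b p))"
        using b by (intro member_le_sum[where f="\<lambda>b. \<Sum>p<n. of_bool (power_bad N R (p0 + d) \<theta> u b p)"]) auto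
      also have "\<dots> \<le> \<Phi>2 \<theta>" unfolding \<Phi>2_def
        by (intro member_le_sum[where f="\<lambda>u. \<Sum>b<B. \<Sum>p<n. of_bool (power_bad N R (p0 + d) \<theta> u b p)"]) auto
      finally show False using le by simp
    qed
  next
    fix p q assume p: "p < n" "q \<in> ids"
    show "(cmod (\<theta> p q))\<^sup>2 \<le> (real n)\<^sup>2"
    proof (rule ccontr)
      assume "\<not> ?thesis"
      then have "1 = (of_bool ((cmod (\<theta> p q))\<^sup>2 > (real n)\<^sup>2) :: ennreal)"
        by (simp only: not_le of_bool_def if_True)
      also have "\<dots> \<le> (\<Sum>q\<in>ids. of_bool ((cmod (\<theta> p q))\<^sup>2 > (real n)\<^sup>2))"
        using p finite_ids by (intro member_le_sum[where f="\<lambda>q. of_bool ((cmod (\<theta> p q))\<^sup>2 > (real n)\<^sup>2)"]) auto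
      also have "\<dots> \<le> \<Phi>3 \<theta>" unfolding \<Phi>3_def
        using p by (intro member_le_sum[where f="\<lambda>p. \<Sum>q\<in>ids. of_bool ((cmod (\<theta> p q))\<^sup>2 > (real n)\<^sup>2)"]) auto
      finally show False using le by simp
    qed
  qed
qed

text \<open>While decoding succeeds, the input is the intended signal, of average power at most
  \<open>p0 + d\<close> by choice of the codebook. Otherwise the letter bound caps its power, and
  this cap is weighted by the error probability \<open>4 * \<eta>\<close>.\<close>

lemma code_exists:
  fixes \<eta> \<kappa> p0 d P :: real
  assumes N: "B * n \<le> N" and R: "\<And>u. rate R u \<ge> 0" and K: "\<And>u. card (messages N (rate R u)) \<le> base u ^ D"
    and sp: "spread N R \<kappa>" and k: "\<kappa> \<ge> 0" and p0: "\<And>u. (al u)\<^sup>2 + (be u)\<^sup>2 \<le> p0" and d: "d > 0"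
    and eta: "err_bound \<le> \<eta>" "\<eta> > 0"
    and small: "2 * B * n * (32 * p0\<^sup>2 * \<kappa> / d\<^sup>2) + n * card ids * (2 * exp (- (real n)\<^sup>2 / 2)) \<le> 1 / 2"
    and P: "\<And>u. p0 + d + 4 * \<eta> * ((\<bar>al u\<bar> + \<bar>be u\<bar>) * n)\<^sup>2 \<le> P"
  shows "\<exists>f h. is_code gd gc P F N R f h \<and> (\<forall>u. error_prob gd gc F N R f h u \<le> 4 * \<eta>)"
proof -
  let ?W = "message_pairs N R" and ?Z = "noise_space N"
  obtain \<theta> where sp\<theta>: "\<theta> \<in> space codebooks" and err: "(\<Sum>w\<in>?W. \<integral>\<^sup>+ z. of_bool (\<not> all_ok \<theta> w z) \<partial>?Z) \<le> ennreal (4 * \<eta> * card ?W)"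
    and pow: "\<And>u b p. b < B \<Longrightarrow> p < n \<Longrightarrow> \<not> power_bad N R (p0 + d) \<theta> u b p"
    and ent: "\<And>p q. p < n \<Longrightarrow> q \<in> ids \<Longrightarrow> (cmod (\<theta> p q))\<^sup>2 \<le> (real n)\<^sup>2"
    using good_codebooks_exist[OF N R sp k p0 d eta small] by blast
  let ?f = "enc \<theta>" and ?h = "dec \<theta>"
  note f = measurable_encoder_enc[of N R \<theta>] and h = measurable_decoder_dec[of N \<theta>]
  have ne: "?W \<noteq> {}" by (rule message_pairs_nonempty[OF R])
  then have cW: "real (card ?W) > 0" by (simp add: card_gt_0_iff)
  have ok_m: "(\<lambda>z. of_bool (\<not> all_ok \<theta> w z) :: ennreal) \<in> borel_measurable ?Z" for w
  proof -
    have "(\<lambda>x. of_bool (\<not> all_ok (snd x) w (fst x)) :: ennreal) \<in> borel_measurable (?Z \<Otimes>\<^sub>M codebooks)"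
      by (intro borel_measurable_of_bool pred_intros_logic pred_all_ok N)
    from measurable_compose[OF measurable_Pair2'[OF sp\<theta>] this] show ?thesis by simp
  qed
  have correct: "?h u (\<lambda>j\<in>{1..N}. chan_out gd gc F ?f w z u j) = w u" if "w \<in> ?W" "all_ok \<theta> w z" for w z u
  proof -
    have "w u \<in> messages N (rate R u)" using that by (simp add: message_pairs_def)
    then have "1 \<le> w u" "w u \<le> card (messages N (rate R u))" by (auto simp: messages_def)
    then show ?thesis using dec_correct[OF that(2) N, of u] K[of u] by (simp add: out_def)
  qed
  have "error_prob gd gc F N R ?f ?h u \<le> 4 * \<eta>" for u
  proof -
    let ?e = "\<lambda>w. measure ?Z {z \<in> space ?Z. ?h u (\<lambda>j\<in>{1..N}. chan_out gd gc F ?f w z u j) \<noteq> w u}"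
    have "ennreal (\<Sum>w\<in>?W. ?e w) = (\<Sum>w\<in>?W. ennreal (?e w))" by (simp add: sum_ennreal)
    also have "\<dots> \<le> (\<Sum>w\<in>?W. \<integral>\<^sup>+ z. of_bool (\<not> all_ok \<theta> w z) \<partial>?Z)"
    proof (rule sum_mono)
      fix w assume w: "w \<in> ?W"
      have S: "{z \<in> space ?Z. ?h u (\<lambda>j\<in>{1..N}. chan_out gd gc F ?f w z u j) \<noteq> w u} \<in> sets ?Z"
        using pred_intros_logic(2)[OF pred_decoding[OF f h w, of u gd gc F "w u"]] by (simp add: pred_def)
      have "ennreal (?e w) = (\<integral>\<^sup>+ z. indicator {z \<in> space ?Z. ?h u (\<lambda>j\<in>{1..N}. chan_out gd gc F ?f w z u j) \<noteq> w u} z \<partial>?Z)"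
        using S by (simp add: noise.emeasure_eq_measure)
      also have "\<dots> \<le> (\<integral>\<^sup>+ z. of_bool (\<not> all_ok \<theta> w z) \<partial>?Z)"
        by (rule nn_integral_mono) (use correct[OF w] in \<open>auto simp: indicator_def\<close>)
      finally show "ennreal (?e w) \<le> (\<integral>\<^sup>+ z. of_bool (\<not> all_ok \<theta> w z) \<partial>?Z)" .
    qed
    also note err
    finally have "(\<Sum>w\<in>?W. ?e w) \<le> 4 * \<eta> * card ?W" using eta by (subst (asm) ennreal_le_iff) auto
    then show ?thesis unfolding error_prob_eq[OF f h R] using cW by (simp add: pos_divide_le_eq)
  qed
  moreover have "power_constraint gd gc P F N R ?f"
    unfolding power_constraint_def
  proof (intro allI ballI)
    fix u j assume j: "j \<in> {1..N}"
    have P0: "P \<ge> 0"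
    proof -
      have "0 \<le> p0" using p0[of u] by (smt (verit) zero_le_power2)
      moreover have "0 \<le> 4 * \<eta> * ((\<bar>al u\<bar> + \<bar>be u\<bar>) * n)\<^sup>2" using eta by simp
      ultimately show ?thesis using P[of u] d by linarith
    qed
    have xm: "(\<lambda>z. ennreal ((cmod (chan_in gd gc F ?f w z u j))\<^sup>2)) \<in> borel_measurable ?Z" if "w \<in> ?W" for w
      using measurable_chan_in[OF f that order_refl j] by measurable
    have "(\<Sum>w\<in>?W. \<integral>\<^sup>+ z. ennreal ((cmod (chan_in gd gc F ?f w z u j))\<^sup>2) \<partial>?Z) \<le> ennreal (P * card ?W)"
    proof (cases "B * n < j")
      case True
      then show ?thesis by (simp add: chan_in_idle)
    next
      case False
      define b where "b = (j - 1) div n"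
      define p where "p = (j - 1) mod n"
      have p: "p < n" using n by (simp add: p_def)
      have jbp: "j = b * n + p + 1" using j by (auto simp: b_def p_def)
      have b: "b < B"
      proof -
        have "b * n < B * n" using False jbp by linarith
        then show ?thesis using n by simp
      qed
      let ?S = "\<lambda>w. (cmod (signal \<theta> u (tx_common u w b) (private_index u (w u) b) p))\<^sup>2"
      let ?L = "((\<bar>al u\<bar> + \<bar>be u\<bar>) * n)\<^sup>2"
      have cwb: "cmod (cw \<theta> c v i p) \<le> n" if "i \<le> book_size c v" for c v i
        using ent[OF p, of "(c, v, i)"] that by (auto simp: cw_def ids_iff intro: power2_le_imp_le)
      have sigb: "(cmod (signal \<theta> u i l p))\<^sup>2 \<le> ?L" if "i \<le> book_size True u" "l \<le> book_size False u" for i l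
      proof -
        have "cmod (signal \<theta> u i l p) \<le> \<bar>al u\<bar> * cmod (cw \<theta> True u i p) + \<bar>be u\<bar> * cmod (cw \<theta> False u l p)"
          unfolding signal_def by (rule order_trans[OF norm_triangle_ineq]) (simp add: norm_mult)
        also have "\<dots> \<le> \<bar>al u\<bar> * n + \<bar>be u\<bar> * n" using cwb that by (intro add_mono mult_left_mono) auto
        finally show ?thesis by (intro power_mono) (auto simp: distrib_right)
      qed
      have ptw: "(cmod (chan_in gd gc F ?f w z u j))\<^sup>2 \<le> ?S w + of_bool (\<not> all_ok \<theta> w z) * ?L" for w z
      proof (cases "u = s")
        case True
        have "chan_in gd gc F ?f w z u j = signal \<theta> u (tx_common u w b) (private_index u (w u) b) p"
          unfolding True jbp chan_in_source[OF p b] by (simp add: tx_common_def)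
        then show ?thesis by simp
      next
        case False
        then have u: "u = r" using user_eq_other[of u s] by simp
        have x: "chan_in gd gc F ?f w z u j = signal \<theta> u (relay_est \<theta> (w r) (out \<theta> w z k) b) (private_index u (w u) b) p"
          unfolding u jbp by (rule chan_in_relay[OF p b])
        show ?thesis
        proof (cases "all_ok \<theta> w z")
          case True
          have "relay_est \<theta> (w r) (out \<theta> w z k) b = common_index (w s) b"
            using b True by (intro relay_est_correct) (auto simp: all_ok_def D_def)
          then show ?thesis unfolding x by (simp add: True tx_common_def u)
        next
          case False
          have "relay_est \<theta> (w r) (out \<theta> w z k) b \<le> book_size True u"
          proof (cases b)
            case (Suc b')
            then show ?thesis using threshold_decode_bounds[OF A] by (simp add: decode_def book_size_def)
          qed simp
          then have "(cmod (chan_in gd gc F ?f w z u j))\<^sup>2 \<le> ?L"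
            unfolding x by (intro sigb index_le)
          then show ?thesis using False by (simp add: add_increasing)
        qed
      qed
      have "(\<Sum>w\<in>?W. \<integral>\<^sup>+ z. ennreal ((cmod (chan_in gd gc F ?f w z u j))\<^sup>2) \<partial>?Z)
        \<le> (\<Sum>w\<in>?W. \<integral>\<^sup>+ z. ennreal (?S w) + ennreal ?L * of_bool (\<not> all_ok \<theta> w z) \<partial>?Z)"
      proof (intro sum_mono nn_integral_mono)
        fix w z
        have "ennreal ((cmod (chan_in gd gc F ?f w z u j))\<^sup>2) \<le> ennreal (?S w + of_bool (\<not> all_ok \<theta> w z) * ?L)"
          by (intro ennreal_leI ptw)
        also have "\<dots> = ennreal (?S w) + ennreal ?L * of_bool (\<not> all_ok \<theta> w z)"
          by (cases "all_ok \<theta> w z") auto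
        finally show "ennreal ((cmod (chan_in gd gc F ?f w z u j))\<^sup>2) \<le> ennreal (?S w) + ennreal ?L * of_bool (\<not> all_ok \<theta> w z)" .
      qed
      also have "\<dots> = (\<Sum>w\<in>?W. ennreal (?S w)) + ennreal ?L * (\<Sum>w\<in>?W. \<integral>\<^sup>+ z. of_bool (\<not> all_ok \<theta> w z) \<partial>?Z)"
        using ok_m noise.emeasure_space_1 by (simp add: nn_integral_add nn_integral_cmult sum.distrib sum_distrib_left)
      also have "\<dots> \<le> ennreal ((p0 + d) * card ?W) + ennreal ?L * ennreal (4 * \<eta> * card ?W)"
      proof (intro add_mono mult_left_mono err)
        have "(\<Sum>w\<in>?W. ?S w) \<le> (p0 + d) * card ?W" using pow[OF b p, of u] by (simp add: power_bad_def not_less)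
        then show "(\<Sum>w\<in>?W. ennreal (?S w)) \<le> ennreal ((p0 + d) * card ?W)"
          by (simp add: sum_ennreal ennreal_leI)
      qed simp
      also have "\<dots> = ennreal ((p0 + d + 4 * \<eta> * ?L) * card ?W)"
      proof -
        have "0 \<le> p0" using p0[of u] by (smt (verit) zero_le_power2)
        then have "0 \<le> (p0 + d) * card ?W" "0 \<le> ?L * (4 * \<eta> * card ?W)" "0 \<le> ?L" using d eta by auto
        then have "ennreal ((p0 + d) * card ?W) + ennreal ?L * ennreal (4 * \<eta> * card ?W) = ennreal ((p0 + d) * card ?W + ?L * (4 * \<eta> * card ?W))"
          by (simp only: ennreal_mult'[symmetric] ennreal_plus)
        then show ?thesis by (simp add: algebra_simps)
      qed
      also have "\<dots> \<le> ennreal (P * card ?W)" using P[of u] by (intro ennreal_leI mult_right_mono) auto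
      finally show ?thesis .
    qed
    then have "(\<Sum>w\<in>?W. \<integral>\<^sup>+ z. ennreal ((cmod (chan_in gd gc F ?f w z u j))\<^sup>2) \<partial>?Z) / ennreal (card ?W) \<le> ennreal (P * card ?W) / ennreal (card ?W)"
      by (rule divide_right_mono_ennreal)
    also have "\<dots> = ennreal P" using cW ne P0 by (simp add: divide_ennreal)
    finally show "(\<integral>\<^sup>+ (w, z). ennreal ((cmod (chan_in gd gc F ?f w z u j))\<^sup>2) \<partial>source_space N R) \<le> ennreal P"
      by (subst nn_integral_source_space) (use xm in auto)
  qed
  ultimately show ?thesis using f h by (auto simp: is_code_def)
qed

end

section \<open>Achievable rates\<close>

text \<open>Plain convergence to 0 would be too weak: error bounds get multiplied by powers of the
  block length, which a geometric bound absorbs.\<close>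

definition exp_small :: "(nat \<Rightarrow> real) \<Rightarrow> bool" where
  "exp_small f \<longleftrightarrow> (\<exists>q K. 0 \<le> q \<and> q < 1 \<and> 0 \<le> K \<and> (\<forall>n. f n \<le> K * q ^ n))"

lemma exp_smallI: "0 \<le> q \<Longrightarrow> q < 1 \<Longrightarrow> 0 \<le> K \<Longrightarrow> (\<And>n. f n \<le> K * q ^ n) \<Longrightarrow> exp_small f"
  unfolding exp_small_def by blast

lemma exp_small_power: "0 \<le> q \<Longrightarrow> q < 1 \<Longrightarrow> exp_small (\<lambda>n. q ^ n)"
  by (rule exp_smallI[of q 1]) auto

lemma exp_small_0: "exp_small (\<lambda>n. 0)"
  by (rule exp_smallI[of 0 0]) auto

lemma exp_small_add:
  assumes "exp_small f" "exp_small g" shows "exp_small (\<lambda>n. f n + g n)"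
proof -
  obtain p K where f: "0 \<le> p" "p < 1" "0 \<le> K" "\<And>n. f n \<le> K * p ^ n" using assms(1) by (auto simp: exp_small_def)
  obtain q L where g: "0 \<le> q" "q < 1" "0 \<le> L" "\<And>n. g n \<le> L * q ^ n" using assms(2) by (auto simp: exp_small_def)
  show ?thesis
  proof (rule exp_smallI[of "max p q" "K + L"])
    fix n
    have "K * p ^ n \<le> K * max p q ^ n" "L * q ^ n \<le> L * max p q ^ n"
      using f g by (auto intro!: mult_left_mono power_mono)
    then show "f n + g n \<le> (K + L) * max p q ^ n"
      using f(4)[of n] g(4)[of n] by (simp add: distrib_right)
  qed (use f g in auto)
qed

lemma exp_small_cmult:
  assumes "exp_small f" "c \<ge> 0" shows "exp_small (\<lambda>n. c * f n)"
proof -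
  obtain p K where f: "0 \<le> p" "p < 1" "0 \<le> K" "\<And>n. f n \<le> K * p ^ n" using assms(1) by (auto simp: exp_small_def)
  show ?thesis
    by (rule exp_smallI[of p "c * K"]) (use f assms(2) in \<open>auto simp: mult.assoc intro: mult_left_mono\<close>)
qed

lemma exp_small_sum: "finite I \<Longrightarrow> (\<And>i. i \<in> I \<Longrightarrow> exp_small (f i)) \<Longrightarrow> exp_small (\<lambda>n. \<Sum>i\<in>I. f i n)"
  by (induction I rule: finite_induct) (auto intro: exp_small_0 exp_small_add)

lemma exp_small_mono: "exp_small g \<Longrightarrow> (\<And>n. f n \<le> g n) \<Longrightarrow> exp_small f"
  unfolding exp_small_def by (meson order_trans)

text \<open>Splitting \<open>p ^ n\<close> into the square of \<open>sqrt p ^ n\<close> gives each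
  factor \<open>n\<close> its own geometric sequence. The other two limits follow by
  domination.\<close>

lemma exp_small_tendsto:
  assumes "exp_small f" "\<And>n. f n \<ge> 0"
  shows "(\<lambda>n. (real n)\<^sup>2 * f n) \<longlonglongrightarrow> 0" "(\<lambda>n. real n * f n) \<longlonglongrightarrow> 0" "f \<longlonglongrightarrow> 0"
proof -
  obtain p K where f: "0 \<le> p" "p < 1" "0 \<le> K" "\<And>n. f n \<le> K * p ^ n" using assms(1) by (auto simp: exp_small_def)
  have "sqrt p < 1" using f by (simp add: real_sqrt_lt_1_iff)
  then have "(\<lambda>n. real n * sqrt p ^ n) \<longlonglongrightarrow> 0"
    using f powser_times_n_limit_0[of "sqrt p"] by simp
  then have "(\<lambda>n. K * (real n * sqrt p ^ n)\<^sup>2) \<longlonglongrightarrow> K * 0\<^sup>2"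
    by (intro tendsto_intros)
  moreover have "K * (real n * sqrt p ^ n)\<^sup>2 = (real n)\<^sup>2 * (K * p ^ n)" for n
  proof -
    have "(sqrt p ^ n)\<^sup>2 = (sqrt p * sqrt p) ^ n" by (simp only: power2_eq_square power_mult_distrib)
    also have "\<dots> = p ^ n" using f by simp
    finally show ?thesis by (simp only: power_mult_distrib mult.left_commute)
  qed
  ultimately have lim: "(\<lambda>n. (real n)\<^sup>2 * (K * p ^ n)) \<longlonglongrightarrow> 0" by simp
  show 2: "(\<lambda>n. (real n)\<^sup>2 * f n) \<longlonglongrightarrow> 0"
    by (rule tendsto_sandwich[OF _ _ tendsto_const lim]) (use assms f in \<open>auto intro!: always_eventually mult_left_mono\<close>)
  show "(\<lambda>n. real n * f n) \<longlonglongrightarrow> 0"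
  proof (rule tendsto_sandwich[OF _ _ tendsto_const 2])
    have "real n \<le> (real n)\<^sup>2" for n by (cases n) (auto simp: power2_eq_square)
    then show "\<forall>\<^sub>F n in sequentially. real n * f n \<le> (real n)\<^sup>2 * f n"
      using assms by (intro always_eventually allI mult_right_mono) auto
  qed (use assms in auto)
  show "f \<longlonglongrightarrow> 0"
  proof (rule tendsto_sandwich[OF _ _ tendsto_const 2])
    show "\<forall>\<^sub>F n in sequentially. f n \<le> (real n)\<^sup>2 * f n"
      using eventually_ge_at_top[of 1]
    proof eventually_elim
      case (elim n)
      then have "1 \<le> (real n)\<^sup>2" by (simp add: one_le_power)
      then show ?case using mult_right_mono[of 1 "(real n)\<^sup>2" "f n"] assms by simp
    qed
  qed (use assms in auto)
qed

text \<open>The exponent has \<open>n + 1\<close> because all code lengths from \<open>n * B\<close>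
  to just below \<open>(n + 1) * B\<close> use block length \<open>n\<close>, and each of their
  messages needs a digit string. Rate 0 gives a book with a single codeword.\<close>

definition book :: "real \<Rightarrow> nat \<Rightarrow> nat" where
  "book x n = nat \<lceil>2 powr (real (n + 1) * x)\<rceil>"

lemma book_bounds:
  assumes "x \<ge> 0"
  shows "1 \<le> book x n" "2 powr (real (n + 1) * x) \<le> real (book x n)" "real (book x n) \<le> 2 * 2 powr (real (n + 1) * x)"
    "real (book x n - 1) \<le> 2 powr (real (n + 1) * x)"
proof -
  define y where "y = 2 powr (real (n + 1) * x)"
  have y: "y \<ge> 1" using assms by (simp add: y_def ge_one_powr_ge_zero)
  have r: "real (book x n) = of_int \<lceil>y\<rceil>" using y by (simp add: book_def y_def)
  have c: "y \<le> of_int \<lceil>y\<rceil>" "of_int \<lceil>y\<rceil> < y + 1" by linarith+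
  have b1: "1 \<le> real (book x n)" using y c r by linarith
  then show "1 \<le> book x n" by simp
  then have "real (book x n - 1) = real (book x n) - 1" by simp
  then show "real (book x n - 1) \<le> 2 powr (real (n + 1) * x)" using c r unfolding y_def[symmetric] by linarith
  show "2 powr (real (n + 1) * x) \<le> real (book x n)" "real (book x n) \<le> 2 * 2 powr (real (n + 1) * x)"
    using c r y unfolding y_def[symmetric] by linarith+
qed

lemma book_0 [simp]: "book 0 n = 1"
  by (simp add: book_def)

lemma one_plus_times_exp_less_1: "0 < e \<Longrightarrow> (1 + e) * exp (- e) < (1 :: real)"
  using exp_minus_ge[of e] exp_gt_one[of e] exp_ge_add_one_self[of e] ln_add_one_self_less_self[of e]
  by (simp add: exp_minus field_simps) (metis add_pos_pos exp_less_cancel_iff exp_ln zero_less_one)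

text \<open>The rate condition says that the growth of the book is beaten by the decay of the chance
  that one wrong codeword passes; at rate 0 there are no wrong codewords.\<close>

lemma step_bound_exp_small:
  assumes x: "x \<ge> 0" and v: "v > 0" "H \<ge> 0" and e: "0 < e" "e < 1"
    and r: "x = 0 \<or> exp (2 * e) * (2 powr x * v / (v + H)) < 1"
  shows "exp_small (\<lambda>n. step_bound e (book x n) v H n)"
proof -
  let ?y = "exp (2 * e) * v / (v + H)"
  have y0: "?y \<ge> 0" using v by simp
  have third: "exp_small (\<lambda>n. real (book x n - 1) * ?y ^ n)"
  proof (cases "x = 0")
    case True
    then show ?thesis by (simp add: exp_small_0)
  next
    case False
    show ?thesis
    proof (rule exp_smallI[of "2 powr x * ?y" "2 powr x"])
      fix n
      have "real (book x n - 1) * ?y ^ n \<le> 2 powr (real (n + 1) * x) * ?y ^ n"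
        by (intro mult_right_mono book_bounds(4)[OF x] zero_le_power y0)
      also have "2 powr (real (n + 1) * x) = 2 powr x * (2 powr x) ^ n"
        by (simp add: powr_realpow[symmetric] powr_powr powr_add[symmetric] algebra_simps)
      finally show "real (book x n - 1) * ?y ^ n \<le> 2 powr x * (2 powr x * ?y) ^ n"
        by (simp only: power_mult_distrib mult.assoc)
    qed (use r False v in \<open>auto simp: mult_ac intro!: divide_nonneg_pos add_pos_nonneg\<close>)
  qed
  have 1: "exp_small (\<lambda>n. ((1 + e) * exp (- e)) ^ n)"
    by (rule exp_small_power) (use e one_plus_times_exp_less_1[of e] in auto)
  have 2: "exp_small (\<lambda>n. ((1 - e) * exp e) ^ n)"
    by (rule exp_small_power) (use e one_minus_times_exp_less_1[of e] in auto)
  show ?thesis unfolding step_bound_def by (intro exp_small_add 1 2 third)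
qed

text \<open>Finitely many strict inequalities at \<open>e = 0\<close> survive a small positive
  \<open>e\<close> by continuity; thus one threshold serves all decoding steps.\<close>

lemma exists_exponent:
  assumes "finite I" "\<And>i. i \<in> I \<Longrightarrow> y i < (1 :: real)"
  obtains e where "0 < e" "e < 1" "\<And>i. i \<in> I \<Longrightarrow> exp (2 * e) * y i < 1"
proof -
  have "\<forall>\<^sub>F e in at_right 0. exp (2 * e) * y i < 1" if "i \<in> I" for i
  proof -
    have "((\<lambda>e. exp (2 * e) * y i) \<longlongrightarrow> exp (2 * 0) * y i) (at_right 0)" by (intro tendsto_intros)
    then show ?thesis using assms(2)[OF that] by (intro order_tendstoD(2)) auto
  qed
  then have "\<forall>\<^sub>F e in at_right 0. \<forall>i\<in>I. exp (2 * e) * y i < 1"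
    using assms(1) by (intro eventually_ball_finite) auto
  moreover have "\<forall>\<^sub>F e in at_right (0 :: real). 0 < e \<and> e < 1"
    using eventually_at_right_field[of "\<lambda>e. 0 < e \<and> e < 1" 0] zero_less_one by (metis (mono_tags, lifting))
  ultimately have "\<forall>\<^sub>F e in at_right 0. (0 < e \<and> e < 1) \<and> (\<forall>i\<in>I. exp (2 * e) * y i < 1)"
    by eventually_elim auto
  then obtain e where "(0 < e \<and> e < 1) \<and> (\<forall>i\<in>I. exp (2 * e) * y i < 1)"
    using eventually_happens trivial_limit_at_right_real by blast
  then show ?thesis using that by blast
qed

section \<open>Digit frequencies of messages and size of letters\<close>

lemma eq_if_div_mod_eq: "a div M = b div M \<Longrightarrow> a mod M = b mod M \<Longrightarrow> a = (b :: nat)"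
  by (metis div_mult_mod_eq)

text \<open>With the middle digit fixed, \<open>m - 1\<close> is determined by its quotient by
  \<open>Q * M\<close> and its remainder modulo \<open>Q\<close>. Counting such pairs gives
  \<open>K / M\<close> up to a rounding term \<open>Q\<close>.\<close>

lemma card_digit_le:
  fixes Q M K x :: nat
  assumes "Q \<ge> 1" "M \<ge> 1"
  shows "real (card {m \<in> {1..K}. (m - 1) div Q mod M = x}) \<le> K / M + Q"
proof -
  let ?S = "{m \<in> {1..K}. (m - 1) div Q mod M = x}"
  let ?f = "\<lambda>m. ((m - 1) div (Q * M), (m - 1) mod Q)"
  have "inj_on ?f ?S"
  proof (rule inj_onI)
    fix m m' assume m: "m \<in> ?S" and m': "m' \<in> ?S" and eq: "?f m = ?f m'"
    have d: "(m - 1) div Q div M = (m' - 1) div Q div M" "(m - 1) div Q mod M = (m' - 1) div Q mod M"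
      using m m' eq by (auto simp: div_mult2_eq)
    have d3: "(m - 1) div Q = (m' - 1) div Q"
      using d by (rule eq_if_div_mod_eq)
    have "(m - 1) mod Q = (m' - 1) mod Q" using eq by simp
    with d3 have "m - 1 = m' - 1" by (rule eq_if_div_mod_eq)
    then show "m = m'" using m m' by auto
  qed
  moreover have "?f ` ?S \<subseteq> {0..(K - 1) div (Q * M)} \<times> {..<Q}"
    using assms by (auto intro!: div_le_mono diff_le_mono)
  ultimately have "card ?S \<le> card ({0..(K - 1) div (Q * M)} \<times> {..<Q})"
    by (rule card_inj_on_le) simp
  also have "\<dots> = ((K - 1) div (Q * M) + 1) * Q" by simp
  finally have "real (card ?S) \<le> (real ((K - 1) div (Q * M)) + 1) * Q"
    by (simp only: of_nat_le_iff[symmetric, where 'a=real] of_nat_mult of_nat_add of_nat_1)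
  also have "\<dots> \<le> (real K / (Q * M) + 1) * Q"
  proof (intro mult_right_mono add_right_mono)
    have "real ((K - 1) div (Q * M)) \<le> real (K - 1) / real (Q * M)" by (rule of_nat_div_le_of_nat)
    also have "\<dots> \<le> real K / real (Q * M)" by (intro divide_right_mono) auto
    finally show "real ((K - 1) div (Q * M)) \<le> real K / (Q * M)" by simp
  qed simp
  also have "\<dots> = K / M + Q" using assms by (simp add: field_simps)
  finally show ?thesis .
qed

text \<open>The book grows exponentially, but a letter exceeds \<open>n\<close> only with
  probability of order \<open>exp (- (real n)\<^sup>2 / 2)\<close>. Completing the square at
  \<open>c + 1\<close> leaves a linear exponent.\<close>

lemma book_exp_small:
  assumes "x \<ge> 0" shows "exp_small (\<lambda>n. real (book x n) * (2 * exp (- (real n)\<^sup>2 / 2)))"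
proof (rule exp_smallI[of "exp (- 1)"])
  define c where "c = x * ln 2"
  fix n
  have "real (book x n) * (2 * exp (- (real n)\<^sup>2 / 2)) \<le> 2 * 2 powr (real (n + 1) * x) * (2 * exp (- (real n)\<^sup>2 / 2))"
    by (intro mult_right_mono book_bounds assms) auto
  also have "\<dots> = 4 * exp ((real n + 1) * c - (real n)\<^sup>2 / 2)"
  proof -
    have "2 powr (real (n + 1) * x) = exp ((real n + 1) * c)" by (simp add: powr_def c_def mult.assoc)
    then have "2 * 2 powr (real (n + 1) * x) * (2 * exp (- (real n)\<^sup>2 / 2)) = 4 * (exp ((real n + 1) * c) * exp (- (real n)\<^sup>2 / 2))"
      by simp
    then show ?thesis by (simp only: exp_add[symmetric]) simp
  qed
  also have "\<dots> \<le> 4 * exp (c + (c + 1)\<^sup>2 / 2 - real n)"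
  proof -
    have "0 \<le> (real n - (c + 1))\<^sup>2" by simp
    then have "(real n + 1) * c - (real n)\<^sup>2 / 2 \<le> c + (c + 1)\<^sup>2 / 2 - real n"
      by (simp add: power2_eq_square field_simps)
    then show ?thesis by simp
  qed
  also have "\<dots> = 4 * exp (c + (c + 1)\<^sup>2 / 2) * exp (- 1) ^ n"
  proof -
    have "exp (- 1) ^ n = exp (- real n)" using exp_of_nat_mult[of n "- 1 :: real"] by simp
    then show ?thesis by (simp only: mult.assoc exp_add[symmetric]) simp
  qed
  finally show "real (book x n) * (2 * exp (- (real n)\<^sup>2 / 2)) \<le> 4 * exp (c + (c + 1)\<^sup>2 / 2) * exp (- 1) ^ n" .
qed auto

text \<open>The messages need not fill all \<open>base u ^ D\<close> digit strings, so the digits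
  are not exactly uniform. In \<open>card_digit_le\<close> the rounding term is at most
  \<open>base u ^ D / M\<close>, which costs the factor \<open>ratio\<close>, bounded as long as the
  two cardinalities are comparable.\<close>

lemma (in block_markov) spreadI:
  assumes R: "\<And>u. rate R u \<ge> 0" and ratio: "\<And>u. 1 + real (base u ^ D) / card (messages N (rate R u)) \<le> ratio"
    and ka: "\<And>u. al u \<noteq> 0 \<Longrightarrow> ratio / A \<le> \<kappa>" and kb: "\<And>u. be u \<noteq> 0 \<Longrightarrow> ratio / C u \<le> \<kappa>"
  shows "spread N R \<kappa>"
proof -
  have gen: "real (card {m \<in> messages N (rate R u). (m - 1) div Q mod M = x}) \<le> \<kappa> * card (messages N (rate R u))"
    if Q: "Q \<ge> 1" and M: "M \<ge> 1" and QM: "Q * M \<le> base u ^ D" and k: "ratio / M \<le> \<kappa>" for u Q M x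
  proof -
    define K where "K = card (messages N (rate R u))"
    have K: "K \<ge> 1" using messages_nonempty[OF R[of u], of N] by (simp add: K_def Suc_le_eq card_gt_0_iff) auto
    have mK: "messages N (rate R u) = {1..K}" by (simp add: K_def messages_def)
    have "real (card {m \<in> messages N (rate R u). (m - 1) div Q mod M = x}) \<le> K / M + Q"
      unfolding mK by (rule card_digit_le[OF Q M])
    also have "real Q \<le> real (base u ^ D) / M"
      using QM M by (simp add: pos_le_divide_eq of_nat_mult[symmetric] del: of_nat_mult of_nat_power)
    also have "real K / M + real (base u ^ D) / M = (1 + real (base u ^ D) / K) / M * K"
    proof -
      have "(1 + real (base u ^ D) / K) * K = K + real (base u ^ D)" using K by (simp add: distrib_right)
      then have "(1 + real (base u ^ D) / K) / M * K = (K + real (base u ^ D)) / M" by (metis times_divide_eq_left)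
      then show ?thesis by (simp add: add_divide_distrib)
    qed
    also have "\<dots> \<le> ratio / M * K"
      using ratio[of u] by (intro mult_right_mono divide_right_mono) (auto simp: K_def)
    also have "\<dots> \<le> \<kappa> * K" using k by (intro mult_right_mono) auto
    finally show ?thesis by (simp add: K_def)
  qed
  have base1: "base u \<ge> 1" for u using A C[of u] by (auto simp: base_def common_size_def Suc_le_eq)
  have pow: "base u ^ Suc b \<le> base u ^ D" if "b < D" for u b
    using that base1 by (intro power_increasing) auto
  show ?thesis unfolding spread_def
  proof (intro conjI impI allI)
    fix b x assume "\<exists>u. al u \<noteq> 0" and b: "b < D"
    then obtain u where u: "al u \<noteq> 0" by blast
    have "base s ^ b * A \<le> base s ^ b * base s" using C[of s] by (intro mult_left_mono) (auto simp: base_def common_size_def)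
    also have "\<dots> \<le> base s ^ D" using pow[OF b, of s] by (simp add: mult.commute)
    finally show "real (card {m \<in> messages N (rate R s). (m - 1) div base s ^ b mod A = x}) \<le> \<kappa> * card (messages N (rate R s))"
      using ka[OF u] A base1[of s] by (intro gen) (auto simp: Suc_le_eq)
  next
    fix u b x assume u: "be u \<noteq> 0" and b: "b < D"
    have "base u ^ b * common_size u * C u = base u ^ Suc b" by (simp add: base_def mult_ac)
    also have "\<dots> \<le> base u ^ D" by (rule pow[OF b])
    finally show "real (card {m \<in> messages N (rate R u). (m - 1) div (base u ^ b * common_size u) mod C u = x}) \<le> \<kappa> * card (messages N (rate R u))"
      using kb[OF u] C[of u] A base1[of u] by (intro gen) (auto simp: Suc_le_eq common_size_def)
  qed
qed

lemma (in block_markov) card_ids: "card ids = 2 * A + C U1 + C U2"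
  unfolding ids_def by (simp add: card_SigmaI UNIV_user UNIV_bool book_size_def)

text \<open>Repeated outside the locale, so that rate conditions can be stated before block length
  and codebooks are fixed.\<close>

definition path_gain :: "complex \<Rightarrow> complex \<Rightarrow> user \<Rightarrow> user \<Rightarrow> complex" where
  "path_gain gd gc d t = (if d = t then gd else gc)"

lemma (in block_markov) gain_eq: "gain = path_gain gd gc"
  by (simp add: fun_eq_iff gain_def path_gain_def)

text \<open>The number \<open>B\<close> of blocks is fixed and the block length
  \<open>n = N div B\<close> grows. Strict rate conditions make every decoding step fail with
  exponentially small probability, which even beats the factor of order \<open>n\<close> squared in
  the power of a misled relay. The last block carries no fresh index, hence the factor
  \<open>(B - 1) / B\<close>.\<close>

theorem block_markov_achievable:
  fixes gd gc :: complex and P p0 a :: real and F :: feedback and r k :: user and B :: nat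
    and al be l :: "user \<Rightarrow> real" and fw :: "user \<Rightarrow> bool"
  defines "s \<equiv> other r" and "g \<equiv> path_gain gd gc"
  assumes link: "F k r" and B: "B \<ge> 1" and a: "a \<ge> 0" and l: "\<And>u. l u \<ge> 0"
    and zero: "\<And>u. a = 0 \<Longrightarrow> al u = 0" "\<And>u. l u = 0 \<Longrightarrow> be u = 0"
    and p0: "\<And>u. (al u)\<^sup>2 + (be u)\<^sup>2 \<le> p0" "p0 < P"
    and relay: "a = 0 \<or> 2 powr a < 1 + (cmod (g k s * al s))\<^sup>2 / (1 + (cmod (g k s * be s))\<^sup>2)"
    and recv: "\<And>d. a = 0 \<or> 2 powr a < 1 + (cmod (if fw d then g d s * al s else g d r * al r))\<^sup>2 /
        (1 + (cmod (g d s * be s))\<^sup>2 + (cmod (g d r * be r))\<^sup>2)"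
    and priv: "\<And>d. l d = 0 \<or> 2 powr l d < 1 + (cmod (gd * be d))\<^sup>2 / (1 + (cmod (gc * be (other d)))\<^sup>2)"
    and R: "\<And>u. rate R u = real (B - 1) / real B * ((if u = s then a else 0) + l u)"
  shows "achievable gd gc P F R"
proof -
  define D where "D = B - 1"
  define \<sigma> where "\<sigma> = (\<lambda>u. (if u = s then a else 0) + l u)"
  have \<sigma>: "\<sigma> u \<ge> 0" for u using a l by (simp add: \<sigma>_def)
  have R': "rate R u = real D / real B * \<sigma> u" for u by (simp add: R \<sigma>_def D_def)
  have R0: "rate R u \<ge> 0" for u using \<sigma> by (simp add: R')
  define vr where "vr = 1 + (cmod (g k s * be s))\<^sup>2"
  define hr where "hr = (cmod (g k s * al s))\<^sup>2"
  define vc where "vc = (\<lambda>d. 1 + (cmod (g d s * be s))\<^sup>2 + (cmod (g d r * be r))\<^sup>2)"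
  define hc where "hc = (\<lambda>d. (cmod (if fw d then g d s * al s else g d r * al r))\<^sup>2)"
  define vp where "vp = (\<lambda>d. 1 + (cmod (gc * be (other d)))\<^sup>2)"
  define hp where "hp = (\<lambda>d. (cmod (gd * be d))\<^sup>2)"
  have v: "vr > 0" "\<And>d. vc d > 0" "\<And>d. vp d > 0"
    by (auto simp: vr_def vc_def vp_def intro!: add_pos_nonneg)
  have h: "hr \<ge> 0" "\<And>d. hc d \<ge> 0" "\<And>d. hp d \<ge> 0" by (auto simp: hr_def hc_def hp_def)
  \<comment> \<open>At rate 0 and without power the ratio would equal 1 instead of being below it;
    the value 0 keeps such steps out of the choice of \<open>e\<close>.\<close>
  define Y where "Y = (\<lambda>x v h. if x = 0 then 0 else 2 powr x * v / (v + h) :: real)"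
  have Y1: "Y x v h < 1" if "x = 0 \<or> 2 powr x < 1 + h / v" "v > 0" "h \<ge> 0" for x v h
    using that by (auto simp: Y_def field_simps add_pos_nonneg)
  define I where "I = insert (Y a vr hr) ((\<lambda>d. Y a (vc d) (hc d)) ` UNIV \<union> (\<lambda>d. Y (l d) (vp d) (hp d)) ` UNIV)"
  have "finite I" by (simp add: I_def)
  moreover have "y < 1" if "y \<in> I" for y
  proof -
    have "Y a vr hr < 1" by (rule Y1[OF _ v(1) h(1)]) (use relay in \<open>simp add: hr_def vr_def\<close>)
    moreover have "Y a (vc d) (hc d) < 1" for d
      by (rule Y1[OF _ v(2) h(2)]) (use recv[of d] in \<open>simp add: hc_def vc_def\<close>)
    moreover have "Y (l d) (vp d) (hp d) < 1" for d
      by (rule Y1[OF _ v(3) h(3)]) (use priv[of d] in \<open>simp add: hp_def vp_def\<close>)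
    ultimately show ?thesis using that by (auto simp: I_def)
  qed
  ultimately obtain e where e: "0 < e" "e < 1" and eI: "\<And>y. y \<in> I \<Longrightarrow> exp (2 * e) * y < 1"
    using exists_exponent[of I "\<lambda>y. y"] by blast
  have small_step: "exp_small (\<lambda>n. step_bound e (book x n) v h n)" if "Y x v h \<in> I" "x \<ge> 0" "v > 0" "h \<ge> 0" for x v h
  proof (rule step_bound_exp_small[OF that(2-4) e])
    show "x = 0 \<or> exp (2 * e) * (2 powr x * v / (v + h)) < 1"
      using eI[OF that(1)] by (cases "x = 0") (simp, simp only: Y_def if_False simp_thms)
  qed
  define E where "E = (\<lambda>n. real D * (step_bound e (book a n) vr hr n +
     (\<Sum>d\<in>UNIV. step_bound e (book a n) (vc d) (hc d) n + step_bound e (book (l d) n) (vp d) (hp d) n)))"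
  have E: "exp_small E"
    unfolding E_def using v h a l
    by (intro exp_small_cmult exp_small_add exp_small_sum small_step) (auto simp: I_def)
  \<comment> \<open>The summand \<open>(1 / 2) ^ n\<close> makes \<open>\<eta>\<close> positive,
    since \<open>good_codebooks_exist\<close> divides by it.\<close>
  define \<eta> where "\<eta> = (\<lambda>n. max 0 (E n) + (1 / 2) ^ n)"
  have \<eta>0: "\<eta> n > 0" for n by (auto simp: \<eta>_def intro!: add_nonneg_pos)
  have \<eta>E: "E n \<le> \<eta> n" for n by (simp add: \<eta>_def add_increasing2)
  have \<eta>s: "exp_small \<eta>"
  proof -
    obtain q K where q: "0 \<le> q" "q < 1" "0 \<le> K" "\<And>n. E n \<le> K * q ^ n" using E by (auto simp: exp_small_def)
    have "exp_small (\<lambda>n. max 0 (E n))"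
      by (rule exp_smallI[OF q(1-3)]) (use q in auto)
    then show ?thesis unfolding \<eta>_def by (intro exp_small_add exp_small_power) auto
  qed
  note \<eta>_lim = exp_small_tendsto[OF \<eta>s less_imp_le[OF \<eta>0]]
  \<comment> \<open>Bounds the ratio of \<open>spreadI\<close>: \<open>4 ^ D\<close> comes from
    rounding up two books per digit, 2 from rounding down the number of messages, and the power of 2
    from \<open>n + 1\<close> against \<open>n\<close>.\<close>
  define c0 where "c0 = 1 + (\<Sum>u\<in>UNIV. 2 * 4 ^ D * 2 powr (real D * \<sigma> u))"
  have c0: "c0 \<ge> 0" unfolding c0_def by (intro add_nonneg_nonneg sum_nonneg) auto
  \<comment> \<open>A book of rate 0 has one codeword, on which all messages agree. Its amplitude is
    0 by \<open>zero\<close>, so it is left out of the collision frequency.\<close>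
  define K1 where "K1 = (\<lambda>x n. if x = 0 then 0 else (2 powr (- x)) ^ n :: real)"
  have K1s: "exp_small (K1 x)" if "x \<ge> 0" for x
    using that by (cases "x = 0") (auto simp: K1_def[abs_def] intro!: exp_small_power exp_small_0 powr_less_one)
  have K1_0: "K1 x n \<ge> 0" for x n by (simp add: K1_def)
  have K1_le: "c0 / book x n \<le> c0 * K1 x n" if "x \<ge> 0" "x \<noteq> 0" for x n
  proof -
    have "1 / real (book x n) \<le> 1 / 2 powr (real (n + 1) * x)"
      using book_bounds[OF that(1), of n] by (intro divide_left_mono) auto
    also have "\<dots> \<le> 1 / 2 powr (real n * x)" using that by (intro divide_left_mono powr_mono) (auto simp: mult_right_mono)
    also have "\<dots> = K1 x n"
    proof -
      have "(2 powr (- x)) ^ n = 2 powr (- (real n * x))" by (simp add: powr_power mult.commute)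
      then show ?thesis using that by (simp only: K1_def if_False powr_minus_divide)
    qed
    finally show ?thesis using mult_left_mono[OF _ c0] by fastforce
  qed
  define \<kappa> where "\<kappa> = (\<lambda>n. c0 * (K1 a n + (\<Sum>u\<in>UNIV. K1 (l u) n)))"
  have \<kappa>s: "exp_small \<kappa>" unfolding \<kappa>_def
    by (intro exp_small_cmult exp_small_add exp_small_sum K1s a l c0) auto
  have \<kappa>0: "\<kappa> n \<ge> 0" for n unfolding \<kappa>_def by (intro mult_nonneg_nonneg add_nonneg_nonneg sum_nonneg K1_0 c0)
  have \<kappa>a: "c0 * K1 a n \<le> \<kappa> n" for n unfolding \<kappa>_def
    using K1_0 sum_nonneg[of UNIV "\<lambda>u. K1 (l u) n"] by (intro mult_left_mono c0) auto
  have \<kappa>l: "c0 * K1 (l u) n \<le> \<kappa> n" for n u unfolding \<kappa>_def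
    using K1_0 member_le_sum[of u UNIV "\<lambda>u. K1 (l u) n"] by (intro mult_left_mono c0) (auto intro: add_increasing)
  define G where "G = (\<lambda>n. real (2 * book a n + book (l U1) n + book (l U2) n) * (2 * exp (- (real n)\<^sup>2 / 2)))"
  have Gs: "exp_small G"
  proof -
    have "exp_small (\<lambda>n. 2 * (real (book a n) * (2 * exp (- (real n)\<^sup>2 / 2))) + real (book (l U1) n) * (2 * exp (- (real n)\<^sup>2 / 2))
       + real (book (l U2) n) * (2 * exp (- (real n)\<^sup>2 / 2)))"
      by (intro exp_small_add exp_small_cmult book_exp_small a l) auto
    then show ?thesis by (rule exp_small_mono) (simp add: G_def algebra_simps)
  qed
  have G0: "G n \<ge> 0" for n by (simp add: G_def)
  define \<delta> where "\<delta> = (P - p0) / 2"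
  have \<delta>: "\<delta> > 0" using p0 by (simp add: \<delta>_def)
  have ev1: "\<forall>\<^sub>F n in sequentially. 2 * real B * real n * (32 * p0\<^sup>2 * \<kappa> n / \<delta>\<^sup>2) + real n * G n \<le> 1 / 2"
  proof -
    have "(\<lambda>n. (64 * B * p0\<^sup>2 / \<delta>\<^sup>2) * (real n * \<kappa> n) + real n * G n) \<longlonglongrightarrow> (64 * B * p0\<^sup>2 / \<delta>\<^sup>2) * 0 + 0"
      by (intro tendsto_intros exp_small_tendsto \<kappa>s \<kappa>0 Gs G0)
    then have "\<forall>\<^sub>F n in sequentially. (64 * B * p0\<^sup>2 / \<delta>\<^sup>2) * (real n * \<kappa> n) + real n * G n < 1 / 2"
      by (rule order_tendstoD(2)) simp
    then show ?thesis by eventually_elim (simp add: mult_ac)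
  qed
  have ev2: "\<forall>\<^sub>F n in sequentially. p0 + \<delta> + 4 * \<eta> n * ((\<bar>al u\<bar> + \<bar>be u\<bar>) * n)\<^sup>2 \<le> P" for u
  proof -
    have "(\<lambda>n. p0 + \<delta> + (4 * (\<bar>al u\<bar> + \<bar>be u\<bar>)\<^sup>2) * ((real n)\<^sup>2 * \<eta> n)) \<longlonglongrightarrow> p0 + \<delta> + (4 * (\<bar>al u\<bar> + \<bar>be u\<bar>)\<^sup>2) * 0"
      by (intro tendsto_intros \<eta>_lim(1))
    then have "\<forall>\<^sub>F n in sequentially. p0 + \<delta> + (4 * (\<bar>al u\<bar> + \<bar>be u\<bar>)\<^sup>2) * ((real n)\<^sup>2 * \<eta> n) < P"
      by (rule order_tendstoD(2)) (use p0 in \<open>simp add: \<delta>_def field_simps\<close>)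
    then show ?thesis by eventually_elim (simp add: power_mult_distrib mult_ac)
  qed
  define ok where "ok = (\<lambda>n. n \<ge> 1 \<and> 2 * real B * real n * (32 * p0\<^sup>2 * \<kappa> n / \<delta>\<^sup>2) + real n * G n \<le> 1 / 2 \<and>
     (\<forall>u. p0 + \<delta> + 4 * \<eta> n * ((\<bar>al u\<bar> + \<bar>be u\<bar>) * n)\<^sup>2 \<le> P))"
  have ok_ev: "\<forall>\<^sub>F n in sequentially. ok n"
    unfolding ok_def all_user using ev1 ev2[of U1] ev2[of U2] eventually_ge_at_top[of 1] by eventually_elim simp
  have code: "\<exists>f h. is_code gd gc P F N R f h \<and> (\<forall>u. error_prob gd gc F N R f h u \<le> 4 * \<eta> (N div B))"
    if okN: "ok (N div B)" for N
  proof -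
    define n where "n = N div B"
    have n: "n \<ge> 1" and ok1: "2 * real B * real n * (32 * p0\<^sup>2 * \<kappa> n / \<delta>\<^sup>2) + real n * G n \<le> 1 / 2"
      and ok2: "\<And>u. p0 + \<delta> + 4 * \<eta> n * ((\<bar>al u\<bar> + \<bar>be u\<bar>) * n)\<^sup>2 \<le> P" using okN by (auto simp: ok_def n_def)
    interpret bm: block_markov gd gc F r k n B "book a n" "\<lambda>u. book (l u) n" al be e fw
      by unfold_locales (use link n B e book_bounds(1) a l in auto)
    have bmD: "bm.D = D" by (simp add: bm.D_def D_def)
    have NB: "B * n \<le> N" by (simp add: n_def)
    have nB: "real n * real B \<le> real N" "real N \<le> real (n + 1) * real B"
    proof -
      show "real n * real B \<le> real N" using NB by (metis mult.commute of_nat_le_iff of_nat_mult)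
      have "N < (n + 1) * B" using B unfolding n_def by (metis add.commute dividend_less_div_times less_le_trans mult_Suc plus_1_eq_Suc zero_less_one)
      then show "real N \<le> real (n + 1) * real B" by (metis less_imp_le of_nat_le_iff of_nat_mult)
    qed
    have NR: "real n * (real D * \<sigma> u) \<le> real N * rate R u" "real N * rate R u \<le> real (n + 1) * (real D * \<sigma> u)" for u
    proof -
      have e: "real N * rate R u = real N / real B * (real D * \<sigma> u)" by (simp add: R')
      have b: "real n \<le> real N / real B" "real N / real B \<le> real (n + 1)"
        using nB B by (simp_all add: pos_le_divide_eq pos_divide_le_eq)
      have "0 \<le> real D * \<sigma> u" using \<sigma> by simp
      then show "real n * (real D * \<sigma> u) \<le> real N * rate R u" "real N * rate R u \<le> real (n + 1) * (real D * \<sigma> u)"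
        unfolding e by (intro mult_right_mono b; assumption)+
    qed
    have base_eq: "bm.base u = (if u = s then book a n else 1) * book (l u) n" for u
      by (simp add: bm.base_def bm.common_size_def s_def)
    have base_ge: "2 powr (real (n + 1) * \<sigma> u) \<le> real (bm.base u)" for u
    proof -
      have "2 powr (real (n + 1) * (if u = s then a else 0)) * 2 powr (real (n + 1) * l u) \<le> real (if u = s then book a n else 1) * real (book (l u) n)"
        using book_bounds(2)[OF a, of n] book_bounds(2)[OF l[of u], of n] by (intro mult_mono) auto
      then show ?thesis by (simp add: base_eq \<sigma>_def powr_add[symmetric] distrib_left)
    qed
    have base_le: "real (bm.base u) \<le> 4 * 2 powr (real (n + 1) * \<sigma> u)" for u
    proof -
      have "real (if u = s then book a n else 1) * real (book (l u) n) \<le> (2 * 2 powr (real (n + 1) * (if u = s then a else 0))) * (2 * 2 powr (real (n + 1) * l u))"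
        using book_bounds(3)[OF a, of n] book_bounds(3)[OF l[of u], of n] by (intro mult_mono) auto
      also have "\<dots> = 4 * 2 powr (real (n + 1) * \<sigma> u)" by (simp add: \<sigma>_def powr_add[symmetric] distrib_left)
      finally show ?thesis by (simp only: base_eq of_nat_mult)
    qed
    have pw: "(2 powr (real (n + 1) * \<sigma> u)) ^ D = 2 powr (real (n + 1) * (real D * \<sigma> u))" for u
      by (simp add: powr_realpow[symmetric] powr_powr mult_ac)
    have card_le: "card (messages N (rate R u)) \<le> bm.base u ^ bm.D" for u
    proof -
      have "real (card (messages N (rate R u))) \<le> 2 powr (real N * rate R u)"
        by (simp add: messages_def)
      also have "\<dots> \<le> 2 powr (real (n + 1) * (real D * \<sigma> u))" using NR(2) by (intro powr_mono) auto
      also have "\<dots> = (2 powr (real (n + 1) * \<sigma> u)) ^ D" by (rule pw[symmetric])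
      also have "\<dots> \<le> real (bm.base u) ^ D" by (intro power_mono base_ge) auto
      finally show ?thesis by (metis bmD of_nat_le_iff of_nat_power)
    qed
    have spread: "bm.spread N R (\<kappa> n)"
    proof (rule bm.spreadI[OF R0, where ratio=c0])
      fix u
      have "real (bm.base u ^ bm.D) \<le> (4 * 2 powr (real (n + 1) * \<sigma> u)) ^ D"
        unfolding bmD of_nat_power by (intro power_mono base_le) auto
      also have "\<dots> = 4 ^ D * 2 powr (real (n + 1) * (real D * \<sigma> u))" by (simp only: power_mult_distrib pw)
      also have "\<dots> = (2 * 4 ^ D * 2 powr (real D * \<sigma> u)) * (2 powr (real n * (real D * \<sigma> u)) / 2)"
        by (simp add: powr_add distrib_right)
      also have "\<dots> \<le> (2 * 4 ^ D * 2 powr (real D * \<sigma> u)) * real (card (messages N (rate R u)))"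
      proof (rule mult_left_mono)
        have "2 powr (real n * (real D * \<sigma> u)) / 2 \<le> 2 powr (real N * rate R u) / 2"
          using NR(1) by (intro divide_right_mono powr_mono) auto
        also have "\<dots> \<le> real (card (messages N (rate R u)))" by (rule card_messages_ge[OF R0])
        finally show "2 powr (real n * (real D * \<sigma> u)) / 2 \<le> real (card (messages N (rate R u)))" .
      qed simp
      finally have le: "real (bm.base u ^ bm.D) \<le> (2 * 4 ^ D * 2 powr (real D * \<sigma> u)) * real (card (messages N (rate R u)))" .
      have "messages N (rate R u) \<noteq> {}" using messages_nonempty[OF R0[of u], of N] by blast
      then have "0 < real (card (messages N (rate R u)))" by (simp add: card_gt_0_iff)
      from le have "real (bm.base u ^ bm.D) / card (messages N (rate R u)) \<le> 2 * 4 ^ D * 2 powr (real D * \<sigma> u)"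
        unfolding pos_divide_le_eq[OF \<open>0 < real (card (messages N (rate R u)))\<close>] .
      also have "\<dots> \<le> (\<Sum>u\<in>UNIV. 2 * 4 ^ D * 2 powr (real D * \<sigma> u))"
        by (intro member_le_sum[where f="\<lambda>u. 2 * 4 ^ D * 2 powr (real D * \<sigma> u)"]) auto
      finally show "1 + real (bm.base u ^ bm.D) / card (messages N (rate R u)) \<le> c0" by (simp add: c0_def)
    next
      fix u assume "al u \<noteq> 0"
      then have "a \<noteq> 0" using zero(1) by blast
      from K1_le[OF a this, of n] show "c0 / book a n \<le> \<kappa> n" using \<kappa>a[of n] by linarith
    next
      fix u assume "be u \<noteq> 0"
      then have "l u \<noteq> 0" using zero(2) by blast
      from K1_le[OF l this, of n] show "c0 / book (l u) n \<le> \<kappa> n" using \<kappa>l[of u n] by linarith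
    qed
    have err: "bm.err_bound \<le> \<eta> n"
    proof -
      have "bm.err_bound = E n"
        unfolding bm.err_bound_def E_def bmD bm.receiver_bound_def bm.relay_var_def bm.common_var_def bm.private_var_def bm.gain_eq
          vr_def hr_def vc_def hc_def vp_def hp_def g_def s_def by (rule refl)
      then show ?thesis using \<eta>E[of n] by simp
    qed
    have "2 * real B * real n * (32 * p0\<^sup>2 * \<kappa> n / \<delta>\<^sup>2) + real n * real (card bm.ids) * (2 * exp (- (real n)\<^sup>2 / 2)) \<le> 1 / 2"
      using ok1 by (simp add: bm.card_ids G_def mult.assoc)
    then show ?thesis
      using bm.code_exists[OF NB R0 card_le spread \<kappa>0 p0(1) \<delta> err \<eta>0 _ ok2] by (simp add: n_def)
  qed
  \<comment> \<open>\<open>achievable\<close> asks for a code at every length; lengths too short for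
    the construction get the zero code, which does not affect the limit of the errors.\<close>
  define fh where "fh = (\<lambda>N. if ok (N div B) then SOME p. is_code gd gc P F N R (fst p) (snd p) \<and> (\<forall>u. error_prob gd gc F N R (fst p) (snd p) u \<le> 4 * \<eta> (N div B))
      else ((\<lambda>_ _ _ _ _. 0), (\<lambda>_ _. 0)))"
  have fh: "is_code gd gc P F N R (fst (fh N)) (snd (fh N)) \<and> (\<forall>u. error_prob gd gc F N R (fst (fh N)) (snd (fh N)) u \<le> 4 * \<eta> (N div B))"
    if "ok (N div B)" for N
  proof -
    have "\<exists>p. is_code gd gc P F N R (fst p) (snd p) \<and> (\<forall>u. error_prob gd gc F N R (fst p) (snd p) u \<le> 4 * \<eta> (N div B))"
      using code[OF that] by auto
    from someI_ex[OF this] show ?thesis using that by (simp add: fh_def)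
  qed
  have is_code: "is_code gd gc P F N R (fst (fh N)) (snd (fh N))" for N
  proof (cases "ok (N div B)")
    case False
    have "measurable_encoder N R (\<lambda>_ _ _ _ _. 0)" "measurable_decoder N (\<lambda>_ _. 0)"
      by (auto simp: measurable_encoder_def measurable_decoder_def)
    moreover have "power_constraint gd gc P F N R (\<lambda>_ _ _ _ _. 0)"
    proof -
      have "chan_in gd gc F (\<lambda>_ _ _ _ _. 0) w z u j = 0" for w z u j by (subst chan_in.simps) simp
      then show ?thesis by (simp add: power_constraint_def case_prod_beta')
    qed
    ultimately show ?thesis using False by (simp add: is_code_def fh_def)
  qed (use fh in blast)
  have divB: "filterlim (\<lambda>N. N div B) sequentially sequentially"
  proof (rule filterlim_at_top[THEN iffD2], rule allI)
    fix Z show "\<forall>\<^sub>F N in sequentially. Z \<le> N div B"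
      using eventually_ge_at_top[of "Z * B"] by eventually_elim (use B in \<open>simp add: less_eq_div_iff_mult_less_eq\<close>)
  qed
  have lim: "(\<lambda>N. error_prob gd gc F N R (fst (fh N)) (snd (fh N)) u) \<longlonglongrightarrow> 0" for u
  proof (rule tendsto_sandwich[OF _ _ tendsto_const])
    show "\<forall>\<^sub>F N in sequentially. 0 \<le> error_prob gd gc F N R (fst (fh N)) (snd (fh N)) u"
      by (simp add: error_prob_def)
    have "\<forall>\<^sub>F N in sequentially. ok (N div B)" using eventually_compose_filterlim[OF ok_ev divB] .
    then show "\<forall>\<^sub>F N in sequentially. error_prob gd gc F N R (fst (fh N)) (snd (fh N)) u \<le> 4 * \<eta> (N div B)"
      by eventually_elim (use fh in blast)
    have "(\<lambda>N. 4 * \<eta> (N div B)) \<longlonglongrightarrow> 4 * 0"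
      by (intro tendsto_intros filterlim_compose[OF \<eta>_lim(3) divB])
    then show "(\<lambda>N. 4 * \<eta> (N div B)) \<longlonglongrightarrow> 0" by simp
  qed
  show ?thesis unfolding achievable_def
    using R0 is_code lim by (intro conjI allI exI[of _ "\<lambda>N. fst (fh N)"] exI[of _ "\<lambda>N. snd (fh N)"]) auto
qed

section \<open>Sum-capacity\<close>

lemma achievable_zero_rates:
  assumes "P \<ge> 0" shows "achievable gd gc P F (0, 0)"
proof -
  have r: "rate (0, 0) u = 0" for u by (cases u) auto
  have m: "messages N 0 = {1}" for N by (auto simp: messages_def)
  let ?f = "\<lambda>_ _ _ _ _. 0 :: complex" and ?h = "\<lambda>_ _. 1 :: nat"
  have x0: "chan_in gd gc F ?f w z u j = 0" for w z u j by (subst chan_in.simps) simp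
  have f: "measurable_encoder N (0, 0) ?f" and h: "measurable_decoder N ?h" for N
    by (auto simp: measurable_encoder_def measurable_decoder_def)
  have "power_constraint gd gc P F N (0, 0) ?f" for N
    using x0 by (simp add: power_constraint_def case_prod_beta')
  moreover have "error_prob gd gc F N (0, 0) ?f ?h u = 0" for N u
  proof -
    have "w u = 1" if "w \<in> message_pairs N (0, 0)" for w
      using that by (auto simp: message_pairs_def r m)
    then show ?thesis by (subst error_prob_eq[OF f h]) (auto simp: r)
  qed
  ultimately show ?thesis unfolding achievable_def using f h
    by (intro conjI allI exI[of _ "\<lambda>_. ?f"] exI[of _ "\<lambda>_. ?h"]) (auto simp: r is_code_def)
qed

lemma rate_sum: "rate R U1 + rate R U2 = fst R + snd R"
  by (cases R) simp

lemma capacity_region_sum_le: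
  assumes "P \<ge> 0" "R \<in> capacity_region gd gc P F"
  shows "fst R + snd R \<le> log 2 (sum_rate_bound gd gc P)"
proof -
  let ?S = "{R :: real \<times> real. fst R + snd R \<le> log 2 (sum_rate_bound gd gc P)}"
  have "closed ?S" by (intro closed_Collect_le continuous_intros)
  moreover have "{R. achievable gd gc P F R} \<subseteq> ?S"
    using achievable_sum_rate_le[OF _ assms(1)] by (auto simp: rate_sum)
  ultimately have "capacity_region gd gc P F \<subseteq> ?S" unfolding capacity_region_def by (rule closure_minimal[rotated])
  then show ?thesis using assms(2) by blast
qed

lemma sum_capacity_le:
  assumes "P \<ge> 0" shows "sum_capacity gd gc P F \<le> log 2 (sum_rate_bound gd gc P)"
proof -
  have "(0, 0) \<in> capacity_region gd gc P F"
    unfolding capacity_region_def using achievable_zero_rates[OF assms] by (intro subsetD[OF closure_subset]) simp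
  then show ?thesis unfolding sum_capacity_def
    by (intro cSUP_least) (use capacity_region_sum_le[OF assms] in fastforce)+
qed

lemma sum_rate_le_sum_capacity:
  assumes "P \<ge> 0" "achievable gd gc P F R" shows "rate R U1 + rate R U2 \<le> sum_capacity gd gc P F"
proof -
  have "R \<in> capacity_region gd gc P F"
    unfolding capacity_region_def using assms(2) by (intro subsetD[OF closure_subset]) simp
  moreover have "bdd_above ((\<lambda>(R1, R2). R1 + R2) ` capacity_region gd gc P F)"
    by (rule bdd_aboveI2[where M="log 2 (sum_rate_bound gd gc P)"])
      (use capacity_region_sum_le[OF assms(1)] in fastforce)
  ultimately have "(\<lambda>(R1, R2). R1 + R2) R \<le> sum_capacity gd gc P F"
    unfolding sum_capacity_def by (intro cSUP_upper)
  then show ?thesis by (simp add: rate_sum case_prod_beta)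
qed

lemma sum_capacity_nonneg: "P \<ge> 0 \<Longrightarrow> sum_capacity gd gc P F \<ge> 0"
  using sum_rate_le_sum_capacity[OF _ achievable_zero_rates] by fastforce

lemma le_if_scaled_le:
  assumes "\<And>t. 0 < t \<Longrightarrow> t < 1 \<Longrightarrow> t * x \<le> (y :: real)" shows "x \<le> y"
proof -
  have "((\<lambda>t. t * x) \<longlongrightarrow> 1 * x) (at_left 1)" by (intro tendsto_intros)
  moreover have "\<forall>\<^sub>F t in at_left (1 :: real). t * x \<le> y"
    by (rule eventually_mono[OF eventually_at_left_real[of 0 1]]) (use assms in auto)
  ultimately have "1 * x \<le> y" by (intro tendsto_upperbound) auto
  then show ?thesis by simp
qed

text \<open>Two limits remove the losses: scaling all rates by \<open>t < 1\<close> makes the rate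
  conditions strict, and letting \<open>B\<close> tend to infinity removes the cost of the last
  block.\<close>

lemma block_markov_sum_capacity:
  fixes gd gc :: complex and a pw P :: real and al be l :: "user \<Rightarrow> real"
  defines "g \<equiv> path_gain gd gc"
  assumes link: "F k r" and a: "a \<ge> 0" and l: "\<And>u. l u \<ge> 0"
    and zero: "\<And>u. a = 0 \<Longrightarrow> al u = 0" "\<And>u. l u = 0 \<Longrightarrow> be u = 0"
    and pw: "\<And>u. (al u)\<^sup>2 + (be u)\<^sup>2 \<le> pw" "pw < P"
    and relay: "2 powr a \<le> 1 + (cmod (g k (other r) * al (other r)))\<^sup>2 / (1 + (cmod (g k (other r) * be (other r)))\<^sup>2)"
    and recv: "\<And>d. 2 powr a \<le> 1 + (cmod (if fw d then g d (other r) * al (other r) else g d r * al r))\<^sup>2 /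
        (1 + (cmod (g d (other r) * be (other r)))\<^sup>2 + (cmod (g d r * be r))\<^sup>2)"
    and priv: "\<And>d. 2 powr l d \<le> 1 + (cmod (gd * be d))\<^sup>2 / (1 + (cmod (gc * be (other d)))\<^sup>2)"
  shows "a + l U1 + l U2 \<le> sum_capacity gd gc P F"
proof (rule le_if_scaled_le)
  fix t :: real assume t: "0 < t" "t < 1"
  define T where "T = t * (a + l U1 + l U2)"
  have P: "P \<ge> 0" using pw(1)[of U1] pw(2) by (smt (verit) zero_le_power2)
  have strict: "t * x = 0 \<or> 2 powr (t * x) < y" if "x \<ge> 0" "2 powr x \<le> y" for x y
  proof (cases "x = 0")
    case False
    then have "t * x < x" using t that by simp
    then have "2 powr (t * x) < 2 powr x" by (intro powr_less_mono) auto
    then show ?thesis using that by linarith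
  qed simp
  have "real (B - 1) / real B * T \<le> sum_capacity gd gc P F" if B: "B \<ge> 1" for B
  proof -
    define f where "f = (\<lambda>u. real (B - 1) / real B * ((if u = other r then t * a else 0) + t * l u))"
    have rate: "rate (f U1, f U2) u = f u" for u by (cases u) auto
    have "achievable gd gc P F (f U1, f U2)"
    proof (rule block_markov_achievable[where F=F and k=k and r=r and B=B and a="t * a" and l="\<lambda>u. t * l u" and al=al and be=be and fw=fw])
      show "t * a = 0 \<Longrightarrow> al u = 0" "t * l u = 0 \<Longrightarrow> be u = 0" for u using zero t by auto
      show "(al u)\<^sup>2 + (be u)\<^sup>2 \<le> pw" for u by (rule pw(1))
      show "t * a = 0 \<or> 2 powr (t * a) < 1 + (cmod (path_gain gd gc k (other r) * al (other r)))\<^sup>2 / (1 + (cmod (path_gain gd gc k (other r) * be (other r)))\<^sup>2)"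
        using strict[OF a relay] unfolding g_def .
      show "t * a = 0 \<or> 2 powr (t * a) < 1 + (cmod (if fw d then path_gain gd gc d (other r) * al (other r) else path_gain gd gc d r * al r))\<^sup>2 /
        (1 + (cmod (path_gain gd gc d (other r) * be (other r)))\<^sup>2 + (cmod (path_gain gd gc d r * be r))\<^sup>2)" for d
        using strict[OF a recv[of d]] unfolding g_def .
      show "t * l d = 0 \<or> 2 powr (t * l d) < 1 + (cmod (gd * be d))\<^sup>2 / (1 + (cmod (gc * be (other d)))\<^sup>2)" for d
        using strict[OF l priv[of d]] .
      show "rate (f U1, f U2) u = real (B - 1) / real B * ((if u = other r then t * a else 0) + t * l u)" for u
        unfolding rate by (simp only: f_def)
    qed (use link B t a l pw in auto)
    from sum_rate_le_sum_capacity[OF P this] have "f U1 + f U2 \<le> sum_capacity gd gc P F" by simp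
    also have "f U1 + f U2 = real (B - 1) / real B * T"
      by (cases r) (simp_all add: f_def T_def algebra_simps)
    finally show ?thesis .
  qed
  then have "real n / real (Suc n) * T \<le> sum_capacity gd gc P F" for n
    by (metis diff_Suc_1 le_add1 plus_1_eq_Suc)
  moreover have "(\<lambda>n. real n / real (Suc n) * T) \<longlonglongrightarrow> 1 * T"
    by (intro tendsto_intros LIMSEQ_n_over_Suc_n)
  ultimately have "1 * T \<le> sum_capacity gd gc P F"
    by (intro LIMSEQ_le_const2) auto
  then show "t * (a + l U1 + l U2) \<le> sum_capacity gd gc P F" by (simp add: T_def)
qed

text \<open>Receiver 1 decodes forwards from transmitter 2 and receiver 2 backwards from the relay,
  transmitter 1, while the relay hears transmitter 2 at receiver 1. Thus all three steps use the
  gain \<open>gc\<close>, and without private signals each is a point-to-point link.\<close>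

lemma sum_capacity_strong_ge:
  assumes link: "F U1 U1" and P: "P \<ge> 0"
  shows "log 2 (1 + INR gc P) \<le> sum_capacity gd gc P F"
proof (cases "INR gc P > 0")
  case True
  then have gc: "(cmod gc)\<^sup>2 > 0" and P: "P > 0" using P by (auto simp: INR_def zero_less_mult_iff)
  show ?thesis
  proof (rule le_if_scaled_le)
    fix t :: real assume t: "0 < t" "t < 1"
    define a where "a = t * log 2 (1 + INR gc P)"
    have a: "0 < a" "a < log 2 (1 + INR gc P)" using t True by (auto simp: a_def)
    then have a2: "2 powr a < 1 + INR gc P" using True by (simp add: less_log_iff)
    have a1: "1 < 2 powr a" using a by simp
    \<comment> \<open>The power at which a link of gain \<open>gc\<close> supports exactly the rate
      \<open>a\<close>; it is below \<open>P\<close> because \<open>a\<close> is below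
      \<open>log 2 (1 + INR gc P)\<close>.\<close>
    define p where "p = (2 powr a - 1) / (cmod gc)\<^sup>2"
    have p: "p > 0" "p < P" using a1 a2 gc by (auto simp: p_def pos_divide_less_eq INR_def mult.commute)
    have g: "(cmod (gc * sqrt p))\<^sup>2 = 2 powr a - 1" using p gc by (simp add: norm_mult power_mult_distrib p_def)
    have "a + 0 + 0 \<le> sum_capacity gd gc P F"
      by (rule block_markov_sum_capacity[where k=U1 and r=U1 and al="\<lambda>_. sqrt p" and be="\<lambda>_. 0" and l="\<lambda>_. 0" and fw="\<lambda>d. d = U1" and F=F and pw=p])
        (use link a p g in \<open>auto simp: path_gain_def less_eq_real_def\<close>)
    then show "t * log 2 (1 + INR gc P) \<le> sum_capacity gd gc P F" by (simp add: a_def)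
  qed
next
  case False
  then have "INR gc P = 0" using P by (simp add: INR_def zero_less_mult_iff not_less mult_le_0_iff)
  then show ?thesis using sum_capacity_nonneg[OF P] by simp
qed

text \<open>24 is the largest integer below \<open>2 powr 4.59\<close>; the 100th power makes the
  exponent an integer.\<close>

lemma gap_ratio: "(24 :: real) \<le> 2 powr 4.59"
proof -
  have "(24 :: real) ^ 100 \<le> 2 ^ 459" by simp
  also have "(2 :: real) ^ 459 = (2 powr 4.59) ^ 100" by (simp add: powr_power powr_numeral)
  finally show ?thesis by (rule power_mono_iff[THEN iffD1, rotated 3]) auto
qed

lemma log_gap:
  assumes "x > 0" "x \<le> 24 * y" shows "log 2 x - 4.59 \<le> log 2 y"
proof -
  have "y > 0" using assms by linarith
  have "x \<le> 2 powr 4.59 * y" using mult_right_mono[OF gap_ratio, of y] assms \<open>y > 0\<close> by linarith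
  then have "log 2 x \<le> log 2 (2 powr 4.59 * y)" using assms by simp
  also have "\<dots> = 4.59 + log 2 y" using \<open>y > 0\<close> by (simp add: log_mult)
  finally show ?thesis by simp
qed

section \<open>Achievable sums and the gap under weak interference\<close>

lemma cmod_sqrt_sq: "x \<ge> 0 \<Longrightarrow> (cmod (z * complex_of_real (sqrt x)))\<^sup>2 = (cmod z)\<^sup>2 * x"
  by (simp add: norm_mult power_mult_distrib)

text \<open>No common message is sent and interference is treated as noise, which loses little when
  it arrives below the noise level.\<close>

lemma sum_capacity_private_ge:
  assumes link: "F k r" and "P > 0" "SNR gd P > 0"
  shows "2 * log 2 (1 + 9/10 * SNR gd P / (1 + 9/10 * INR gc P)) \<le> sum_capacity gd gc P F"
proof -
  define q where "q = 9/10 * P"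
  have q: "0 \<le> q" "q < P" using assms by (auto simp: q_def)
  have gd: "(cmod (gd * sqrt q))\<^sup>2 = 9/10 * SNR gd P" and gc: "(cmod (gc * sqrt q))\<^sup>2 = 9/10 * INR gc P"
    unfolding cmod_sqrt_sq[OF q(1)] by (simp_all add: q_def SNR_def INR_def)
  have I: "INR gc P \<ge> 0" using assms by (simp add: INR_def)
  define L where "L = 1 + 9/10 * SNR gd P / (1 + 9/10 * INR gc P)"
  have L: "L > 1" unfolding L_def using I assms by (simp add: add_pos_nonneg)
  then have L0: "log 2 L > 0" "2 powr log 2 L = L" by auto
  have "0 + log 2 L + log 2 L \<le> sum_capacity gd gc P F"
    by (rule block_markov_sum_capacity[where k=k and r=r and al="\<lambda>_. 0" and be="\<lambda>_. sqrt q"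
          and l="\<lambda>_. log 2 L" and F=F and pw=q])
      (use link q L0 in \<open>simp_all add: gd gc, simp add: L_def\<close>)
  then show ?thesis by (simp add: L_def)
qed

text \<open>The private signals are received at the noise level by the unintended receiver; the common
  message of the user that is not \<open>r\<close> takes the remaining power.\<close>

lemma sum_capacity_common_private_ge:
  assumes link: "F k r" and P: "P > 0" and IS: "1 \<le> INR gc P" "INR gc P \<le> SNR gd P"
    and M: "1 \<le> M" "M \<le> (19/10 + 9/10 * SNR gd P) / (19/10 + 9/10 * (SNR gd P / INR gc P))"
    and Mr: "k = r \<Longrightarrow> M \<le> (1 + 9/10 * INR gc P) / (19/10)"
  shows "log 2 M + 2 * log 2 (1 + 9/10 * (SNR gd P / INR gc P) / (19/10)) \<le> sum_capacity gd gc P F"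
proof -
  define S I where "S = SNR gd P" and "I = INR gc P"
  have SI: "1 \<le> I" "I \<le> S" using IS by (auto simp: S_def I_def)
  \<comment> \<open>Power \<open>P / I\<close> would arrive across exactly at noise level; the
    factor \<open>9/10\<close>, which keeps the total strictly below \<open>P\<close>, lowers it to
    \<open>9/10\<close>, and noise plus interference to \<open>19/10\<close>.\<close>
  define x y where "x = 9/10 * (P - P / I)" and "y = 9/10 * (P / I)"
  have "P / I \<le> P" "0 < P / I" using SI P by (simp_all add: pos_divide_le_eq)
  then have xy: "x \<ge> 0" "y > 0" by (simp_all add: x_def y_def)
  have "x + y = 9/10 * P" by (simp only: x_def y_def distrib_left[symmetric] diff_add_cancel)
  then have xyP: "x + y < P" using P by simp
  have g: "(cmod gd)\<^sup>2 * y = 9/10 * (S / I)" "(cmod gc)\<^sup>2 * y = 9/10"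
    "(cmod gd)\<^sup>2 * x = 9/10 * (S - S / I)" "(cmod gc)\<^sup>2 * x = 9/10 * (I - 1)"
  proof -
    have e: "(cmod gd)\<^sup>2 * P = S" "(cmod gc)\<^sup>2 * P = I" by (simp_all add: S_def I_def SNR_def INR_def)
    show "(cmod gd)\<^sup>2 * y = 9/10 * (S / I)" "(cmod gc)\<^sup>2 * y = 9/10"
      using SI e by (simp_all add: y_def)
    have "(cmod gd)\<^sup>2 * x = 9/10 * ((cmod gd)\<^sup>2 * P - (cmod gd)\<^sup>2 * P / I)"
      "(cmod gc)\<^sup>2 * x = 9/10 * ((cmod gc)\<^sup>2 * P - (cmod gc)\<^sup>2 * P / I)"
      by (simp_all add: x_def right_diff_distrib)
    then show "(cmod gd)\<^sup>2 * x = 9/10 * (S - S / I)" "(cmod gc)\<^sup>2 * x = 9/10 * (I - 1)"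
      using SI unfolding e by simp_all
  qed
  \<comment> \<open>\<open>block_markov_sum_capacity\<close> asks for a silent common signal at rate
    0, which is the case \<open>M = 1\<close>.\<close>
  define al where "al = (if M = 1 then 0 else sqrt x)"
  define L where "L = 1 + 9/10 * (S / I) / (19/10)"
  define Q where "Q = S / I"
  have Q: "Q \<ge> 1" "Q \<le> S" using SI by (auto simp: Q_def pos_divide_le_eq)
  have L: "L > 1" using SI by (simp add: L_def)
  have gal: "(cmod (z * al))\<^sup>2 = (if M = 1 then 0 else (cmod z)\<^sup>2 * x)"
    and gbe: "(cmod (z * sqrt y))\<^sup>2 = (cmod z)\<^sup>2 * y" for z :: complex
    using xy cmod_sqrt_sq[of x z] cmod_sqrt_sq[of y z] by (auto simp: al_def)
  have a2: "2 powr log 2 M = M" using M by simp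
  have lM: "log 2 M = 0 \<Longrightarrow> M = 1" using a2 by (metis powr_zero_eq_one zero_neq_numeral)
  have lL: "log 2 L > 0" using L by simp
  have eq: "1 + 9/10 * (S - Q) / (19/10 + 9/10 * Q) = (19/10 + 9/10 * S) / (19/10 + 9/10 * Q)"
    using Q by (simp add: field_simps)
  have "log 2 M + log 2 L + log 2 L \<le> sum_capacity gd gc P F"
  proof (rule block_markov_sum_capacity[where k=k and r=r and al="\<lambda>_. al" and be="\<lambda>_. sqrt y"
        and l="\<lambda>_. log 2 L" and fw="\<lambda>d. d = other r" and F=F and pw="x + y"])
    show "(al)\<^sup>2 + (sqrt y)\<^sup>2 \<le> x + y" using xy by (simp add: al_def)
    show "2 powr log 2 M \<le> 1 + (cmod (path_gain gd gc k (other r) * al))\<^sup>2 / (1 + (cmod (path_gain gd gc k (other r) * sqrt y))\<^sup>2)"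
    proof (cases "M = 1")
      case False
      show ?thesis
      \<comment> \<open>Listening to its own receiver, the relay hears the source through
        \<open>gc\<close>, whence the cap \<open>Mr\<close>. Listening to the other one, it hears
        the source through \<open>gd\<close> with less noise than a receiver has, so the receivers'
        cap is the stricter one.\<close>
      proof (cases "k = r")
        case True
        then have "M \<le> 1 + 9/10 * (I - 1) / (1 + 9/10)" using Mr by (simp add: I_def field_simps)
        then show ?thesis unfolding gal gbe a2 using False True by (cases r) (simp_all add: path_gain_def g)
      next
        case k: False
        have "M \<le> 1 + 9/10 * (S - Q) / (19/10 + 9/10 * Q)" unfolding eq using M by (simp add: S_def I_def Q_def)
        also have "9/10 * (S - Q) / (19/10 + 9/10 * Q) \<le> 9/10 * (S - Q) / (1 + 9/10 * Q)"
          using Q by (intro divide_left_mono) auto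
        finally show ?thesis unfolding gal gbe a2 using False k by (cases r; cases k) (simp_all add: path_gain_def g Q_def)
      qed
    qed (simp add: a2)
    show "2 powr log 2 M \<le> 1 + (cmod (if d = other r then path_gain gd gc d (other r) * al else path_gain gd gc d r * al))\<^sup>2 /
        (1 + (cmod (path_gain gd gc d (other r) * sqrt y))\<^sup>2 + (cmod (path_gain gd gc d r * sqrt y))\<^sup>2)" for d
    proof (cases "M = 1")
      case False
      have "M \<le> 1 + 9/10 * (S - Q) / (19/10 + 9/10 * Q)" unfolding eq using M by (simp add: S_def I_def Q_def)
      then show ?thesis unfolding if_distrib[of cmod] if_distrib[of "\<lambda>x. x\<^sup>2"] gal gbe a2
        using False by (cases r; cases d) (simp_all add: path_gain_def g Q_def add_ac)
    qed (simp add: a2)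
    show "2 powr log 2 L \<le> 1 + (cmod (gd * sqrt y))\<^sup>2 / (1 + (cmod (gc * sqrt y))\<^sup>2)" for d :: user
      unfolding gbe using L by (simp add: g L_def)
  qed (use link M lM lL xy xyP in \<open>auto simp: al_def\<close>)
  then show ?thesis by (simp add: L_def S_def I_def)
qed

text \<open>Both factors on the left are compared with \<open>1 + S\<close>, and \<open>19/9\<close>
  is the price of replacing it by \<open>1 + 9/19 * S\<close>. The resulting constant, 4 times the
  square of \<open>19/9\<close>, is below 24.\<close>

lemma weak_gap_private:
  fixes S I :: real assumes "0 \<le> I" "I \<le> 1" "0 \<le> S"
  shows "(1 + 2 * S + 2 * I) * (1 + S / (1 + I)) \<le> 24 * (1 + 9/10 * S / (1 + 9/10 * I))\<^sup>2"
proof -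
  have "(1 + 2 * S + 2 * I) * (1 + S / (1 + I)) \<le> (4 * (1 + S)) * (1 + S)"
    using assms by (intro mult_mono) (auto simp: divide_le_eq mult_le_cancel_left1)
  also have "\<dots> \<le> (4 * (19/9 * (1 + 9/19 * S))) * (19/9 * (1 + 9/19 * S))"
    using assms by (intro mult_mono) auto
  also have "\<dots> \<le> 24 * (1 + 9/19 * S)\<^sup>2"
  proof -
    have "0 \<le> (1 + 9/19 * S)\<^sup>2" by simp
    moreover have "(4 * (19/9 * x)) * (19/9 * x) = 1444/81 * x\<^sup>2" for x :: real by (simp add: power2_eq_square)
    moreover have "1444/81 * y \<le> 24 * y" if "0 \<le> y" for y :: real using that by simp
    ultimately show ?thesis by metis
  qed
  also have "\<dots> \<le> 24 * (1 + 9/10 * S / (1 + 9/10 * I))\<^sup>2"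
  proof -
    have "9/10 * S / (19/10) \<le> 9/10 * S / (1 + 9/10 * I)" using assms by (intro divide_left_mono) auto
    then show ?thesis using assms by (intro mult_left_mono power_mono) auto
  qed
  finally show ?thesis .
qed

text \<open>The two claims match the two caps on the common rate, by the receivers and by the relay.
  In terms of \<open>Q = S / I\<close> the comparison is one of products of linear factors, with
  constants \<open>1444/81\<close> and \<open>13718/729\<close>, both below 19.\<close>

lemma weak_gap_common:
  fixes S I :: real assumes "1 \<le> I" "I \<le> S"
  defines "L \<equiv> 1 + 9/10 * (S / I) / (19/10)"
  shows "(1 + 2 * S + 2 * I) * (1 + S / (1 + I)) \<le> 24 * ((19/10 + 9/10 * S) / (19/10 + 9/10 * (S / I)) * L\<^sup>2)"
    and "(1 + 2 * S + 2 * I) * (1 + S / (1 + I)) \<le> 24 * ((1 + 9/10 * I) / (19/10) * L\<^sup>2)"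
proof -
  define Q where "Q = S / I"
  have Q: "Q \<ge> 1" and S: "S = Q * I" using assms by (auto simp: Q_def)
  have L: "L = (19 + 9 * Q) / 19" by (simp add: L_def Q_def)
  have q: "1 + S / (1 + I) \<le> (19 + 9 * Q) / 9"
  proof -
    have "S / (1 + I) \<le> Q" unfolding Q_def using assms by (intro divide_left_mono) auto
    then have "1 + S / (1 + I) \<le> 1 + Q" by (rule add_left_mono)
    also have "\<dots> \<le> (19 + 9 * Q) / 9" by simp
    finally show ?thesis .
  qed
  have q0: "0 \<le> 1 + S / (1 + I)" using assms by simp
  have "(1 + 2 * S + 2 * I) * (1 + S / (1 + I)) \<le> (4 * (19 + 9 * S) / 9) * ((19 + 9 * Q) / 9)"
    using assms by (intro mult_mono q q0) auto
  also have "\<dots> \<le> 24 * ((19 + 9 * S) * (19 + 9 * Q) / 361)"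
  proof -
    have "0 \<le> (19 + 9 * S) * (19 + 9 * Q)" using assms Q by (intro mult_nonneg_nonneg) auto
    moreover have "(4 * (19 + 9 * S) / 9) * ((19 + 9 * Q) / 9) = 4/81 * ((19 + 9 * S) * (19 + 9 * Q))" by simp
    ultimately show ?thesis by linarith
  qed
  also have "(19 + 9 * S) * (19 + 9 * Q) / 361 = (19/10 + 9/10 * S) / (19/10 + 9/10 * Q) * L\<^sup>2"
  proof -
    have "(19/10 + 9/10 * S) / (19/10 + 9/10 * Q) = (19 + 9 * S) / (19 + 9 * Q)"
      using Q by (simp add: field_simps)
    then show ?thesis using Q unfolding L by (simp add: power2_eq_square)
  qed
  finally show "(1 + 2 * S + 2 * I) * (1 + S / (1 + I)) \<le> 24 * ((19/10 + 9/10 * S) / (19/10 + 9/10 * (S / I)) * L\<^sup>2)"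
    by (simp add: Q_def)
  have "1 + 2 * S + 2 * I \<le> I * (2 * Q + 3)" using assms by (simp add: S algebra_simps)
  also have "\<dots> \<le> (10 + 9 * I) / 9 * (2 * (19 + 9 * Q) / 9)" using assms Q by (intro mult_mono) auto
  finally have "(1 + 2 * S + 2 * I) * (1 + S / (1 + I)) \<le> ((10 + 9 * I) / 9 * (2 * (19 + 9 * Q) / 9)) * ((19 + 9 * Q) / 9)"
    using assms Q by (intro mult_mono q q0) auto
  also have "\<dots> \<le> 24 * ((10 + 9 * I) * (19 + 9 * Q)\<^sup>2 / 6859)"
  proof -
    have "0 \<le> (10 + 9 * I) * ((19 + 9 * Q) * (19 + 9 * Q))" using assms Q by (intro mult_nonneg_nonneg) auto
    moreover have "((10 + 9 * I) / 9 * (2 * (19 + 9 * Q) / 9)) * ((19 + 9 * Q) / 9)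
        = 2/729 * ((10 + 9 * I) * ((19 + 9 * Q) * (19 + 9 * Q)))" by simp
    ultimately show ?thesis unfolding power2_eq_square by linarith
  qed
  also have "(10 + 9 * I) * (19 + 9 * Q)\<^sup>2 / 6859 = (1 + 9/10 * I) / (19/10) * L\<^sup>2"
  proof -
    have "(1 + 9/10 * I) / (19/10) = (10 + 9 * I) / 19" by simp
    then show ?thesis by (simp add: L power2_eq_square)
  qed
  finally show "(1 + 2 * S + 2 * I) * (1 + S / (1 + I)) \<le> 24 * ((1 + 9/10 * I) / (19/10) * L\<^sup>2)" .
qed

text \<open>Interference below the noise calls for private messages alone, interference above it for
  the added common message. At \<open>S = 0\<close> both the bound and the private rate degenerate
  to 0.\<close>

lemma sum_capacity_weak_ge:
  assumes "F \<noteq> no_feedback" and P: "P \<ge> 0" and IS: "INR gc P \<le> SNR gd P"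
  shows "log 2 (sum_rate_bound gd gc P) - 4.59 \<le> sum_capacity gd gc P F"
proof -
  obtain k r where link: "F k r" using assms(1) by (auto simp: no_feedback_def fun_eq_iff)
  define S I where "S = SNR gd P" and "I = INR gc P"
  have I0: "I \<ge> 0" and SI: "I \<le> S" using P IS by (auto simp: I_def S_def INR_def)
  have c: "sum_rate_bound gd gc P = (1 + 2 * S + 2 * I) * (1 + S / (1 + I))"
    by (simp add: sum_rate_bound_def S_def I_def)
  have c0: "sum_rate_bound gd gc P > 0" unfolding c using I0 SI by (intro mult_pos_pos add_pos_nonneg) auto
  consider "S = 0" | "S > 0" "I \<le> 1" | "I \<ge> 1" using I0 SI by linarith
  then show ?thesis
  proof cases
    case 1
    then have "sum_rate_bound gd gc P = 1" using I0 SI by (simp add: c)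
    then show ?thesis using sum_capacity_nonneg[OF P, of gd gc F] by simp
  next
    case 2
    then have P': "P > 0" using P by (cases "P = 0") (auto simp: S_def SNR_def)
    define L where "L = 1 + 9/10 * S / (1 + 9/10 * I)"
    have "L \<ge> 1" using 2 I0 by (simp add: L_def)
    have "log 2 (sum_rate_bound gd gc P) - 4.59 \<le> log 2 (L\<^sup>2)"
      using c0 weak_gap_private[OF I0 2(2), of S] 2 by (intro log_gap) (auto simp: c L_def)
    also have "\<dots> = 2 * log 2 L" using \<open>L \<ge> 1\<close> by (simp add: log_nat_power)
    also have "\<dots> \<le> sum_capacity gd gc P F"
      using sum_capacity_private_ge[of F k r, OF link P', of gd gc] 2 by (simp add: L_def S_def I_def)
    finally show ?thesis .
  next
    case 3
    then have P': "P > 0" using P by (cases "P = 0") (auto simp: I_def INR_def)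
    define D where "D = (19/10 + 9/10 * S) / (19/10 + 9/10 * (S / I))"
    \<comment> \<open>The largest common rate, as a power of 2, that the receivers and, if it hears
      the source through \<open>gc\<close>, the relay can decode.\<close>
    define M where "M = (if k = r then min D ((1 + 9/10 * I) / (19/10)) else D)"
    define L where "L = 1 + 9/10 * (S / I) / (19/10)"
    have Q: "0 \<le> S / I" "S / I \<le> S" using 3 SI by (auto simp: pos_divide_le_eq)
    have M: "1 \<le> M" using 3 Q by (auto simp: M_def D_def)
    have L: "L \<ge> 1" using Q by (simp add: L_def)
    have "sum_rate_bound gd gc P \<le> 24 * (M * L\<^sup>2)"
      using weak_gap_common[OF 3 SI] unfolding c L_def D_def M_def min_def by simp
    then have "log 2 (sum_rate_bound gd gc P) - 4.59 \<le> log 2 (M * L\<^sup>2)" by (rule log_gap[OF c0])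
    also have "\<dots> = log 2 M + 2 * log 2 L" using M L by (simp add: log_mult log_nat_power)
    also have "\<dots> \<le> sum_capacity gd gc P F"
      unfolding L_def S_def I_def
    proof (rule sum_capacity_common_private_ge[of F k r, OF link P'])
      show "M \<le> (19/10 + 9/10 * SNR gd P) / (19/10 + 9/10 * (SNR gd P / INR gc P))"
        by (simp only: M_def D_def S_def I_def) simp
      show "k = r \<Longrightarrow> M \<le> (1 + 9/10 * INR gc P) / (19/10)"
        by (simp only: M_def I_def simp_thms if_True min.cobounded2)
    qed (use 3 SI M in \<open>simp_all add: S_def I_def\<close>)
    finally show ?thesis .
  qed
qed

text \<open>For \<open>S < I\<close> the first factor of the bound is at most
  \<open>4 * (1 + I)\<close> and the second at most 2; their product accounts for the 3
  bits.\<close>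

lemma sum_capacity_strong_le:
  assumes P: "P \<ge> 0" and IS: "SNR gd P < INR gc P"
  shows "sum_capacity gd gc P F \<le> 3 + log 2 (1 + INR gc P)"
proof -
  define S I where "S = SNR gd P" and "I = INR gc P"
  have S0: "S \<ge> 0" and SI: "S < I" using P IS by (auto simp: I_def S_def SNR_def)
  have c: "sum_rate_bound gd gc P = (1 + 2 * S + 2 * I) * (1 + S / (1 + I))"
    by (simp add: sum_rate_bound_def S_def I_def)
  have c0: "sum_rate_bound gd gc P > 0" unfolding c using S0 SI by (intro mult_pos_pos add_pos_nonneg) auto
  have "sum_rate_bound gd gc P \<le> (4 * (1 + I)) * 2"
    unfolding c using S0 SI by (intro mult_mono) (auto simp: divide_le_eq)
  then have "log 2 (sum_rate_bound gd gc P) \<le> log 2 (2 ^ 3 * (1 + I))" using c0 by simp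
  also have "\<dots> = log 2 (2 ^ 3) + log 2 (1 + I)" using S0 SI by (subst log_mult) auto
  also have "log 2 (2 ^ 3 :: real) = 3" by (subst log_nat_power) auto
  finally show ?thesis using sum_capacity_le[OF P, of gd gc F] by (simp add: I_def)
qed

text \<open>In each regime all sum-capacities lie in one interval of the stated length, whose ends
  depend on the gains and the power but not on the feedback.\<close>

theorem mainTheorem7:
  fixes gd gc :: complex and P :: real
  assumes "P \<ge> 0"
  shows
    "(SNR gd P \<ge> INR gc P \<longrightarrow>
       (\<forall>F F' :: feedback. F \<noteq> no_feedback \<longrightarrow> F' \<noteq> no_feedback \<longrightarrow>
          \<bar>sum_capacity gd gc P F - sum_capacity gd gc P F'\<bar> \<le> 4.59)) \<and>
     (SNR gd P < INR gc P \<longrightarrow>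
       (\<forall>F F' :: feedback. F U1 U1 \<longrightarrow> F' U1 U1 \<longrightarrow>
          \<bar>sum_capacity gd gc P F - sum_capacity gd gc P F'\<bar> \<le> 3))"
proof (intro conjI impI allI)
  fix F F' assume IS: "INR gc P \<le> SNR gd P" and F: "F \<noteq> no_feedback" "F' \<noteq> no_feedback"
  show "\<bar>sum_capacity gd gc P F - sum_capacity gd gc P F'\<bar> \<le> 4.59"
    using sum_capacity_weak_ge[OF F(1) assms IS] sum_capacity_weak_ge[OF F(2) assms IS]
      sum_capacity_le[OF assms, of gd gc F] sum_capacity_le[OF assms, of gd gc F'] by linarith
next
  fix F F' :: feedback assume IS: "SNR gd P < INR gc P" and F: "F U1 U1" "F' U1 U1"
  show "\<bar>sum_capacity gd gc P F - sum_capacity gd gc P F'\<bar> \<le> 3"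
    using sum_capacity_strong_ge[of F, OF F(1) assms, of gc gd] sum_capacity_strong_ge[of F', OF F(2) assms, of gc gd]
      sum_capacity_strong_le[OF assms IS, of F] sum_capacity_strong_le[OF assms IS, of F'] by linarith
qed

end
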